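(* Let $d\in\mathbb N$, $a\in\{-1,1\}$, and let $\gamma,\alpha\in\mathbb R$ satisfy $\gamma>-\min(2,d)$ and $\alpha>1+\frac{2+\gamma}{d}$. Let $l\in\mathbb R$ and $q\in[1,\infty]$ satisfy $\frac ld+\frac1q=\frac1{q_c(\gamma)}$ and $\frac{\gamma}{\alpha-1}\le l$. Let $k\in\mathbb R$, $p\in[1,\infty]$ satisfy $$\alpha<p\le\infty,\quad \frac{l+\gamma}{\alpha}\le k\le l,\quad 0\le\frac kd+\frac1p,\quad \frac{2+\gamma\alpha}{d\alpha(\alpha-1)}<\frac kd+\frac1p<\min\Big\{\frac1{q_c(\gamma)},\frac{d+\gamma}{d\alpha}\Big\}.$$ Let $\frac{2+\gamma}{\alpha-1}\le\sigma<d$ and $\Phi_\sigma(x)=\omega(x)|x|^{-\sigma}$, where $\omega\in L^\infty(\mathbb R^d)$ is homogeneous of degree $0$ with $\|\omega\|_{L^\infty}$ sufficiently small. Let $\varphi\in\mathcal S'(\mathbb R^d)$ be nontrivial with $\|e^{t\Delta}\varphi\|_{\mathcal K^p_k}$ sufficiently small, and assume in addition that there exist positive constants $C$ and $\delta$ such that, for all $t>0$, $$\|e^{t\Delta}\varphi\|_{L^{p,\infty}_k}\le Ct^{-\frac d2(\frac\sigma d-\frac kd-\frac1p)}\quad\text{and}\quad \|e^{t\Delta}(\varphi-\Phi_\sigma)\|_{L^{p,\infty}_k}\le Ct^{-\frac d2(\frac\sigma d-\frac kd-\frac1p)-\delta}.$$ Let $u\in\mathcal K^p_k$ be the global solution of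 the Hardy–Hénon equation with initial data $\varphi$. Then the following hold. (i) (Nonlinear behavior) If $\sigma=\frac{2+\gamma}{\alpha-1}$, then there exists a constant $C>0$ such that $$\|u(t)-u_{\mathcal S}(t)\|_{L^{\tilde p,\infty}_{\tilde k}}\le Ct^{-\frac d2(\frac1{q_c(\gamma)}-\frac{\tilde k}d-\frac1{\tilde p})-\delta}\quad\text{and}\quad \big\|t^{\frac{2+\gamma}{2(\alpha-1)}}u(t,\sqrt t\,\cdot)-u_{\mathcal S}(1,\cdot)\big\|_{L^{\tilde p,\infty}_{\tilde k}}\le Ct^{-\delta}$$ for all $t>0$ and all $(\tilde k,\tilde p)\in\mathbb R\times[1,\infty]$ with $\tilde k\le k$, $p\le\tilde p$, $0\le\frac{\tilde k}d+\frac1{\tilde p}$, where $u_{\mathcal S}$ is the global self-similar solution with initial data $\omega(x)|x|^{-\frac{2+\gamma}{\alpha-1}}$. In particular, there exists a constant $\tilde C>0$ such that for $t$ large $$\tilde C^{-1}t^{-\frac d2(\frac1{q_c(\gamma)}-\frac{\tilde k}d-\frac1{\tilde p})}\le\|u(t)\|_{L^{\tilde p,\infty}_{\tilde k}}\le\tilde Ct^{-\frac d2(\frac1{q_c(\gamma)}-\frac{\tilde k}d-\frac1{\tilde p})}.$$ (ii) (Linear behavior) If $\sigma>\frac{2+\gamma}{\alpha-1}$ and $\frac{\sigma+\gamma}{d\alpha}<\frac kd+\frac1p$, then there exists a constant $C>0$ such that $$\|u(t)-e^{t\Delta}\Phi_\sigma\|_{L^{\tilde p,\infty}_{\tilde k}}\le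 Ct^{-\frac d2(\frac\sigma d-\frac{\tilde k}d-\frac1{\tilde p})-\delta}\quad\text{and}\quad \big\|t^{\frac\sigma2}u(t,\sqrt t\,\cdot)-e^\Delta\Phi_\sigma\big\|_{L^{\tilde p,\infty}_{\tilde k}}\le Ct^{-\delta}$$ for all $t>0$ and all $(\tilde k,\tilde p)\in\mathbb R\times[1,\infty]$ with $\tilde k\le k$, $p\le\tilde p$, $0\le\frac{\tilde k}d+\frac1{\tilde p}$. In particular, there exists a constant $\tilde C>0$ such that for $t$ large $$\tilde C^{-1}t^{-\frac d2(\frac\sigma d-\frac{\tilde k}d-\frac1{\tilde p})}\le\|u(t)\|_{L^{\tilde p,\infty}_{\tilde k}}\le\tilde Ct^{-\frac d2(\frac\sigma d-\frac{\tilde k}d-\frac1{\tilde p})}.$$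
   Context: The Hardy–Hénon equation is $\partial_tu-\Delta u=a|x|^\gamma|u|^{\alpha-1}u$; a solution with initial data $\varphi$ means a solution of the integral equation $u(t)=e^{t\Delta}\varphi+a\int_0^te^{(t-\tau)\Delta}\{|\cdot|^\gamma|u(\tau)|^{\alpha-1}u(\tau)\}\,d\tau$ for all $t>0$, a.e. $x$, with $e^{t\Delta}$ the heat semigroup on $\mathbb R^d$. $\frac1{q_c(\gamma)}=\frac{2+\gamma}{d(\alpha-1)}$. $\|f\|_{L^{p,\infty}_k}=\||\cdot|^kf\|_{L^{p,\infty}}$, where $\|g\|_{L^{p,\infty}}=\sup_{t>0}t^{1/p}g^*(t)$ with $g^*$ the decreasing rearrangement ($L^{\infty,\infty}=L^\infty$). $\|u\|_{\mathcal K^p_k}=\sup_{t>0}t^{\frac d2(\frac1{q_c(\gamma)}-\frac kd-\frac1p)}\|u(t)\|_{L^{p,\infty}_k}$; $\mathcal K^p_k$ is the set of $u\in\mathscr D'((0,\infty)\times\mathbb R^d)$ for which the corresponding supremum over $0<t<T'$ is finite for every $T'<\infty$. When $\|e^{t\Delta}\varphi\|_{\mathcal K^p_k}$ is sufficiently small, "the global solution with initial data $\varphi$" is the one given by the contraction principle: the unique solution of the integral equation in $\{w:\|w\|_{\mathcal K^p_k}\le M\}$ for a sufficiently small $M>0$. The self-similar solution $u_{\mathcal S}$ is the solution obtained in this way for the data $\omega(x)|x|^{-\frac{2+\gamma}{\alpha-1}}$ (with $\|\omega\|_{L^\infty}$ small); it satisfies $\lambda^{\frac{2+\gamma}{\alpha-1}}u_{\mathcal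 S}(\lambda^2t,\lambda x)=u_{\mathcal S}(t,x)$ for all $\lambda>0$.
   Formalization: In (i) and (ii) the gain δ in the conclusions is replaced by min(δ,δ₀) for some δ₀>0 depending only on the parameters (the claim fails for large δ), and the lower bounds on u(t) are stated only when ω is not a.e. zero (they fail for ω=0). *)

theory Defs
  imports "HOL-Analysis.Analysis" "HOL-Probability.Essential_Supremum"
begin

section \<open>Weighted weak Lebesgue spaces\<close>

text \<open>
  The space \<open>\<real>\<^sup>d\<close> is a type \<open>'a :: euclidean_space\<close> with \<open>d = DIM('a)\<close>.  Exponents in
  \<open>[1,\<infinity>]\<close> have type \<^typ>\<open>ennreal\<close>; \<open>recip p\<close> is \<open>1/p\<close> with \<open>1/\<infinity> = 0\<close>.
\<close>

definition recip :: "ennreal \<Rightarrow> real" where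
  "recip p = enn2real (1 / p)"

definition decreasing_rearrangement :: "('a::euclidean_space \<Rightarrow> complex) \<Rightarrow> real \<Rightarrow> ennreal" where
  "decreasing_rearrangement g t =
     (INF s\<in>{s::real. 0 \<le> s \<and> emeasure lebesgue {x. s < norm (g x)} \<le> ennreal t}. ennreal s)"

definition weak_norm :: "ennreal \<Rightarrow> ('a::euclidean_space \<Rightarrow> complex) \<Rightarrow> ennreal" where
  "weak_norm p g = (SUP t\<in>{0<..}. ennreal (t powr recip p) * decreasing_rearrangement g t)"

definition weighted_weak_norm ::
    "real \<Rightarrow> ennreal \<Rightarrow> ('a::euclidean_space \<Rightarrow> complex) \<Rightarrow> ennreal" where
  "weighted_weak_norm k p f = weak_norm p (\<lambda>x. of_real (norm x powr k) * f x)"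

text \<open>For \<open>p = \<infinity>\<close> the formula gives the norm of \<open>L\<^sup>\<infinity>\<close>.\<close>

lemma weak_norm_infinity:
  fixes g :: "'a::euclidean_space \<Rightarrow> complex"
  assumes g: "g \<in> borel_measurable lebesgue"
  shows "weak_norm \<infinity> g = esssup lebesgue (\<lambda>x. ennreal (norm (g x)))"
proof (rule antisym)
  let ?E = "esssup lebesgue (\<lambda>x. ennreal (norm (g x)))"
  have m: "(\<lambda>x. ennreal (norm (g x))) \<in> borel_measurable lebesgue"
    using g by measurable
  have sets: "{x. e < norm (g x)} \<in> sets lebesgue" for e
  proof -
    have "{x \<in> space lebesgue. e < norm (g x)} \<in> sets lebesgue"
      using g by measurable
    then show ?thesis by simp
  qed
  have r: "recip top = 0" by (simp add: recip_def)
  show "weak_norm \<infinity> g \<le> ?E"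
    unfolding weak_norm_def
  proof (rule SUP_least)
    fix t :: real assume t: "t \<in> {0<..}"
    have "decreasing_rearrangement g t \<le> ?E"
    proof (cases "?E = \<infinity>")
      case True
      then show ?thesis by simp
    next
      case False
      then obtain e where e: "?E = ennreal e" "0 \<le> e"
        by (metis ennreal_cases infinity_ennreal_def)
      have "AE x in lebesgue. ennreal (norm (g x)) \<le> ?E"
        by (rule esssup_AE)
      then have "AE x in lebesgue. \<not> e < norm (g x)"
        by eventually_elim (use e in \<open>simp add: not_less\<close>)
      then have "emeasure lebesgue {x. e < norm (g x)} = 0"
        using sets by (subst (asm) AE_iff_measurable[OF _ refl]) auto
      then show ?thesis
        unfolding decreasing_rearrangement_def e(1) by (intro INF_lower) (use e t in auto)
    qed
    then show "ennreal (t powr recip \<infinity>) * decreasing_rearrangement g t \<le> ?E"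
      using t by (simp add: r)
  qed
  show "?E \<le> weak_norm \<infinity> g"
  proof (rule dense_ge, rule ccontr)
    fix z assume z: "weak_norm \<infinity> g < z" and n: "\<not> ?E \<le> z"
    then have "z < \<infinity>" by (metis infinity_ennreal_def not_le top_greatest top.not_eq_extremum)
    then obtain s where s: "z = ennreal s" "0 \<le> s"
      by (metis ennreal_cases infinity_ennreal_def less_irrefl)
    have eq: "{x \<in> space lebesgue. z < ennreal (norm (g x))} = {x. s < norm (g x)}"
      using s by (auto simp: ennreal_less_iff)
    have pos: "0 < emeasure lebesgue {x. s < norm (g x)}"
      using esssup_pos_measure[OF m, of z] n eq by (auto simp: not_le)
    obtain t where t: "0 < t" "ennreal t < emeasure lebesgue {x. s < norm (g x)}"
      using dense[OF pos] by (metis ennreal_cases ennreal_less_zero_iff not_less top_greatest)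
    have "z \<le> decreasing_rearrangement g t"
      unfolding decreasing_rearrangement_def
    proof (rule INF_greatest)
      fix s' assume s': "s' \<in> {s. 0 \<le> s \<and> emeasure lebesgue {x. s < norm (g x)} \<le> ennreal t}"
      have "s \<le> s'"
      proof (rule ccontr)
        assume "\<not> s \<le> s'"
        then have "emeasure lebesgue {x. s < norm (g x)} \<le> emeasure lebesgue {x. s' < norm (g x)}"
          using sets by (intro emeasure_mono) auto
        then show False using s' t by auto
      qed
      then show "z \<le> ennreal s'" by (simp add: s ennreal_leI)
    qed
    also have "\<dots> \<le> weak_norm \<infinity> g"
      unfolding weak_norm_def by (rule SUP_upper2[of t]) (use t in \<open>auto simp: r\<close>)
    finally show False using z by simp
  qed
qed


section \<open>Tempered distributions and the heat semigroup\<close>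

fun iterated_partial :: "'a::euclidean_space list \<Rightarrow> ('a \<Rightarrow> complex) \<Rightarrow> 'a \<Rightarrow> complex" where
  "iterated_partial [] f = f"
| "iterated_partial (b # bs) f = (\<lambda>x. frechet_derivative (iterated_partial bs f) (at x) b)"

text \<open>
  A multi-index \<open>\<beta>\<close> is represented by a list of basis vectors of length \<open>|\<beta>|\<close>.  Differentiability
  of all iterated partial derivatives amounts to \<open>C\<^sup>\<infinity>\<close>.
\<close>

definition schwartz :: "('a::euclidean_space \<Rightarrow> complex) set" where
  "schwartz = {f. \<forall>bs\<in>lists Basis. (\<forall>x. iterated_partial bs f differentiable at x) \<and>
     (\<forall>N::nat. bounded (range (\<lambda>x. (1 + norm x) ^ N * norm (iterated_partial bs f x))))}"

definition schwartz_seminorm :: "nat \<Rightarrow> ('a::euclidean_space \<Rightarrow> complex) \<Rightarrow> real" where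
  "schwartz_seminorm N f =
     (SUP (bs, x)\<in>{bs\<in>lists Basis. length bs \<le> N} \<times> UNIV.
        (1 + norm x) ^ N * norm (iterated_partial bs f x))"

text \<open>
  The elements of \<open>\<S>'\<close>.  Values of the functional outside the Schwartz space are irrelevant.
\<close>

definition tempered_distribution :: "(('a::euclidean_space \<Rightarrow> complex) \<Rightarrow> complex) \<Rightarrow> bool" where
  "tempered_distribution \<phi> \<longleftrightarrow>
     (\<forall>f\<in>schwartz. \<forall>g\<in>schwartz. \<phi> (\<lambda>x. f x + g x) = \<phi> f + \<phi> g) \<and>
     (\<forall>c. \<forall>f\<in>schwartz. \<phi> (\<lambda>x. c * f x) = c * \<phi> f) \<and>
     (\<exists>N C. \<forall>f\<in>schwartz. norm (\<phi> f) \<le> C * schwartz_seminorm N f)"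

definition regular_distribution ::
    "('a::euclidean_space \<Rightarrow> complex) \<Rightarrow> ('a \<Rightarrow> complex) \<Rightarrow> complex" where
  "regular_distribution f = (\<lambda>\<psi>. LINT y|lebesgue. f y * \<psi> y)"

definition heat_kernel :: "real \<Rightarrow> 'a::euclidean_space \<Rightarrow> real" where
  "heat_kernel t x = (4 * pi * t) powr (- (real DIM('a) / 2)) * exp (- (norm x)\<^sup>2 / (4 * t))"

text \<open>
  \<open>heat t \<phi>\<close> is the function \<open>e\<^sup>t\<^sup>\<Delta>\<phi> = G\<^sub>t * \<phi>\<close>.  For a function \<open>f\<close>, \<open>e\<^sup>t\<^sup>\<Delta>f\<close> is
  \<open>heat t (regular_distribution f)\<close>, which unfolds to the convolution integral.
\<close>

definition heat ::
    "real \<Rightarrow> (('a::euclidean_space \<Rightarrow> complex) \<Rightarrow> complex) \<Rightarrow> 'a \<Rightarrow> complex" where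
  "heat t \<phi> x = \<phi> (\<lambda>y. of_real (heat_kernel t (x - y)))"


section \<open>The Hardy--Henon equation\<close>

text \<open>\<open>inv_qc d \<gamma> \<alpha>\<close> is \<open>1 / q\<^sub>c(\<gamma>)\<close>.\<close>

definition inv_qc :: "real \<Rightarrow> real \<Rightarrow> real \<Rightarrow> real" where
  "inv_qc d \<gamma> \<alpha> = (2 + \<gamma>) / (d * (\<alpha> - 1))"

text \<open>The exponent \<open>d/2 (s - k/d - 1/p)\<close>, used with \<open>s = 1/q\<^sub>c(\<gamma>)\<close> and \<open>s = \<sigma>/d\<close>.\<close>

definition decay_exponent :: "real \<Rightarrow> real \<Rightarrow> real \<Rightarrow> ennreal \<Rightarrow> real" where
  "decay_exponent d s k p = d / 2 * (s - k / d - recip p)"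

definition kato_norm_on ::
    "real set \<Rightarrow> real \<Rightarrow> real \<Rightarrow> real \<Rightarrow> ennreal \<Rightarrow> (real \<Rightarrow> 'a::euclidean_space \<Rightarrow> complex) \<Rightarrow> ennreal"
  where
  "kato_norm_on I \<gamma> \<alpha> k p u =
     (SUP t\<in>I. ennreal (t powr decay_exponent (real DIM('a)) (inv_qc (real DIM('a)) \<gamma> \<alpha>) k p)
        * weighted_weak_norm k p (u t))"

abbreviation kato_norm ::
    "real \<Rightarrow> real \<Rightarrow> real \<Rightarrow> ennreal \<Rightarrow> (real \<Rightarrow> 'a::euclidean_space \<Rightarrow> complex) \<Rightarrow> ennreal" where
  "kato_norm \<equiv> kato_norm_on {0<..}"

text \<open>
  Finiteness of the norm forces \<open>u(t)\<close> to be a function for every \<open>t > 0\<close>.  Hence an element of the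
  space is a function of \<open>(t,x)\<close>, measurable in \<open>x\<close> for each \<open>t\<close>; local integrability on
  \<open>(0,\<infinity>) \<times> \<real>\<^sup>d\<close> makes it a distribution there.
\<close>

definition kato_space ::
    "real \<Rightarrow> real \<Rightarrow> real \<Rightarrow> ennreal \<Rightarrow> (real \<Rightarrow> 'a::euclidean_space \<Rightarrow> complex) set" where
  "kato_space \<gamma> \<alpha> k p = {u.
     (\<forall>t>0. u t \<in> borel_measurable lebesgue) \<and>
     (\<forall>K. compact K \<and> K \<subseteq> {0<..} \<times> UNIV \<longrightarrow> set_integrable lebesgue K (\<lambda>(t, x). u t x)) \<and>
     (\<forall>T>0. kato_norm_on {0<..<T} \<gamma> \<alpha> k p u < \<infinity>)}"

definition nonlinearity ::
    "real \<Rightarrow> real \<Rightarrow> ('a::euclidean_space \<Rightarrow> complex) \<Rightarrow> 'a \<Rightarrow> complex" where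
  "nonlinearity \<gamma> \<alpha> v = (\<lambda>y. of_real (norm y powr \<gamma> * norm (v y) powr (\<alpha> - 1)) * v y)"

text \<open>
  The integrability clause says that the Duhamel integral converges absolutely; without it the
  Bochner integral would silently be \<open>0\<close> where it diverges.
\<close>

definition integral_solution ::
    "real \<Rightarrow> real \<Rightarrow> real \<Rightarrow> (('a::euclidean_space \<Rightarrow> complex) \<Rightarrow> complex) \<Rightarrow>
     (real \<Rightarrow> 'a \<Rightarrow> complex) \<Rightarrow> bool" where
  "integral_solution a \<gamma> \<alpha> \<phi> u \<longleftrightarrow>
     (\<forall>t>0. AE x in lebesgue.
        set_integrable lebesgue ({0<..<t} \<times> UNIV)
          (\<lambda>(\<tau>, y). of_real (heat_kernel (t - \<tau>) (x - y)) * nonlinearity \<gamma> \<alpha> (u \<tau>) y) \<and>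
        u t x = heat t \<phi> x + of_real a *
          (LINT \<tau>:{0<..<t}|lebesgue.
             heat (t - \<tau>) (regular_distribution (nonlinearity \<gamma> \<alpha> (u \<tau>))) x))"

text \<open>
  For small \<open>M\<close> the contraction principle gives at most one solution in the ball of radius \<open>M\<close> (up to
  equality almost everywhere for each \<open>t\<close>), so uniqueness is not repeated in the definition.
\<close>

definition global_solution ::
    "real \<Rightarrow> real \<Rightarrow> real \<Rightarrow> real \<Rightarrow> ennreal \<Rightarrow> real \<Rightarrow> (('a::euclidean_space \<Rightarrow> complex) \<Rightarrow> complex) \<Rightarrow>
     (real \<Rightarrow> 'a \<Rightarrow> complex) \<Rightarrow> bool" where
  "global_solution a \<gamma> \<alpha> k p M \<phi> u \<longleftrightarrow>
     u \<in> kato_space \<gamma> \<alpha> k p \<and> kato_norm \<gamma> \<alpha> k p u \<le> ennreal M \<and> integral_solution a \<gamma> \<alpha> \<phi> u"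

definition homogeneous_degree_0 :: "('a::euclidean_space \<Rightarrow> complex) \<Rightarrow> bool" where
  "homogeneous_degree_0 \<omega> \<longleftrightarrow> (\<forall>c>0. AE x in lebesgue. \<omega> (c *\<^sub>R x) = \<omega> x)"

definition Phi :: "('a::euclidean_space \<Rightarrow> complex) \<Rightarrow> real \<Rightarrow> 'a \<Rightarrow> complex" where
  "Phi \<omega> \<sigma> = (\<lambda>x. \<omega> x * of_real (norm x powr (- \<sigma>)))"

definition admissible :: "real \<Rightarrow> real \<Rightarrow> ennreal \<Rightarrow> real \<Rightarrow> ennreal \<Rightarrow> bool" where
  "admissible d k p k' p' \<longleftrightarrow> 1 \<le> p' \<and> k' \<le> k \<and> p \<le> p' \<and> 0 \<le> k' / d + recip p'"

end

(* All estimates are made along a path of exponents from (k, 1/p) to homogeneity 0, which controls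
   every admissible pair with one constant. The Duhamel term is a contraction on small solutions, so
   a difference of two solutions decays like the difference of their linear parts; smoothing in small
   steps transports the decay along the path. In case (i) this is applied to all rescalings of u and
   to u_S, in case (ii) to u and 0. Lower bounds hold because u stays close, relative to its size, to
   the self-similar function exp(t Laplacian) Phi, which is nonzero for nonzero omega. *)

theory Submission
  imports Defs "HOL-Probability.Distributions"
begin

text \<open>A weak quasi-norm satisfies the triangle inequality only up to a constant, so it does
  not move under the Duhamel integral. Estimates are therefore proved in dual form: for a reciprocal
  exponent R < 1, a bound on s |{f > s}|^R is equivalent, up to constants, to a bound on the
  integral of f over every set E by a multiple of |E|^(1 - R), and the latter commutes with
  integrals in space and time by Tonelli. The steps along the path are small because passing from
  homogeneity s1 to s2 costs \<open>(t - r) powr (- (\<beta> + d / 2 * (s1 - s2)))\<close>, which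
  has to be integrable at r = t. At r = 0 the improved bound is the more singular one, so a step
  uses it at late times only and the original bound at early times. Convergence of the time integral
  at r = 0 limits the rate: a decay of order b + \<delta> of the linear parts is transported as long
  as (\<alpha> - 1) \<theta> + b + \<delta> < 1. This is the origin of \<delta>0 and of min \<delta>
  \<delta>0.\<close>

abbreviation nn_lborel :: "('a::euclidean_space => ennreal) => ennreal" (binder "NN " 10) where
 "nn_lborel f == nn_integral lborel f"

abbreviation nn_lebesgue :: "('a::euclidean_space => ennreal) => ennreal" (binder "NL " 10) where
 "nn_lebesgue f == nn_integral lebesgue f"

abbreviation (input) "Lmeas == borel_measurable lebesgue"
abbreviation (input) "Bmeas == borel_measurable borel"

abbreviation (input) hk :: "real => 'a::euclidean_space => real" where "hk == heat_kernel"

declare emeasure_completion [simp del]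

section \<open>Weak bounds tested on sets of finite measure\<close>

text \<open>The weak Lebesgue bound with exponent \<open>1/R\<close>; \<open>R = 0\<close> is the
  essential supremum, so \<open>p = \<infinity>\<close> needs no separate treatment. Testing on sets
  \<open>E\<close> of finite measure avoids superlevel sets of infinite measure, where
  \<open>measure\<close> would return 0, and asks no measurability of \<open>f\<close>. Since
  \<open>0 powr 0 = 0\<close>, null sets impose nothing even for \<open>R = 0\<close>. The bound is
  one-sided in \<open>f\<close>, which suits differences of moduli.\<close>

definition weak_bound :: "real => real => ('a::euclidean_space => real) => bool" where
 "weak_bound R N f \<longleftrightarrow>
   0 <= N & (\<forall>s>0. \<forall>E\<in>lmeasurable. (\<forall>x\<in>E. s < f x) --> s * measure lebesgue E powr R <= N)"

lemma weak_boundI: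
 assumes "0 <= N"
  and "!!s E. [|0 < s; E \<in> lmeasurable; !!x. x \<in> E ==> s < f x; 0 < measure lebesgue E|]
      ==> s * measure lebesgue E powr R <= N"
 shows "weak_bound R N f"
 unfolding weak_bound_def
proof (intro conjI allI impI ballI)
 fix s :: real and E :: "'a set"
 assume *: "0 < s" "E \<in> lmeasurable" "\<forall>x\<in>E. s < f x"
 show "s * measure lebesgue E powr R <= N"
 proof (cases "measure lebesgue E = 0")
  case False
  then have "0 < measure lebesgue E" by (simp add: zero_less_measure_iff)
  with * assms(2) show ?thesis by blast
 qed (use assms(1) in simp)
qed (use assms in auto)

lemma weak_boundD:
 "[|weak_bound R N f; 0 < s; E \<in> lmeasurable; !!x. x \<in> E ==> s < f x|]
   ==> s * measure lebesgue E powr R <= N"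
 unfolding weak_bound_def by blast

lemma weak_bound_nonneg: "weak_bound R N f ==> 0 <= N"
 unfolding weak_bound_def by blast

lemma weak_bound_mono: "weak_bound R N f ==> N <= N' ==> weak_bound R N' f"
 unfolding weak_bound_def by (meson order_trans)

lemma weak_bound_AE_mono:
 assumes g: "weak_bound R N g" and le: "AE x in lebesgue. f x <= g x"
 shows "weak_bound R N f"
proof (rule weak_boundI)
 show "0 <= N" using g by (rule weak_bound_nonneg)
 fix s E assume s: "0 < s" and E: "E \<in> lmeasurable" and sub: "!!x. x \<in> E ==> s < f x"
 obtain Z where Z: "Z \<in> null_sets lebesgue" "{x. ~ f x <= g x} \<subseteq> Z"
 proof -
  have "\<exists>Z\<in>null_sets lebesgue. {x \<in> space lebesgue. ~ f x <= g x} \<subseteq> Z"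
   using le by (simp add: eventually_ae_filter)
  then show thesis using that by auto
 qed
 have "E - Z \<in> lmeasurable" using E Z(1) by (metis fmeasurable.Diff fmeasurableI_null_sets)
 moreover have "measure lebesgue (E - Z) = measure lebesgue E"
  using E Z(1) by (simp add: fmeasurableD measure_Diff_null_set)
 moreover have "s < g x" if "x \<in> E - Z" for x
  using that Z(2) sub[of x] by force
 ultimately show "s * measure lebesgue E powr R <= N"
  using weak_boundD[OF g s, of "E - Z"] by simp
qed

text \<open>Passage to the limit in the constant; it closes the iteration that absorbs a small
  multiple of the unknown bound.\<close>

lemma weak_bound_closed:
 assumes "!!n. weak_bound R (X n) f" "X \<longlonglongrightarrow> N"
 shows "weak_bound R N f"
proof (rule weak_boundI)
 show "0 <= N" using assms weak_bound_nonneg by (metis LIMSEQ_le_const)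
 fix s E assume "0 < s" "E \<in> lmeasurable" "!!x. x \<in> E ==> s < f x"
 then have "s * measure lebesgue E powr R <= X n" for n
  using weak_boundD[OF assms(1)] by blast
 then show "s * measure lebesgue E powr R <= N"
  using assms(2) by (meson LIMSEQ_le_const)
qed

lemma weak_bound_cmult:
 assumes f: "weak_bound R N f" and c: "0 <= c"
 shows "weak_bound R (c * N) (%x. c * f x)"
proof (rule weak_boundI)
 show "0 <= c * N" using weak_bound_nonneg[OF f] c by simp
 fix s E assume s: "0 < s" and E: "E \<in> lmeasurable" and sub: "!!x. x \<in> E ==> s < c * f x"
  and pos: "0 < measure lebesgue E"
 have "c \<noteq> 0"
 proof
  assume "c = 0"
  then have "E = {}" using sub s by force
  with pos show False by simp
 qed
 with c have c: "0 < c" by simp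
 have "s / c * measure lebesgue E powr R <= N"
  using sub c s by (intro weak_boundD[OF f _ E]) (auto simp: field_simps)
 then show "s * measure lebesgue E powr R <= c * N" using c by (simp add: field_simps)
qed

text \<open>Pigeonhole on measure. It plays the part of the inequalities for the decreasing
  rearrangement of a sum or a product.\<close>

lemma half_measure_cases:
 assumes E: "E \<in> lmeasurable" and A: "A \<in> sets lebesgue" and B: "B \<in> sets lebesgue"
  and sub: "E \<subseteq> A \<union> B"
 shows "(E \<inter> A \<in> lmeasurable & measure lebesgue E / 2 <= measure lebesgue (E \<inter> A)) \<or>
     (E \<inter> B \<in> lmeasurable & measure lebesgue E / 2 <= measure lebesgue (E \<inter> B))"
proof -
 have m: "E \<inter> A \<in> lmeasurable" "E \<inter> B \<in> lmeasurable"
  using E A B by (auto intro: fmeasurable_Int_fmeasurable)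
 have "E = (E \<inter> A) \<union> (E \<inter> B)" using sub by auto
 then have "measure lebesgue E <= measure lebesgue (E \<inter> A) + measure lebesgue (E \<inter> B)"
  using measure_Un_le[of "E \<inter> A" lebesgue "E \<inter> B"] m by (simp add: fmeasurableD)
 with m show ?thesis by linarith
qed

lemma superlevel_sets_lebesgue [simp]:
 fixes f :: "'a::euclidean_space => real"
 shows "f \<in> Lmeas ==> {x. s < f x} \<in> sets lebesgue"
 using borel_measurable_less[of "%_. s" lebesgue f] by simp

text \<open>Where the sum exceeds \<open>s\<close>, one summand exceeds \<open>s/2\<close>, and one
  of them does so on half of the set. Halving the level and halving the set cost at most a factor 2
  each, as \<open>R <= 1\<close>; hence the 4.\<close>

lemma weak_bound_add:
 assumes f: "weak_bound R A f" and g: "weak_bound R B g" and R: "0 <= R" "R <= 1"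
  and m: "f \<in> Lmeas" "g \<in> Lmeas"
 shows "weak_bound R (4 * (A + B)) (%x. f x + g x)"
proof (rule weak_boundI)
 note AB = weak_bound_nonneg[OF f] weak_bound_nonneg[OF g]
 then show "0 <= 4 * (A + B)" by simp
 fix s E assume s: "0 < s" and E: "E \<in> lmeasurable" and sub: "!!x. x \<in> E ==> s < f x + g x"
  and pos: "0 < measure lebesgue E"
 have p2: "2 powr R <= (2::real)" using powr_mono[of R 1 2] R by simp
 have half: "measure lebesgue E powr R <= 2 * e powr R" if "measure lebesgue E / 2 <= e" for e
 proof -
  have "measure lebesgue E powr R <= (2 * e) powr R" using that R by (intro powr_mono2) auto
  also have "... = 2 powr R * e powr R" by (rule powr_mult)
  also have "... <= 2 * e powr R" using p2 by (intro mult_right_mono) auto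
  finally show ?thesis .
 qed
 have "E \<subseteq> {x. s/2 < f x} \<union> {x. s/2 < g x}" using sub by force
 from half_measure_cases[OF E superlevel_sets_lebesgue[OF m(1)] superlevel_sets_lebesgue[OF m(2)] this]
 have "(s/2) * measure lebesgue E powr R <= 2 * A \<or> (s/2) * measure lebesgue E powr R <= 2 * B"
 proof (elim disjE conjE, goal_cases)
  case 1
  have "(s/2) * measure lebesgue (E \<inter> {x. s/2 < f x}) powr R <= A"
   using s by (intro weak_boundD[OF f _ 1(1)]) auto
  moreover have "(s/2) * measure lebesgue E powr R <= (s/2) * (2 * measure lebesgue (E \<inter> {x. s/2 < f x}) powr R)"
   using half[OF 1(2)] s by (intro mult_left_mono) auto
  ultimately show ?case by linarith
 next
  case 2
  have "(s/2) * measure lebesgue (E \<inter> {x. s/2 < g x}) powr R <= B"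
   using s by (intro weak_boundD[OF g _ 2(1)]) auto
  moreover have "(s/2) * measure lebesgue E powr R <= (s/2) * (2 * measure lebesgue (E \<inter> {x. s/2 < g x}) powr R)"
   using half[OF 2(2)] s by (intro mult_left_mono) auto
  ultimately show ?case by linarith
 qed
 then show "s * measure lebesgue E powr R <= 4 * (A + B)" using AB by auto
qed

text \<open>Hoelder's inequality in weak spaces. The levels \<open>A * ?e powr (-R)\<close> and
  \<open>B * ?e powr (-Q)\<close> are the largest that the factors can exceed on half of
  \<open>E\<close>; if levels just above them had a product below \<open>s\<close>, half of
  \<open>E\<close> would violate one of the two bounds.\<close>

lemma weak_bound_mult:
 assumes f: "weak_bound R A f" and g: "weak_bound Q B g"
  and RQ: "0 <= R" "0 <= Q" "R + Q <= 1"
  and m: "f \<in> Lmeas" "g \<in> Lmeas"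
  and nn: "!!x. 0 <= f x" "!!x. 0 <= g x"
 shows "weak_bound (R + Q) (2 * A * B) (%x. f x * g x)"
proof (rule weak_boundI)
 note AB = weak_bound_nonneg[OF f] weak_bound_nonneg[OF g]
 then show "0 <= 2 * A * B" by simp
 fix s E assume s: "0 < s" and E: "E \<in> lmeasurable" and sub: "!!x. x \<in> E ==> s < f x * g x"
  and pos: "0 < measure lebesgue E"
 let ?e = "measure lebesgue E / 2"
 have level: "\<mu> * \<nu> \<ge> s" if \<mu>: "\<mu> > A * ?e powr (-R)" and \<nu>: "\<nu> > B * ?e powr (-Q)" for \<mu> \<nu>
 proof (rule ccontr)
  assume n: "~ \<mu> * \<nu> \<ge> s"
  have p: "0 < \<mu>" "0 < \<nu>" using that AB by (meson le_less_trans mult_nonneg_nonneg powr_ge_zero)+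
  have "E \<subseteq> {x. \<mu> < f x} \<union> {x. \<nu> < g x}"
  proof
   fix x assume x: "x \<in> E"
   show "x \<in> {x. \<mu> < f x} \<union> {x. \<nu> < g x}"
   proof (rule ccontr)
    assume "x \<notin> {x. \<mu> < f x} \<union> {x. \<nu> < g x}"
    then have "f x * g x <= \<mu> * \<nu>" using nn p by (intro mult_mono) auto
    with sub[OF x] n show False by simp
   qed
  qed
  from half_measure_cases[OF E superlevel_sets_lebesgue[OF m(1)] superlevel_sets_lebesgue[OF m(2)] this]
  show False
  proof (elim disjE conjE, goal_cases)
   case 1
   have "\<mu> * ?e powr R <= \<mu> * measure lebesgue (E \<inter> {x. \<mu> < f x}) powr R"
    using 1(2) RQ p by (intro mult_left_mono powr_mono2) auto
   also have "... <= A" using p by (intro weak_boundD[OF f _ 1(1)]) auto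
   finally show False using \<mu> pos by (simp add: powr_minus field_simps)
  next
   case 2
   have "\<nu> * ?e powr Q <= \<nu> * measure lebesgue (E \<inter> {x. \<nu> < g x}) powr Q"
    using 2(2) RQ p by (intro mult_left_mono powr_mono2) auto
   also have "... <= B" using p by (intro weak_boundD[OF g _ 2(1)]) auto
   finally show False using \<nu> pos by (simp add: powr_minus field_simps)
  qed
 qed
 \<comment> \<open>The thresholds themselves are excluded in \<open>level\<close>, so they are
   approached from above.\<close>
 have lim: "(%n. (A * ?e powr (-R) + inverse (real (Suc n))) * (B * ?e powr (-Q) + inverse (real (Suc n))))
   \<longlonglongrightarrow> (A * ?e powr (-R) + 0) * (B * ?e powr (-Q) + 0)"
  by (intro tendsto_intros LIMSEQ_inverse_real_of_nat)
 have "s <= (A * ?e powr (-R) + 0) * (B * ?e powr (-Q) + 0)"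
  by (rule LIMSEQ_le_const[OF lim]) (auto intro!: exI[of _ 0] level)
 also have "... = A * B * ?e powr (-(R+Q))" by (simp add: powr_add[symmetric] algebra_simps)
 finally have "s * ?e powr (R+Q) <= A * B * ?e powr (-(R+Q)) * ?e powr (R+Q)"
  by (intro mult_right_mono) auto
 then have "s * ?e powr (R+Q) <= A * B"
  using pos by (simp only: mult.assoc powr_add[symmetric]) simp
 moreover have "measure lebesgue E powr (R+Q) <= 2 * ?e powr (R+Q)"
 proof -
  have "measure lebesgue E powr (R+Q) = (2 * ?e) powr (R+Q)" by simp
  also have "... = 2 powr (R+Q) * ?e powr (R+Q)" by (rule powr_mult)
  also have "... <= 2 * ?e powr (R+Q)" using powr_mono[of "R+Q" 1 2] RQ by (intro mult_right_mono) auto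
  finally show ?thesis .
 qed
 ultimately have "s * measure lebesgue E powr (R+Q) <= s * (2 * ?e powr (R+Q))"
  using s by (intro mult_left_mono) auto
 also have "... = 2 * (s * ?e powr (R+Q))" by simp
 also have "... <= 2 * (A * B)" using \<open>s * ?e powr (R+Q) <= A * B\<close> by (intro mult_left_mono) auto
 finally have "s * measure lebesgue E powr (R+Q) <= 2 * (A * B)" .
 then show "s * measure lebesgue E powr (R+Q) <= 2 * A * B" by simp
qed

lemma weak_bound_powr:
 assumes f: "weak_bound R N f" and b: "0 < b" and nn: "!!x. 0 <= f x"
 shows "weak_bound (b * R) (N powr b) (%x. f x powr b)"
proof (rule weak_boundI)
 fix s E assume s: "0 < s" and E: "E \<in> lmeasurable" and sub: "!!x. x \<in> E ==> s < f x powr b"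
 have "s powr (1/b) < f x" if "x \<in> E" for x
 proof -
  have "s powr (1/b) < (f x powr b) powr (1/b)" using sub[OF that] s b by (intro powr_less_mono2) auto
  then show ?thesis using b nn[of x] by (simp add: powr_powr)
 qed
 then have "s powr (1/b) * measure lebesgue E powr R <= N"
  using s by (intro weak_boundD[OF f _ E]) auto
 then have "(s powr (1/b) * measure lebesgue E powr R) powr b <= N powr b"
  using b by (intro powr_mono2) auto
 then show "s * measure lebesgue E powr (b * R) <= N powr b"
  using b s by (simp add: powr_mult powr_powr mult.commute)
qed simp

text \<open>For fixed \<open>s\<close> and \<open>E\<close> the tested quantity is the geometric
  mean of the two endpoint quantities, so the constants interpolate without loss.\<close>

lemma weak_bound_interpolate:
 assumes f: "weak_bound R0 N0 f" "weak_bound R1 N1 f" and \<theta>: "0 <= \<theta>" "\<theta> <= 1"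
 shows "weak_bound ((1-\<theta>) * R0 + \<theta> * R1) (N0 powr (1-\<theta>) * N1 powr \<theta>) f"
proof (rule weak_boundI)
 fix s E assume s: "0 < s" and E: "E \<in> lmeasurable" and sub: "!!x. x \<in> E ==> s < f x"
  and pos: "0 < measure lebesgue E"
 let ?e = "measure lebesgue E"
 have "s * ?e powr ((1-\<theta>) * R0 + \<theta> * R1) = (s * ?e powr R0) powr (1-\<theta>) * (s * ?e powr R1) powr \<theta>"
  using s pos by (simp add: powr_mult powr_powr powr_add powr_diff field_simps)
 also have "... <= N0 powr (1-\<theta>) * N1 powr \<theta>"
  using weak_boundD[OF f(1) s E sub] weak_boundD[OF f(2) s E sub] \<theta> s
  by (intro mult_mono powr_mono2) auto
 finally show "s * ?e powr ((1-\<theta>) * R0 + \<theta> * R1) <= N0 powr (1-\<theta>) * N1 powr \<theta>" .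
qed simp

lemma scaleR_image_lmeasurable:
 fixes E :: "'a::euclidean_space set"
 assumes "E \<in> lmeasurable" "0 < c"
 shows "(*\<^sub>R) c ` E \<in> lmeasurable"
  and "measure lebesgue ((*\<^sub>R) c ` E) = c powr real DIM('a) * measure lebesgue E"
proof -
 have "(*\<^sub>R) c ` E = (*\<^sub>R) (1/c) -` E \<inter> space lebesgue"
  using assms(2) by (auto simp: image_iff intro!: bexI[of _ "(1/c) *\<^sub>R _"])
 then have "(*\<^sub>R) c ` E \<in> sets lebesgue"
  using measurable_sets[OF lebesgue_measurable_scaling, of E "1/c"] assms by (simp add: fmeasurableD)
 moreover have "emeasure lebesgue ((*\<^sub>R) c ` E) < \<infinity>"
 proof -
  have "emeasure lebesgue E < \<infinity>" using assms by (auto simp: fmeasurable_def)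
  then show ?thesis using emeasure_lebesgue_affine[of c 0 E]
   by (simp add: ennreal_mult_less_top)
 qed
 ultimately show "(*\<^sub>R) c ` E \<in> lmeasurable" by (simp add: fmeasurable_def)
 show "measure lebesgue ((*\<^sub>R) c ` E) = c powr real DIM('a) * measure lebesgue E"
  using measure_lebesgue_affine[of c 0 E] assms by (simp add: powr_realpow image_def)
qed

lemma weak_bound_scale:
 fixes f :: "'a::euclidean_space => real"
 assumes f: "weak_bound R N f" and c: "0 < c"
 shows "weak_bound R (c powr (- real DIM('a) * R) * N) (%x. f (c *\<^sub>R x))"
proof (rule weak_boundI)
 show "0 <= c powr (- real DIM('a) * R) * N" using weak_bound_nonneg[OF f] by simp
 fix s and E :: "'a set" assume s: "0 < s" and E: "E \<in> lmeasurable" and sub: "!!x. x \<in> E ==> s < f (c *\<^sub>R x)"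
 have "s * measure lebesgue ((*\<^sub>R) c ` E) powr R <= N"
  using sub by (intro weak_boundD[OF f s scaleR_image_lmeasurable(1)[OF E c]]) auto
 then show "s * measure lebesgue E powr R <= c powr (- real DIM('a) * R) * N"
  using c by (simp add: scaleR_image_lmeasurable(2)[OF E c] powr_mult powr_powr powr_minus field_simps)
qed

lemma measure_ball_power:
 "0 <= r ==> measure lebesgue (ball (0::'a::euclidean_space) r) = unit_ball_vol DIM('a) * r ^ DIM('a)"
 by (simp add: content_ball)

text \<open>The superlevel sets lie in balls. Adding 1 to the volume dominates every power of it
  with exponent \<open>K / d\<close> in [0,1], which makes the constant independent of
  \<open>K\<close>.\<close>

lemma weak_bound_power_weight:
 assumes K: "0 <= K" "K <= real DIM('a::euclidean_space)"
 shows "weak_bound (K / real DIM('a)) (1 + unit_ball_vol (real DIM('a))) (%x::'a. norm x powr (- K))"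
proof (rule weak_boundI)
 let ?d = "real DIM('a)" and ?\<omega> = "unit_ball_vol (real DIM('a))"
 have \<omega>: "0 <= ?\<omega>" by simp
 then show "0 <= 1 + ?\<omega>" by simp
 fix s and E :: "'a set" assume s: "0 < s" and E: "E \<in> lmeasurable" and sub: "!!x. x \<in> E ==> s < norm x powr (- K)"
  and pos: "0 < measure lebesgue E"
 show "s * measure lebesgue E powr (K / ?d) <= 1 + ?\<omega>"
 proof (cases "K = 0")
  case True
  obtain x where "x \<in> E" using pos by fastforce
  then have "s < 1" using sub[of x] True by (simp split: if_splits)
  then show ?thesis using True \<omega> pos by (simp add: add_increasing2)
 next
  case False
  with K have K': "0 < K" by simp
  have "E \<subseteq> ball 0 (s powr (-1/K))"
  proof
   fix x assume "x \<in> E"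
   from sub[OF this] have *: "s < norm x powr (-K)" .
   then have "x \<noteq> 0" using s by auto
   then have "(norm x powr (-K)) powr (-1/K) < s powr (-1/K)"
    using * s K' by (intro powr_less_mono2_neg) auto
   then show "x \<in> ball 0 (s powr (-1/K))" using K' by (simp add: powr_powr)
  qed
  then have "measure lebesgue E <= measure lebesgue (ball (0::'a) (s powr (-1/K)))"
   using E by (intro measure_mono_fmeasurable) (auto simp: fmeasurableD)
  also have "... = ?\<omega> * s powr (- ?d / K)"
   by (subst measure_ball_power) (use s in \<open>auto simp: powr_realpow[symmetric] powr_powr\<close>)
  finally have "measure lebesgue E powr (K / ?d) <= (?\<omega> * s powr (- ?d / K)) powr (K / ?d)"
   using K' by (intro powr_mono2) auto
  also have "... = ?\<omega> powr (K / ?d) * s powr (-1)"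
   using K' s by (simp add: powr_mult powr_powr)
  also have "... <= (1 + ?\<omega>) * s powr (-1)"
  proof (intro mult_right_mono)
   have "?\<omega> powr (K / ?d) <= (1 + ?\<omega>) powr (K / ?d)" using K by (intro powr_mono2) auto
   also have "... <= (1 + ?\<omega>) powr 1" using K by (intro powr_mono) (auto simp: field_simps)
   finally show "?\<omega> powr (K / ?d) <= 1 + ?\<omega>" using \<omega> by simp
  qed simp
  finally show ?thesis using s by (simp add: powr_minus field_simps)
 qed
qed

section \<open>Comparison with the weak norms, and integrals over sets\<close>

lemma recip_nonneg [simp]: "0 <= recip p"
 by (simp add: recip_def)

lemma weak_norm_imp_weak_bound:
 fixes g :: "'a::euclidean_space => complex"
 assumes g: "g \<in> Lmeas" and N: "0 <= N" and le: "weak_norm p g <= ennreal N"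
 shows "weak_bound (recip p) N (%x. norm (g x))"
proof (rule weak_boundI[OF N])
 fix s and E :: "'a set" assume s: "0 < s" and E: "E \<in> lmeasurable" and sub: "!!x. x \<in> E ==> s < norm (g x)"
  and pos: "0 < measure lebesgue E"
 let ?e = "measure lebesgue E"
 have m: "{x. c < norm (g x)} \<in> sets lebesgue" for c
  using g by (intro superlevel_sets_lebesgue) auto
 have *: "t powr recip p * s <= N" if t: "0 < t" "t < ?e" for t
 proof -
  have "ennreal s <= decreasing_rearrangement g t"
   unfolding decreasing_rearrangement_def
  proof (rule INF_greatest)
   fix s' assume s': "s' \<in> {s. 0 <= s & emeasure lebesgue {x. s < norm (g x)} <= ennreal t}"
   have "s <= s'"
   proof (rule ccontr)
    assume "~ s <= s'"
    then have "emeasure lebesgue E <= emeasure lebesgue {x. s' < norm (g x)}"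
     by (intro emeasure_mono m) (use sub \<open>~ s <= s'\<close> in \<open>fastforce intro: less_trans\<close>)
    also have "... <= ennreal t" using s' by simp
    finally show False using E t by (simp add: emeasure_eq_measure2)
   qed
   then show "ennreal s <= ennreal s'" by (rule ennreal_leI)
  qed
  then have "ennreal (t powr recip p) * ennreal s <= ennreal (t powr recip p) * decreasing_rearrangement g t"
   by (rule mult_left_mono) simp
  also have "... <= weak_norm p g" unfolding weak_norm_def using t by (intro SUP_upper) auto
  also note le
  finally show ?thesis using N s by (simp add: ennreal_mult[symmetric])
 qed
 \<comment> \<open>The rearrangement is known to be at least \<open>s\<close> only at arguments
   strictly below the measure of \<open>E\<close>, so \<open>t\<close> approaches it from below;
   \<open>Suc (Suc n)\<close> keeps the factor strictly between 0 and 1.\<close>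
 have lim: "(%n. (?e * (1 - inverse (real (Suc (Suc n))))) powr recip p * s) \<longlonglongrightarrow> (?e * (1 - 0)) powr recip p * s"
  using pos by (intro tendsto_intros LIMSEQ_Suc[OF LIMSEQ_inverse_real_of_nat]) auto
 have "(?e * (1 - 0)) powr recip p * s <= N"
 proof (rule LIMSEQ_le_const2[OF lim], intro exI allI impI)
  fix n
  have "0 < 1 - inverse (real (Suc (Suc n)))" "1 - inverse (real (Suc (Suc n))) < 1"
   by (auto simp: field_simps)
  then show "(?e * (1 - inverse (real (Suc (Suc n))))) powr recip p * s <= N"
   using pos by (intro *) (auto simp del: of_nat_Suc)
 qed
 then show "s * ?e powr recip p <= N" by (simp add: mult.commute)
qed

text \<open>Superlevel sets may have infinite measure; cutting with large balls produces the finite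
  sets on which \<open>weak_bound\<close> is tested.\<close>

lemma lmeasurable_subset_measure_gt:
 assumes A: "A \<in> sets lebesgue" and t: "ennreal t < emeasure lebesgue A" "0 <= t"
 obtains E where "E \<subseteq> A" "E \<in> lmeasurable" "t < measure lebesgue E"
proof -
 let ?E = "%n. A \<inter> ball 0 (real n)"
 have U: "(\<Union>n. ?E n) = A" by (auto simp: reals_Archimedean2)
 have inc: "incseq ?E" by (auto simp: incseq_def)
 have "(SUP n. emeasure lebesgue (?E n)) = emeasure lebesgue A"
 proof -
  have "range ?E \<subseteq> sets lebesgue" using A by auto
  from SUP_emeasure_incseq[OF this inc] show ?thesis unfolding U .
 qed
 with t(1) have "ennreal t < (SUP n. emeasure lebesgue (?E n))" by (simp only:)
 then obtain n where n: "ennreal t < emeasure lebesgue (?E n)" unfolding less_SUP_iff by blast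
 have l: "?E n \<in> lmeasurable" using A by (intro bounded_set_imp_lmeasurable) auto
 show thesis
  by (rule that[OF _ l]) (use n t(2) in \<open>auto simp: emeasure_eq_measure2[OF l] ennreal_less_iff\<close>)
qed

lemma weak_bound_imp_weak_norm:
 fixes g :: "'a::euclidean_space => complex"
 assumes g: "g \<in> Lmeas" and wb: "weak_bound (recip p) N (%x. norm (g x))"
 shows "weak_norm p g <= ennreal N"
 unfolding weak_norm_def
proof (rule SUP_least)
 fix t :: real assume "t \<in> {0<..}" then have t: "0 < t" by simp
 let ?R = "recip p"
 have N: "0 <= N" using weak_bound_nonneg[OF wb] .
 have "decreasing_rearrangement g t <= ennreal (N * t powr (-?R))"
 proof (rule ennreal_le_epsilon)
  fix e :: real assume e: "0 < e"
  \<comment> \<open>The margin \<open>e\<close> creates the contradiction: a superlevel set of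
    measure above \<open>t\<close> would give \<open>?s * t powr ?R <= N\<close>, while the left
    side is \<open>N + e * t powr ?R\<close>.\<close>
  let ?s = "N * t powr (-?R) + e"
  have s0: "0 < ?s" using N e by (simp add: add_nonneg_pos)
  have A: "{x. ?s < norm (g x)} \<in> sets lebesgue"
   using g by (intro superlevel_sets_lebesgue) auto
  have "emeasure lebesgue {x. ?s < norm (g x)} <= ennreal t"
  proof (rule ccontr)
   assume "~ ?thesis"
   then obtain E where E: "E \<subseteq> {x. ?s < norm (g x)}" "E \<in> lmeasurable" "t < measure lebesgue E"
    using lmeasurable_subset_measure_gt[OF A, of t] t by (metis less_imp_le not_le)
   have "?s * t powr ?R <= ?s * measure lebesgue E powr ?R"
    using E(3) t s0 by (intro mult_left_mono powr_mono2) auto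
   also have "... <= N"
   proof (rule weak_boundD[OF wb s0 E(2)])
    show "?s < norm (g x)" if "x \<in> E" for x using that E(1) by blast
   qed
   finally have le: "?s * t powr ?R <= N" .
   have "?s * t powr ?R = N + e * t powr ?R"
    using t by (simp only: distrib_right mult.assoc powr_add[symmetric]) simp
   moreover have "0 < e * t powr ?R" using e t by simp
   ultimately show False using le by linarith
  qed
  then have "?s \<in> {s. 0 <= s & emeasure lebesgue {x. s < norm (g x)} <= ennreal t}"
   using less_imp_le[OF s0] by blast
  then have "decreasing_rearrangement g t <= ennreal ?s"
   unfolding decreasing_rearrangement_def by (rule INF_lower)
  also have "... = ennreal (N * t powr (-?R)) + ennreal e"
   using N e by (intro ennreal_plus) auto
  finally show "decreasing_rearrangement g t <= ennreal (N * t powr (-?R)) + ennreal e" .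
 qed
 then have "ennreal (t powr ?R) * decreasing_rearrangement g t <= ennreal (t powr ?R) * ennreal (N * t powr (-?R))"
  by (rule mult_left_mono) simp
 also have "... = ennreal N"
  using t N by (simp add: ennreal_mult[symmetric] powr_minus field_simps)
 finally show "ennreal (t powr ?R) * decreasing_rearrangement g t <= ennreal N" .
qed

lemma borel_measurable_norm_powr [measurable]:
 "(%x::'a::euclidean_space. norm x powr k) \<in> Bmeas"
 by measurable

lemma borel_measurable_norm_powr_lebesgue [measurable]:
 "(%x::'a::euclidean_space. norm x powr k) \<in> Lmeas"
 using measurable_completion[of "%x::'a. norm x powr k" lborel borel] by simp

lemma weighted_weak_norm_le_iff:
 fixes f :: "'a::euclidean_space => complex"
 assumes f: "f \<in> Lmeas" and N: "0 <= N"
 shows "weighted_weak_norm k p f <= ennreal N \<longleftrightarrow>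
     weak_bound (recip p) N (%x. norm x powr k * norm (f x))"
proof -
 have m: "(%x. complex_of_real (norm x powr k) * f x) \<in> Lmeas"
  using f by measurable
 have eq: "(%x. norm (complex_of_real (norm x powr k) * f x)) = (%x. norm x powr k * norm (f x))"
  by (simp add: norm_mult)
 show ?thesis
  unfolding weighted_weak_norm_def
  using weak_norm_imp_weak_bound[OF m N, of p] weak_bound_imp_weak_norm[OF m, of p N] by (auto simp: eq)
qed

text \<open>One half of the duality. Cut \<open>E\<close> at doubling levels: the superlevel sets
  shrink by the factor \<open>2 powr (-1/R)\<close> per doubling, and this beats the factor 2
  exactly when \<open>R < 1\<close>, so a geometric series remains.\<close>

lemma weak_bound_nn_integral:
 assumes R: "0 <= R" "R < 1"
 obtains C where "0 < C"
  "!!f N E. [|weak_bound R N f; 0 < N; f \<in> Lmeas; E \<in> lmeasurable|] ==>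
    (NL x. ennreal (f x) * indicator E (x::'a::euclidean_space))
     <= ennreal (C * N * measure lebesgue E powr (1 - R))"
proof -
 \<comment> \<open>The ratio by which superlevel sets shrink when the level doubles. For
   \<open>R = 0\<close> they are null, and any value below 1/2 serves.\<close>
 define \<rho> :: real where "\<rho> = (if R = 0 then 1/4 else 2 powr (-1/R))"
 have \<rho>: "0 < \<rho>" "2 * \<rho> < 1"
 proof -
  show "0 < \<rho>" by (simp add: \<rho>_def)
  show "2 * \<rho> < 1"
  proof (cases "R = 0")
   case False
   have "2 powr (-1/R) < (2::real) powr (-1)" using False R by (intro powr_less_mono) (auto simp: field_simps)
   then show ?thesis using False by (simp add: \<rho>_def powr_minus)
  qed (simp add: \<rho>_def)
 qed
 define C where "C = 2 + 2 / (1 - 2 * \<rho>)"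
 have C: "0 < C" using \<rho> by (simp add: C_def add_pos_pos)
 show thesis
 proof (rule that[OF C])
  fix f :: "'a => real" and N :: real and E :: "'a set"
  assume f: "weak_bound R N f" and N: "0 < N" and fm [measurable]: "f \<in> Lmeas"
   and E: "E \<in> lmeasurable"
  have Em [measurable]: "E \<in> sets lebesgue" using E by (rule fmeasurableD)
  let ?e = "measure lebesgue E"
  show "(NL x. ennreal (f x) * indicator E x) <= ennreal (C * N * ?e powr (1 - R))"
  proof (cases "?e = 0")
   case True
   then have "E \<in> null_sets lebesgue" using E
    by (metis completion.complete2 emeasure_eq_measure2 ennreal_0 fmeasurableD null_setsI)
   then have "AE x in lebesgue. ennreal (f x) * indicator E x = 0"
    using AE_not_in by (fastforce simp: indicator_def)
   then have "(NL x. ennreal (f x) * indicator E x) = 0"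
    by (subst nn_integral_0_iff_AE) auto
   then show ?thesis by simp
  next
   case False
   then have e: "0 < ?e" by (simp add: zero_less_measure_iff)
   \<comment> \<open>The base level is twice the one at which the weak bound starts to say something
     on \<open>E\<close>, so already \<open>S 0\<close> carries a factor
     \<open>\<rho>\<close>.\<close>
   define s where "s j = 2 * N * ?e powr (-R) * 2 ^ j" for j
   have s: "0 < s j" for j using N e by (simp add: s_def)
   define S where "S j = E \<inter> {x. s j < f x}" for j
   have Sl: "S j \<in> lmeasurable" for j
    unfolding S_def using E by (intro fmeasurable_Int_fmeasurable) auto
   have S: "measure lebesgue (S j) <= ?e * \<rho> ^ Suc j" for j
   proof -
    have "s j * measure lebesgue (S j) powr R <= N"
     by (intro weak_boundD[OF f s Sl]) (auto simp: S_def)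
    then have *: "measure lebesgue (S j) powr R <= ?e powr R * (1/2) ^ Suc j"
     using N e by (simp add: s_def powr_minus field_simps)
    show ?thesis
    proof (cases "R = 0")
     case True
     have "measure lebesgue (S j) = 0"
     proof (rule ccontr)
      assume "measure lebesgue (S j) \<noteq> 0"
      then have "1 <= (1/2::real) ^ Suc j" using * True e by simp
      then show False using power_Suc_less_one[of "1/2::real" j] by simp
     qed
     then show ?thesis using e \<rho> by simp
    next
     case False
     with R have R0: "0 < R" by simp
     have "measure lebesgue (S j) = (measure lebesgue (S j) powr R) powr (1/R)"
      using R0 by (simp add: powr_powr)
     also have "... <= (?e powr R * (1/2) ^ Suc j) powr (1/R)"
      using * R0 by (intro powr_mono2) auto
     also have "... = ?e * ((1/2) ^ Suc j) powr (1/R)"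
      using R0 e by (simp add: powr_mult powr_powr del: power_Suc)
     also have "((1/2::real) ^ Suc j) powr (1/R) = \<rho> ^ Suc j"
     proof -
      have "((1/2::real) ^ Suc j) powr (1/R) = (2 powr (- real (Suc j))) powr (1/R)"
       by (simp add: powr_minus powr_realpow power_one_over divide_simps del: of_nat_Suc power_Suc)
      also have "... = (2 powr (-1/R)) powr real (Suc j)" by (simp add: powr_powr del: of_nat_Suc)
      also have "... = \<rho> ^ Suc j" using R0 by (subst powr_realpow) (simp_all add: \<rho>_def)
      finally show ?thesis .
     qed
     finally show ?thesis .
    qed
   qed
   have ptw: "ennreal (f x) * indicator E x <= ennreal (s 0) * indicator E x + (\<Sum>j. ennreal (s (Suc j)) * indicator (S j) x)" for x
   proof (cases "x \<in> E & s 0 < f x")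
    case True
    obtain n where n: "f x / s 0 < 2 ^ n" using real_arch_pow[of 2 "f x / s 0"] by auto
    then have "f x <= s n" using s[of 0] by (simp add: s_def field_simps)
    define m where "m = (LEAST n. f x <= s n)"
    have m: "f x <= s m" unfolding m_def using \<open>f x <= s n\<close> by (rule LeastI)
    with True obtain j where j: "m = Suc j" by (cases m) auto
    have "s j < f x" using not_less_Least[of j "%n. f x <= s n"] j m_def by auto
    then have "x \<in> S j" using True by (simp add: S_def)
    have "ennreal (f x) * indicator E x <= ennreal (s (Suc j)) * indicator (S j) x"
     using \<open>x \<in> S j\<close> m j True by (simp add: ennreal_leI)
    also have "... <= (\<Sum>j. ennreal (s (Suc j)) * indicator (S j) x)"
     using sum_le_suminf[of "%j. ennreal (s (Suc j)) * indicator (S j) x" "{j}"]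
     by (simp only: sum.insert sum.empty finite.intros empty_iff not_False_eq_True add_0_right) auto
    finally show ?thesis by (simp add: add_increasing)
   next
    case False
    then have "ennreal (f x) * indicator E x <= ennreal (s 0) * indicator E x"
     by (auto simp: indicator_def intro!: ennreal_leI)
    then show ?thesis by (simp add: add_increasing2)
   qed
   have Sm [measurable]: "S j \<in> sets lebesgue" for j using Sl by (rule fmeasurableD)
   let ?c = "2 * N * ?e powr (1 - R)"
   have se: "s j * ?e = ?c * 2 ^ j" for j
    using e by (simp add: s_def powr_diff powr_minus field_simps)
   have "(%j. (2 * \<rho>) ^ j) sums (1 / (1 - 2 * \<rho>))"
    by (rule geometric_sums) (use \<rho> in simp)
   then have "(%j. ?c * (2 * \<rho> * (2 * \<rho>) ^ j)) sums (?c * (2 * \<rho> * (1 / (1 - 2 * \<rho>))))"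
    by (intro sums_mult)
   then have sums: "(%j. ?c * (2 * \<rho>) ^ Suc j) sums (?c * (2 * \<rho> * (1 / (1 - 2 * \<rho>))))"
    by (simp only: power_Suc)
   have "(NL x. ennreal (f x) * indicator E x)
     <= (NL x. ennreal (s 0) * indicator E x + (\<Sum>j. ennreal (s (Suc j)) * indicator (S j) x))"
    using ptw by (intro nn_integral_mono) auto
   also have "... = ennreal (s 0) * emeasure lebesgue E + (\<Sum>j. ennreal (s (Suc j)) * emeasure lebesgue (S j))"
    by (subst nn_integral_add, measurable, subst nn_integral_suminf, measurable)
      (simp add: nn_integral_cmult_indicator)
   also have "... <= ennreal ?c + (\<Sum>j. ennreal (?c * (2 * \<rho>) ^ Suc j))"
   proof (intro add_mono suminf_le summableI)
    show "ennreal (s 0) * emeasure lebesgue E <= ennreal ?c"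
     using se[of 0] s[of 0] by (simp add: emeasure_eq_measure2[OF E] ennreal_mult[symmetric])
    fix j
    have "s (Suc j) * measure lebesgue (S j) <= s (Suc j) * (?e * \<rho> ^ Suc j)"
     using S s[of "Suc j"] by (intro mult_left_mono) auto
    also have "... = ?c * (2 * \<rho>) ^ Suc j" using se[of "Suc j"] by (simp add: power_mult_distrib)
    finally show "ennreal (s (Suc j)) * emeasure lebesgue (S j) <= ennreal (?c * (2 * \<rho>) ^ Suc j)"
     using s[of "Suc j"] by (simp add: emeasure_eq_measure2[OF Sl] ennreal_mult[symmetric] ennreal_leI)
   qed
   also have "... = ennreal ?c + ennreal (?c * (2 * \<rho> * (1 / (1 - 2 * \<rho>))))"
    using sums \<rho> N by (subst suminf_ennreal2) (auto simp: sums_iff)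
   also have "... = ennreal (?c + ?c * (2 * \<rho> * (1 / (1 - 2 * \<rho>))))"
    using \<rho> N by (subst ennreal_plus) auto
   also have "... <= ennreal (C * N * ?e powr (1 - R))"
   proof (rule ennreal_leI)
    have "2 * \<rho> * (1 / (1 - 2 * \<rho>)) <= 1 / (1 - 2 * \<rho>)" using \<rho> by (intro mult_left_le_one_le) auto
    then have "?c * (1 + 2 * \<rho> * (1 / (1 - 2 * \<rho>))) <= ?c * (1 + 1 / (1 - 2 * \<rho>))"
     using N by (intro mult_left_mono) auto
    also have "... = C * N * ?e powr (1 - R)" by (simp add: C_def algebra_simps)
    finally show "?c + ?c * (2 * \<rho> * (1 / (1 - 2 * \<rho>))) <= C * N * ?e powr (1 - R)"
     by (simp only: distrib_left mult_1_right)
   qed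
   finally show ?thesis .
  qed
 qed
qed

section \<open>The path of exponents\<close>

text \<open>Going down from homogeneity \<open>k/d + 1/p\<close>, the weight stays \<open>k\<close>
  while the reciprocal exponent shrinks to 0; below \<open>k/d\<close>, if that is positive, the
  exponent is infinite and the weight itself decreases. For \<open>k <= 0\<close> and nonnegative
  homogeneity only the first regime occurs.\<close>

definition path_weight :: "real => real => real => real" where
 "path_weight d k s = min k (d * s)"

definition path_recip :: "real => real => real => real" where
 "path_recip d k s = s - min (k / d) s"

lemma path_recip_eq: "0 < d ==> path_recip d k s = s - path_weight d k s / d"
 by (simp add: path_recip_def path_weight_def min_def field_simps)

text \<open>Hoelder with the power \<open>k' - k\<close> of the norm, which lies in the weak space
  of reciprocal exponent \<open>(k - k') / d\<close>: weight is exchanged for integrability at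
  constant homogeneity.\<close>

lemma weak_bound_lower_weight:
 fixes f :: "'a::euclidean_space => real"
 assumes f: "weak_bound R N (%x. norm x powr k * f x)" and m: "f \<in> Lmeas"
  and nn: "!!x. 0 <= f x" and R: "0 <= R" and k: "k' <= k" and R': "R' = R + (k - k') / real DIM('a)" "R' <= 1"
 shows "weak_bound R' (2 * (1 + unit_ball_vol (real DIM('a))) * N) (%x. norm x powr k' * f x)"
proof -
 have "(k - k') / real DIM('a) <= 1" using R R' by linarith
 then have K: "k - k' <= real DIM('a)" by (subst (asm) pos_divide_le_eq) auto
 have mm: "(%x. norm x powr k * f x) \<in> Lmeas"
  by (intro borel_measurable_times borel_measurable_norm_powr_lebesgue m)
 have "weak_bound ((k - k') / real DIM('a) + R) (2 * (1 + unit_ball_vol (real DIM('a))) * N)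
   (%x. norm x powr (-(k - k')) * (norm x powr k * f x))"
  using K k R R' nn mm by (intro weak_bound_mult f weak_bound_power_weight) auto
 moreover have "(%x. norm x powr (-(k - k')) * (norm x powr k * f x)) = (%x. norm x powr k' * f x)"
  by (simp add: mult.assoc[symmetric] powr_add[symmetric])
 ultimately show ?thesis using R' by (simp add: add.commute)
qed

text \<open>The interpolated function is the product of powers of the two given ones. The endpoints
  are treated apart because a power with exponent 0 vanishes at 0 and \<open>weak_bound_powr\<close>
  takes positive exponents.\<close>

lemma weak_bound_interpolate_weight:
 fixes f :: "'a::euclidean_space => real"
 assumes f: "weak_bound 0 A f" "weak_bound 0 B (%x. norm x powr k * f x)"
  and m: "f \<in> Lmeas" and nn: "!!x. 0 <= f x" and \<theta>: "0 <= \<theta>" "\<theta> <= 1"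
  and AB: "0 < A" "0 < B"
 shows "weak_bound 0 (2 * A powr (1 - \<theta>) * B powr \<theta>) (%x. norm x powr (\<theta> * k) * f x)"
proof -
 have mm: "(%x. norm x powr k * f x) \<in> Lmeas"
  by (intro borel_measurable_times borel_measurable_norm_powr_lebesgue m)
 consider "\<theta> = 0" | "\<theta> = 1" | "0 < \<theta>" "\<theta> < 1" using \<theta> by linarith
 then show ?thesis
 proof cases
  case 1
  have "weak_bound 0 A (%x. norm x powr (\<theta> * k) * f x)"
   by (rule weak_bound_AE_mono[OF f(1)]) (auto simp: 1 nn intro!: AE_I2)
  then show ?thesis by (rule weak_bound_mono) (use AB 1 in auto)
 next
  case 2
  have "weak_bound 0 B (%x. norm x powr (\<theta> * k) * f x)" using f(2) by (simp add: 2)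
  then show ?thesis by (rule weak_bound_mono) (use AB 2 in auto)
 next
  case 3
  have "weak_bound ((1 - \<theta>) * 0 + \<theta> * 0) (2 * A powr (1 - \<theta>) * B powr \<theta>)
    (%x. f x powr (1 - \<theta>) * (norm x powr k * f x) powr \<theta>)"
   using 3 nn m mm by (intro weak_bound_mult weak_bound_powr f) auto
  moreover have "f x powr (1 - \<theta>) * (norm x powr k * f x) powr \<theta> = norm x powr (\<theta> * k) * f x" for x
  proof -
   have "f x powr (1 - \<theta>) * (norm x powr k * f x) powr \<theta>
     = norm x powr (\<theta> * k) * (f x powr (1 - \<theta>) * f x powr \<theta>)"
    by (simp add: powr_mult powr_powr mult_ac)
   also have "f x powr (1 - \<theta>) * f x powr \<theta> = f x" using nn[of x] by (simp add: powr_add[symmetric])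
   finally show ?thesis .
  qed
  ultimately show ?thesis by simp
 qed
qed

text \<open>
 The spaces with weight \<open>path_weight d k s\<close> and exponent \<open>path_recip d k s\<close> form a path, parametrised
 by the homogeneity \<open>s = k'/d + 1/p'\<close>, of the strongest admissible norms; its corners control all
 admissible norms uniformly.
\<close>

lemma weak_bound_admissible:
 fixes f :: "'a::euclidean_space => real" and k R :: real
 defines "d \<equiv> real DIM('a)"
 defines "s \<equiv> k / d + R"
 assumes m: "f \<in> Lmeas" and nn: "!!x. 0 <= f x"
  and R: "0 <= R" "R <= 1" and s: "0 <= s" and T: "0 < T" and N: "0 < N"
  and f: "!!s'. s' \<in> {0, max (k / d) 0, s} ==>
    weak_bound (path_recip d k s') (N * T powr s') (%x. norm x powr path_weight d k s' * f x)"
  and adm: "k' <= k" "0 <= R'" "R' <= R" "0 <= k' / d + R'"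
 shows "weak_bound R' (4 * (1 + unit_ball_vol d) * N * T powr (k' / d + R')) (%x. norm x powr k' * f x)"
proof -
 have d: "0 < d" by (simp add: d_def)
 define s' where "s' = k' / d + R'"
 define mm where "mm = max (k / d) 0"
 have kd: "k' / d <= k / d" using adm d by (simp add: divide_right_mono)
 have s's: "s' <= s" "0 <= s'" using adm kd by (auto simp: s'_def s_def)
 have ms: "mm <= s" using R s by (auto simp: mm_def s_def)
 have fs: "weak_bound R (N * T powr s) (%x. norm x powr k * f x)"
 proof -
  have "path_weight d k s = k" "path_recip d k s = R"
   using R d by (auto simp: path_weight_def path_recip_def s_def min_def field_simps)
  then show ?thesis using f[of s] by simp
 qed
 have fm: "weak_bound (mm - k / d) (N * T powr mm) (%x. norm x powr k * f x)"
 proof -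
  have "path_weight d k mm = k" "path_recip d k mm = mm - k / d"
   using d by (auto simp: path_weight_def path_recip_def mm_def min_def max_def field_simps)
  then show ?thesis using f[of mm] by (simp add: mm_def)
 qed
 \<comment> \<open>The bounds depend exponentially on the homogeneity, so interpolation reproduces
   the same form with the same \<open>N\<close>.\<close>
 have interp: "N * T powr a = (N * T powr b) powr (1 - \<theta>) * (N * T powr c) powr \<theta>"
  if "a = (1 - \<theta>) * b + \<theta> * c" for a b c \<theta>
 proof -
  have "(N * T powr b) powr (1 - \<theta>) * (N * T powr c) powr \<theta>
    = (N powr (1 - \<theta>) * N powr \<theta>) * (T powr ((1 - \<theta>) * b) * T powr (\<theta> * c))"
   using T by (simp add: powr_mult powr_powr mult_ac)
  also have "... = N * T powr a" using N by (simp add: powr_add[symmetric] that)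
  finally show ?thesis by simp
 qed
 \<comment> \<open>Every admissible pair is reached by lowering the weight from the point of the
   path with the same homogeneity \<open>s'\<close>. Here \<open>mm\<close> is the corner where the
   reciprocal exponent becomes 0, or the end of the path if \<open>k <= 0\<close>.\<close>
 show ?thesis
 proof (cases "mm <= s'")
  case True
  obtain \<theta> where \<theta>: "0 <= \<theta>" "\<theta> <= 1" "s' = (1 - \<theta>) * mm + \<theta> * s"
  proof (cases "mm = s")
   case True
   then show thesis using \<open>mm <= s'\<close> s's by (intro that[of 0]) auto
  next
   case False
   then have "0 < s - mm" using ms by simp
   then have "(s' - mm) / (s - mm) * (s - mm) = s' - mm" by simp
   then have "s' = (1 - (s' - mm) / (s - mm)) * mm + (s' - mm) / (s - mm) * s" by (simp only: algebra_simps)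
   then show thesis using \<open>mm <= s'\<close> s's \<open>0 < s - mm\<close>
    by (intro that[of "(s' - mm) / (s - mm)"]) auto
  qed
  have "weak_bound ((1 - \<theta>) * (mm - k / d) + \<theta> * R) ((N * T powr mm) powr (1 - \<theta>) * (N * T powr s) powr \<theta>)
    (%x. norm x powr k * f x)"
   by (rule weak_bound_interpolate[OF fm fs \<theta>(1,2)])
  moreover have "(1 - \<theta>) * (mm - k / d) + \<theta> * R = s' - k / d"
   unfolding \<theta>(3) by (simp add: s_def algebra_simps diff_divide_distrib)
  ultimately have "weak_bound (s' - k / d) (N * T powr s') (%x. norm x powr k * f x)"
   by (simp add: interp[OF \<theta>(3)])
  then have "weak_bound R' (2 * (1 + unit_ball_vol (real DIM('a))) * (N * T powr s')) (%x. norm x powr k' * f x)"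
  proof (rule weak_bound_lower_weight)
   show "0 <= s' - k / d" using True by (auto simp: mm_def)
   show "R' = s' - k / d + (k - k') / real DIM('a)"
    using d by (simp add: s'_def d_def[symmetric] diff_divide_distrib)
  qed (use m nn adm R in auto)
  then show ?thesis by (rule weak_bound_mono) (use N T in \<open>simp add: s'_def d_def field_simps add_nonneg_nonneg\<close>)
 next
  case False
  then have k: "0 < k" "mm = k / d" using s's d by (auto simp: mm_def max_def field_simps split: if_splits)
  have "path_weight d k 0 = 0" "path_recip d k 0 = 0"
   using k d by (auto simp: path_weight_def path_recip_def)
  then have "weak_bound 0 N (%x. norm x powr 0 * f x)" using f[of 0] T by simp
  \<comment> \<open>As \<open>0 powr 0 = 0\<close>, the weight with exponent 0 is 1 only off the
    origin.\<close>
  moreover have "AE x in lebesgue. f x <= norm x powr 0 * f x"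
  proof -
   have "AE x in lebesgue. x \<noteq> (0::'a)" by (rule AE_completion, rule AE_lborel_singleton)
   then show ?thesis by eventually_elim simp
  qed
  ultimately have f0: "weak_bound 0 N f" by (rule weak_bound_AE_mono)
  define \<theta> where "\<theta> = s' / mm"
  have \<theta>: "0 <= \<theta>" "\<theta> <= 1" "s' = (1 - \<theta>) * 0 + \<theta> * mm" "\<theta> * k = d * s'"
   using False k s's d by (auto simp: \<theta>_def field_simps)
  have "weak_bound 0 (2 * N powr (1 - \<theta>) * (N * T powr mm) powr \<theta>) (%x. norm x powr (\<theta> * k) * f x)"
   using fm k N T by (intro weak_bound_interpolate_weight f0 m nn \<theta>) auto
  then have "weak_bound 0 (2 * (N * T powr s')) (%x. norm x powr (d * s') * f x)"
   using interp[OF \<theta>(3)] T by (simp add: \<theta>(4) mult.assoc)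
  then have "weak_bound R' (2 * (1 + unit_ball_vol (real DIM('a))) * (2 * (N * T powr s'))) (%x. norm x powr k' * f x)"
  proof (rule weak_bound_lower_weight)
   have "k' <= d * s'" using adm d by (simp add: s'_def field_simps)
   then show "k' <= d * s'" .
   show "R' = 0 + (d * s' - k') / real DIM('a)"
    using d by (simp add: s'_def d_def[symmetric] field_simps)
  qed (use m nn adm R in auto)
  moreover have "2 * (1 + unit_ball_vol (real DIM('a))) * (2 * (N * T powr s'))
    = 4 * (1 + unit_ball_vol d) * N * T powr (k' / d + R')"
   by (simp add: s'_def d_def)
  ultimately show ?thesis by (simp only:)
 qed
qed

section \<open>The heat kernel: mass, scaling and pointwise bounds\<close>

lemma heat_kernel_nonneg [simp]: "0 <= hk t x"
 by (simp add: heat_kernel_def)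

lemma borel_measurable_heat_kernel [measurable]:
 "(%(t, x). hk t (x::'a::euclidean_space)) \<in> borel_measurable (borel \<Otimes>\<^sub>M borel)"
 unfolding heat_kernel_def split_beta by measurable

lemma borel_measurable_heat_kernel' [measurable (raw)]:
 fixes g :: "'b => 'a::euclidean_space"
 assumes "f \<in> borel_measurable M" "g \<in> borel_measurable M"
 shows "(%x. hk (f x) (g x)) \<in> borel_measurable M"
 using assms unfolding heat_kernel_def by measurable

text \<open>Coordinatewise the kernel is the centred normal density of variance
  \<open>2 * t\<close>; total mass and the semigroup law are inherited from one-dimensional
  Gaussians.\<close>

lemma heat_kernel_eq_prod:
 fixes x :: "'a::euclidean_space"
 assumes t: "0 < t"
 shows "hk t x = (\<Prod>b\<in>Basis. normal_density 0 (sqrt (2 * t)) (x \<bullet> b))"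
proof -
 have "(\<Prod>b\<in>Basis. normal_density 0 (sqrt (2 * t)) (x \<bullet> b))
   = (\<Prod>b\<in>(Basis::'a set). 1 / sqrt (4 * pi * t)) * (\<Prod>b\<in>Basis. exp (- (x \<bullet> b)\<^sup>2 / (4 * t)))"
 proof -
  have "normal_density 0 (sqrt (2 * t)) s = 1 / sqrt (4 * pi * t) * exp (- s\<^sup>2 / (4 * t))" for s
  proof -
   have "2 * pi * (sqrt (2 * t))\<^sup>2 = 4 * pi * t" "2 * (sqrt (2 * t))\<^sup>2 = 4 * t" using t by auto
   then show ?thesis unfolding normal_density_def by simp
  qed
  then show ?thesis by (simp only: prod.distrib)
 qed
 also have "(\<Prod>b\<in>(Basis::'a set). 1 / sqrt (4 * pi * t)) = ((4 * pi * t) powr (- (1 / 2))) ^ DIM('a)"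
 proof -
  have "(4 * pi * t) powr (1 / 2) = sqrt (4 * pi * t)" by (rule powr_half_sqrt) (use t in simp)
  then show ?thesis by (simp only: prod_constant powr_minus inverse_eq_divide)
 qed
 also have "... = (4 * pi * t) powr (- (real DIM('a) / 2))"
  using t by (subst powr_realpow[symmetric]) (auto simp only: powr_powr, auto)
 also have "(\<Prod>b\<in>Basis. exp (- (x \<bullet> b)\<^sup>2 / (4 * t))) = exp (- (norm x)\<^sup>2 / (4 * t))"
 proof -
  have "(norm x)\<^sup>2 = (\<Sum>b\<in>Basis. (x \<bullet> b)\<^sup>2)"
   unfolding power2_norm_eq_inner euclidean_inner[of x x] by (simp add: power2_eq_square)
  then show ?thesis by (simp add: exp_sum[symmetric] sum_negf sum_divide_distrib)
 qed
 finally show ?thesis by (simp add: heat_kernel_def)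
qed

lemma nn_integral_heat_kernel:
 assumes t: "0 < t"
 shows "(\<integral>\<^sup>+x. ennreal (hk t x) \<partial>(lborel :: 'a::euclidean_space measure)) = 1"
proof -
 let ?n = "normal_density 0 (sqrt (2 * t))"
 have "(\<integral>\<^sup>+x. ennreal (hk t x) \<partial>(lborel :: 'a measure)) = (\<integral>\<^sup>+x. (\<Prod>b\<in>Basis. ennreal (?n (x \<bullet> b))) \<partial>(lborel :: 'a measure))"
  by (simp add: heat_kernel_eq_prod[OF t] prod_ennreal)
 also have "... = (\<Prod>b\<in>(Basis::'a set). (NN x. ennreal (?n x)))"
  by (rule nn_integral_lborel_prod) auto
 also have "(NN x. ennreal (?n x)) = 1"
  using t by (subst nn_integral_eq_integral) auto
 finally show ?thesis by simp
qed

lemma heat_kernel_minus: "hk t (- x) = hk t x"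
 by (simp add: heat_kernel_def)

lemma heat_kernel_commute: "hk t (x - y) = hk t (y - x)"
 by (simp add: heat_kernel_def norm_minus_commute)

lemma nn_integral_lborel_scale:
 fixes f :: "'a::euclidean_space => ennreal"
 assumes f [measurable]: "f \<in> Bmeas" and c: "0 < c"
 shows "(NN x. f x) = ennreal (c ^ DIM('a)) * (NN x. f (c *\<^sub>R x))"
 by (subst lborel_affine[of c 0]) (use c in \<open>simp_all add: nn_integral_density nn_integral_distr nn_integral_cmult\<close>)

lemma nn_integral_lborel_translate:
 fixes f :: "'a::euclidean_space => ennreal"
 assumes f [measurable]: "f \<in> Bmeas"
 shows "(NN x. f (x + z)) = (NN x. f x)"
proof -
 have "(NN x. f x) = (\<integral>\<^sup>+x. f x \<partial>distr lborel borel ((+) z))" by (simp add: lborel_distr_plus)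
 also have "... = (NN x. f (z + x))" by (subst nn_integral_distr) auto
 finally show ?thesis by (simp add: add.commute)
qed

lemma nn_integral_lborel_reflect:
 fixes f :: "'a::euclidean_space => ennreal"
 assumes f [measurable]: "f \<in> Bmeas"
 shows "(NN x. f (z - x)) = (NN x. f x)"
 by (subst (2) lborel_affine[of "-1" z]) (simp_all add: nn_integral_density nn_integral_distr)

lemma nn_integral_heat_kernel_diff:
 assumes t: "0 < t"
 shows "(\<integral>\<^sup>+y. ennreal (hk t (x - y)) \<partial>(lborel :: 'a::euclidean_space measure)) = 1"
  and "(\<integral>\<^sup>+y. ennreal (hk t (y - x)) \<partial>(lborel :: 'a::euclidean_space measure)) = 1"
proof -
 show *: "(\<integral>\<^sup>+y. ennreal (hk t (x - y)) \<partial>(lborel :: 'a measure)) = 1"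
  using nn_integral_lborel_reflect[of "%y. ennreal (hk t y)" x] nn_integral_heat_kernel[OF t] by simp
 show "(\<integral>\<^sup>+y. ennreal (hk t (y - x)) \<partial>(lborel :: 'a measure)) = 1"
  using * by (simp add: heat_kernel_commute)
qed

lemma heat_kernel_scale:
 fixes z :: "'a::euclidean_space"
 assumes c: "0 < c" and t: "0 < t"
 shows "hk (c\<^sup>2 * t) (c *\<^sub>R z) = c powr (- real DIM('a)) * hk t z"
proof -
 have "(4 * pi * (c\<^sup>2 * t)) powr (- (real DIM('a) / 2)) = (c powr 2 * (4 * pi * t)) powr (- (real DIM('a) / 2))"
  using c by (simp add: powr_numeral mult_ac)
 also have "... = c powr (- real DIM('a)) * (4 * pi * t) powr (- (real DIM('a) / 2))"
  by (simp only: powr_mult powr_powr) simp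
 finally show ?thesis
  using c t by (simp add: heat_kernel_def power_mult_distrib)
qed

lemma heat_kernel_le:
 fixes z :: "'a::euclidean_space"
 assumes t: "0 < t"
 shows "hk t z <= hk t (0::'a)"
 unfolding heat_kernel_def using t by (intro mult_left_mono) auto

text \<open>Polynomial growth is absorbed by doubling the time: the power is at most
  \<open>exp (m * norm z)\<close>, and completing the square bounds \<open>m * norm z\<close> by
  \<open>2 * m^2 * t\<close> plus half of the available Gaussian exponent.\<close>

lemma weighted_heat_kernel_le:
 assumes m: "0 <= m" and t: "0 < t"
 obtains c where "0 < c"
  "!!z::'a::euclidean_space. (1 + norm z) powr m * hk t z <= c * hk (2 * t) z"
proof
 let ?D = "- (real DIM('a) / 2)"
 let ?c = "exp (2 * m\<^sup>2 * t) * ((4 * pi * t) powr ?D / (4 * pi * (2 * t)) powr ?D)"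
 show "0 < ?c" using t by simp
 fix z :: 'a
 have "(1 + norm z) powr m <= exp (norm z) powr m"
  using m by (intro powr_mono2) (auto simp: add.commute exp_ge_add_one_self)
 also have "... = exp (m * norm z)" by (simp add: powr_def)
 also have "... <= exp (2 * m\<^sup>2 * t + (norm z)\<^sup>2 / (8 * t))"
 proof -
  have "0 <= (norm z - 4 * m * t)\<^sup>2 / (8 * t)" using t by simp
  also have "... = (norm z)\<^sup>2 / (8 * t) - m * norm z + 2 * m\<^sup>2 * t"
   using t by (simp add: power2_eq_square field_simps)
  finally show ?thesis by simp
 qed
 finally have "(1 + norm z) powr m * exp (- (norm z)\<^sup>2 / (4 * t))
   <= exp (2 * m\<^sup>2 * t + (norm z)\<^sup>2 / (8 * t)) * exp (- (norm z)\<^sup>2 / (4 * t))"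
  by (rule mult_right_mono) simp
 also have "... = exp (2 * m\<^sup>2 * t) * exp (- (norm z)\<^sup>2 / (4 * (2 * t)))"
  using t by (simp add: exp_add[symmetric] field_simps)
 finally have "(4 * pi * t) powr ?D * ((1 + norm z) powr m * exp (- (norm z)\<^sup>2 / (4 * t)))
   <= (4 * pi * t) powr ?D * (exp (2 * m\<^sup>2 * t) * exp (- (norm z)\<^sup>2 / (4 * (2 * t))))"
  by (rule mult_left_mono) simp
 also have "... = ?c * hk (2 * t) z" using t by (simp add: heat_kernel_def)
 finally show "(1 + norm z) powr m * hk t z <= ?c * hk (2 * t) z"
  by (simp add: heat_kernel_def mult_ac)
qed

section \<open>Weighted smoothing estimates in dual form\<close>

text \<open>Separates the two weights: what is singular stays in the unit balls of \<open>x\<close>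
  and of \<open>y\<close>, and the rest is a power of \<open>1 + |x - y|\<close> that the Gaussian
  absorbs. When both points are outside the unit ball, their norms differ at most by the factor
  \<open>1 + |x - y|\<close>, and \<open>K2 <= K1\<close> makes the surplus power of
  \<open>norm y\<close> harmless.\<close>

lemma weighted_kernel_split:
 fixes x y :: "'a::euclidean_space"
 assumes K: "K2 <= K1"
 shows "norm x powr K2 * norm y powr (- K1)
  <= (if norm x <= 1 then norm x powr K2 else 1) * (if norm y <= 1 then norm y powr (- K1) else 1)
    * (1 + norm (x - y)) powr \<bar>K2\<bar>"
proof -
 define r where "r = norm (x - y)"
 have r: "0 <= r" "norm x <= norm y + r" "norm y <= norm x + r"
  using norm_triangle_ineq[of y "x - y"] norm_triangle_ineq[of x "y - x"]
  by (auto simp: r_def norm_minus_commute)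
 have one: "1 <= (1 + r) powr \<bar>K2\<bar>" using r by (intro ge_one_powr_ge_zero) auto
 consider "norm x <= 1" "norm y <= 1" | "1 < norm x" "norm y <= 1" | "norm x <= 1" "1 < norm y" | "1 < norm x" "1 < norm y"
  by linarith
 then show ?thesis
 proof cases
  case 1
  then show ?thesis
   using mult_left_mono[OF one, of "norm x powr K2 * norm y powr (- K1)"] by (simp add: r_def)
 next
  case 2
  have "norm x powr K2 <= (1 + r) powr \<bar>K2\<bar>"
  proof (cases "0 <= K2")
   case True
   then show ?thesis using 2 r by (simp add: powr_mono2)
  next
   case False
   then have "norm x powr K2 <= norm x powr 0" using 2 by (intro powr_mono) auto
   then show ?thesis using 2 one by (simp split: if_splits)
  qed
  from mult_right_mono[OF this, of "norm y powr (-K1)"] 2 show ?thesis by (simp add: r_def mult.commute)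
 next
  case 3
  have "norm y powr (-K1) <= (1 + r) powr \<bar>K2\<bar>"
  proof (cases "0 <= K2")
   case True
   then have "norm y powr (-K1) <= norm y powr 0" using 3 K by (intro powr_mono) auto
   then show ?thesis using 3 one by (simp split: if_splits)
  next
   case False
   then have "norm y powr (-K1) <= norm y powr (-K2)" using 3 K by (intro powr_mono) auto
   also have "... <= (1 + r) powr (-K2)" using False 3 r by (intro powr_mono2) auto
   finally show ?thesis using False by simp
  qed
  from mult_left_mono[OF this, of "norm x powr K2"] 3 show ?thesis by (simp add: r_def)
 next
  case 4
  have xy: "norm x <= norm y * (1 + r)" "norm y <= norm x * (1 + r)"
   using r 4 mult_right_mono[of 1 "norm y" r] mult_right_mono[of 1 "norm x" r] by (auto simp: algebra_simps)
  have "norm x powr K2 * norm y powr (-K1) <= norm x powr K2 * norm y powr (-K2)"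
   using 4 K by (intro mult_left_mono powr_mono) auto
  also have "... <= (1 + r) powr \<bar>K2\<bar>"
  proof (cases "0 <= K2")
   case True
   have "norm x powr K2 * norm y powr (-K2) = (norm x / norm y) powr K2"
    using 4 by (simp add: powr_divide powr_minus_divide)
   also have "... <= (1 + r) powr K2"
    using True 4 xy by (intro powr_mono2) (auto simp: divide_le_eq mult.commute)
   finally show ?thesis using True by simp
  next
   case False
   have "norm x powr K2 * norm y powr (-K2) = (norm y / norm x) powr (-K2)"
    using 4 by (simp add: powr_divide powr_minus_divide)
   also have "... <= (1 + r) powr (-K2)"
    using False 4 xy by (intro powr_mono2) (auto simp: divide_le_eq mult.commute)
   finally show ?thesis using False by simp
  qed
  finally show ?thesis using 4 by (simp add: r_def)
 qed
qed

text \<open>Split \<open>h\<close> at the level \<open>2 * N\<close>. Below it the mass of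
  \<open>w\<close> counts; above it lies a set of measure at most 1, where \<open>w <= c\<close> and
  the integral bound for weak functions apply. The factor 2 makes the measure estimate strict, also
  for \<open>R = 0\<close>.\<close>

lemma weak_bound_bounded_part:
 fixes h :: "'a::euclidean_space => real"
 assumes R: "0 <= R" "R < 1"
 obtains C where "0 < C"
  "!!h N w c. [|weak_bound R N h; 0 < N; h \<in> Lmeas; !!y. 0 <= h y;
    w \<in> Lmeas; !!y::'a. 0 <= w y; !!y. w y <= c; (NL y. ennreal (w y)) <= 1|]
    ==> (NL y. ennreal (w y * h y)) <= ennreal ((2 + C * c) * N)"
proof -
 obtain C where C: "0 < C"
  "!!f N E. [|weak_bound R N f; 0 < N; f \<in> Lmeas; E \<in> lmeasurable|] ==>
    (NL x. ennreal (f x) * indicator E (x::'a)) <= ennreal (C * N * measure lebesgue E powr (1 - R))"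
  using weak_bound_nn_integral[OF R] by blast
 show thesis
 proof (rule that[OF C(1)])
  fix h w :: "'a => real" and N c :: real
  assume h: "weak_bound R N h" and N: "0 < N" and hm [measurable]: "h \<in> Lmeas"
   and h0: "!!y. 0 <= h y" and wm [measurable]: "w \<in> Lmeas"
   and w0: "!!y. 0 <= w y" and wc: "!!y. w y <= c" and w1: "(NL y. ennreal (w y)) <= 1"
  define S where "S = {y. 2 * N < h y}"
  have S [measurable]: "S \<in> sets lebesgue" unfolding S_def using hm by (rule superlevel_sets_lebesgue)
  have S1: "emeasure lebesgue S <= 1"
  proof (rule ccontr)
   assume "~ ?thesis"
   then obtain E where E: "E \<subseteq> S" "E \<in> lmeasurable" "1 < measure lebesgue E"
    using lmeasurable_subset_measure_gt[OF S, of 1] by (metis ennreal_1 not_le zero_le_one)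
   have "2 * N * measure lebesgue E powr R <= N"
    using E(1) N by (intro weak_boundD[OF h _ E(2)]) (auto simp: S_def)
   moreover have "1 <= measure lebesgue E powr R" using E(3) R by (intro ge_one_powr_ge_zero) auto
   then have "2 * N * 1 <= 2 * N * measure lebesgue E powr R" using N by (intro mult_left_mono) auto
   ultimately show False using N by simp
  qed
  then have Sl: "S \<in> lmeasurable" using S by (auto simp: fmeasurable_def intro: le_less_trans)
  have mS: "measure lebesgue S <= 1" using S1 by (simp add: emeasure_eq_measure2[OF Sl])
  have c0: "0 <= c" using w0 wc order_trans by blast
  have "(NL y. ennreal (w y * h y))
    <= (NL y. ennreal (2 * N) * ennreal (w y) + ennreal c * (ennreal (h y) * indicator S y))"
  proof (rule nn_integral_mono)
   fix y
   show "ennreal (w y * h y) <= ennreal (2 * N) * ennreal (w y) + ennreal c * (ennreal (h y) * indicator S y)"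
   proof (cases "y \<in> S")
    case True
    have "ennreal (w y * h y) <= ennreal (c * h y)"
     using wc h0 by (intro ennreal_leI mult_right_mono) auto
    then show ?thesis using True c0 h0 by (simp add: ennreal_mult add_increasing)
   next
    case False
    have "ennreal (w y * h y) <= ennreal (w y * (2 * N))"
     using w0 False by (intro ennreal_leI mult_left_mono) (auto simp: S_def)
    then show ?thesis using False w0 N by (simp add: ennreal_mult mult.commute)
   qed
  qed
  also have "... = ennreal (2 * N) * (NL y. ennreal (w y))
    + ennreal c * (NL y. ennreal (h y) * indicator S y)"
   by (subst nn_integral_add, measurable) (simp add: nn_integral_cmult)
  also have "... <= ennreal (2 * N) * 1 + ennreal c * ennreal (C * N * measure lebesgue S powr (1 - R))"
   by (intro add_mono mult_left_mono w1 C(2) h N hm Sl) auto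
  also have "... <= ennreal (2 * N) * 1 + ennreal c * ennreal (C * N * 1)"
   using C(1) N mS R by (intro add_mono mult_left_mono ennreal_leI powr_le1) auto
  also have "... = ennreal ((2 + C * c) * N)"
   using C(1) N c0 by (simp add: ennreal_mult[symmetric] ennreal_plus[symmetric] algebra_simps del: ennreal_plus)
  finally show "(NL y. ennreal (w y * h y)) <= ennreal ((2 + C * c) * N)" .
 qed
qed

text \<open>Integrals over sets of finite measure of a power which is locally in weak \<open>L\<^sup>1\<^sup>/\<^sup>R\<close>.\<close>

lemma nn_integral_local_weight:
 fixes K R :: real
 assumes R: "0 <= R" "R < 1" and K: "0 <= K / real DIM('a::euclidean_space) + R"
 obtains C where "0 < C"
  "!!E. E \<in> lmeasurable ==>
    (NL x. ennreal (norm x powr K) * indicator (E \<inter> cball (0::'a) 1) x)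
     <= ennreal (C * measure lebesgue E powr (1 - R))"
proof -
 let ?d = "real DIM('a)" and ?B = "cball (0::'a) 1"
 \<comment> \<open>On the unit ball a positive power is at most 1, and the hypothesis
   \<open>K\<close> limits a singular one: \<open>\<kappa> / d <= R\<close>.\<close>
 define \<kappa> where "\<kappa> = max 0 (- K)"
 have d: "0 < ?d" by simp
 have \<kappa>R: "\<kappa> / ?d <= R" using K R d by (auto simp: \<kappa>_def max_def field_simps)
 have \<kappa>: "0 <= \<kappa>" "\<kappa> / ?d < 1" "\<kappa> <= ?d" "- \<kappa> <= K"
 proof -
  show "0 <= \<kappa>" "- \<kappa> <= K" by (auto simp: \<kappa>_def)
  show *: "\<kappa> / ?d < 1" using \<kappa>R R by linarith
  show "\<kappa> <= ?d" using * by (subst (asm) pos_divide_less_eq) auto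
 qed
 obtain C where C: "0 < C"
  "!!f N E. [|weak_bound (\<kappa> / ?d) N f; 0 < N; f \<in> Lmeas; E \<in> lmeasurable|] ==>
    (NL x. ennreal (f x) * indicator E (x::'a)) <= ennreal (C * N * measure lebesgue E powr (1 - \<kappa> / ?d))"
  using weak_bound_nn_integral[OF divide_nonneg_nonneg[OF \<kappa>(1) of_nat_0_le_iff] \<kappa>(2)] by blast
 define \<omega> where "\<omega> = 1 + unit_ball_vol ?d"
 have \<omega>: "1 <= \<omega>" by (simp add: \<omega>_def)
 define b where "b = 1 + measure lebesgue ?B"
 have b: "1 <= b" by (simp add: b_def)
 have C0: "0 < C * \<omega> * b" using C(1) \<omega> b by simp
 show thesis
 proof (rule that[OF C0])
  fix E :: "'a set" assume E: "E \<in> lmeasurable"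
  have EB: "E \<inter> ?B \<in> lmeasurable" using E by (intro fmeasurable_Int_fmeasurable) auto
  let ?m = "measure lebesgue (E \<inter> ?B)"
  have m: "?m <= b" "?m <= measure lebesgue E"
  proof -
   have "?m <= measure lebesgue ?B"
    using EB by (intro measure_mono_fmeasurable) (auto simp: fmeasurableD lmeasurable_cball)
   then show "?m <= b" by (simp add: b_def)
   show "?m <= measure lebesgue E"
    using EB E by (intro measure_mono_fmeasurable) (auto simp: fmeasurableD)
  qed
  have "(NL x. ennreal (norm x powr K) * indicator (E \<inter> ?B) x)
    <= (NL x. ennreal (norm x powr (- \<kappa>)) * indicator (E \<inter> ?B) x)"
   using \<kappa> by (intro nn_integral_mono) (auto simp: indicator_def intro!: ennreal_leI powr_mono')
  also have "... <= ennreal (C * \<omega> * ?m powr (1 - \<kappa> / ?d))"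
  proof (rule C(2))
   show "weak_bound (\<kappa> / ?d) \<omega> (%x::'a. norm x powr (- \<kappa>))"
    unfolding \<omega>_def using \<kappa> by (intro weak_bound_power_weight) auto
  qed (use \<omega> EB in auto)
  also have "... <= ennreal (C * \<omega> * b * measure lebesgue E powr (1 - R))"
  proof (rule ennreal_leI)
   \<comment> \<open>The exponent \<open>1 - \<kappa> / d\<close> may exceed \<open>1 - R\<close>;
     the surplus power is bounded because the set lies in the unit ball.\<close>
   have "?m powr (1 - \<kappa> / ?d) = ?m powr (R - \<kappa> / ?d) * ?m powr (1 - R)"
    by (simp add: powr_add[symmetric])
   also have "... <= b * measure lebesgue E powr (1 - R)"
   proof (intro mult_mono)
    have "0 <= \<kappa> / ?d" using \<kappa> by simp
    then have R1: "R - \<kappa> / ?d <= 1" using R by linarith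
    have "?m powr (R - \<kappa> / ?d) <= b powr (R - \<kappa> / ?d)" using m \<kappa>R by (intro powr_mono2) auto
    also have "... <= b powr 1" using b R1 by (intro powr_mono) auto
    finally show "?m powr (R - \<kappa> / ?d) <= b" using b by simp
   qed (use m R b in \<open>auto intro: powr_mono2\<close>)
   finally show "C * \<omega> * ?m powr (1 - \<kappa> / ?d) <= C * \<omega> * b * measure lebesgue E powr (1 - R)"
    using C(1) \<omega> by (simp add: mult.assoc)
  qed
  finally show "(NL x. ennreal (norm x powr K) * indicator (E \<inter> ?B) x)
   <= ennreal (C * \<omega> * b * measure lebesgue E powr (1 - R))" .
 qed
qed

text \<open>The data split into a part near the origin, integrable because
  \<open>K1 / d + R1 < 1\<close>, and a part far from it, which keeps the weak exponent
  \<open>R1\<close>. Both convolutions are bounded; integrated over \<open>E\<close>, the first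
  gives at most its mass and the second a multiple of \<open>|E|^(1 - R1)\<close>. If the measure of
  \<open>E\<close> is at most 1, the boundedness yields the power \<open>1 - R2\<close>; if it is
  larger, the integrated bounds do, since \<open>R2 <= R1\<close>.\<close>

lemma smoothing_unit_time:
 fixes K1 K2 R1 R2 :: real
 defines "d \<equiv> real DIM('a::euclidean_space)"
 assumes R1: "0 <= R1" "R1 < 1" and S1: "K1 / d + R1 < 1" and K: "K2 <= K1"
  and R2: "0 <= R2" "R2 <= R1" and S2: "0 <= K2 / d + R2"
 obtains C where "0 < C"
  "!!f N E. [|f \<in> Bmeas; !!y. 0 <= f y; 0 < N; weak_bound R1 N (%y::'a. norm y powr K1 * f y);
    E \<in> sets borel; E \<in> lmeasurable|] ==>
   (NN x. ennreal (norm x powr K2) * indicator E x *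
     (NN y. ennreal (hk 1 (x - y) * f y)))
    <= ennreal (C * N * measure lebesgue E powr (1 - R2))"
proof -
 have d: "0 < d" by (simp add: d_def)
 let ?B = "cball (0::'a) 1"
 have Bl: "?B \<in> lmeasurable" by simp
 have [measurable]: "?B \<in> sets borel" "- ?B \<in> sets borel" by auto
 \<comment> \<open>Replacing \<open>K1\<close> by its positive part costs nothing on the unit ball
   and keeps \<open>\<kappa> / d + R1 < 1\<close>.\<close>
 define \<kappa> where "\<kappa> = max 0 K1"
 have \<kappa>: "0 <= \<kappa>" "\<kappa> / d + R1 < 1" "K1 <= \<kappa>" using S1 R1 by (auto simp: \<kappa>_def max_def)
 then have \<kappa>d: "\<kappa> <= d"
 proof -
  have "\<kappa> / d < 1" using \<kappa> R1 by linarith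
  then show ?thesis using d by (subst (asm) pos_divide_less_eq) auto
 qed
 have Q: "0 <= \<kappa> / d + R1" using \<kappa> d R1 by simp
 obtain Ca where Ca: "0 < Ca"
  "!!f N E. [|weak_bound (\<kappa> / d + R1) N f; 0 < N; f \<in> Lmeas; E \<in> lmeasurable|] ==>
    (NL x. ennreal (f x) * indicator E (x::'a)) <= ennreal (Ca * N * measure lebesgue E powr (1 - (\<kappa> / d + R1)))"
  using weak_bound_nn_integral[OF Q \<kappa>(2)] by blast
 obtain Cb where Cb: "0 < Cb"
  "!!f N E. [|weak_bound R1 N f; 0 < N; f \<in> Lmeas; E \<in> lmeasurable|] ==>
    (NL x. ennreal (f x) * indicator E (x::'a)) <= ennreal (Cb * N * measure lebesgue E powr (1 - R1))"
  using weak_bound_nn_integral[OF R1] by blast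
 obtain Cc where Cc: "0 < Cc"
  "!!h N w c. [|weak_bound R1 N h; 0 < N; h \<in> Lmeas; !!y. 0 <= h y;
    w \<in> Lmeas; !!y::'a. 0 <= w y; !!y. w y <= c; (NL y. ennreal (w y)) <= 1|]
    ==> (NL y. ennreal (w y * h y)) <= ennreal ((2 + Cc * c) * N)"
  by (rule weak_bound_bounded_part[OF R1]) blast
 obtain Cd where Cd: "0 < Cd"
  "!!E. E \<in> lmeasurable ==>
    (NL x. ennreal (norm x powr K2) * indicator (E \<inter> ?B) x)
     <= ennreal (Cd * measure lebesgue E powr (1 - R2))"
  using nn_integral_local_weight[where 'a='a, OF R2(1) le_less_trans[OF R2(2) R1(2)] S2[unfolded d_def]]
  by blast
 obtain c0 where c0: "0 < c0" "!!z::'a. (1 + norm z) powr \<bar>K2\<bar> * hk 1 z <= c0 * hk 2 z"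
  using weighted_heat_kernel_le[of "\<bar>K2\<bar>" 1] by auto
 define \<omega> where "\<omega> = 1 + unit_ball_vol d"
 have \<omega>: "1 <= \<omega>" by (simp add: \<omega>_def d_def)
 define \<gamma> where "\<gamma> = hk 2 (0::'a)"
 have \<gamma>: "0 <= \<gamma>" by (simp add: \<gamma>_def)
 define c1 where "c1 = Ca * (2 * \<omega>) * measure lebesgue ?B powr (1 - (\<kappa> / d + R1))"
 have c1: "0 <= c1" using Ca \<omega> by (simp add: c1_def)
 define c3 where "c3 = \<gamma> * c1 + (2 + Cc * \<gamma>)"
 have c3: "0 < c3" using \<gamma> c1 Cc by (simp add: c3_def add_nonneg_pos add_pos_nonneg)
 define C where "C = c0 * (c3 * Cd + (c3 + c1 + Cb))"
 have C: "0 < C" using c0 c3 Cd c1 Cb by (simp add: C_def add_pos_pos add_nonneg_pos add_pos_nonneg)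
 show thesis
 proof (rule that[OF C])
  fix f :: "'a => real" and N :: real and E :: "'a set"
  assume fm [measurable]: "f \<in> Bmeas" and f0: "!!y. 0 <= f y" and N: "0 < N"
   and f: "weak_bound R1 N (%y. norm y powr K1 * f y)"
   and Em [measurable]: "E \<in> sets borel" and E: "E \<in> lmeasurable"
  let ?e = "measure lebesgue E"
  define h where "h y = norm y powr K1 * f y" for y
  have hm [measurable]: "h \<in> Bmeas" unfolding h_def by measurable
  have h0: "0 <= h y" for y using f0 by (simp add: h_def)
  have hw: "weak_bound R1 N h" using f by (simp add: h_def[abs_def])
  define g1 where "g1 y = indicator ?B y * norm y powr (- K1) * h y" for y
  define g2 where "g2 y = indicator (- ?B) y * h y" for y
  have gm [measurable]: "g1 \<in> Bmeas" "g2 \<in> Bmeas"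
   unfolding g1_def g2_def by measurable
  have g0: "0 <= g1 y" "0 <= g2 y" for y using h0 by (auto simp: g1_def g2_def)
  have leb: "u \<in> Lmeas" if "u \<in> Bmeas" for u :: "'a => real"
   using measurable_completion[of u lborel borel] that by simp
  have G1: "(NN y. ennreal (g1 y)) <= ennreal (c1 * N)"
  proof -
   have "weak_bound (\<kappa> / d + R1) (2 * \<omega> * N) (%y. norm y powr (- \<kappa>) * h y)"
    using \<kappa> \<kappa>d R1 h0 d unfolding \<omega>_def d_def
    by (intro weak_bound_mult weak_bound_power_weight hw leb) auto
   then have "(NL y. ennreal (norm y powr (- \<kappa>) * h y) * indicator ?B y)
     <= ennreal (Ca * (2 * \<omega> * N) * measure lebesgue ?B powr (1 - (\<kappa> / d + R1)))"
    using \<omega> N by (intro Ca(2) leb Bl) auto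
   moreover have "(NL y. ennreal (g1 y))
     <= (NL y. ennreal (norm y powr (- \<kappa>) * h y) * indicator ?B y)"
    using \<kappa> h0 by (intro nn_integral_mono)
     (auto simp: g1_def indicator_def intro!: ennreal_leI mult_right_mono powr_mono')
   ultimately show ?thesis by (simp add: nn_integral_completion c1_def mult_ac)
  qed
  have G2: "weak_bound R1 N g2"
   by (rule weak_bound_AE_mono[OF hw]) (auto simp: g2_def indicator_def h0)
  define conv where "conv g x = (NN y. ennreal (hk 2 (x - y) * g y))" for g :: "'a => real" and x
  have conv1: "conv g1 x <= ennreal (\<gamma> * c1 * N)" for x
  proof -
   have "conv g1 x <= (NN y. ennreal \<gamma> * ennreal (g1 y))"
    unfolding conv_def \<gamma>_def
    by (intro nn_integral_mono) (auto simp: ennreal_mult[symmetric] g0 intro!: ennreal_leI mult_right_mono heat_kernel_le)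
   also have "... = ennreal \<gamma> * (NN y. ennreal (g1 y))" by (intro nn_integral_cmult) auto
   also have "... <= ennreal \<gamma> * ennreal (c1 * N)" by (intro mult_left_mono G1) auto
   finally show ?thesis using \<gamma> c1 N by (simp add: ennreal_mult[symmetric] mult.assoc)
  qed
  have conv2: "conv g2 x <= ennreal ((2 + Cc * \<gamma>) * N)" for x
  proof -
   have "(NL y. ennreal (hk 2 (x - y) * g2 y)) <= ennreal ((2 + Cc * \<gamma>) * N)"
    by (rule Cc(2)[OF G2 N]) (auto simp: g0 nn_integral_completion nn_integral_heat_kernel_diff \<gamma>_def
      intro!: leb heat_kernel_le)
   then show ?thesis by (simp add: conv_def nn_integral_completion)
  qed
  have convm [measurable]: "conv g \<in> Bmeas" if [measurable]: "g \<in> Bmeas" for g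
   unfolding conv_def by measurable
  have conv_sum: "conv g1 x + conv g2 x <= ennreal (c3 * N)" for x
  proof -
   have "conv g1 x + conv g2 x <= ennreal (\<gamma> * c1 * N) + ennreal ((2 + Cc * \<gamma>) * N)"
    by (intro add_mono conv1 conv2)
   also have "... = ennreal (c3 * N)"
    using \<gamma> c1 N Cc by (simp add: ennreal_plus[symmetric] c3_def algebra_simps del: ennreal_plus)
   finally show ?thesis .
  qed
  have E1: "(NN x. indicator E x * conv g1 x) <= ennreal (c1 * N)"
  proof -
   have "(NN x. indicator E x * conv g1 x)
     = (NN x. (NN y. indicator E x * ennreal (hk 2 (x - y) * g1 y)))"
    unfolding conv_def by (subst nn_integral_cmult) auto
   also have "... = (NN y. (NN x. indicator E x * ennreal (hk 2 (x - y) * g1 y)))"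
    by (rule lborel_pair.Fubini') measurable
   also have "... <= (NN y. (NN x. ennreal (g1 y) * ennreal (hk 2 (x - y))))"
    using g0 by (intro nn_integral_mono) (auto simp: indicator_def ennreal_mult mult.commute)
   also have "... = (NN y. ennreal (g1 y))"
    by (subst nn_integral_cmult) (auto simp: nn_integral_heat_kernel_diff)
   finally show ?thesis using G1 by simp
  qed
  have E2: "(NN x. indicator E x * conv g2 x) <= ennreal (Cb * N * ?e powr (1 - R1))"
  proof -
   \<comment> \<open>Translation invariance: the weak bound of \<open>g2\<close> is applied on a
     translate of \<open>E\<close>, and the kernel then only contributes its mass.\<close>
   have inner: "(NN x. indicator E x * ennreal (g2 (x - z))) <= ennreal (Cb * N * ?e powr (1 - R1))" for z
   proof -
    let ?Ez = "(%x. x + z) -` E"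
    have Ezm [measurable]: "?Ez \<in> sets borel" using measurable_sets[of "%x. x + z" borel borel E] by simp
    have "emeasure lborel ?Ez = (NN x. indicator ?Ez x)" by simp
    also have "... = (NN x. indicator E (x + z))"
     by (intro nn_integral_cong) (simp add: indicator_def)
    also have "... = emeasure lborel E" by (subst nn_integral_lborel_translate) auto
    finally have em: "emeasure lborel ?Ez = emeasure lborel E" .
    then have Ezl: "?Ez \<in> lmeasurable" "measure lebesgue ?Ez = ?e"
     using E by (auto simp: fmeasurable_def measure_def emeasure_completion)
    have "(NN x. indicator E x * ennreal (g2 (x - z)))
      = (NN x. indicator E (x + z) * ennreal (g2 (x + z - z)))"
     by (rule nn_integral_lborel_translate[symmetric]) auto
    also have "... = (NL x. ennreal (g2 x) * indicator ?Ez x)"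
     by (simp add: nn_integral_completion mult.commute indicator_def cong: if_cong)
    also have "... <= ennreal (Cb * N * ?e powr (1 - R1))"
     using Cb(2)[OF G2 N leb[OF gm(2)] Ezl(1)] Ezl(2) by simp
    finally show ?thesis .
   qed
   have "conv g2 x = (NN z. ennreal (hk 2 z * g2 (x - z)))" for x
    unfolding conv_def
    using nn_integral_lborel_reflect[of "%y. ennreal (hk 2 (x - y) * g2 y)" x] by simp
   then have "(NN x. indicator E x * conv g2 x)
     = (NN x. (NN z. indicator E x * ennreal (hk 2 z * g2 (x - z))))"
    by (subst nn_integral_cmult) auto
   also have "... = (NN z. (NN x. indicator E x * ennreal (hk 2 z * g2 (x - z))))"
    by (rule lborel_pair.Fubini') measurable
   also have "... = (NN z. ennreal (hk 2 z) * (NN x. indicator E x * ennreal (g2 (x - z))))"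
    by (subst nn_integral_cmult[symmetric]) (auto simp: ennreal_mult g0 mult_ac intro!: nn_integral_cong)
   also have "... <= (NN z. ennreal (hk 2 (z::'a)) * ennreal (Cb * N * ?e powr (1 - R1)))"
    by (intro nn_integral_mono mult_left_mono inner) auto
   also have "... = ennreal (Cb * N * ?e powr (1 - R1))"
    by (subst nn_integral_multc) (auto simp: nn_integral_heat_kernel)
   finally show ?thesis .
  qed
  have ptw: "ennreal (norm x powr K2) * (NN y. ennreal (hk 1 (x - y) * f y))
    <= ennreal c0 * ((ennreal (norm x powr K2) * indicator ?B x + 1) * (conv g1 x + conv g2 x))" for x
  proof -
   let ?A = "if norm x <= 1 then norm x powr K2 else 1"
   have "ennreal (norm x powr K2) * (NN y. ennreal (hk 1 (x - y) * f y))
     = (NN y. ennreal (norm x powr K2 * (hk 1 (x - y) * f y)))"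
    by (subst nn_integral_cmult[symmetric]) (auto simp: ennreal_mult f0)
   also have "... <= (NN y. ennreal (c0 * ?A) * (ennreal (hk 2 (x - y) * g1 y) + ennreal (hk 2 (x - y) * g2 y)))"
   proof (rule nn_integral_mono_AE)
    have "AE y in lborel. y \<noteq> (0::'a)" by (rule AE_lborel_singleton)
    then show "AE y in lborel. ennreal (norm x powr K2 * (hk 1 (x - y) * f y)) <=
      ennreal (c0 * ?A) * (ennreal (hk 2 (x - y) * g1 y) + ennreal (hk 2 (x - y) * g2 y))"
    proof eventually_elim
     fix y :: 'a assume y: "y \<noteq> 0"
     let ?Bw = "if norm y <= 1 then norm y powr (- K1) else 1"
     have fy: "f y = norm y powr (- K1) * h y" using y by (simp add: h_def powr_minus field_simps)
     have gg: "g1 y + g2 y = ?Bw * h y" by (simp add: g1_def g2_def indicator_def)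
     have "norm x powr K2 * (hk 1 (x - y) * f y)
       = (norm x powr K2 * norm y powr (- K1)) * (hk 1 (x - y) * h y)" by (simp add: fy mult_ac)
     also have "... <= (?A * ?Bw * (1 + norm (x - y)) powr \<bar>K2\<bar>) * (hk 1 (x - y) * h y)"
      by (intro mult_right_mono weighted_kernel_split K) (auto simp: h0)
     also have "... = (?A * ?Bw * h y) * ((1 + norm (x - y)) powr \<bar>K2\<bar> * hk 1 (x - y))"
      by (simp only: mult_ac)
     also have "... <= (?A * ?Bw * h y) * (c0 * hk 2 (x - y))"
      by (intro mult_left_mono c0) (auto simp: h0)
     also have "... = (c0 * ?A) * (hk 2 (x - y) * g1 y + hk 2 (x - y) * g2 y)"
      unfolding distrib_left[symmetric] gg by (simp only: mult_ac)
     finally show "ennreal (norm x powr K2 * (hk 1 (x - y) * f y)) <=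
      ennreal (c0 * ?A) * (ennreal (hk 2 (x - y) * g1 y) + ennreal (hk 2 (x - y) * g2 y))"
      using c0(1) g0[of y]
      by (subst ennreal_plus[symmetric], simp, simp, subst ennreal_mult[symmetric]) (auto intro!: ennreal_leI)
    qed
   qed
   also have "... = ennreal (c0 * ?A) * (conv g1 x + conv g2 x)"
    unfolding conv_def by (subst nn_integral_cmult, measurable) (subst nn_integral_add, auto)
   also have "... = ennreal c0 * (ennreal ?A * (conv g1 x + conv g2 x))"
    using c0 by (simp add: ennreal_mult mult.assoc)
   also have "... <= ennreal c0 * ((ennreal (norm x powr K2) * indicator ?B x + 1) * (conv g1 x + conv g2 x))"
    by (intro mult_left_mono mult_right_mono) (auto simp: indicator_def add_increasing2)
   finally show ?thesis .
  qed
  \<comment> \<open>The singular local weight is paired with the sup bound \<open>conv_sum\<close>;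
    what remains is an integral over \<open>E\<close> without weight, estimated by cases on its
    measure.\<close>
  have "(NN x. ennreal (norm x powr K2) * indicator E x *
     (NN y. ennreal (hk 1 (x - y) * f y)))
    <= (NN x. ennreal c0 * (ennreal (c3 * N) * (ennreal (norm x powr K2) * indicator (E \<inter> ?B) x)
      + indicator E x * (conv g1 x + conv g2 x)))"
  proof (rule nn_integral_mono)
   fix x
   have "ennreal (norm x powr K2) * indicator E x * (NN y. ennreal (hk 1 (x - y) * f y))
     = indicator E x * (ennreal (norm x powr K2) * (NN y. ennreal (hk 1 (x - y) * f y)))"
    by (simp only: mult_ac)
   also have "... <= indicator E x * (ennreal c0 * ((ennreal (norm x powr K2) * indicator ?B x + 1) * (conv g1 x + conv g2 x)))"
    by (intro mult_left_mono ptw) auto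
   also have "... = ennreal c0 * ((conv g1 x + conv g2 x) * (ennreal (norm x powr K2) * indicator (E \<inter> ?B) x)
      + indicator E x * (conv g1 x + conv g2 x))"
    by (simp add: indicator_inter_arith distrib_right distrib_left mult_ac)
   also have "... <= ennreal c0 * (ennreal (c3 * N) * (ennreal (norm x powr K2) * indicator (E \<inter> ?B) x)
      + indicator E x * (conv g1 x + conv g2 x))"
    by (intro mult_left_mono add_mono mult_right_mono conv_sum) auto
   finally show "ennreal (norm x powr K2) * indicator E x * (NN y. ennreal (hk 1 (x - y) * f y))
     <= ennreal c0 * (ennreal (c3 * N) * (ennreal (norm x powr K2) * indicator (E \<inter> ?B) x)
      + indicator E x * (conv g1 x + conv g2 x))" .
  qed
  also have "... = ennreal c0 * (ennreal (c3 * N) * (NN x. ennreal (norm x powr K2) * indicator (E \<inter> ?B) x)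
      + (NN x. indicator E x * (conv g1 x + conv g2 x)))"
   by (subst nn_integral_cmult, measurable, subst nn_integral_add, measurable, subst nn_integral_cmult) auto
  also have "... <= ennreal c0 * (ennreal (c3 * N) * ennreal (Cd * ?e powr (1 - R2))
      + ennreal ((c3 + c1 + Cb) * N * ?e powr (1 - R2)))"
  proof (intro mult_left_mono add_mono)
   show "(NN x. ennreal (norm x powr K2) * indicator (E \<inter> ?B) x) <= ennreal (Cd * ?e powr (1 - R2))"
    using Cd(2)[OF E] by (simp add: nn_integral_completion)
   show "(NN x. indicator E x * (conv g1 x + conv g2 x)) <= ennreal ((c3 + c1 + Cb) * N * ?e powr (1 - R2))"
   proof (cases "?e <= 1")
    case True
    have "(NN x. indicator E x * (conv g1 x + conv g2 x)) <= (NN x. indicator E x * ennreal (c3 * N))"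
     by (intro nn_integral_mono mult_left_mono conv_sum) auto
    also have "... = ennreal (c3 * N * ?e)"
    proof -
     have "emeasure lborel E = ennreal ?e"
      using emeasure_eq_measure2[OF E] by (simp add: emeasure_completion)
     then show ?thesis using c3 N by (subst nn_integral_multc) (auto simp: ennreal_mult mult.commute)
    qed
    also have "... <= ennreal ((c3 + c1 + Cb) * N * ?e powr (1 - R2))"
    proof (intro ennreal_leI mult_mono)
     show "?e <= ?e powr (1 - R2)" using powr_mono'[of "1 - R2" 1 ?e] True R2 by simp
    qed (use c3 N c1 Cb in auto)
    finally show ?thesis .
   next
    case False
    have "(NN x. indicator E x * (conv g1 x + conv g2 x))
      = (NN x. indicator E x * conv g1 x) + (NN x. indicator E x * conv g2 x)"
     by (simp add: distrib_left nn_integral_add)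
    also have "... <= ennreal (c1 * N) + ennreal (Cb * N * ?e powr (1 - R1))"
     by (intro add_mono E1 E2)
    also have "... = ennreal (c1 * N + Cb * N * ?e powr (1 - R1))"
     using c1 N Cb by (intro ennreal_plus[symmetric]) auto
    also have "... <= ennreal ((c3 + c1 + Cb) * N * ?e powr (1 - R2))"
    proof (rule ennreal_leI)
     have "c1 * N * 1 <= c1 * N * ?e powr (1 - R2)"
      using c1 N False R1 R2 by (intro mult_left_mono ge_one_powr_ge_zero) auto
     moreover have "Cb * N * ?e powr (1 - R1) <= Cb * N * ?e powr (1 - R2)"
      using Cb N False R2 by (intro mult_left_mono powr_mono) auto
     moreover have "0 <= c3 * N * ?e powr (1 - R2)" using c3 N by simp
     ultimately show "c1 * N + Cb * N * ?e powr (1 - R1) <= (c3 + c1 + Cb) * N * ?e powr (1 - R2)"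
      by (simp add: distrib_right)
    qed
    finally show ?thesis .
   qed
  qed auto
  also have "... = ennreal (C * N * ?e powr (1 - R2))"
  proof -
   have X1: "ennreal (c3 * N) * ennreal (Cd * ?e powr (1 - R2)) + ennreal ((c3 + c1 + Cb) * N * ?e powr (1 - R2))
     = ennreal (c3 * N * (Cd * ?e powr (1 - R2)) + (c3 + c1 + Cb) * N * ?e powr (1 - R2))"
    using c3 N Cd c1 Cb by (subst ennreal_mult[symmetric]) (auto intro!: ennreal_plus[symmetric])
   have X2: "c0 * (c3 * N * (Cd * ?e powr (1 - R2)) + (c3 + c1 + Cb) * N * ?e powr (1 - R2)) = C * N * ?e powr (1 - R2)"
    by (simp add: C_def algebra_simps)
   have "ennreal c0 * ennreal (c3 * N * (Cd * ?e powr (1 - R2)) + (c3 + c1 + Cb) * N * ?e powr (1 - R2))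
     = ennreal (c0 * (c3 * N * (Cd * ?e powr (1 - R2)) + (c3 + c1 + Cb) * N * ?e powr (1 - R2)))"
    using c0(1) c3 N Cd(1) c1 Cb(1) by (intro ennreal_mult[symmetric]) auto
   then show ?thesis by (simp only: X1 X2)
  qed
  finally show "(NN x. ennreal (norm x powr K2) * indicator E x *
     (NN y. ennreal (hk 1 (x - y) * f y)))
    <= ennreal (C * N * ?e powr (1 - R2))" .
 qed
qed

text \<open>Parabolic scaling by \<open>sqrt t\<close> reduces to unit time; the power of
  \<open>t\<close> is minus \<open>d/2\<close> times the loss of homogeneity.\<close>

lemma smoothing:
 fixes K1 K2 R1 R2 :: real
 defines "d \<equiv> real DIM('a::euclidean_space)"
 assumes R1: "0 <= R1" "R1 < 1" and S1: "K1 / d + R1 < 1" and K: "K2 <= K1"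
  and R2: "0 <= R2" "R2 <= R1" and S2: "0 <= K2 / d + R2"
 obtains C where "0 < C"
  "!!f N E t. [|f \<in> Bmeas; !!y. 0 <= f y; 0 < N; weak_bound R1 N (%y::'a. norm y powr K1 * f y);
    E \<in> sets borel; E \<in> lmeasurable; 0 < t|] ==>
   (NN x. ennreal (norm x powr K2) * indicator E x *
     (NN y. ennreal (hk t (x - y) * f y)))
    <= ennreal (C * t powr (- (d / 2) * (K1 / d + R1 - (K2 / d + R2))) * N * measure lebesgue E powr (1 - R2))"
proof -
 have d: "0 < d" by (simp add: d_def)
 obtain C where C: "0 < C"
  "!!f N E. [|f \<in> Bmeas; !!y. 0 <= f y; 0 < N; weak_bound R1 N (%y::'a. norm y powr K1 * f y);
    E \<in> sets borel; E \<in> lmeasurable|] ==>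
   (NN x. ennreal (norm x powr K2) * indicator E x *
     (NN y. ennreal (hk 1 (x - y) * f y)))
    <= ennreal (C * N * measure lebesgue E powr (1 - R2))"
  using smoothing_unit_time[where 'a='a, OF R1 S1[unfolded d_def] K R2 S2[unfolded d_def]] by blast
 show thesis
 proof (rule that[OF C(1)])
  fix f :: "'a => real" and N t :: real and E :: "'a set"
  assume fm [measurable]: "f \<in> Bmeas" and f0: "!!y. 0 <= f y" and N: "0 < N"
   and f: "weak_bound R1 N (%y. norm y powr K1 * f y)"
   and Em [measurable]: "E \<in> sets borel" and E: "E \<in> lmeasurable" and t: "0 < t"
  define c where "c = sqrt t"
  have c: "0 < c" "c\<^sup>2 = t" using t by (auto simp: c_def)
  let ?D = "DIM('a)"
  let ?E' = "(*\<^sub>R) c -` E"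
  have E'm [measurable]: "?E' \<in> sets borel" using measurable_sets[of "(*\<^sub>R) c" borel borel E] by simp
  have E'eq: "?E' = (*\<^sub>R) (1/c) ` E"
   using c by (auto simp: image_iff intro!: bexI[of _ "c *\<^sub>R _"])
  have E'l: "?E' \<in> lmeasurable" "measure lebesgue ?E' = c powr (- d) * measure lebesgue E"
  proof -
   have "(1 / c) powr d = c powr (- d)" using c by (simp add: powr_divide powr_minus_divide)
   then show "?E' \<in> lmeasurable" "measure lebesgue ?E' = c powr (- d) * measure lebesgue E"
    using scaleR_image_lmeasurable[OF E, of "1/c"] c(1) unfolding E'eq d_def by (simp_all only: divide_pos_pos zero_less_one)
  qed
  define fc where "fc y = f (c *\<^sub>R y)" for y
  have fcm [measurable]: "fc \<in> Bmeas" unfolding fc_def by measurable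
  have fcw: "weak_bound R1 (c powr (- K1 - d * R1) * N) (%y. norm y powr K1 * fc y)"
  proof -
   have "weak_bound R1 (c powr (- K1) * (c powr (- d * R1) * N)) (%y. c powr (- K1) * (norm (c *\<^sub>R y) powr K1 * f (c *\<^sub>R y)))"
    using weak_bound_cmult[OF weak_bound_scale[OF f c(1)], of "c powr (-K1)"] by (simp add: d_def)
   moreover have "c powr (- K1) * (norm (c *\<^sub>R y) powr K1 * f (c *\<^sub>R y)) = norm y powr K1 * fc y" for y :: 'a
    using c by (simp add: fc_def powr_mult powr_minus field_simps)
   moreover have "c powr (- K1) * (c powr (- d * R1) * N) = c powr (- K1 - d * R1) * N"
    by (simp add: powr_add[symmetric] mult.assoc[symmetric])
   ultimately show ?thesis by (simp only:)
  qed
  have ker: "hk t (c *\<^sub>R x - c *\<^sub>R y) = c powr (- d) * hk 1 (x - y)" for x y :: 'a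
   using heat_kernel_scale[OF c(1), of 1 "x - y"] c by (simp add: d_def scaleR_diff_right)
  have inner: "(NN y. ennreal (hk t (c *\<^sub>R x - y) * f y))
    = (NN y. ennreal (hk 1 (x - y) * fc y))" for x
  proof -
   have "(NN y. ennreal (hk t (c *\<^sub>R x - y) * f y))
     = ennreal (c ^ ?D) * (NN y. ennreal (c powr (- d)) * ennreal (hk 1 (x - y) * fc y))"
    using c f0 by (subst nn_integral_lborel_scale[OF _ c(1)]) (auto simp: ker fc_def ennreal_mult mult.assoc)
   also have "... = ennreal (c ^ ?D) * (ennreal (c powr (- d)) * (NN y. ennreal (hk 1 (x - y) * fc y)))"
    by (subst nn_integral_cmult) auto
   also have "... = ennreal (c ^ ?D * c powr (- d)) * (NN y. ennreal (hk 1 (x - y) * fc y))"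
    using c by (simp add: ennreal_mult mult.assoc)
   also have "c ^ ?D * c powr (- d) = 1"
   proof -
    have "c ^ ?D * c powr (- d) = c powr d * c powr (- d)" using c(1) by (simp only: d_def powr_realpow)
    also have "... = 1" using c(1) by (simp only: powr_add[symmetric]) simp
    finally show ?thesis .
   qed
   finally show ?thesis by simp
  qed
  let ?I = "\<integral>\<^sup>+x. ennreal (norm x powr K2) * indicator ?E' x *
     (NN y. ennreal (hk 1 (x - y) * fc y)) \<partial>lborel"
  have "(NN x. ennreal (norm x powr K2) * indicator E x *
     (NN y. ennreal (hk t (x - y) * f y)))
    = ennreal (c ^ ?D) * (NN x. ennreal (norm (c *\<^sub>R x) powr K2) * indicator E (c *\<^sub>R x) *
     (NN y. ennreal (hk 1 (x - y) * fc y)))"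
   by (subst nn_integral_lborel_scale[OF _ c(1)]) (auto simp: inner)
  also have "... = ennreal (c ^ ?D) * (NN x. ennreal (c powr K2) * (ennreal (norm x powr K2) * indicator ?E' x *
     (NN y. ennreal (hk 1 (x - y) * fc y))))"
  proof -
   have "ennreal (norm (c *\<^sub>R x) powr K2) * indicator E (c *\<^sub>R x) * X
     = ennreal (c powr K2) * (ennreal (norm x powr K2) * indicator ?E' x * X)" for x :: 'a and X
    using c by (auto simp: powr_mult ennreal_mult indicator_def mult.assoc)
   then show ?thesis by (simp only:)
  qed
  also have "... = ennreal (c ^ ?D) * (ennreal (c powr K2) * ?I)"
   by (subst nn_integral_cmult) auto
  also have "... = ennreal (c powr (d + K2)) * ?I"
  proof -
   have "c ^ ?D * c powr K2 = c powr (d + K2)" using c(1) by (simp only: d_def powr_realpow powr_add)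
   then show ?thesis using c(1) by (simp only: mult.assoc[symmetric] ennreal_mult[symmetric] zero_le_power less_imp_le powr_ge_zero)
  qed
  also have "... <= ennreal (c powr (d + K2)) * ennreal (C * (c powr (- K1 - d * R1) * N) * measure lebesgue ?E' powr (1 - R2))"
   using N c f0 by (intro mult_left_mono C(2) fcw E'l) (auto simp: fc_def)
  also have "... = ennreal (C * (c powr (d + K2) * c powr (- K1 - d * R1) * c powr (- d * (1 - R2))) * N * measure lebesgue E powr (1 - R2))"
   using C N c by (simp add: ennreal_mult[symmetric] E'l(2) powr_mult powr_powr mult_ac)
  also have "c powr (d + K2) * c powr (- K1 - d * R1) * c powr (- d * (1 - R2)) = t powr (- (d / 2) * (K1 / d + R1 - (K2 / d + R2)))"
  proof -
   have "c powr (d + K2) * c powr (- K1 - d * R1) * c powr (- d * (1 - R2)) = c powr (K2 - K1 + d * (R2 - R1))"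
    by (simp add: powr_add[symmetric] algebra_simps)
   also have "... = t powr ((K2 - K1 + d * (R2 - R1)) / 2)"
    using t by (simp add: c_def powr_half_sqrt[symmetric] powr_powr)
   also have "(K2 - K1 + d * (R2 - R1)) / 2 = - (d / 2) * (K1 / d + R1 - (K2 / d + R2))"
    using d by (simp add: field_simps)
   finally show ?thesis .
  qed
  finally show "(NN x. ennreal (norm x powr K2) * indicator E x *
     (NN y. ennreal (hk t (x - y) * f y)))
    <= ennreal (C * t powr (- (d / 2) * (K1 / d + R1 - (K2 / d + R2))) * N * measure lebesgue E powr (1 - R2))" .
 qed
qed

text \<open>The other half of the duality, by Chebyshev: where \<open>f > s\<close>, the integral
  over \<open>E\<close> is at least \<open>s |E|\<close>. The majorant \<open>h\<close> may be
  infinite, so a Duhamel integral can be inserted before its finiteness is known. As the dual bound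
  concerns Borel sets, \<open>E\<close> is replaced by its Borel main part of equal measure.\<close>

lemma weak_bound_of_dual:
 fixes f :: "'a::euclidean_space => real"
 assumes N: "0 <= N" and le: "AE x in lborel. ennreal (f x) <= h x"
  and dual: "!!E. [|E \<in> sets borel; E \<in> lmeasurable|] ==>
   (NN x. h x * indicator E x) <= ennreal (N * measure lebesgue E powr (1 - R))"
 shows "weak_bound R N f"
proof (rule weak_boundI[OF N])
 fix s and E :: "'a set" assume s: "0 < s" and E: "E \<in> lmeasurable" and sub: "!!x. x \<in> E ==> s < f x"
  and pos: "0 < measure lebesgue E"
 define E' where "E' = main_part lborel E"
 have Es: "E \<in> sets lebesgue" using E by (rule fmeasurableD)
 then have E'm [measurable]: "E' \<in> sets borel" unfolding E'_def by (metis main_part_sets sets_lborel)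
 have E'sub: "E' \<subseteq> E" unfolding E'_def by (metis Es Un_upper1 main_part_null_part_Un)
 have em: "emeasure lborel E' = emeasure lebesgue E" by (simp add: E'_def emeasure_completion Es)
 have E'l: "E' \<in> lmeasurable" using E em by (auto simp: fmeasurable_def emeasure_completion)
 have mE': "measure lebesgue E' = measure lebesgue E" using em by (simp add: measure_def emeasure_completion)
 have "ennreal (s * measure lebesgue E) = (NN x. ennreal s * indicator E' x)"
  using s emeasure_eq_measure2[OF E] by (simp add: nn_integral_cmult_indicator em ennreal_mult)
 also have "... <= (NN x. h x * indicator E' x)"
 proof (rule nn_integral_mono_AE)
  show "AE x in lborel. ennreal s * indicator E' x <= h x * indicator E' x"
   using le
  proof eventually_elim
   fix x assume *: "ennreal (f x) <= h x"
   show "ennreal s * indicator E' x <= h x * indicator E' x"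
   proof (cases "x \<in> E'")
    case True
    then have "ennreal s <= ennreal (f x)" using sub E'sub by (intro ennreal_leI less_imp_le) auto
    then show ?thesis using * True by simp
   qed simp
  qed
 qed
 also have "... <= ennreal (N * measure lebesgue E' powr (1 - R))" by (rule dual[OF E'm E'l])
 finally have "s * measure lebesgue E <= N * measure lebesgue E powr (1 - R)"
  using N by (simp add: mE')
 also have "... = N * measure lebesgue E / measure lebesgue E powr R" using pos by (simp add: powr_diff)
 finally show "s * measure lebesgue E powr R <= N" using pos by (simp add: field_simps)
qed

section \<open>Duhamel integrals of nonnegative sources\<close>

text \<open>A majorant of the modulus of a Duhamel term whose source is dominated by
  \<open>F\<close>. The time set is a parameter so that early and late times can be estimated by
  different bounds.\<close>

definition duhamel :: "real set => real => (real \<times> 'a::euclidean_space => real) => 'a => ennreal" where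
 "duhamel I t F x =
   (NN r. indicator I r * (NN y. ennreal (hk (t - r) (x - y) * F (r, y))))"

lemma borel_measurable_duhamel_kernel:
 fixes F :: "real \<times> 'a::euclidean_space => real"
 assumes F: "F \<in> Bmeas"
 shows "(%(r, x). \<integral>\<^sup>+y. ennreal (hk (t - r) (x - y) * F (r, y)) \<partial>lborel)
      \<in> borel_measurable (lborel \<Otimes>\<^sub>M lborel)"
proof -
 have [measurable]: "F \<in> borel_measurable (borel \<Otimes>\<^sub>M borel)" using F by (simp add: borel_prod)
 show ?thesis unfolding split_beta by measurable
qed

lemma borel_measurable_duhamel [measurable]:
 fixes F :: "real \<times> 'a::euclidean_space => real"
 assumes F: "F \<in> Bmeas" and [measurable]: "I \<in> sets borel"
 shows "duhamel I t F \<in> Bmeas"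
proof -
 have [measurable]: "F \<in> borel_measurable (borel \<Otimes>\<^sub>M borel)" using F by (simp add: borel_prod)
 show ?thesis unfolding duhamel_def by measurable
qed

lemma duhamel_Un:
 fixes F :: "real \<times> 'a::euclidean_space => real"
 assumes F: "F \<in> Bmeas" and m [measurable]: "I \<in> sets borel" "J \<in> sets borel" and dis: "I \<inter> J = {}"
 shows "duhamel (I \<union> J) t F x = duhamel I t F x + duhamel J t F x"
proof -
 have [measurable]: "F \<in> borel_measurable (borel \<Otimes>\<^sub>M borel)" using F by (simp add: borel_prod)
 have "indicator (I \<union> J) r * X = indicator I r * X + indicator J r * X" for r and X :: ennreal
  using dis by (auto simp: indicator_def)
 then show ?thesis unfolding duhamel_def by (simp add: nn_integral_add)
qed

text \<open>Tonelli moves the test over \<open>E\<close> under the time integral, where the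
  smoothing estimate applies at each time with its own bound \<open>n r\<close>.\<close>

lemma duhamel_smoothing:
 fixes K1 K2 R1 R2 :: real
 defines "d \<equiv> real DIM('a::euclidean_space)"
 assumes R1: "0 <= R1" "R1 < 1" and S1: "K1 / d + R1 < 1" and K: "K2 <= K1"
  and R2: "0 <= R2" "R2 <= R1" and S2: "0 <= K2 / d + R2"
 obtains C where "0 < C"
  "!!F I t n E. [|F \<in> Bmeas; !!z. 0 <= F z; I \<in> sets borel; I \<subseteq> {..<t};
    AE r in lborel. r \<in> I --> 0 < n r & weak_bound R1 (n r) (%y::'a. norm y powr K1 * F (r, y));
    n \<in> Bmeas; E \<in> sets borel; E \<in> lmeasurable|] ==>
   (NN x. ennreal (norm x powr K2) * duhamel I t F x * indicator E x)
    <= (NN r. indicator I r * ennreal ((t - r) powr (- (d / 2) * (K1 / d + R1 - (K2 / d + R2))) * n r))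
     * ennreal (C * measure lebesgue E powr (1 - R2))"
proof -
 let ?\<beta> = "- (d / 2) * (K1 / d + R1 - (K2 / d + R2))"
 obtain C where C: "0 < C"
  "!!f N E t. [|f \<in> Bmeas; !!y. 0 <= f y; 0 < N; weak_bound R1 N (%y::'a. norm y powr K1 * f y);
    E \<in> sets borel; E \<in> lmeasurable; 0 < t|] ==>
   (NN x. ennreal (norm x powr K2) * indicator E x *
     (NN y. ennreal (hk t (x - y) * f y)))
    <= ennreal (C * t powr ?\<beta> * N * measure lebesgue E powr (1 - R2))"
  using smoothing[where 'a='a, OF R1 S1[unfolded d_def] K R2 S2[unfolded d_def]] unfolding d_def by blast
 show thesis
 proof (rule that[OF C(1)])
  fix F :: "real \<times> 'a => real" and I t n and E :: "'a set"
  assume F: "F \<in> Bmeas" and F0: "!!z. 0 <= F z" and I [measurable]: "I \<in> sets borel" and It: "I \<subseteq> {..<t}"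
   and n: "AE r in lborel. r \<in> I --> 0 < n r & weak_bound R1 (n r) (%y. norm y powr K1 * F (r, y))"
   and nm [measurable]: "n \<in> Bmeas" and Em [measurable]: "E \<in> sets borel" and E: "E \<in> lmeasurable"
  have Fm [measurable]: "F \<in> borel_measurable (borel \<Otimes>\<^sub>M borel)" using F by (simp add: borel_prod)
  define \<Psi> where "\<Psi> r x = (NN y. ennreal (hk (t - r) (x - y) * F (r, y)))" for r x
  have \<Psi>m [measurable]: "(%(r, x). \<Psi> r x) \<in> borel_measurable (borel \<Otimes>\<^sub>M borel)"
   using borel_measurable_duhamel_kernel[OF F, of t] by (simp add: \<Psi>_def)
  let ?e = "measure lebesgue E"
  have "(NN x. ennreal (norm x powr K2) * duhamel I t F x * indicator E x)
    = (NN x. (NN r. ennreal (norm x powr K2) * indicator E x * (indicator I r * \<Psi> r x)))"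
   unfolding duhamel_def \<Psi>_def[symmetric] by (subst nn_integral_cmult) (auto simp: mult_ac)
  also have "... = (NN r. (NN x. ennreal (norm x powr K2) * indicator E x * (indicator I r * \<Psi> r x)))"
   by (rule lborel_pair.Fubini') measurable
  also have "... = (NN r. indicator I r * (NN x. ennreal (norm x powr K2) * indicator E x * \<Psi> r x))"
   by (intro nn_integral_cong, subst nn_integral_cmult[symmetric]) (auto simp: mult_ac)
  also have "... <= (NN r. indicator I r * ennreal ((t - r) powr ?\<beta> * n r) * ennreal (C * ?e powr (1 - R2)))"
  proof (rule nn_integral_mono_AE)
   show "AE r in lborel. indicator I r * (NN x. ennreal (norm x powr K2) * indicator E x * \<Psi> r x)
     <= indicator I r * ennreal ((t - r) powr ?\<beta> * n r) * ennreal (C * ?e powr (1 - R2))"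
    using n
   proof eventually_elim
    fix r assume *: "r \<in> I --> 0 < n r & weak_bound R1 (n r) (%y. norm y powr K1 * F (r, y))"
    show "indicator I r * (NN x. ennreal (norm x powr K2) * indicator E x * \<Psi> r x)
     <= indicator I r * ennreal ((t - r) powr ?\<beta> * n r) * ennreal (C * ?e powr (1 - R2))"
    proof (cases "r \<in> I")
     case True
     have "(NN x. ennreal (norm x powr K2) * indicator E x * \<Psi> r x)
       <= ennreal (C * (t - r) powr ?\<beta> * n r * ?e powr (1 - R2))"
      unfolding \<Psi>_def using True * It by (intro C(2) E) (auto simp: F0)
     also have "... = ennreal ((t - r) powr ?\<beta> * n r) * ennreal (C * ?e powr (1 - R2))"
      using True * C(1) by (subst ennreal_mult[symmetric]) (auto simp: mult_ac)
     finally show ?thesis using True by simp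
    qed simp
   qed
  qed
  also have "... = (NN r. indicator I r * ennreal ((t - r) powr ?\<beta> * n r)) * ennreal (C * ?e powr (1 - R2))"
   by (rule nn_integral_multc) measurable
  finally show "(NN x. ennreal (norm x powr K2) * duhamel I t F x * indicator E x)
    <= (NN r. indicator I r * ennreal ((t - r) powr ?\<beta> * n r)) * ennreal (C * ?e powr (1 - R2))" .
 qed
qed

lemma nn_integral_powr_from_0:
 fixes a c :: real
 assumes "c < 1" "0 <= a"
 shows "(NN r. indicator {0..a} r * ennreal (r powr (- c))) = ennreal (a powr (1 - c) / (1 - c))"
proof -
 have "((%x. x powr (- c)) has_integral (a powr (- c + 1) / (- c + 1))) {0..a}"
  using assms by (intro has_integral_powr_from_0) auto
 moreover have "(%x. if x \<in> {0..a} then x powr (- c) else 0) = (%x. indicator {0..a} x * x powr (- c))"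
  by (auto simp: fun_eq_iff indicator_def)
 ultimately have "((%x. indicator {0..a} x * x powr (- c)) has_integral (a powr (- c + 1) / (- c + 1))) UNIV"
  using has_integral_restrict_UNIV[of "{0..a}" "%x. x powr (- c)"] by simp
 then have "(NN r. ennreal (indicator {0..a} r * r powr (- c))) = ennreal (a powr (- c + 1) / (- c + 1))"
  by (intro nn_integral_has_integral_lborel) auto
 then show ?thesis by (simp add: ennreal_mult' ennreal_indicator)
qed

lemma half_powr_le:
 fixes a b t :: real
 assumes t: "0 < t"
 shows "(t / 2) powr (- a) * (t / 2) powr (1 - b) <= t powr (1 - a - b) * 2 powr (a + b)"
proof -
 have "(t / 2) powr (- a) * (t / 2) powr (1 - b) = (t / 2) powr (1 - a - b)"
  by (simp only: powr_add[symmetric]) (simp add: algebra_simps)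
 also have "... = t powr (1 - a - b) * 2 powr (- (1 - a - b))"
  by (simp only: powr_minus_divide[of 2 "1 - a - b"]) (use t in \<open>simp add: powr_divide\<close>)
 also have "... <= t powr (1 - a - b) * 2 powr (a + b)"
  by (intro mult_left_mono powr_mono) auto
 finally show ?thesis .
qed

text \<open>On the first half \<open>t - r\<close> is comparable to \<open>t\<close>, so
  \<open>\<beta>\<close> may be arbitrarily large and only the singularity at \<open>r = 0\<close>
  has to be integrable.\<close>

lemma duhamel_time_integral_early:
 fixes \<beta> c t :: real
 assumes \<beta>: "0 <= \<beta>" and c: "0 <= c" "c < 1" and t: "0 < t"
 shows "(NN r. indicator {0<..<t/2} r * ennreal ((t - r) powr (- \<beta>) * r powr (- c)))
   <= ennreal (2 powr (\<beta> + c) / (1 - c) * t powr (1 - \<beta> - c))"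
proof -
 have "(NN r. indicator {0<..<t/2} r * ennreal ((t - r) powr (- \<beta>) * r powr (- c)))
  <= (NN r. ennreal ((t / 2) powr (- \<beta>)) * (indicator {0..t/2} r * ennreal (r powr (- c))))"
 proof (rule nn_integral_mono)
  fix r
  have "(t - r) powr (- \<beta>) <= (t / 2) powr (- \<beta>)" if "0 < r" "r < t/2"
   using that t \<beta> by (intro powr_mono2') auto
  then show "indicator {0<..<t/2} r * ennreal ((t - r) powr (- \<beta>) * r powr (- c))
   <= ennreal ((t / 2) powr (- \<beta>)) * (indicator {0..t/2} r * ennreal (r powr (- c)))"
   by (auto simp: indicator_def ennreal_mult[symmetric] intro!: ennreal_leI mult_right_mono)
 qed
 also have "... = ennreal ((t / 2) powr (- \<beta>)) * ennreal ((t / 2) powr (1 - c) / (1 - c))"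
  using c t by (subst nn_integral_cmult) (auto simp: nn_integral_powr_from_0)
 also have "... = ennreal ((t / 2) powr (- \<beta>) * ((t / 2) powr (1 - c) / (1 - c)))"
  using c by (intro ennreal_mult[symmetric]) auto
 also have "... <= ennreal (2 powr (\<beta> + c) / (1 - c) * t powr (1 - \<beta> - c))"
 proof (rule ennreal_leI)
  have "(t / 2) powr (- \<beta>) * (t / 2) powr (1 - c) <= t powr (1 - \<beta> - c) * 2 powr (\<beta> + c)"
   using half_powr_le[OF t, of \<beta> c] by (simp add: algebra_simps)
  then have "(t / 2) powr (- \<beta>) * (t / 2) powr (1 - c) / (1 - c) <= t powr (1 - \<beta> - c) * 2 powr (\<beta> + c) / (1 - c)"
   using c by (intro divide_right_mono) auto
  then show "(t / 2) powr (- \<beta>) * ((t / 2) powr (1 - c) / (1 - c)) <= 2 powr (\<beta> + c) / (1 - c) * t powr (1 - \<beta> - c)"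
   by (simp add: mult.commute)
 qed
 finally show ?thesis .
qed

text \<open>The mirror image: \<open>r\<close> is comparable to \<open>t\<close>, so
  \<open>c\<close> may be arbitrarily large and only the singularity at \<open>r = t\<close> has to
  be integrable.\<close>

lemma duhamel_time_integral_late:
 fixes \<beta> c t :: real
 assumes \<beta>: "0 <= \<beta>" "\<beta> < 1" and c: "0 <= c" and t: "0 < t"
 shows "(NN r. indicator {t/2..<t} r * ennreal ((t - r) powr (- \<beta>) * r powr (- c)))
   <= ennreal (2 powr (\<beta> + c) / (1 - \<beta>) * t powr (1 - \<beta> - c))"
proof -
 have "(NN r. indicator {t/2..<t} r * ennreal ((t - r) powr (- \<beta>) * r powr (- c)))
  <= (NN r. ennreal ((t / 2) powr (- c)) * (indicator {0..t/2} (t - r) * ennreal ((t - r) powr (- \<beta>))))"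
 proof (rule nn_integral_mono)
  fix r
  have "r powr (- c) <= (t / 2) powr (- c)" if "t/2 <= r"
   using that t c by (intro powr_mono2') auto
  then show "indicator {t/2..<t} r * ennreal ((t - r) powr (- \<beta>) * r powr (- c))
   <= ennreal ((t / 2) powr (- c)) * (indicator {0..t/2} (t - r) * ennreal ((t - r) powr (- \<beta>)))"
   by (auto simp: indicator_def ennreal_mult[symmetric] mult.commute intro!: ennreal_leI mult_right_mono)
 qed
 also have "... = ennreal ((t / 2) powr (- c)) * (NN r. indicator {0..t/2} (t - r) * ennreal ((t - r) powr (- \<beta>)))"
  by (rule nn_integral_cmult) measurable
 also have "(NN r. indicator {0..t/2} (t - r) * ennreal ((t - r) powr (- \<beta>)))
   = (NN r. indicator {0..t/2} r * ennreal (r powr (- \<beta>)))"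
  by (rule nn_integral_lborel_reflect[of "%r. indicator {0..t/2} r * ennreal (r powr (- \<beta>))" t]) measurable
 also have "... = ennreal ((t / 2) powr (1 - \<beta>) / (1 - \<beta>))"
  using \<beta> t by (intro nn_integral_powr_from_0) auto
 also have "ennreal ((t / 2) powr (- c)) * ... = ennreal ((t / 2) powr (- c) * ((t / 2) powr (1 - \<beta>) / (1 - \<beta>)))"
  using \<beta> by (intro ennreal_mult[symmetric]) auto
 also have "... <= ennreal (2 powr (\<beta> + c) / (1 - \<beta>) * t powr (1 - \<beta> - c))"
 proof (rule ennreal_leI)
  have "(t / 2) powr (- c) * (t / 2) powr (1 - \<beta>) <= t powr (1 - \<beta> - c) * 2 powr (\<beta> + c)"
   using half_powr_le[OF t, of c \<beta>] by (simp add: algebra_simps)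
  then have "(t / 2) powr (- c) * (t / 2) powr (1 - \<beta>) / (1 - \<beta>) <= t powr (1 - \<beta> - c) * 2 powr (\<beta> + c) / (1 - \<beta>)"
   using \<beta> by (intro divide_right_mono) auto
  then show "(t / 2) powr (- c) * ((t / 2) powr (1 - \<beta>) / (1 - \<beta>)) <= 2 powr (\<beta> + c) / (1 - \<beta>) * t powr (1 - \<beta> - c)"
   by (simp add: mult.commute)
 qed
 finally show ?thesis .
qed

section \<open>Exponents of the equation and Duhamel estimates along the path\<close>

text \<open>
 Here \<open>R = 1/p\<close>, \<open>s = k/d + 1/p\<close> and \<open>\<theta> = d/2 (1/q\<^sub>c - s)\<close>; the identity
 \<open>(\<alpha> - 1) \<theta> + \<beta> = 1\<close> is the scaling invariance of the equation.
\<close>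

locale kato_exponents =
 fixes d \<gamma> \<alpha> k R :: real
 assumes d_pos: "0 < d" and \<alpha>_gt_1: "1 < \<alpha>" and R_nonneg: "0 <= R" and \<alpha>R: "\<alpha> * R < 1"
  and \<gamma>_le: "\<gamma> <= (\<alpha> - 1) * k" and s_nonneg': "0 <= k / d + R"
  and source_lt: "\<alpha> * (k / d + R) - \<gamma> / d < 1"
  and \<theta>_pos': "0 < (2 + \<gamma>) / (2 * (\<alpha> - 1)) - d / 2 * (k / d + R)"
  and \<alpha>\<theta>': "\<alpha> * ((2 + \<gamma>) / (2 * (\<alpha> - 1)) - d / 2 * (k / d + R)) < 1"
begin

definition s :: real where "s = k / d + R"
definition \<theta> :: real where "\<theta> = (2 + \<gamma>) / (2 * (\<alpha> - 1)) - d / 2 * s"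
text \<open>The nonlinearity raises the homogeneity from \<open>s\<close> to
  \<open>\<alpha> * s - \<gamma> / d\<close>, an excess of \<open>2 * \<beta> / d\<close>; smoothing
  the source back to the level \<open>s\<close> therefore costs
  \<open>(t - r) powr (- \<beta>)\<close>.\<close>

definition \<beta> :: real where "\<beta> = d / 2 * ((\<alpha> - 1) * s - \<gamma> / d)"

lemma s_nonneg: "0 <= s" and \<theta>_pos: "0 < \<theta>" and \<alpha>\<theta>: "\<alpha> * \<theta> < 1"
 using s_nonneg' \<theta>_pos' \<alpha>\<theta>' by (auto simp: s_def \<theta>_def)

lemma scaling_identity: "(\<alpha> - 1) * \<theta> + \<beta> = 1"
proof -
 have *: "x * (y / (2 * x)) = y / 2" if "x \<noteq> 0" for x y :: real using that by simp
 have "(\<alpha> - 1) * ((2 + \<gamma>) / (2 * (\<alpha> - 1))) = (2 + \<gamma>) / 2" by (rule *) (use \<alpha>_gt_1 in simp)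
 then have 1: "(\<alpha> - 1) * \<theta> = (2 + \<gamma>) / 2 - (\<alpha> - 1) * (d / 2 * s)"
  by (simp only: \<theta>_def right_diff_distrib)
 have "d / 2 * (\<gamma> / d) = \<gamma> / 2" using d_pos by simp
 then have 2: "\<beta> = (\<alpha> - 1) * (d / 2 * s) - \<gamma> / 2"
  by (simp only: \<beta>_def right_diff_distrib) (simp only: mult_ac)
 show ?thesis unfolding 1 2 by (simp add: add_divide_distrib)
qed

lemma \<beta>_bounds: "0 < \<beta>" "\<beta> < 1"
proof -
 have "0 < (\<alpha> - 1) * \<theta>" using \<theta>_pos \<alpha>_gt_1 by simp
 moreover have "(\<alpha> - 1) * \<theta> < 1" using \<alpha>\<theta> \<theta>_pos by (simp add: left_diff_distrib)
 ultimately show "0 < \<beta>" "\<beta> < 1" using scaling_identity by linarith+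
qed

lemma source_eq: "\<alpha> * s - \<gamma> / d = s + 2 * \<beta> / d"
 using d_pos by (simp add: \<beta>_def field_simps)

lemma s_lt_1: "s < 1"
proof -
 have "0 < 2 * \<beta> / d" using \<beta>_bounds d_pos by simp
 then show ?thesis using source_lt source_eq unfolding s_def[symmetric] by linarith
qed

lemma R_lt_1: "R < 1"
 using \<alpha>R \<alpha>_gt_1 R_nonneg mult_right_mono[of 1 \<alpha> R] by linarith

definition pw :: "real => real" where "pw s' = path_weight d k s'"
definition pr :: "real => real" where "pr s' = path_recip d k s'"

lemma pw_s: "pw s = k" and pr_s: "pr s = R"
 using d_pos R_nonneg by (auto simp: pw_def pr_def path_weight_def path_recip_def s_def min_def field_simps)

lemma path_homogeneity: "pw s' / d + pr s' = s'"
 using d_pos by (simp add: pw_def pr_def path_recip_eq)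

lemma pw_mono: "s2 <= s1 ==> pw s2 <= pw s1"
 using d_pos by (auto simp: pw_def path_weight_def min_def intro: order_trans mult_left_mono)

lemma pr_mono: "s2 <= s1 ==> pr s2 <= pr s1"
 by (auto simp: pr_def path_recip_def min_def)

lemma pr_nonneg: "0 <= pr s'"
 by (auto simp: pr_def path_recip_def min_def)

lemma pr_le: "s' <= s ==> pr s' <= R"
 using pr_mono[of s' s] by (simp add: pr_s)

text \<open>The majorant of the nonlinearity; \<open>\<alpha> + 1\<close> accommodates differences of the nonlinearity.\<close>

definition majorises :: "(real \<times> 'a::euclidean_space => real) => (real => 'a => real) => (real => 'a => real) => bool" where
 "majorises F V W \<longleftrightarrow> F \<in> Bmeas & (\<forall>z. 0 <= F z) &
   (AE r in lborel. 0 < r --> (AE y in lebesgue. F (r, y) <= (\<alpha> + 1) * (norm y powr \<gamma> * V r y powr (\<alpha> - 1) * W r y)))"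

text \<open>Hoelder with the power \<open>\<alpha> - 1\<close> of \<open>V\<close>, measured at the
  end of the path, and one factor \<open>W\<close>, measured at \<open>s1\<close>; the reciprocal
  exponents add up to at most \<open>\<alpha> * R < 1\<close>. Linearity in \<open>W\<close> is what
  later allows both contraction and bootstrap.\<close>

lemma majorant_weak_bound:
 fixes V W F :: "'a::euclidean_space => real"
 assumes s1: "s1 <= s" and V: "weak_bound R A (%y. norm y powr k * V y)" and W: "weak_bound (pr s1) B (%y. norm y powr pw s1 * W y)"
  and m: "V \<in> Lmeas" "W \<in> Lmeas" and nn: "!!y. 0 <= V y" "!!y. 0 <= W y"
  and F: "AE y in lebesgue. F y <= (\<alpha> + 1) * (norm y powr \<gamma> * V y powr (\<alpha> - 1) * W y)"
 shows "weak_bound (pr s1 + (\<alpha> - 1) * R) ((\<alpha> + 1) * (2 * A powr (\<alpha> - 1) * B)) (%y. norm y powr (pw s1 + (\<alpha> - 1) * k - \<gamma>) * F y)"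
proof -
 have mk: "(%y. norm y powr K * f y) \<in> Lmeas" if "f \<in> Lmeas" for K and f :: "'a => real"
  by (intro borel_measurable_times borel_measurable_norm_powr_lebesgue that)
 have "weak_bound ((\<alpha> - 1) * R + pr s1) (2 * (A powr (\<alpha> - 1)) * B)
   (%y. (norm y powr k * V y) powr (\<alpha> - 1) * (norm y powr pw s1 * W y))"
 proof (intro weak_bound_mult weak_bound_powr V W)
  have "(\<alpha> - 1) * R + pr s1 <= \<alpha> * R" using pr_le[OF s1] by (simp add: algebra_simps)
  then show "(\<alpha> - 1) * R + pr s1 <= 1" using \<alpha>R by linarith
  show "(%y. (norm y powr k * V y) powr (\<alpha> - 1)) \<in> Lmeas"
   using mk[OF m(1), of k] by measurable
 qed (use \<alpha>_gt_1 R_nonneg nn pr_nonneg mk m in auto)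
 then have "weak_bound ((\<alpha> - 1) * R + pr s1) ((\<alpha> + 1) * (2 * (A powr (\<alpha> - 1)) * B))
   (%y. (\<alpha> + 1) * ((norm y powr k * V y) powr (\<alpha> - 1) * (norm y powr pw s1 * W y)))"
  using \<alpha>_gt_1 by (intro weak_bound_cmult) auto
 then show ?thesis
 proof (subst add.commute, rule weak_bound_AE_mono)
  show "AE y in lebesgue. norm y powr (pw s1 + (\<alpha> - 1) * k - \<gamma>) * F y
    <= (\<alpha> + 1) * ((norm y powr k * V y) powr (\<alpha> - 1) * (norm y powr pw s1 * W y))"
   using F
  proof eventually_elim
   fix y assume "F y <= (\<alpha> + 1) * (norm y powr \<gamma> * V y powr (\<alpha> - 1) * W y)"
   then have "norm y powr (pw s1 + (\<alpha> - 1) * k - \<gamma>) * F y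
     <= norm y powr (pw s1 + (\<alpha> - 1) * k - \<gamma>) * ((\<alpha> + 1) * (norm y powr \<gamma> * V y powr (\<alpha> - 1) * W y))"
    by (rule mult_left_mono) simp
   also have "... = (\<alpha> + 1) * ((norm y powr (pw s1 + (\<alpha> - 1) * k - \<gamma>) * norm y powr \<gamma>) * V y powr (\<alpha> - 1) * W y)"
    by (simp only: mult_ac)
   also have "norm y powr (pw s1 + (\<alpha> - 1) * k - \<gamma>) * norm y powr \<gamma> = norm y powr ((\<alpha> - 1) * k) * norm y powr pw s1"
    by (simp add: powr_add[symmetric] add.commute)
   also have "(\<alpha> + 1) * ((norm y powr ((\<alpha> - 1) * k) * norm y powr pw s1) * V y powr (\<alpha> - 1) * W y)
     = (\<alpha> + 1) * ((norm y powr k * V y) powr (\<alpha> - 1) * (norm y powr pw s1 * W y))"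
    by (simp add: powr_mult powr_powr mult_ac)
   finally show "norm y powr (pw s1 + (\<alpha> - 1) * k - \<gamma>) * F y
     <= (\<alpha> + 1) * ((norm y powr k * V y) powr (\<alpha> - 1) * (norm y powr pw s1 * W y))" .
  qed
 qed
qed

text \<open>The source has homogeneity \<open>s1 + 2 * \<beta> / d\<close>, which
  \<open>source_lt\<close> keeps below 1, so the dual smoothing estimate applies.\<close>

lemma duhamel_path_smoothing:
 assumes dim: "d = real DIM('a::euclidean_space)" and s12: "0 <= s2" "s2 <= s1" "s1 <= s"
 obtains C where "0 < C"
  "!!F I t E V W A B. [|majorises F V W; I \<in> sets borel; I \<subseteq> {0<..<t};
    !!r. r \<in> I ==> V r \<in> Lmeas; !!r. r \<in> I ==> W r \<in> Lmeas;
    !!r y. 0 <= V r y; !!r y. 0 <= W r y;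
    !!r. r \<in> I ==> 0 < A r & weak_bound R (A r) (%y::'a. norm y powr k * V r y);
    !!r. r \<in> I ==> 0 < B r & weak_bound (pr s1) (B r) (%y::'a. norm y powr pw s1 * W r y);
    A \<in> Bmeas; B \<in> Bmeas; E \<in> sets borel; E \<in> lmeasurable|] ==>
   (NN x. ennreal (norm x powr pw s2) * duhamel I t F x * indicator E x)
    <= (NN r. indicator I r * ennreal ((t - r) powr (- (\<beta> + d / 2 * (s1 - s2))) * (A r powr (\<alpha> - 1) * B r)))
     * ennreal (C * measure lebesgue E powr (1 - pr s2))"
proof -
 let ?K1 = "pw s1 + (\<alpha> - 1) * k - \<gamma>" and ?R1 = "pr s1 + (\<alpha> - 1) * R"
 have hom: "?K1 / d + ?R1 = s1 + 2 * \<beta> / d"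
 proof -
  have "?K1 / d + ?R1 = (pw s1 / d + pr s1) + (\<alpha> - 1) * s - \<gamma> / d"
   by (simp add: s_def add_divide_distrib diff_divide_distrib algebra_simps)
  then show ?thesis using source_eq unfolding path_homogeneity by (simp add: algebra_simps)
 qed
 have R1: "0 <= ?R1" "?R1 < 1"
 proof -
  show "0 <= ?R1" using pr_nonneg R_nonneg \<alpha>_gt_1 by simp
  have "?R1 <= \<alpha> * R" using pr_le[OF s12(3)] by (simp add: algebra_simps)
  then show "?R1 < 1" using \<alpha>R by linarith
 qed
 have S1: "?K1 / real DIM('a) + ?R1 < 1"
  using source_lt s12 source_eq unfolding dim[symmetric] hom s_def[symmetric] by linarith
 have K: "pw s2 <= ?K1" using pw_mono[OF s12(2)] \<gamma>_le by linarith
 have R2: "0 <= pr s2" "pr s2 <= ?R1"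
  using pr_nonneg pr_mono[OF s12(2)] R_nonneg \<alpha>_gt_1 by (auto intro: add_increasing2)
 have S2: "0 <= pw s2 / real DIM('a) + pr s2"
  using s12 path_homogeneity[of s2] unfolding dim[symmetric] by simp
 have expo: "- (d / 2) * (?K1 / d + ?R1 - (pw s2 / d + pr s2)) = - (\<beta> + d / 2 * (s1 - s2))"
  unfolding hom path_homogeneity using d_pos by (simp add: field_simps)
 obtain C where C: "0 < C"
  "!!F I t n E. [|F \<in> Bmeas; !!z. 0 <= F z; I \<in> sets borel; I \<subseteq> {..<t};
    AE r in lborel. r \<in> I --> 0 < n r & weak_bound ?R1 (n r) (%y::'a. norm y powr ?K1 * F (r, y));
    n \<in> Bmeas; E \<in> sets borel; E \<in> lmeasurable|] ==>
   (NN x. ennreal (norm x powr pw s2) * duhamel I t F x * indicator E x)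
    <= (NN r. indicator I r * ennreal ((t - r) powr (- (\<beta> + d / 2 * (s1 - s2))) * n r))
     * ennreal (C * measure lebesgue E powr (1 - pr s2))"
  using duhamel_smoothing[where 'a='a, OF R1 S1 K R2 S2] unfolding dim[symmetric] expo by blast
 define c where "c = 2 * (\<alpha> + 1)"
 have c: "0 < c" using \<alpha>_gt_1 by (simp add: c_def)
 show thesis
 proof (rule that[of "c * C"])
  show "0 < c * C" using c C(1) by simp
  fix F :: "real \<times> 'a => real" and I t and E :: "'a set" and V W A B
  assume maj: "majorises F V W" and I [measurable]: "I \<in> sets borel" and It: "I \<subseteq> {0<..<t}"
   and m: "!!r. r \<in> I ==> V r \<in> Lmeas" "!!r. r \<in> I ==> W r \<in> Lmeas"
   and nn: "!!r y. 0 <= V r y" "!!r y. 0 <= W r y"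
   and A: "!!r. r \<in> I ==> 0 < A r & weak_bound R (A r) (%y. norm y powr k * V r y)"
   and B: "!!r. r \<in> I ==> 0 < B r & weak_bound (pr s1) (B r) (%y. norm y powr pw s1 * W r y)"
   and ABm [measurable]: "A \<in> Bmeas" "B \<in> Bmeas"
   and E: "E \<in> sets borel" "E \<in> lmeasurable"
  let ?n = "%r. (\<alpha> + 1) * (2 * A r powr (\<alpha> - 1) * B r)"
  have Fprop: "F \<in> Bmeas" "!!z. 0 <= F z"
   "AE r in lborel. 0 < r --> (AE y in lebesgue. F (r, y) <= (\<alpha> + 1) * (norm y powr \<gamma> * V r y powr (\<alpha> - 1) * W r y))"
   using maj by (auto simp: majorises_def)
  have "(NN x. ennreal (norm x powr pw s2) * duhamel I t F x * indicator E x)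
    <= (NN r. indicator I r * ennreal ((t - r) powr (- (\<beta> + d / 2 * (s1 - s2))) * ?n r))
     * ennreal (C * measure lebesgue E powr (1 - pr s2))"
  proof (rule C(2)[OF Fprop(1,2) I])
   show "I \<subseteq> {..<t}" using It by auto
   show "AE r in lborel. r \<in> I --> 0 < ?n r & weak_bound ?R1 (?n r) (%y. norm y powr ?K1 * F (r, y))"
    using Fprop(3)
   proof eventually_elim
    fix r assume *: "0 < r --> (AE y in lebesgue. F (r, y) <= (\<alpha> + 1) * (norm y powr \<gamma> * V r y powr (\<alpha> - 1) * W r y))"
    show "r \<in> I --> 0 < ?n r & weak_bound ?R1 (?n r) (%y. norm y powr ?K1 * F (r, y))"
    proof
     assume r: "r \<in> I"
     then have "0 < r" using It by auto
     with * have F: "AE y in lebesgue. F (r, y) <= (\<alpha> + 1) * (norm y powr \<gamma> * V r y powr (\<alpha> - 1) * W r y)" by simp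
     show "0 < ?n r & weak_bound ?R1 (?n r) (%y. norm y powr ?K1 * F (r, y))"
      using A[OF r] B[OF r] \<alpha>_gt_1 m[OF r] nn F
      by (intro conjI majorant_weak_bound[OF s12(3), where V = "V r" and W = "W r"]) auto
    qed
   qed
   show "?n \<in> Bmeas" by measurable
  qed (use E in auto)
  also have "... = (NN r. ennreal c * (indicator I r * ennreal ((t - r) powr (- (\<beta> + d / 2 * (s1 - s2))) * (A r powr (\<alpha> - 1) * B r))))
     * ennreal (C * measure lebesgue E powr (1 - pr s2))"
  proof -
   have "indicator I r * ennreal (X * ?n r) = ennreal c * (indicator I r * ennreal (X * (A r powr (\<alpha> - 1) * B r)))" if "0 <= X" for r X
   proof (cases "r \<in> I")
    case True
    have "X * ?n r = c * (X * (A r powr (\<alpha> - 1) * B r))" by (simp add: c_def)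
    then have "ennreal (X * ?n r) = ennreal (c * (X * (A r powr (\<alpha> - 1) * B r)))" by (simp only:)
    also have "... = ennreal c * ennreal (X * (A r powr (\<alpha> - 1) * B r))"
     using B[OF True] c that by (intro ennreal_mult) auto
    finally show ?thesis using True by simp
   qed simp
   then show ?thesis by simp
  qed
  also have "... = (ennreal c * (NN r. indicator I r * ennreal ((t - r) powr (- (\<beta> + d / 2 * (s1 - s2))) * (A r powr (\<alpha> - 1) * B r))))
     * ennreal (C * measure lebesgue E powr (1 - pr s2))"
   by (subst nn_integral_cmult) measurable
  also have "... = (NN r. indicator I r * ennreal ((t - r) powr (- (\<beta> + d / 2 * (s1 - s2))) * (A r powr (\<alpha> - 1) * B r)))
     * ennreal (c * C * measure lebesgue E powr (1 - pr s2))"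
   using c C(1) by (simp add: ennreal_mult mult_ac)
  finally show "(NN x. ennreal (norm x powr pw s2) * duhamel I t F x * indicator E x)
    <= (NN r. indicator I r * ennreal ((t - r) powr (- (\<beta> + d / 2 * (s1 - s2))) * (A r powr (\<alpha> - 1) * B r)))
     * ennreal (c * C * measure lebesgue E powr (1 - pr s2))" .
 qed
qed

end

text \<open>The bound \<open>c'\<close> makes the constant independent of \<open>c\<close>, hence of
  the decay rates in the applications; 4 dominates \<open>2 powr (\<beta> + c)\<close>, as both
  exponents are below 1.\<close>

lemma duhamel_time_integral:
 fixes \<beta> c t :: real
 assumes \<beta>: "0 <= \<beta>" "\<beta> < 1" and c: "0 <= c" "c <= c'" "c' < 1" and t: "0 < t"
 shows "(NN r. indicator {0<..<t} r * ennreal ((t - r) powr (- \<beta>) * r powr (- c)))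
   <= ennreal ((4 / (1 - c') + 4 / (1 - \<beta>)) * t powr (1 - \<beta> - c))"
proof -
 let ?f = "%r. ennreal ((t - r) powr (- \<beta>) * r powr (- c))"
 have p: "2 powr (\<beta> + c) <= (4::real)" using powr_mono[of "\<beta> + c" 2 2] \<beta> c by simp
 have "(NN r. indicator {0<..<t} r * ?f r)
   = (NN r. indicator {0<..<t/2} r * ?f r + indicator {t/2..<t} r * ?f r)"
  using t by (intro nn_integral_cong) (auto simp: indicator_def)
 also have "... = (NN r. indicator {0<..<t/2} r * ?f r) + (NN r. indicator {t/2..<t} r * ?f r)"
  by (rule nn_integral_add) measurable
 also have "... <= ennreal (2 powr (\<beta> + c) / (1 - c) * t powr (1 - \<beta> - c)) + ennreal (2 powr (\<beta> + c) / (1 - \<beta>) * t powr (1 - \<beta> - c))"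
  using \<beta> c t by (intro add_mono duhamel_time_integral_early duhamel_time_integral_late) auto
 also have "... = ennreal (2 powr (\<beta> + c) / (1 - c) * t powr (1 - \<beta> - c) + 2 powr (\<beta> + c) / (1 - \<beta>) * t powr (1 - \<beta> - c))"
  using \<beta> c by (intro ennreal_plus[symmetric]) auto
 also have "... <= ennreal ((4 / (1 - c') + 4 / (1 - \<beta>)) * t powr (1 - \<beta> - c))"
  unfolding distrib_right[symmetric] using \<beta> c p by (intro ennreal_leI mult_right_mono add_mono frac_le) auto
 finally show ?thesis .
qed

context kato_exponents
begin

text \<open>At the end \<open>s\<close> of the path no homogeneity is lost, and
  \<open>\<beta> < 1\<close> suffices. For \<open>v = \<theta>\<close> the scaling identity
  reproduces the powers of \<open>t\<close> exactly, so a small \<open>A\<close> makes the Duhamel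
  term a contraction. Two powers are carried because the lower bounds split the linear part into a
  self-similar part and a faster decaying remainder. Bounds are assumed up to time \<open>t\<close>
  only, so that an iteration on a bounded time interval can be started.\<close>

lemma duhamel_contraction:
 assumes dim: "d = real DIM('a::euclidean_space)" and c': "c' < 1"
 obtains C where "0 < C"
  "!!F t V W v A b1 B1 b2 B2 f. [|majorises F V W; 0 < t;
    !!r. 0 < r ==> V r \<in> Lmeas; !!r. 0 < r ==> W r \<in> Lmeas;
    !!r y. 0 <= V r y; !!r y. 0 <= W r y; 0 < A; 0 < B1; 0 <= B2;
    0 <= (\<alpha> - 1) * v + b1; (\<alpha> - 1) * v + b1 <= c'; 0 <= (\<alpha> - 1) * v + b2; (\<alpha> - 1) * v + b2 <= c';
    !!r. [|0 < r; r < t|] ==> weak_bound R (A * r powr (- v)) (%y::'a. norm y powr k * V r y);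
    !!r. [|0 < r; r < t|] ==> weak_bound R (B1 * r powr (- b1) + B2 * r powr (- b2)) (%y::'a. norm y powr k * W r y);
    AE x in lborel. ennreal (f x) <= duhamel {0<..<t} t F x|] ==>
   weak_bound R (C * A powr (\<alpha> - 1) * (B1 * t powr ((\<alpha> - 1) * (\<theta> - v) - b1) + B2 * t powr ((\<alpha> - 1) * (\<theta> - v) - b2)))
    (%x. norm x powr k * f x)"
proof -
 show thesis
 proof (rule duhamel_path_smoothing[OF dim s_nonneg order_refl order_refl])
 fix C :: real assume C: "0 < C"
  "!!F I t E V W A B. [|majorises F V W; I \<in> sets borel; I \<subseteq> {0<..<t};
    !!r. r \<in> I ==> V r \<in> Lmeas; !!r. r \<in> I ==> W r \<in> Lmeas;
    !!r y. 0 <= V r y; !!r y. 0 <= W r y;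
    !!r. r \<in> I ==> 0 < A r & weak_bound R (A r) (%y::'a. norm y powr k * V r y);
    !!r. r \<in> I ==> 0 < B r & weak_bound (pr s) (B r) (%y::'a. norm y powr pw s * W r y);
    A \<in> Bmeas; B \<in> Bmeas; E \<in> sets borel; E \<in> lmeasurable|] ==>
   (NN x. ennreal (norm x powr pw s) * duhamel I t F x * indicator E x)
    <= (NN r. indicator I r * ennreal ((t - r) powr (- (\<beta> + d / 2 * (s - s))) * (A r powr (\<alpha> - 1) * B r)))
     * ennreal (C * measure lebesgue E powr (1 - pr s))"
 define Q where "Q = 4 / (1 - c') + 4 / (1 - \<beta>)"
 have Q: "0 < Q" using c' \<beta>_bounds by (simp add: Q_def add_pos_pos)
 show thesis
 proof (rule that[of "C * Q"])
  show "0 < C * Q" using C(1) Q by simp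
  fix F :: "real \<times> 'a => real" and t V W v A b1 B1 b2 B2 and f :: "'a => real"
  assume maj: "majorises F V W" and t: "0 < t"
   and m: "!!r. 0 < r ==> V r \<in> Lmeas" "!!r. 0 < r ==> W r \<in> Lmeas"
   and nn: "!!r y. 0 <= V r y" "!!r y. 0 <= W r y" and AB: "0 < A" "0 < B1" "0 <= B2"
   and c1: "0 <= (\<alpha> - 1) * v + b1" "(\<alpha> - 1) * v + b1 <= c'" and c2: "0 <= (\<alpha> - 1) * v + b2" "(\<alpha> - 1) * v + b2 <= c'"
   and V: "!!r. [|0 < r; r < t|] ==> weak_bound R (A * r powr (- v)) (%y::'a. norm y powr k * V r y)"
   and W: "!!r. [|0 < r; r < t|] ==> weak_bound R (B1 * r powr (- b1) + B2 * r powr (- b2)) (%y::'a. norm y powr k * W r y)"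
   and f: "AE x in lborel. ennreal (f x) <= duhamel {0<..<t} t F x"
  let ?c1 = "(\<alpha> - 1) * v + b1" and ?c2 = "(\<alpha> - 1) * v + b2" and ?I = "{0<..<t}"
  let ?T = "B1 * t powr ((\<alpha> - 1) * (\<theta> - v) - b1) + B2 * t powr ((\<alpha> - 1) * (\<theta> - v) - b2)"
  have "(\<alpha> - 1) * \<theta> = 1 - \<beta>" using scaling_identity by simp
  then have ex: "1 - \<beta> - ?c1 = (\<alpha> - 1) * (\<theta> - v) - b1" "1 - \<beta> - ?c2 = (\<alpha> - 1) * (\<theta> - v) - b2"
   by (simp_all add: right_diff_distrib)
  have time: "(NN r. indicator ?I r * ennreal ((t - r) powr (- (\<beta> + d / 2 * (s - s))) *
     ((A * r powr (- v)) powr (\<alpha> - 1) * (B1 * r powr (- b1) + B2 * r powr (- b2)))))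
    <= ennreal (A powr (\<alpha> - 1) * Q * ?T)"
  proof -
   have "indicator ?I r * ennreal ((t - r) powr (- (\<beta> + d / 2 * (s - s))) *
     ((A * r powr (- v)) powr (\<alpha> - 1) * (B1 * r powr (- b1) + B2 * r powr (- b2))))
    = ennreal (A powr (\<alpha> - 1) * B1) * (indicator ?I r * ennreal ((t - r) powr (- \<beta>) * r powr (- ?c1)))
    + ennreal (A powr (\<alpha> - 1) * B2) * (indicator ?I r * ennreal ((t - r) powr (- \<beta>) * r powr (- ?c2)))" for r
   proof (cases "r \<in> ?I")
    case True
    have e: "r powr (- ?c1) = r powr (- v * (\<alpha> - 1)) * r powr (- b1)" "r powr (- ?c2) = r powr (- v * (\<alpha> - 1)) * r powr (- b2)"
     by (simp_all add: powr_add[symmetric] algebra_simps)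
    have "(t - r) powr (- (\<beta> + d / 2 * (s - s))) *
     ((A * r powr (- v)) powr (\<alpha> - 1) * (B1 * r powr (- b1) + B2 * r powr (- b2)))
     = A powr (\<alpha> - 1) * B1 * ((t - r) powr (- \<beta>) * r powr (- ?c1)) + A powr (\<alpha> - 1) * B2 * ((t - r) powr (- \<beta>) * r powr (- ?c2))"
     unfolding e powr_mult powr_powr by (simp add: algebra_simps)
    then show ?thesis using True AB by (simp add: ennreal_mult[symmetric] ennreal_plus[symmetric] del: ennreal_plus)
   qed simp
   then have "(NN r. indicator ?I r * ennreal ((t - r) powr (- (\<beta> + d / 2 * (s - s))) *
     ((A * r powr (- v)) powr (\<alpha> - 1) * (B1 * r powr (- b1) + B2 * r powr (- b2)))))
    = ennreal (A powr (\<alpha> - 1) * B1) * (NN r. indicator ?I r * ennreal ((t - r) powr (- \<beta>) * r powr (- ?c1)))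
    + ennreal (A powr (\<alpha> - 1) * B2) * (NN r. indicator ?I r * ennreal ((t - r) powr (- \<beta>) * r powr (- ?c2)))"
    by (simp only:) (subst nn_integral_add, measurable, subst nn_integral_cmult, measurable, subst nn_integral_cmult, measurable)
   also have "... <= ennreal (A powr (\<alpha> - 1) * B1) * ennreal (Q * t powr (1 - \<beta> - ?c1))
    + ennreal (A powr (\<alpha> - 1) * B2) * ennreal (Q * t powr (1 - \<beta> - ?c2))"
    unfolding Q_def using \<beta>_bounds c1 c2 c' t
    by (intro add_mono mult_left_mono duhamel_time_integral) auto
   also have "... = ennreal (A powr (\<alpha> - 1) * B1 * (Q * t powr (1 - \<beta> - ?c1)) + A powr (\<alpha> - 1) * B2 * (Q * t powr (1 - \<beta> - ?c2)))"
    using AB Q by (subst ennreal_plus) (simp_all add: ennreal_mult)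
   also have "... = ennreal (A powr (\<alpha> - 1) * Q * ?T)" unfolding ex by (simp add: algebra_simps)
   finally show ?thesis .
  qed
  show "weak_bound R (C * Q * A powr (\<alpha> - 1) * ?T) (%x. norm x powr k * f x)"
  proof (rule weak_bound_of_dual)
   show "0 <= C * Q * A powr (\<alpha> - 1) * ?T" using C(1) Q AB by simp
   show "AE x in lborel. ennreal (norm x powr k * f x) <= ennreal (norm x powr k) * duhamel ?I t F x"
    using f by eventually_elim (simp add: ennreal_mult' mult_left_mono)
   fix E :: "'a set" assume E: "E \<in> sets borel" "E \<in> lmeasurable"
   have "(NN x. ennreal (norm x powr pw s) * duhamel ?I t F x * indicator E x)
    <= (NN r. indicator ?I r * ennreal ((t - r) powr (- (\<beta> + d / 2 * (s - s))) *
     ((A * r powr (- v)) powr (\<alpha> - 1) * (B1 * r powr (- b1) + B2 * r powr (- b2)))))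
     * ennreal (C * measure lebesgue E powr (1 - pr s))"
    by (rule C(2)[OF maj]) (use m nn V W AB E in \<open>auto simp: pw_s pr_s add_pos_nonneg\<close>)
   also have "... <= ennreal (A powr (\<alpha> - 1) * Q * ?T) * ennreal (C * measure lebesgue E powr (1 - pr s))"
    by (intro mult_right_mono time) auto
   also have "... = ennreal (C * Q * A powr (\<alpha> - 1) * ?T * measure lebesgue E powr (1 - R))"
    using C(1) Q AB by (subst ennreal_mult[symmetric]) (auto simp: pr_s mult_ac)
   finally show "(NN x. ennreal (norm x powr k) * duhamel ?I t F x * indicator E x)
    <= ennreal (C * Q * A powr (\<alpha> - 1) * ?T * measure lebesgue E powr (1 - R))"
    by (simp only: pw_s)
  qed
 qed
qed
qed

text \<open>The bound at \<open>s1\<close> may be too singular at \<open>r = 0\<close>, and with the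
  bound at \<open>s\<close> the kernel may be too singular at \<open>r = t\<close>. Late times
  therefore use \<open>s1\<close>, where \<open>gain\<close> makes the kernel integrable, and early
  times use \<open>s\<close>, where the exponent of the kernel does not matter.\<close>

lemma duhamel_step:
 assumes dim: "d = real DIM('a::euclidean_space)" and c': "c' < 1"
  and s12: "0 <= s2" "s2 <= s1" "s1 <= s" and gain: "\<beta> + d / 2 * (s1 - s2) < 1"
 obtains C where "0 < C"
  "!!F t V W v A b B f. [|majorises F V W; 0 < t;
    !!r. 0 < r ==> V r \<in> Lmeas; !!r. 0 < r ==> W r \<in> Lmeas;
    !!r y. 0 <= V r y; !!r y. 0 <= W r y; 0 < A; 0 < B;
    0 <= (\<alpha> - 1) * v + b; (\<alpha> - 1) * v + b <= c';
    !!r. 0 < r ==> weak_bound R (A * r powr (- v)) (%y::'a. norm y powr k * V r y);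
    !!r. 0 < r ==> weak_bound R (B * r powr (- b)) (%y::'a. norm y powr k * W r y);
    !!r. 0 < r ==> weak_bound (pr s1) (B * r powr (- b - d / 2 * (s - s1))) (%y::'a. norm y powr pw s1 * W r y);
    AE x in lborel. ennreal (f x) <= duhamel {0<..<t} t F x|] ==>
   weak_bound (pr s2) (C * A powr (\<alpha> - 1) * B * t powr ((\<alpha> - 1) * (\<theta> - v) - b - d / 2 * (s - s2)))
    (%x. norm x powr pw s2 * f x)"
proof -
 have s2s: "s2 <= s" using s12 by simp
 show thesis
 proof (rule duhamel_path_smoothing[OF dim s12(1) s2s order_refl])
 fix C :: real assume C: "0 < C"
  "!!F I t E V W A B. [|majorises F V W; I \<in> sets borel; I \<subseteq> {0<..<t};
    !!r. r \<in> I ==> V r \<in> Lmeas; !!r. r \<in> I ==> W r \<in> Lmeas;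
    !!r y. 0 <= V r y; !!r y. 0 <= W r y;
    !!r. r \<in> I ==> 0 < A r & weak_bound R (A r) (%y::'a. norm y powr k * V r y);
    !!r. r \<in> I ==> 0 < B r & weak_bound (pr s) (B r) (%y::'a. norm y powr pw s * W r y);
    A \<in> Bmeas; B \<in> Bmeas; E \<in> sets borel; E \<in> lmeasurable|] ==>
   (NN x. ennreal (norm x powr pw s2) * duhamel I t F x * indicator E x)
    <= (NN r. indicator I r * ennreal ((t - r) powr (- (\<beta> + d / 2 * (s - s2))) * (A r powr (\<alpha> - 1) * B r)))
     * ennreal (C * measure lebesgue E powr (1 - pr s2))"
 show thesis
 proof (rule duhamel_path_smoothing[OF dim s12])
 fix C' :: real assume C'0: "0 < C'" and C'2:
  "!!F I t E V W A B. [|majorises F V W; I \<in> sets borel; I \<subseteq> {0<..<t};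
    !!r. r \<in> I ==> V r \<in> Lmeas; !!r. r \<in> I ==> W r \<in> Lmeas;
    !!r y. 0 <= V r y; !!r y. 0 <= W r y;
    !!r. r \<in> I ==> 0 < A r & weak_bound R (A r) (%y::'a. norm y powr k * V r y);
    !!r. r \<in> I ==> 0 < B r & weak_bound (pr s1) (B r) (%y::'a. norm y powr pw s1 * W r y);
    A \<in> Bmeas; B \<in> Bmeas; E \<in> sets borel; E \<in> lmeasurable|] ==>
   (NN x. ennreal (norm x powr pw s2) * duhamel I t F x * indicator E x)
    <= (NN r. indicator I r * ennreal ((t - r) powr (- (\<beta> + d / 2 * (s1 - s2))) * (A r powr (\<alpha> - 1) * B r)))
     * ennreal (C' * measure lebesgue E powr (1 - pr s2))"
 define \<beta>1 where "\<beta>1 = \<beta> + d / 2 * (s - s2)"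
 define \<beta>2 where "\<beta>2 = \<beta> + d / 2 * (s1 - s2)"
 define e where "e = d / 2 * (s - s1)"
 have b12: "0 <= \<beta>1" "0 <= \<beta>2" "\<beta>2 < 1" "0 <= e" "\<beta>1 = \<beta>2 + e"
 proof -
  have "0 <= d / 2 * (s - s2)" "0 <= d / 2 * (s1 - s2)" "0 <= d / 2 * (s - s1)"
   using d_pos s12 by (simp_all add: mult_nonneg_nonneg)
  then show "0 <= \<beta>1" "0 <= \<beta>2" "\<beta>2 < 1" "0 <= e"
   using \<beta>_bounds gain unfolding \<beta>1_def \<beta>2_def e_def by linarith+
  have "d / 2 * (s1 - s2) + d / 2 * (s - s1) = d / 2 * (s - s2)"
   unfolding distrib_left[symmetric] by simp
  then show "\<beta>1 = \<beta>2 + e" unfolding \<beta>1_def \<beta>2_def e_def by linarith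
 qed
 define Q1 where "Q1 = 2 powr (\<beta>1 + 1) / (1 - c')"
 define Q2 where "Q2 = 2 powr (\<beta>2 + 1 + e) / (1 - \<beta>2)"
 have Q: "0 < Q1" "0 < Q2" using c' b12 by (auto simp: Q1_def Q2_def)
 show thesis
 proof (rule that[of "C * Q1 + C' * Q2"])
  show "0 < C * Q1 + C' * Q2" using C(1) C'0 Q by (simp add: add_pos_pos)
  fix F :: "real \<times> 'a => real" and t V W v A b B and f :: "'a => real"
  assume maj: "majorises F V W" and t: "0 < t"
   and m: "!!r. 0 < r ==> V r \<in> Lmeas" "!!r. 0 < r ==> W r \<in> Lmeas"
   and nn: "!!r y. 0 <= V r y" "!!r y. 0 <= W r y" and AB: "0 < A" "0 < B"
   and c1: "0 <= (\<alpha> - 1) * v + b" "(\<alpha> - 1) * v + b <= c'"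
   and V: "!!r. 0 < r ==> weak_bound R (A * r powr (- v)) (%y::'a. norm y powr k * V r y)"
   and W: "!!r. 0 < r ==> weak_bound R (B * r powr (- b)) (%y::'a. norm y powr k * W r y)"
   and W1: "!!r. 0 < r ==> weak_bound (pr s1) (B * r powr (- b - d / 2 * (s - s1))) (%y::'a. norm y powr pw s1 * W r y)"
   and f: "AE x in lborel. ennreal (f x) <= duhamel {0<..<t} t F x"
  let ?c = "(\<alpha> - 1) * v + b"
  let ?T = "t powr ((\<alpha> - 1) * (\<theta> - v) - b - d / 2 * (s - s2))"
  have Fm: "F \<in> Bmeas" using maj by (simp add: majorises_def)
  have "(\<alpha> - 1) * \<theta> = 1 - \<beta>" using scaling_identity by simp
  then have ex: "(\<alpha> - 1) * (\<theta> - v) - b - d / 2 * (s - s2) = 1 - \<beta>1 - ?c"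
   by (simp add: right_diff_distrib \<beta>1_def)
  have time1: "(NN r. indicator {0<..<t/2} r * ennreal ((t - r) powr (- (\<beta> + d / 2 * (s - s2))) *
     ((A * r powr (- v)) powr (\<alpha> - 1) * (B * r powr (- b)))))
    <= ennreal (A powr (\<alpha> - 1) * B * (Q1 * ?T))"
  proof -
   have "(t - r) powr (- (\<beta> + d / 2 * (s - s2))) * ((A * r powr (- v)) powr (\<alpha> - 1) * (B * r powr (- b)))
     = A powr (\<alpha> - 1) * B * ((t - r) powr (- \<beta>1) * r powr (- ?c))" for r
   proof -
    have e: "r powr (- ?c) = r powr (- v * (\<alpha> - 1)) * r powr (- b)"
     by (simp add: powr_add[symmetric] algebra_simps)
    show ?thesis unfolding e powr_mult powr_powr \<beta>1_def[symmetric] by (simp only: mult_ac)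
   qed
   then have "(NN r. indicator {0<..<t/2} r * ennreal ((t - r) powr (- (\<beta> + d / 2 * (s - s2))) *
     ((A * r powr (- v)) powr (\<alpha> - 1) * (B * r powr (- b)))))
    = (NN r. ennreal (A powr (\<alpha> - 1) * B) * (indicator {0<..<t/2} r * ennreal ((t - r) powr (- \<beta>1) * r powr (- ?c))))"
    using AB by (simp add: ennreal_mult mult_ac)
   also have "... = ennreal (A powr (\<alpha> - 1) * B) * (NN r. indicator {0<..<t/2} r * ennreal ((t - r) powr (- \<beta>1) * r powr (- ?c)))"
    by (rule nn_integral_cmult) measurable
   also have "... <= ennreal (A powr (\<alpha> - 1) * B) * ennreal (2 powr (\<beta>1 + ?c) / (1 - ?c) * t powr (1 - \<beta>1 - ?c))"
    using b12 c1 c' t by (intro mult_left_mono duhamel_time_integral_early) auto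
   also have "... <= ennreal (A powr (\<alpha> - 1) * B) * ennreal (Q1 * t powr (1 - \<beta>1 - ?c))"
    unfolding Q1_def using c1 c' by (intro mult_left_mono ennreal_leI mult_right_mono frac_le powr_mono) auto
   also have "... = ennreal (A powr (\<alpha> - 1) * B * (Q1 * ?T))"
    using AB Q unfolding ex by (intro ennreal_mult[symmetric]) auto
   finally show ?thesis .
  qed
  have time2: "(NN r. indicator {t/2..<t} r * ennreal ((t - r) powr (- (\<beta> + d / 2 * (s1 - s2))) *
     ((A * r powr (- v)) powr (\<alpha> - 1) * (B * r powr (- b - d / 2 * (s - s1))))))
    <= ennreal (A powr (\<alpha> - 1) * B * (Q2 * ?T))"
  proof -
   have "(t - r) powr (- (\<beta> + d / 2 * (s1 - s2))) * ((A * r powr (- v)) powr (\<alpha> - 1) * (B * r powr (- b - d / 2 * (s - s1))))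
     = A powr (\<alpha> - 1) * B * ((t - r) powr (- \<beta>2) * r powr (- (?c + e)))" for r
   proof -
    have e: "r powr (- (?c + e)) = r powr (- v * (\<alpha> - 1)) * r powr (- b - e)"
     by (simp add: powr_add[symmetric] algebra_simps)
    show ?thesis unfolding e powr_mult powr_powr \<beta>2_def[symmetric] e_def[symmetric] by (simp only: mult_ac)
   qed
   then have "(NN r. indicator {t/2..<t} r * ennreal ((t - r) powr (- (\<beta> + d / 2 * (s1 - s2))) *
     ((A * r powr (- v)) powr (\<alpha> - 1) * (B * r powr (- b - d / 2 * (s - s1))))))
    = (NN r. ennreal (A powr (\<alpha> - 1) * B) * (indicator {t/2..<t} r * ennreal ((t - r) powr (- \<beta>2) * r powr (- (?c + e)))))"
    using AB by (simp add: ennreal_mult mult_ac)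
   also have "... = ennreal (A powr (\<alpha> - 1) * B) * (NN r. indicator {t/2..<t} r * ennreal ((t - r) powr (- \<beta>2) * r powr (- (?c + e))))"
    by (rule nn_integral_cmult) measurable
   also have "... <= ennreal (A powr (\<alpha> - 1) * B) * ennreal (2 powr (\<beta>2 + (?c + e)) / (1 - \<beta>2) * t powr (1 - \<beta>2 - (?c + e)))"
    using b12 c1 c' t by (intro mult_left_mono duhamel_time_integral_late) auto
   also have "... <= ennreal (A powr (\<alpha> - 1) * B) * ennreal (Q2 * t powr (1 - \<beta>2 - (?c + e)))"
    unfolding Q2_def using c1 c' b12 by (intro mult_left_mono ennreal_leI mult_right_mono frac_le powr_mono) auto
   also have "1 - \<beta>2 - (?c + e) = 1 - \<beta>1 - ?c" using b12 by simp
   also have "ennreal (A powr (\<alpha> - 1) * B) * ennreal (Q2 * t powr (1 - \<beta>1 - ?c)) = ennreal (A powr (\<alpha> - 1) * B * (Q2 * ?T))"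
    using AB Q unfolding ex by (intro ennreal_mult[symmetric]) auto
   finally show ?thesis .
  qed
  show "weak_bound (pr s2) ((C * Q1 + C' * Q2) * A powr (\<alpha> - 1) * B * ?T) (%x. norm x powr pw s2 * f x)"
  proof (rule weak_bound_of_dual)
   show "0 <= (C * Q1 + C' * Q2) * A powr (\<alpha> - 1) * B * ?T" using C(1) C'0 Q AB by simp
   show "AE x in lborel. ennreal (norm x powr pw s2 * f x) <= ennreal (norm x powr pw s2) * duhamel {0<..<t} t F x"
    using f by eventually_elim (simp add: ennreal_mult' mult_left_mono)
   fix E :: "'a set" assume E: "E \<in> sets borel" "E \<in> lmeasurable"
   let ?e = "measure lebesgue E powr (1 - pr s2)"
   have I: "{0<..<t} = {0<..<t/2} \<union> {t/2..<t}" "{0<..<t/2} \<inter> {t/2..<t} = {}" using t by auto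
   have "(NN x. ennreal (norm x powr pw s2) * duhamel {0<..<t} t F x * indicator E x)
    = (NN x. ennreal (norm x powr pw s2) * duhamel {0<..<t/2} t F x * indicator E x
      + ennreal (norm x powr pw s2) * duhamel {t/2..<t} t F x * indicator E x)"
    unfolding I(1) by (simp add: duhamel_Un[OF Fm _ _ I(2)] distrib_left distrib_right)
   also have "... = (NN x. ennreal (norm x powr pw s2) * duhamel {0<..<t/2} t F x * indicator E x)
      + (NN x. ennreal (norm x powr pw s2) * duhamel {t/2..<t} t F x * indicator E x)"
    using E Fm by (intro nn_integral_add borel_measurable_times_ennreal) (auto intro!: borel_measurable_duhamel)
   also have "... <= ennreal (A powr (\<alpha> - 1) * B * (Q1 * ?T)) * ennreal (C * ?e)
     + ennreal (A powr (\<alpha> - 1) * B * (Q2 * ?T)) * ennreal (C' * ?e)"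
   proof (rule add_mono)
    have "(NN x. ennreal (norm x powr pw s2) * duhamel {0<..<t/2} t F x * indicator E x)
     <= (NN r. indicator {0<..<t/2} r * ennreal ((t - r) powr (- (\<beta> + d / 2 * (s - s2))) *
      ((A * r powr (- v)) powr (\<alpha> - 1) * (B * r powr (- b))))) * ennreal (C * ?e)"
     by (rule C(2)[OF maj]) (use m nn V W AB E t in \<open>auto simp: pw_s pr_s\<close>)
    also have "... <= ennreal (A powr (\<alpha> - 1) * B * (Q1 * ?T)) * ennreal (C * ?e)"
     by (intro mult_right_mono time1) auto
    finally show "(NN x. ennreal (norm x powr pw s2) * duhamel {0<..<t/2} t F x * indicator E x)
     <= ennreal (A powr (\<alpha> - 1) * B * (Q1 * ?T)) * ennreal (C * ?e)" .
    have "(NN x. ennreal (norm x powr pw s2) * duhamel {t/2..<t} t F x * indicator E x)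
     <= (NN r. indicator {t/2..<t} r * ennreal ((t - r) powr (- (\<beta> + d / 2 * (s1 - s2))) *
      ((A * r powr (- v)) powr (\<alpha> - 1) * (B * r powr (- b - d / 2 * (s - s1)))))) * ennreal (C' * ?e)"
     by (rule C'2[OF maj]) (use m nn V W1 AB E t in auto)
    also have "... <= ennreal (A powr (\<alpha> - 1) * B * (Q2 * ?T)) * ennreal (C' * ?e)"
     by (intro mult_right_mono time2) auto
    finally show "(NN x. ennreal (norm x powr pw s2) * duhamel {t/2..<t} t F x * indicator E x)
     <= ennreal (A powr (\<alpha> - 1) * B * (Q2 * ?T)) * ennreal (C' * ?e)" .
   qed
   also have "... = ennreal (A powr (\<alpha> - 1) * B * (Q1 * ?T) * (C * ?e) + A powr (\<alpha> - 1) * B * (Q2 * ?T) * (C' * ?e))"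
    using C(1) C'0 Q AB by (subst ennreal_plus) (simp_all add: ennreal_mult)
   also have "... = ennreal ((C * Q1 + C' * Q2) * A powr (\<alpha> - 1) * B * ?T * ?e)"
    by (simp only: distrib_left distrib_right mult_ac)
   finally show "(NN x. ennreal (norm x powr pw s2) * duhamel {0<..<t} t F x * indicator E x)
    <= ennreal ((C * Q1 + C' * Q2) * A powr (\<alpha> - 1) * B * ?T * ?e)" .
  qed
 qed
qed
qed
qed


lemma heat_path_smoothing:
 assumes dim: "d = real DIM('a::euclidean_space)" and s2: "0 <= s2" "s2 <= s"
 obtains C where "0 < C"
  "!!f g N t. [|f \<in> Bmeas; !!y. 0 <= f y; 0 < N; weak_bound R N (%y::'a. norm y powr k * f y); 0 < t;
    AE x in lborel. ennreal (g x) <= (NN y. ennreal (hk t (x - y) * f y))|] ==>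
   weak_bound (pr s2) (C * N * t powr (- (d / 2 * (s - s2)))) (%x. norm x powr pw s2 * g x)"
proof -
 have S2: "0 <= pw s2 / real DIM('a) + pr s2"
  using s2 path_homogeneity[of s2] unfolding dim[symmetric] by simp
 have K: "pw s2 <= k" using pw_mono[OF s2(2)] by (simp add: pw_s)
 have S1: "k / real DIM('a) + R < 1" using s_lt_1 by (simp add: s_def dim[symmetric])
 have expo: "- (d / 2) * (k / d + R - (pw s2 / d + pr s2)) = - (d / 2 * (s - s2))"
  unfolding path_homogeneity by (simp add: s_def)
 obtain C where C: "0 < C"
  "!!f N E t. [|f \<in> Bmeas; !!y. 0 <= f y; 0 < N; weak_bound R N (%y::'a. norm y powr k * f y);
    E \<in> sets borel; E \<in> lmeasurable; 0 < t|] ==>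
   (NN x. ennreal (norm x powr pw s2) * indicator E x *
     (NN y. ennreal (hk t (x - y) * f y)))
    <= ennreal (C * t powr (- (d / 2 * (s - s2))) * N * measure lebesgue E powr (1 - pr s2))"
  using smoothing[where 'a='a, OF R_nonneg R_lt_1 S1 K pr_nonneg pr_le[OF s2(2)] S2] unfolding dim[symmetric] expo by blast
 show thesis
 proof (rule that[OF C(1)])
  fix f g :: "'a => real" and N t :: real
  assume f: "f \<in> Bmeas" "!!y. 0 <= f y" and N: "0 < N" and wb: "weak_bound R N (%y. norm y powr k * f y)"
   and t: "0 < t" and g: "AE x in lborel. ennreal (g x) <= (NN y. ennreal (hk t (x - y) * f y))"
  show "weak_bound (pr s2) (C * N * t powr (- (d / 2 * (s - s2)))) (%x. norm x powr pw s2 * g x)"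
  proof (rule weak_bound_of_dual)
   show "0 <= C * N * t powr (- (d / 2 * (s - s2)))" using C(1) N by simp
   show "AE x in lborel. ennreal (norm x powr pw s2 * g x)
     <= ennreal (norm x powr pw s2) * (NN y. ennreal (hk t (x - y) * f y))"
    using g by eventually_elim (simp add: ennreal_mult' mult_left_mono)
   fix E :: "'a set" assume E: "E \<in> sets borel" "E \<in> lmeasurable"
   show "(NN x. ennreal (norm x powr pw s2) * (NN y. ennreal (hk t (x - y) * f y)) * indicator E x)
     <= ennreal (C * N * t powr (- (d / 2 * (s - s2))) * measure lebesgue E powr (1 - pr s2))"
    using C(2)[OF f N wb E t] by (simp add: mult_ac)
  qed
 qed
qed

text \<open>\<open>W\<close> is the modulus of an unknown and \<open>H\<close> that of its linear part.\<close>

definition duhamel_system ::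
  "(real \<times> 'a::euclidean_space => real) => (real => 'a => real) => (real => 'a => real) => (real => 'a => real) => bool" where
 "duhamel_system F V W H \<longleftrightarrow> majorises F V W &
   (\<forall>r>0. V r \<in> Lmeas & W r \<in> Lmeas & H r \<in> Lmeas) &
   (\<forall>r y. 0 <= V r y & 0 <= W r y & 0 <= H r y) &
   (\<forall>t>0. AE x in lborel. ennreal (W t x - H t x) <= duhamel {0<..<t} t F x)"

lemma duhamel_systemD:
 assumes "duhamel_system F V W H"
 shows "majorises F V W" "!!r. 0 < r ==> V r \<in> Lmeas"
  "!!r. 0 < r ==> W r \<in> Lmeas" "!!r. 0 < r ==> H r \<in> Lmeas"
  "!!r y. 0 <= V r y" "!!r y. 0 <= W r y" "!!r y. 0 <= H r y"
  "!!t. 0 < t ==> AE x in lborel. ennreal (W t x - H t x) <= duhamel {0<..<t} t F x"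
 using assms by (auto simp: duhamel_system_def)

lemma weak_bound_add_diff:
 assumes D: "weak_bound Q A (%x. norm x powr K * (W x - H x))" and H: "weak_bound Q B (%x. norm x powr K * H x)"
  and Q: "0 <= Q" "Q <= 1" and m: "W \<in> Lmeas" "H \<in> Lmeas"
 shows "weak_bound Q (4 * (A + B)) (%x. norm x powr K * W x)"
proof -
 have "weak_bound Q (4 * (A + B)) (%x. norm x powr K * (W x - H x) + norm x powr K * H x)"
  by (intro weak_bound_add D H Q borel_measurable_times borel_measurable_norm_powr_lebesgue borel_measurable_diff m)
 then show ?thesis by (simp add: algebra_simps)
qed

text \<open>Finitely many steps lead from \<open>s\<close> down to \<open>s2\<close>. The constant
  is chosen before the system, \<open>b\<close> and \<open>B\<close>, and enters linearly in
  \<open>B\<close>: it has to serve all rescalings of a solution at the same time.\<close>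

lemma duhamel_bootstrap:
 assumes dim: "d = real DIM('a::euclidean_space)" and c': "c' < 1" and A: "0 < A" and CH: "!!s'. 0 < CH s'"
  and s2: "0 <= s2" "s2 <= s"
 shows "\<exists>C>0. \<forall>(F :: real \<times> 'a => real) V W H b B. duhamel_system F V W H --> 0 < B --> 0 <= (\<alpha> - 1) * \<theta> + b --> (\<alpha> - 1) * \<theta> + b <= c' -->
   (\<forall>r>0. weak_bound R (A * r powr (- \<theta>)) (%y. norm y powr k * V r y)) -->
   (\<forall>r>0. weak_bound R (B * r powr (- b)) (%y. norm y powr k * W r y)) -->
   (\<forall>t>0. \<forall>s'. 0 <= s' --> s' <= s --> weak_bound (pr s') (CH s' * B * t powr (- b - d / 2 * (s - s'))) (%y. norm y powr pw s' * H t y)) -->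
   (\<forall>t>0. weak_bound (pr s2) (C * B * t powr (- b - d / 2 * (s - s2))) (%y. norm y powr pw s2 * W t y))"
proof -
 \<comment> \<open>A step of this length raises the kernel exponent \<open>\<beta>\<close> by
   \<open>(1 - \<beta>) / 2\<close>, half of the room below 1.\<close>
 define \<eta> where "\<eta> = (1 - \<beta>) / d"
 have \<eta>: "0 < \<eta>" using \<beta>_bounds d_pos by (simp add: \<eta>_def)
 let ?P = "%s2 C. \<forall>(F :: real \<times> 'a => real) V W H b B. duhamel_system F V W H --> 0 < B --> 0 <= (\<alpha> - 1) * \<theta> + b --> (\<alpha> - 1) * \<theta> + b <= c' -->
   (\<forall>r>0. weak_bound R (A * r powr (- \<theta>)) (%y. norm y powr k * V r y)) -->
   (\<forall>r>0. weak_bound R (B * r powr (- b)) (%y. norm y powr k * W r y)) -->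
   (\<forall>t>0. \<forall>s'. 0 <= s' --> s' <= s --> weak_bound (pr s') (CH s' * B * t powr (- b - d / 2 * (s - s'))) (%y. norm y powr pw s' * H t y)) -->
   (\<forall>t>0. weak_bound (pr s2) (C * B * t powr (- b - d / 2 * (s - s2))) (%y. norm y powr pw s2 * W t y))"
 have ind: "0 <= s2 ==> s2 <= s ==> s - real n * \<eta> <= s2 ==> \<exists>C>0. ?P s2 C" for n s2
 proof (induction n arbitrary: s2)
  case 0
  then have "s2 = s" by simp
  then have "?P s2 1" by (simp add: pw_s pr_s)
  then show ?case using zero_less_one by blast
 next
  case (Suc n)
  define s1 where "s1 = min s (s2 + \<eta>)"
  have s1: "0 <= s1" "s2 <= s1" "s1 <= s" "s - real n * \<eta> <= s1"
   using Suc.prems \<eta> by (auto simp: s1_def min_def algebra_simps)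
  obtain C1 where C1: "0 < C1" "?P s1 C1" using Suc.IH[OF s1(1,3,4)] by blast
  have gain: "\<beta> + d / 2 * (s1 - s2) < 1"
  proof -
   have "d / 2 * (s1 - s2) <= d / 2 * \<eta>" using d_pos by (intro mult_left_mono) (auto simp: s1_def)
   also have "... = (1 - \<beta>) / 2" using d_pos by (simp add: \<eta>_def)
   finally show ?thesis using \<beta>_bounds by (simp add: field_simps)
  qed
  show ?case
  proof (rule duhamel_step[OF dim c' Suc.prems(1) s1(2,3) gain], goal_cases)
   case (1 C) note C = 1
   define C' where "C' = 4 * (C * A powr (\<alpha> - 1) * (1 + C1) + CH s2)"
   have "0 < C'" using C(1) C1(1) CH by (simp add: C'_def add_nonneg_pos)
   moreover have "?P s2 C'"
   proof (intro allI impI)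
    fix F :: "real \<times> 'a => real" and V W H b B t
    assume sys: "duhamel_system F V W H" and B: "0 < B" and b: "0 <= (\<alpha> - 1) * \<theta> + b" "(\<alpha> - 1) * \<theta> + b <= c'"
     and V: "\<forall>r>0. weak_bound R (A * r powr (- \<theta>)) (%y. norm y powr k * V r y)"
     and W: "\<forall>r>0. weak_bound R (B * r powr (- b)) (%y. norm y powr k * W r y)"
     and H: "\<forall>t>0. \<forall>s'. 0 <= s' --> s' <= s --> weak_bound (pr s') (CH s' * B * t powr (- b - d / 2 * (s - s'))) (%y. norm y powr pw s' * H t y)"
     and t: "0 < (t::real)"
    note sysD = duhamel_systemD[OF sys]
    have W1: "\<forall>t>0. weak_bound (pr s1) (C1 * B * t powr (- b - d / 2 * (s - s1))) (%y. norm y powr pw s1 * W t y)"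
     using C1(2) sys B b V W H by blast
    let ?T = "t powr (- b - d / 2 * (s - s2))"
    \<comment> \<open>\<open>duhamel_step\<close> takes one constant for both bounds on
      \<open>W\<close>; \<open>(1 + C1) * B\<close> dominates \<open>B\<close> as well as
      \<open>C1 * B\<close>.\<close>
    have "weak_bound (pr s2) (C * A powr (\<alpha> - 1) * ((1 + C1) * B) * t powr ((\<alpha> - 1) * (\<theta> - \<theta>) - b - d / 2 * (s - s2)))
     (%x. norm x powr pw s2 * (W t x - H t x))"
    proof (rule C(2)[OF sysD(1) t])
     show "0 < (1 + C1) * B" using B C1(1) by simp
     fix r :: real assume r: "0 < r"
     show "weak_bound R ((1 + C1) * B * r powr (- b)) (%y. norm y powr k * W r y)"
      by (rule weak_bound_mono[of _ "B * r powr (- b)"]) (use W r B C1(1) in \<open>auto intro!: mult_right_mono\<close>)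
     show "weak_bound (pr s1) ((1 + C1) * B * r powr (- b - d / 2 * (s - s1))) (%y. norm y powr pw s1 * W r y)"
      by (rule weak_bound_mono[of _ "C1 * B * r powr (- b - d / 2 * (s - s1))"])
        (use W1 r B C1(1) in \<open>auto intro!: mult_right_mono\<close>)
    qed (use sysD A b V t in auto)
    then have "weak_bound (pr s2) (4 * (C * A powr (\<alpha> - 1) * ((1 + C1) * B) * t powr ((\<alpha> - 1) * (\<theta> - \<theta>) - b - d / 2 * (s - s2)) + CH s2 * B * ?T))
      (%y. norm y powr pw s2 * W t y)"
     by (rule weak_bound_add_diff)
       (use H t Suc.prems sysD pr_nonneg pr_le[OF Suc.prems(2)] R_lt_1 in auto)
    moreover have "4 * (C * A powr (\<alpha> - 1) * ((1 + C1) * B) * t powr ((\<alpha> - 1) * (\<theta> - \<theta>) - b - d / 2 * (s - s2)) + CH s2 * B * ?T)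
      = C' * B * ?T" by (simp add: C'_def algebra_simps)
    ultimately show "weak_bound (pr s2) (C' * B * ?T) (%y. norm y powr pw s2 * W t y)" by (simp only:)
   qed
   ultimately show ?case by blast
  qed
 qed
 obtain n where "s / \<eta> <= real n" using real_arch_simple by blast
 then have "s - real n * \<eta> <= s2" using \<eta> s2 by (simp add: field_simps)
 from ind[OF s2 this] show ?thesis .
qed

end

section \<open>The heat kernel as a Schwartz function, and tempered distributions\<close>

lemma real_polynomial_function_has_derivative:
 fixes p :: "'a::euclidean_space => real"
 assumes "real_polynomial_function p"
 shows "\<exists>D. (\<forall>x. (p has_derivative D x) (at x)) & (\<forall>b. real_polynomial_function (%x. D x b))"
 using assms
proof (induction rule: real_polynomial_function.induct)
 case (linear f)
 then show ?case
  by (intro exI[of _ "%_. f"]) (auto intro: bounded_linear_imp_has_derivative real_polynomial_function.intros)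
next
 case (const c)
 show ?case by (intro exI[of _ "%_ _. 0"]) (auto intro: real_polynomial_function.intros)
next
 case (add f g)
 then obtain D D' where "\<forall>x. (f has_derivative D x) (at x)" "\<forall>b. real_polynomial_function (%x. D x b)"
  "\<forall>x. (g has_derivative D' x) (at x)" "\<forall>b. real_polynomial_function (%x. D' x b)" by auto
 then show ?case
  by (intro exI[of _ "%x b. D x b + D' x b"]) (auto intro: has_derivative_add real_polynomial_function.intros)
next
 case (mult f g)
 then obtain D D' where "\<forall>x. (f has_derivative D x) (at x)" "\<forall>b. real_polynomial_function (%x. D x b)"
  "\<forall>x. (g has_derivative D' x) (at x)" "\<forall>b. real_polynomial_function (%x. D' x b)" by auto
 then show ?case using mult.hyps
  by (intro exI[of _ "%x b. f x * D' x b + D x b * g x"] conjI allI)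
   (auto intro!: has_derivative_mult real_polynomial_function.intros(3,4))
qed

lemma real_polynomial_function_growth:
 fixes p :: "'a::euclidean_space => real"
 assumes "real_polynomial_function p"
 shows "\<exists>C N. 0 <= C & (\<forall>x. \<bar>p x\<bar> <= C * (1 + norm x) ^ N)"
 using assms
proof (induction rule: real_polynomial_function.induct)
 case (linear f)
 then obtain K where K: "0 < K" "!!x. norm (f x) <= norm x * K" using bounded_linear.pos_bounded by blast
 have "\<bar>f x\<bar> <= K * (1 + norm x) ^ 1" for x
  using K(2)[of x] K(1) by (simp add: algebra_simps add_increasing)
 then show ?case using K(1) by (metis less_imp_le)
next
 case (const c)
 show ?case by (intro exI[of _ "\<bar>c\<bar>"] exI[of _ 0]) auto
next
 case (add f g)
 then obtain C N C' N' where *: "0 <= C" "!!x. \<bar>f x\<bar> <= C * (1 + norm x) ^ N" "0 <= C'" "!!x. \<bar>g x\<bar> <= C' * (1 + norm x) ^ N'"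
  by blast
 have "\<bar>f x + g x\<bar> <= (C + C') * (1 + norm x) ^ (N + N')" for x
 proof -
  have "C * (1 + norm x) ^ N <= C * (1 + norm x) ^ (N + N')" "C' * (1 + norm x) ^ N' <= C' * (1 + norm x) ^ (N + N')"
   using * by (auto intro!: mult_left_mono power_increasing)
  then show ?thesis using *(2)[of x] *(4)[of x] by (simp add: distrib_right)
 qed
 then show ?case using * by (metis add_nonneg_nonneg)
next
 case (mult f g)
 then obtain C N C' N' where *: "0 <= C" "!!x. \<bar>f x\<bar> <= C * (1 + norm x) ^ N" "0 <= C'" "!!x. \<bar>g x\<bar> <= C' * (1 + norm x) ^ N'"
  by blast
 have "\<bar>f x * g x\<bar> <= (C * C') * (1 + norm x) ^ (N + N')" for x
 proof -
  have "\<bar>f x * g x\<bar> <= (C * (1 + norm x) ^ N) * (C' * (1 + norm x) ^ N')"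
   unfolding abs_mult by (intro mult_mono *) (auto simp: *)
  then show ?thesis by (simp add: power_add mult_ac)
 qed
 then show ?case using * by (metis mult_nonneg_nonneg)
qed

lemma heat_kernel_has_derivative:
 fixes z :: "'a::euclidean_space"
 assumes t: "0 < t"
 shows "(hk t has_derivative (%h. - (z \<bullet> h) / (2 * t) * hk t z)) (at z)"
proof -
 let ?c = "(4 * pi * t) powr (- (real DIM('a) / 2))"
 have "((%z. z \<bullet> z) has_derivative (%h. z \<bullet> h + h \<bullet> z)) (at z)"
  by (intro has_derivative_inner has_derivative_ident)
 then have "((%z. - (1 / (4 * t)) * (z \<bullet> z)) has_derivative (%h. - (1 / (4 * t)) * (z \<bullet> h + h \<bullet> z))) (at z)"
  by (rule has_derivative_mult_right)
 then have "((%z. exp (- (1 / (4 * t)) * (z \<bullet> z))) has_derivative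
   (%h. exp (- (1 / (4 * t)) * (z \<bullet> z)) * (- (1 / (4 * t)) * (z \<bullet> h + h \<bullet> z)))) (at z)"
  by (rule has_derivative_exp[THEN has_derivative_eq_rhs]) (simp add: mult.commute)
 then have "((%z. ?c * exp (- (1 / (4 * t)) * (z \<bullet> z))) has_derivative
   (%h. ?c * (exp (- (1 / (4 * t)) * (z \<bullet> z)) * (- (1 / (4 * t)) * (z \<bullet> h + h \<bullet> z))))) (at z)"
  by (rule has_derivative_mult_right)
 moreover have "hk t = (%z::'a. ?c * exp (- (1 / (4 * t)) * (z \<bullet> z)))"
  by (simp add: heat_kernel_def power2_norm_eq_inner fun_eq_iff)
 moreover have "?c * (exp (- (1 / (4 * t)) * (z \<bullet> z)) * (- (1 / (4 * t)) * (z \<bullet> h + h \<bullet> z)))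
   = - (z \<bullet> h) / (2 * t) * hk t z" for h
  by (simp add: heat_kernel_def power2_norm_eq_inner inner_commute[of h z])
 ultimately show ?thesis by simp
qed

text \<open>\<open>kernel_partial t bs (x - y)\<close> is the partial derivative along \<open>bs\<close> of \<open>y \<mapsto> G\<^sub>t(x - y)\<close>.\<close>

definition kernel_partial :: "real => 'a::euclidean_space list => 'a => real" where
 "kernel_partial t bs z = Re (iterated_partial bs (%y. of_real (hk t (0 - y))) (- z))"

text \<open>Polynomials times the Gaussian form a class closed under differentiation; so all
  derivatives of the kernel stay in it and decay faster than any power.\<close>

lemma poly_heat_kernel_has_derivative:
 fixes p :: "'a::euclidean_space => real"
 assumes p: "real_polynomial_function p" and t: "0 < t"
 shows "\<exists>D. (\<forall>z. ((%z. p z * hk t z) has_derivative D z) (at z)) &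
  (\<forall>b. \<exists>p'. real_polynomial_function p' & (\<forall>z. D z b = p' z * hk t z))"
proof -
 obtain D where D: "\<forall>x. (p has_derivative D x) (at x)" "\<forall>b. real_polynomial_function (%x. D x b)"
  using real_polynomial_function_has_derivative[OF p] by blast
 let ?D = "%z h. p z * (- (z \<bullet> h) / (2 * t) * hk t z) + D z h * hk t z"
 have "((%z. p z * hk t z) has_derivative ?D z) (at z)" for z
  using D(1) heat_kernel_has_derivative[OF t] by (intro has_derivative_mult) auto
 moreover have "\<exists>p'. real_polynomial_function p' & (\<forall>z. ?D z b = p' z * hk t z)" for b
 proof (intro exI conjI allI)
  show "real_polynomial_function (%z. p z * ((- 1 / (2 * t)) * (z \<bullet> b)) + D z b)"
   by (intro real_polynomial_function.intros p D(2)[rule_format] bounded_linear_inner_left)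
 qed (simp add: algebra_simps)
 ultimately show ?thesis by (intro exI[of _ ?D]) auto
qed

lemma iterated_partial_heat_kernel_poly:
 fixes bs :: "'a::euclidean_space list"
 assumes t: "0 < t"
 shows "\<exists>p. real_polynomial_function p &
  (\<forall>x. iterated_partial bs (%y. of_real (hk t (x - y))) = (%y. of_real (p (x - y) * hk t (x - y))))"
proof (induction bs)
 case Nil
 show ?case by (intro exI[of _ "%_. 1"]) (auto intro: real_polynomial_function.intros)
next
 case (Cons b bs)
 then obtain p where p: "real_polynomial_function p"
  "!!x. iterated_partial bs (%y. of_real (hk t (x - y))) = (%y. of_real (p (x - y) * hk t (x - y)))" by blast
 obtain D where D: "!!z. ((%z. p z * hk t z) has_derivative D z) (at z)"
  "!!b. \<exists>p'. real_polynomial_function p' & (\<forall>z. D z b = p' z * hk t z)"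
  using poly_heat_kernel_has_derivative[OF p(1) t] by blast
 obtain p' where p': "real_polynomial_function p'" "!!z. D z b = p' z * hk t z" using D(2) by blast
 have "iterated_partial (b # bs) (%y. of_real (hk t (x - y))) y = of_real (- 1 * p' (x - y) * hk t (x - y))" for x y
 proof -
  have "((%y. x - y) has_derivative (%h. - h)) (at y)" by (auto intro!: derivative_eq_intros)
  then have "((%y. p (x - y) * hk t (x - y)) has_derivative (%h. D (x - y) (- h))) (at y)"
   by (rule has_derivative_compose) (rule D(1))
  then have "((%y. complex_of_real (p (x - y) * hk t (x - y))) has_derivative (%h. of_real (D (x - y) (- h)))) (at y)"
   by (rule has_derivative_of_real)
  then have "iterated_partial (b # bs) (%y. of_real (hk t (x - y))) y = of_real (D (x - y) (- b))"
   by (simp add: p(2) frechet_derivative_at[symmetric])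
  also have "D (x - y) (- b) = - D (x - y) b"
   using D(1)[of "x - y"] by (metis has_derivative_linear linear_neg)
  finally show ?thesis by (simp add: p'(2))
 qed
 then have "iterated_partial (b # bs) (%y. of_real (hk t (x - y))) = (%y. of_real (- 1 * p' (x - y) * hk t (x - y)))" for x
  by (simp add: fun_eq_iff)
 moreover have "real_polynomial_function (%z. - 1 * p' z)" by (intro real_polynomial_function.intros p')
 ultimately show ?case by blast
qed

lemma iterated_partial_heat_kernel:
 assumes t: "0 < t"
 shows "iterated_partial bs (%y. of_real (hk t (x - y))) = (%y. of_real (kernel_partial t bs (x - y)))"
  and "\<exists>p. real_polynomial_function p & (\<forall>z. kernel_partial t bs z = p z * hk t z)"
proof -
 obtain p where p: "real_polynomial_function p"
  "!!x. iterated_partial bs (%y. of_real (hk t (x - y))) = (%y. of_real (p (x - y) * hk t (x - y)))"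
  using iterated_partial_heat_kernel_poly[OF t] by blast
 have k: "kernel_partial t bs z = p z * hk t z" for z
  unfolding kernel_partial_def p(2) by simp
 then show "iterated_partial bs (%y. of_real (hk t (x - y))) = (%y. of_real (kernel_partial t bs (x - y)))"
  unfolding p(2) by simp
 show "\<exists>p. real_polynomial_function p & (\<forall>z. kernel_partial t bs z = p z * hk t z)"
  using p(1) k by blast
qed

lemma kernel_partial_Nil: "kernel_partial t [] z = hk t z"
 by (simp add: kernel_partial_def)

lemma kernel_partial_has_derivative:
 assumes t: "0 < t"
 shows "\<exists>D. (kernel_partial t bs has_derivative D) (at z) & (\<forall>b. D b = - kernel_partial t (b # bs) z)"
proof -
 obtain p where p: "real_polynomial_function p" "!!z. kernel_partial t bs z = p z * hk t z"
  using iterated_partial_heat_kernel(2)[OF t] by blast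
 obtain D where D: "!!z. ((%z. p z * hk t z) has_derivative D z) (at z)"
  using poly_heat_kernel_has_derivative[OF p(1) t] by blast
 have kD: "(kernel_partial t bs has_derivative D z) (at z)" using D[of z] p(2) by (simp add: p(2)[abs_def])
 have "D z b = - kernel_partial t (b # bs) z" for b
 proof -
  have "((%y. 0 - y) has_derivative (%h. - h)) (at (- z))" by (auto intro!: derivative_eq_intros)
  moreover have "(kernel_partial t bs has_derivative D z) (at (0 - (- z)))" using kD by simp
  ultimately have "((%y. kernel_partial t bs (0 - y)) has_derivative (%h. D z (- h))) (at (- z))"
   by (rule has_derivative_compose)
  then have "((%y. complex_of_real (kernel_partial t bs (0 - y))) has_derivative (%h. of_real (D z (- h)))) (at (- z))"
   by (rule has_derivative_of_real)
  then have "frechet_derivative (%y. complex_of_real (kernel_partial t bs (0 - y))) (at (- z)) b = of_real (D z (- b))"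
   by (simp add: frechet_derivative_at[symmetric])
  moreover have "kernel_partial t (b # bs) z
    = Re (frechet_derivative (iterated_partial bs (%y. of_real (hk t (0 - y)))) (at (- z)) b)"
   by (simp only: kernel_partial_def iterated_partial.simps)
  ultimately have "kernel_partial t (b # bs) z = D z (- b)"
   by (simp only: iterated_partial_heat_kernel(1)[OF t] Re_complex_of_real)
  then show ?thesis using kD by (metis has_derivative_linear linear_neg minus_minus)
 qed
 then show ?thesis using kD by blast
qed

lemma heat_kernel_decay:
 assumes t: "0 < t"
 shows "\<exists>C>0. \<forall>z::'a::euclidean_space. (1 + norm z) ^ N * hk t z <= C"
proof -
 obtain c where c: "0 < c" "!!z::'a. (1 + norm z) powr real N * hk t z <= c * hk (2 * t) z"
  by (rule weighted_heat_kernel_le[OF of_nat_0_le_iff t]) blast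
 have "(1 + norm z) ^ N * hk t z <= c * hk (2 * t) (0::'a)" for z :: 'a
 proof -
  have "(1 + norm z) ^ N = (1 + norm z) powr real N" by (rule powr_realpow[symmetric]) (simp add: add_pos_nonneg)
  then have "(1 + norm z) ^ N * hk t z <= c * hk (2 * t) z" using c(2) by simp
  also have "... <= c * hk (2 * t) (0::'a)" using c(1) t by (intro mult_left_mono heat_kernel_le) auto
  finally show ?thesis .
 qed
 moreover have "0 < c * hk (2 * t) (0::'a)" using c(1) t by (simp add: heat_kernel_def)
 ultimately show ?thesis by blast
qed

lemma kernel_partial_decay:
 fixes bs :: "'a::euclidean_space list"
 assumes t: "0 < t"
 shows "\<exists>C>0. \<forall>z. (1 + norm z) ^ N * \<bar>kernel_partial t bs z\<bar> <= C"
proof -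
 obtain p where p: "real_polynomial_function p" "!!z. kernel_partial t bs z = p z * hk t z"
  using iterated_partial_heat_kernel(2)[OF t] by blast
 obtain C M where C: "0 <= C" "!!x. \<bar>p x\<bar> <= C * (1 + norm x) ^ M"
  using real_polynomial_function_growth[OF p(1)] by blast
 obtain C' where C': "0 < C'" "!!z::'a. (1 + norm z) ^ (N + M) * hk t z <= C'"
  using heat_kernel_decay[OF t] by blast
 have "(1 + norm z) ^ N * \<bar>kernel_partial t bs z\<bar> <= C * C' + 1" for z
 proof -
  have "(1 + norm z) ^ N * \<bar>kernel_partial t bs z\<bar> <= (1 + norm z) ^ N * (C * (1 + norm z) ^ M * hk t z)"
   unfolding p(2) abs_mult by (intro mult_left_mono mult_mono C) (auto simp: C)
  also have "... = C * ((1 + norm z) ^ (N + M) * hk t z)" by (simp add: power_add mult_ac)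
  also have "... <= C * C'" by (intro mult_left_mono C' C)
  finally show ?thesis by simp
 qed
 moreover have "0 < C * C' + 1" using C C' by (simp add: add_nonneg_pos)
 ultimately show ?thesis by blast
qed

lemma one_plus_norm_mult: "1 + norm (v::'a::real_normed_vector) <= (1 + norm w) * (1 + norm (v - w))"
proof -
 have "norm v <= norm w + norm (v - w)" using norm_triangle_ineq[of w "v - w"] by simp
 moreover have "(1 + norm w) * (1 + norm (v - w)) = 1 + norm w + norm (v - w) + norm w * norm (v - w)"
  by (simp add: algebra_simps)
 moreover have "0 <= norm w * norm (v - w)" by simp
 ultimately show ?thesis by linarith
qed

text \<open>Mean value theorem on the segment from \<open>w\<close> to \<open>v\<close>; the weight
  at \<open>v\<close> is moved to the intermediate point at the price of a power of
  \<open>1 + |v - w|\<close>. This controls Schwartz seminorms of differences of translated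
  kernels.\<close>

lemma kernel_partial_lipschitz:
 fixes bs :: "'a::euclidean_space list"
 assumes t: "0 < t"
 shows "\<exists>C>0. \<forall>v w. (1 + norm v) ^ N * \<bar>kernel_partial t bs v - kernel_partial t bs w\<bar> <= C * ((1 + norm (v - w)) ^ N * norm (v - w))"
proof -
 have "\<forall>b. \<exists>C>0. \<forall>z. (1 + norm z) ^ N * \<bar>kernel_partial t (b # bs) z\<bar> <= C"
  using kernel_partial_decay[OF t] by blast
 then obtain Cf where Cf: "!!b. 0 < Cf b" "!!b z. (1 + norm z) ^ N * \<bar>kernel_partial t (b # bs) z\<bar> <= Cf b"
  by metis
 define C where "C = (\<Sum>b\<in>(Basis::'a set). Cf b)"
 have C: "0 < C" unfolding C_def using Cf(1) by (intro sum_pos) auto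
 have "(1 + norm v) ^ N * \<bar>kernel_partial t bs v - kernel_partial t bs w\<bar> <= C * ((1 + norm (v - w)) ^ N * norm (v - w))" for v w
 proof -
  define \<phi> where "\<phi> r = kernel_partial t bs (w + r *\<^sub>R (v - w))" for r :: real
  have "\<forall>z. \<exists>D. (kernel_partial t bs has_derivative D) (at z) & (\<forall>b. D b = - kernel_partial t (b # bs) z)"
   using kernel_partial_has_derivative[OF t] by blast
  then obtain D where D: "!!z. (kernel_partial t bs has_derivative D z) (at z)" "!!z b. D z b = - kernel_partial t (b # bs) z"
   by metis
  have der: "DERIV \<phi> r :> D (w + r *\<^sub>R (v - w)) (v - w)" for r
  proof -
   have "((%r. w + r *\<^sub>R (v - w)) has_derivative (%h. h *\<^sub>R (v - w))) (at r)"
    by (auto intro!: derivative_eq_intros)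
   then have "(\<phi> has_derivative (%h. D (w + r *\<^sub>R (v - w)) (h *\<^sub>R (v - w)))) (at r)"
    unfolding \<phi>_def by (rule has_derivative_compose) (rule D(1))
   moreover have "D (w + r *\<^sub>R (v - w)) (h *\<^sub>R (v - w)) = D (w + r *\<^sub>R (v - w)) (v - w) * h" for h
    using has_derivative_linear[OF D(1)] by (simp add: linear_scale)
   ultimately show ?thesis by (simp add: has_field_derivative_def)
  qed
  then obtain r where r: "0 < r" "r < 1" "\<phi> 1 - \<phi> 0 = (1 - 0) * D (w + r *\<^sub>R (v - w)) (v - w)"
   using MVT2[of 0 1 \<phi> "%r. D (w + r *\<^sub>R (v - w)) (v - w)"] by auto
  define \<zeta> where "\<zeta> = w + r *\<^sub>R (v - w)"
  have eq: "kernel_partial t bs v - kernel_partial t bs w = D \<zeta> (v - w)" using r(3) by (simp add: \<phi>_def \<zeta>_def)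
  have Dsum: "D \<zeta> h = (\<Sum>b\<in>Basis. (h \<bullet> b) * D \<zeta> b)" for h
  proof -
   have lin: "linear (D \<zeta>)" using D(1) by (rule has_derivative_linear)
   have "D \<zeta> h = D \<zeta> (\<Sum>b\<in>Basis. (h \<bullet> b) *\<^sub>R b)" by (simp add: euclidean_representation)
   then show ?thesis by (simp add: linear_sum[OF lin] linear_scale[OF lin])
  qed
  have "(1 + norm \<zeta>) ^ N * \<bar>D \<zeta> (v - w)\<bar> <= (\<Sum>b\<in>Basis. norm (v - w) * Cf b)"
  proof -
   have "(1 + norm \<zeta>) ^ N * \<bar>D \<zeta> (v - w)\<bar> <= (1 + norm \<zeta>) ^ N * (\<Sum>b\<in>Basis. \<bar>((v - w) \<bullet> b) * D \<zeta> b\<bar>)"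
    unfolding Dsum[of "v - w"] by (intro mult_left_mono sum_abs) auto
   also have "... = (\<Sum>b\<in>Basis. \<bar>(v - w) \<bullet> b\<bar> * ((1 + norm \<zeta>) ^ N * \<bar>kernel_partial t (b # bs) \<zeta>\<bar>))"
    by (simp add: sum_distrib_left abs_mult D(2) mult_ac)
   also have "... <= (\<Sum>b\<in>Basis. norm (v - w) * Cf b)"
    by (intro sum_mono mult_mono Basis_le_norm Cf) auto
   finally show ?thesis .
  qed
  also have "... = C * norm (v - w)" by (simp add: C_def sum_distrib_right mult.commute)
  finally have *: "(1 + norm \<zeta>) ^ N * \<bar>D \<zeta> (v - w)\<bar> <= C * norm (v - w)" .
  have "norm (v - \<zeta>) <= norm (v - w)"
  proof -
   have "v - \<zeta> = (1 - r) *\<^sub>R (v - w)" by (simp add: \<zeta>_def algebra_simps)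
   then have "norm (v - \<zeta>) = (1 - r) * norm (v - w)" using r by simp
   then show ?thesis using r by (simp add: mult_left_le_one_le)
  qed
  then have "1 + norm v <= (1 + norm \<zeta>) * (1 + norm (v - w))"
   by (intro order_trans[OF one_plus_norm_mult[of v \<zeta>]] mult_left_mono) auto
  then have "(1 + norm v) ^ N <= ((1 + norm \<zeta>) * (1 + norm (v - w))) ^ N" by (intro power_mono) auto
  then have "(1 + norm v) ^ N * \<bar>D \<zeta> (v - w)\<bar> <= ((1 + norm \<zeta>) * (1 + norm (v - w))) ^ N * \<bar>D \<zeta> (v - w)\<bar>"
   by (intro mult_right_mono) auto
  also have "... = (1 + norm (v - w)) ^ N * ((1 + norm \<zeta>) ^ N * \<bar>D \<zeta> (v - w)\<bar>)"
   by (simp add: power_mult_distrib mult_ac)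
  also have "... <= (1 + norm (v - w)) ^ N * (C * norm (v - w))"
   by (intro mult_left_mono *) auto
  finally show ?thesis unfolding eq by (simp add: mult_ac)
 qed
 then show ?thesis using C by blast
qed

lemma schwartzD:
 assumes "f \<in> schwartz" "bs \<in> lists Basis"
 shows "iterated_partial bs f differentiable at x"
  and "bounded (range (%x. (1 + norm x) ^ N * norm (iterated_partial bs f x)))"
 using assms by (auto simp: schwartz_def)

lemma iterated_partial_add:
 assumes f: "f \<in> schwartz" and g: "g \<in> schwartz" and bs: "bs \<in> lists Basis"
 shows "iterated_partial bs (%x. f x + g x) = (%x. iterated_partial bs f x + iterated_partial bs g x)"
 using bs
proof (induction bs)
 case (Cons b bs)
 then have bs: "bs \<in> lists Basis" by simp
 have "frechet_derivative (%x. iterated_partial bs f x + iterated_partial bs g x) (at x) b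
   = frechet_derivative (iterated_partial bs f) (at x) b + frechet_derivative (iterated_partial bs g) (at x) b" for x
 proof -
  have "((%x. iterated_partial bs f x + iterated_partial bs g x) has_derivative
    (%h. frechet_derivative (iterated_partial bs f) (at x) h + frechet_derivative (iterated_partial bs g) (at x) h)) (at x)"
   using schwartzD(1)[OF f bs] schwartzD(1)[OF g bs] unfolding frechet_derivative_works by (rule has_derivative_add)
  then show ?thesis by (simp add: frechet_derivative_at[symmetric])
 qed
 then show ?case by (simp add: Cons.IH)
qed simp

lemma iterated_partial_cmult:
 fixes c :: complex
 assumes f: "f \<in> schwartz" and bs: "bs \<in> lists Basis"
 shows "iterated_partial bs (%x. c * f x) = (%x. c * iterated_partial bs f x)"
 using bs
proof (induction bs)
 case (Cons b bs)
 then have bs: "bs \<in> lists Basis" by simp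
 have "frechet_derivative (%x. c * iterated_partial bs f x) (at x) b = c * frechet_derivative (iterated_partial bs f) (at x) b" for x
 proof -
  have "((%x. c * iterated_partial bs f x) has_derivative (%h. c * frechet_derivative (iterated_partial bs f) (at x) h)) (at x)"
   using schwartzD(1)[OF f bs] unfolding frechet_derivative_works by (rule has_derivative_mult_right)
  then show ?thesis by (simp add: frechet_derivative_at[symmetric])
 qed
 then show ?case by (simp add: Cons.IH)
qed simp

lemma schwartz_add:
 assumes f: "f \<in> schwartz" and g: "g \<in> schwartz"
 shows "(%x. f x + g x) \<in> schwartz"
 unfolding schwartz_def
proof (intro CollectI ballI conjI allI)
 fix bs :: "'a list" and x N assume bs: "bs \<in> lists Basis"
 show "iterated_partial bs (%x. f x + g x) differentiable at x"
  unfolding iterated_partial_add[OF f g bs] by (intro differentiable_add schwartzD f g bs)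
 obtain B B' where B: "!!x. norm ((1 + norm x) ^ N * norm (iterated_partial bs f x)) <= B"
  "!!x. norm ((1 + norm x) ^ N * norm (iterated_partial bs g x)) <= B'"
  using schwartzD(2)[OF f bs, of N] schwartzD(2)[OF g bs, of N] unfolding bounded_iff by blast
 have "norm ((1 + norm x) ^ N * norm (iterated_partial bs f x + iterated_partial bs g x)) <= B + B'" for x
 proof -
  have "(1 + norm x) ^ N * norm (iterated_partial bs f x + iterated_partial bs g x)
   <= (1 + norm x) ^ N * norm (iterated_partial bs f x) + (1 + norm x) ^ N * norm (iterated_partial bs g x)"
   unfolding distrib_left[symmetric] by (intro mult_left_mono norm_triangle_ineq) auto
  then show ?thesis using B[of x] by simp
 qed
 then show "bounded (range (%x. (1 + norm x) ^ N * norm (iterated_partial bs (%x. f x + g x) x)))"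
  unfolding iterated_partial_add[OF f g bs] bounded_iff by blast
qed

lemma schwartz_cmult:
 fixes c :: complex
 assumes f: "f \<in> schwartz"
 shows "(%x. c * f x) \<in> schwartz"
 unfolding schwartz_def
proof (intro CollectI ballI conjI allI)
 fix bs :: "'a list" and x N assume bs: "bs \<in> lists Basis"
 show "iterated_partial bs (%x. c * f x) differentiable at x"
  unfolding iterated_partial_cmult[OF f bs] by (intro differentiable_mult differentiable_const schwartzD f bs)
 obtain B where B: "!!x. norm ((1 + norm x) ^ N * norm (iterated_partial bs f x)) <= B"
  using schwartzD(2)[OF f bs, of N] unfolding bounded_iff by blast
 have "norm ((1 + norm x) ^ N * norm (c * iterated_partial bs f x)) <= norm c * B" for x
  using mult_left_mono[OF B[of x], of "norm c"] by (simp add: norm_mult mult_ac)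
 then show "bounded (range (%x. (1 + norm x) ^ N * norm (iterated_partial bs (%x. c * f x) x)))"
  unfolding iterated_partial_cmult[OF f bs] bounded_iff by blast
qed

lemma heat_kernel_schwartz:
 fixes x :: "'a::euclidean_space"
 assumes t: "0 < t"
 shows "(%y. of_real (hk t (x - y))) \<in> schwartz"
 unfolding schwartz_def
proof (intro CollectI ballI conjI allI)
 fix bs :: "'a list" and y N
 obtain D where D: "(kernel_partial t bs has_derivative D) (at (x - y))"
  using kernel_partial_has_derivative[OF t] by blast
 have "((%y. x - y) has_derivative (%h. - h)) (at y)" by (auto intro!: derivative_eq_intros)
 then have "((%y. kernel_partial t bs (x - y)) has_derivative (%h. D (- h))) (at y)"
  by (rule has_derivative_compose) (rule D)
 then have "((%y. complex_of_real (kernel_partial t bs (x - y))) has_derivative (%h. of_real (D (- h)))) (at y)"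
  by (rule has_derivative_of_real)
 then show "iterated_partial bs (%y. complex_of_real (hk t (x - y))) differentiable at y"
  unfolding iterated_partial_heat_kernel(1)[OF t] by (rule differentiableI)
 obtain C where C: "!!z. (1 + norm z) ^ N * \<bar>kernel_partial t bs z\<bar> <= C" using kernel_partial_decay[OF t] by blast
 have "norm ((1 + norm y) ^ N * norm (complex_of_real (kernel_partial t bs (x - y)))) <= (1 + norm x) ^ N * C" for y
 proof -
  have "(1 + norm y) ^ N <= ((1 + norm x) * (1 + norm (x - y))) ^ N"
   using one_plus_norm_mult[of y x] by (intro power_mono) (auto simp: norm_minus_commute)
  then have "(1 + norm y) ^ N * \<bar>kernel_partial t bs (x - y)\<bar> <= ((1 + norm x) * (1 + norm (x - y))) ^ N * \<bar>kernel_partial t bs (x - y)\<bar>"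
   by (intro mult_right_mono) auto
  also have "... = (1 + norm x) ^ N * ((1 + norm (x - y)) ^ N * \<bar>kernel_partial t bs (x - y)\<bar>)"
   by (simp add: power_mult_distrib)
  also have "... <= (1 + norm x) ^ N * C" by (intro mult_left_mono C) auto
  finally show ?thesis by simp
 qed
 then show "bounded (range (%y. (1 + norm y) ^ N * norm (iterated_partial bs (%y. complex_of_real (hk t (x - y))) y)))"
  unfolding iterated_partial_heat_kernel(1)[OF t] bounded_iff by blast
qed

lemma schwartz_seminorm_le:
 fixes f :: "'a::euclidean_space => complex"
 assumes B: "!!bs x. [|bs \<in> lists Basis; length bs <= N|] ==> (1 + norm x) ^ N * norm (iterated_partial bs f x) <= B"
 shows "0 <= schwartz_seminorm N f" "schwartz_seminorm N f <= B"
proof -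
 let ?S = "{bs \<in> lists Basis. length bs <= N} \<times> (UNIV :: 'a set)"
 let ?f = "%(bs, x). (1 + norm x) ^ N * norm (iterated_partial bs f x)"
 have ne: "([], 0) \<in> ?S" by simp
 have le: "?f z <= B" if "z \<in> ?S" for z using that B by auto
 have bdd: "bdd_above (?f ` ?S)" unfolding bdd_above_def using le by blast
 show "schwartz_seminorm N f <= B"
  unfolding schwartz_seminorm_def
 proof (rule cSUP_least)
  show "?S \<noteq> {}" using ne by blast
 qed (rule le)
 have "0 <= ?f ([], 0)" by simp
 also have "... <= schwartz_seminorm N f"
  unfolding schwartz_seminorm_def by (rule cSUP_upper[OF ne bdd])
 finally show "0 <= schwartz_seminorm N f" .
qed

text \<open>Continuity in usable form: a positive constant, and any common majorant of the weighted
  derivatives in place of the supremum.\<close>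

lemma tempered_distribution_bound:
 fixes \<phi> :: "('a::euclidean_space => complex) => complex"
 assumes "tempered_distribution \<phi>"
 obtains N C where "0 < C"
  "!!f B. [|f \<in> schwartz; !!bs x. [|bs \<in> lists Basis; length bs <= N|] ==> (1 + norm x) ^ N * norm (iterated_partial bs f x) <= B|]
    ==> norm (\<phi> f) <= C * B"
proof -
 obtain N C where C: "!!f. f \<in> schwartz ==> norm (\<phi> f) <= C * schwartz_seminorm N f"
  using assms unfolding tempered_distribution_def by blast
 have "norm (\<phi> f) <= (\<bar>C\<bar> + 1) * B"
  if f: "f \<in> schwartz" and B: "!!bs x. [|bs \<in> lists Basis; length bs <= N|] ==> (1 + norm x) ^ N * norm (iterated_partial bs f x) <= B" for f B
 proof -
  note S = schwartz_seminorm_le[of N f B, OF B]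
  have "norm (\<phi> f) <= C * schwartz_seminorm N f" by (rule C[OF f])
  also have "... <= (\<bar>C\<bar> + 1) * schwartz_seminorm N f" using S(1) by (intro mult_right_mono) auto
  also have "... <= (\<bar>C\<bar> + 1) * B" using S(2) by (intro mult_left_mono) auto
  finally show ?thesis .
 qed
 then show thesis by (intro that[of "\<bar>C\<bar> + 1" N]) auto
qed

lemma tempered_distribution_add:
 "[|tempered_distribution \<phi>; f \<in> schwartz; g \<in> schwartz|] ==> \<phi> (%x. f x + g x) = \<phi> f + \<phi> g"
 unfolding tempered_distribution_def by blast

lemma tempered_distribution_cmult:
 "[|tempered_distribution \<phi>; f \<in> schwartz|] ==> \<phi> (%x. c * f x) = c * \<phi> f"
 unfolding tempered_distribution_def by blast

lemma tempered_distribution_sum: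
 fixes \<phi> :: "('a::euclidean_space => complex) => complex"
 assumes \<phi>: "tempered_distribution \<phi>" and fin: "finite J" and g: "!!j. g j \<in> schwartz"
 shows "(%y. \<Sum>j\<in>J. c j * g j y) \<in> schwartz & \<phi> (%y. \<Sum>j\<in>J. c j * g j y) = (\<Sum>j\<in>J. c j * \<phi> (g j)) &
  (\<forall>bs\<in>lists Basis. iterated_partial bs (%y. \<Sum>j\<in>J. c j * g j y) = (%y. \<Sum>j\<in>J. c j * iterated_partial bs (g j) y))"
 using fin
proof induction
 case empty
 have "(%y. 0 * g undefined y) \<in> schwartz" by (rule schwartz_cmult[OF g])
 moreover have "\<phi> (%y. 0 * g undefined y) = 0 * \<phi> (g undefined)" by (rule tempered_distribution_cmult[OF \<phi> g])
 moreover have "iterated_partial bs (%y. 0 * g undefined y) = (%y. 0 * iterated_partial bs (g undefined) y)"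
  if "bs \<in> lists Basis" for bs by (rule iterated_partial_cmult[OF g that])
 ultimately show ?case by simp
next
 case (insert j J)
 let ?S = "%y. \<Sum>j\<in>J. c j * g j y"
 have S: "?S \<in> schwartz" "\<phi> ?S = (\<Sum>j\<in>J. c j * \<phi> (g j))"
  "!!bs. bs \<in> lists Basis ==> iterated_partial bs ?S = (%y. \<Sum>j\<in>J. c j * iterated_partial bs (g j) y)"
  using insert.IH by auto
 have eq: "(%y. \<Sum>j\<in>insert j J. c j * g j y) = (%y. c j * g j y + ?S y)"
  using insert.hyps by simp
 have cg: "(%y. c j * g j y) \<in> schwartz" by (rule schwartz_cmult[OF g])
 show ?case unfolding eq
 proof (intro conjI ballI)
  show "(%y. c j * g j y + ?S y) \<in> schwartz" by (rule schwartz_add[OF cg S(1)])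
  show "\<phi> (%y. c j * g j y + ?S y) = (\<Sum>j\<in>insert j J. c j * \<phi> (g j))"
   using tempered_distribution_add[OF \<phi> cg S(1)] tempered_distribution_cmult[OF \<phi> g, of "c j" j] S(2) insert.hyps by simp
  show "iterated_partial bs (%y. c j * g j y + ?S y) = (%y. \<Sum>j\<in>insert j J. c j * iterated_partial bs (g j) y)"
   if bs: "bs \<in> lists Basis" for bs
   unfolding iterated_partial_add[OF cg S(1) bs] iterated_partial_cmult[OF g bs] S(3)[OF bs] using insert.hyps by simp
 qed
qed

text \<open>Only finitely many lists of basis vectors have length at most \<open>M'\<close>, so the
  supremum in the seminorm is over a bounded set and really is an upper bound.\<close>

lemma schwartz_seminorm_upper:
 fixes f :: "'a::euclidean_space => complex"
 assumes f: "f \<in> schwartz" and M: "M <= M'" and bs: "bs \<in> lists Basis" "length bs <= M"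
 shows "(1 + norm x) ^ M * norm (iterated_partial bs f x) <= schwartz_seminorm M' f" "0 <= schwartz_seminorm M' f"
proof -
 let ?S = "{bs \<in> lists (Basis :: 'a set). length bs <= M'}"
 have fin: "finite ?S" using finite_lists_length_le[OF finite_Basis, of M'] by (simp add: lists_eq_set conj_commute Collect_conj_eq Int_commute)
 have "\<forall>bs\<in>?S. \<exists>B. 0 <= B & (\<forall>x. (1 + norm x) ^ M' * norm (iterated_partial bs f x) <= B)"
 proof
  fix bs assume "bs \<in> ?S"
  then have "bounded (range (%x. (1 + norm x) ^ M' * norm (iterated_partial bs f x)))" using schwartzD(2)[OF f] by simp
  then obtain B where *: "\<forall>x. norm ((1 + norm x) ^ M' * norm (iterated_partial bs f x)) <= B" unfolding bounded_iff by blast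
  then have "(1 + norm x) ^ M' * norm (iterated_partial bs f x) <= \<bar>B\<bar>" for x
  proof -
   have "norm ((1 + norm x) ^ M' * norm (iterated_partial bs f x)) <= B" using * by blast
   then show ?thesis using abs_ge_self[of B] by (simp add: abs_mult)
  qed
  then show "\<exists>B. 0 <= B & (\<forall>x. (1 + norm x) ^ M' * norm (iterated_partial bs f x) <= B)" by (intro exI[of _ "\<bar>B\<bar>"]) simp
 qed
 from bchoice[OF this] obtain Bf where Bf: "!!bs. bs \<in> ?S ==> 0 <= Bf bs" "!!bs x. bs \<in> ?S ==> (1 + norm x) ^ M' * norm (iterated_partial bs f x) <= Bf bs"
  by blast
 let ?f = "%(bs, x). (1 + norm x) ^ M' * norm (iterated_partial bs f x)"
 have "?f z <= sum Bf ?S" if "z \<in> ?S \<times> UNIV" for z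
 proof -
  obtain bs x where "z = (bs, x)" by (cases z)
  then have z: "z = (bs, x)" "bs \<in> ?S" using that by auto
  have "?f z <= Bf bs" using Bf(2)[OF z(2)] by (simp add: z)
  also have "... <= sum Bf ?S" using fin z Bf(1) by (intro member_le_sum) auto
  finally show ?thesis .
 qed
 then have bdd: "bdd_above (?f ` (?S \<times> UNIV))" unfolding bdd_above_def by blast
 have "(1 + norm x) ^ M * norm (iterated_partial bs f x) <= (1 + norm x) ^ M' * norm (iterated_partial bs f x)"
  using M by (intro mult_right_mono power_increasing) auto
 also have "... <= schwartz_seminorm M' f"
  unfolding schwartz_seminorm_def using cSUP_upper[OF _ bdd, of "(bs, x)"] bs M by auto
 finally show "(1 + norm x) ^ M * norm (iterated_partial bs f x) <= schwartz_seminorm M' f" .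
 then show "0 <= schwartz_seminorm M' f" by (rule order_trans[rotated]) auto
qed

lemma tempered_distribution_diff:
 fixes \<phi> \<psi> :: "('a::euclidean_space => complex) => complex"
 assumes \<phi>: "tempered_distribution \<phi>" and \<psi>: "tempered_distribution \<psi>"
 shows "tempered_distribution (%f. \<phi> f - \<psi> f)"
proof -
 obtain N C where C: "!!f. f \<in> schwartz ==> norm (\<phi> f) <= C * schwartz_seminorm N f"
  using \<phi> unfolding tempered_distribution_def by blast
 obtain N' C' where C': "!!f. f \<in> schwartz ==> norm (\<psi> f) <= C' * schwartz_seminorm N' f"
  using \<psi> unfolding tempered_distribution_def by blast
 have "norm (\<phi> f - \<psi> f) <= (\<bar>C\<bar> + \<bar>C'\<bar>) * schwartz_seminorm (max N N') f" if f: "f \<in> schwartz" for f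
 proof -
  let ?P = "schwartz_seminorm (max N N') f"
  have le: "\<bar>C0\<bar> * ?P \<ge> C0 * schwartz_seminorm M f" if "M <= max N N'" for C0 M
  proof -
   note S = schwartz_seminorm_le[of M f ?P, OF schwartz_seminorm_upper(1)[OF f that]]
   have "C0 * schwartz_seminorm M f <= \<bar>C0\<bar> * schwartz_seminorm M f" using S(1) by (intro mult_right_mono) auto
   also have "... <= \<bar>C0\<bar> * ?P" using S(2) by (intro mult_left_mono) auto
   finally show ?thesis .
  qed
  have "norm (\<phi> f - \<psi> f) <= norm (\<phi> f) + norm (\<psi> f)" by (rule norm_triangle_ineq4)
  also have "... <= \<bar>C\<bar> * ?P + \<bar>C'\<bar> * ?P"
   using C[OF f] C'[OF f] le[of N C] le[of N' C'] by simp
  finally show ?thesis by (simp add: distrib_right)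
 qed
 then have "\<exists>N C. \<forall>f\<in>schwartz. norm (\<phi> f - \<psi> f) <= C * schwartz_seminorm N f" by blast
 then show ?thesis using \<phi> \<psi> unfolding tempered_distribution_def by (auto simp: algebra_simps)
qed

section \<open>The semigroup property on tempered distributions\<close>

lemma nn_integral_heat_kernel_convolution:
 fixes x y :: "'a::euclidean_space"
 assumes s: "0 < s" and t: "0 < t"
 shows "(NN z. ennreal (hk s (x - z) * hk t (z - y))) = ennreal (hk (s + t) (x - y))"
proof -
 let ?n = "%s. normal_density 0 (sqrt (2 * s))"
 have "(NN z. ennreal (hk s (x - z) * hk t (z - y)))
   = (NN z. (\<Prod>b\<in>Basis. ennreal (?n s (x \<bullet> b - z \<bullet> b) * ?n t (z \<bullet> b - y \<bullet> b))))"
  using s t by (simp add: heat_kernel_eq_prod prod.distrib[symmetric] prod_ennreal inner_diff_left)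
 also have "... = (\<Prod>b\<in>(Basis::'a set). (\<integral>\<^sup>+\<zeta>. ennreal (?n s (x \<bullet> b - \<zeta>) * ?n t (\<zeta> - y \<bullet> b)) \<partial>lborel))"
  by (rule nn_integral_lborel_prod) auto
 also have "... = (\<Prod>b\<in>(Basis::'a set). ennreal (?n (s + t) (x \<bullet> b - y \<bullet> b)))"
 proof (rule prod.cong[OF refl])
  fix b :: 'a
  have "(\<integral>\<^sup>+\<zeta>. ennreal (?n s (x \<bullet> b - \<zeta>) * ?n t (\<zeta> - y \<bullet> b)) \<partial>lborel)
    = (\<integral>\<^sup>+\<zeta>. ennreal (?n s (x \<bullet> b - (\<zeta> + y \<bullet> b)) * ?n t (\<zeta> + y \<bullet> b - y \<bullet> b)) \<partial>lborel)"
   by (rule nn_integral_lborel_translate[symmetric]) measurable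
  also have "... = (\<integral>\<^sup>+\<zeta>. ennreal (?n s ((x \<bullet> b - y \<bullet> b) - \<zeta>) * ?n t \<zeta>) \<partial>lborel)"
   by (simp add: diff_diff_eq add.commute)
  also have "... = ennreal (normal_density 0 (sqrt ((sqrt (2 * s))\<^sup>2 + (sqrt (2 * t))\<^sup>2)) (x \<bullet> b - y \<bullet> b))"
   using fun_cong[OF conv_normal_density_zero_mean[of "sqrt (2 * s)" "sqrt (2 * t)"], of "x \<bullet> b - y \<bullet> b"] s t by simp
  also have "(sqrt (2 * s))\<^sup>2 + (sqrt (2 * t))\<^sup>2 = 2 * (s + t)" using s t by simp
  finally show "(\<integral>\<^sup>+\<zeta>. ennreal (?n s (x \<bullet> b - \<zeta>) * ?n t (\<zeta> - y \<bullet> b)) \<partial>lborel) = ennreal (?n (s + t) (x \<bullet> b - y \<bullet> b))" .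
 qed
 also have "... = ennreal (hk (s + t) (x - y))"
  using s t by (simp add: heat_kernel_eq_prod prod_ennreal inner_diff_left)
 finally show ?thesis .
qed

lemma integrable_heat_kernel:
 fixes x :: "'a::euclidean_space"
 assumes "0 < s"
 shows "integrable lborel (%z. hk s (x - z))"
 using nn_integral_heat_kernel_diff(1)[OF assms, of x] by (intro integrableI_bounded) auto

lemma integrable_heat_kernel_poly:
 fixes x :: "'a::euclidean_space"
 assumes s: "0 < s"
 shows "integrable lborel (%z. hk s (x - z) * (1 + norm z) ^ M)"
proof -
 obtain c where c: "0 < c" "!!z::'a. (1 + norm z) powr real M * hk s z <= c * hk (2 * s) z"
  by (rule weighted_heat_kernel_le[OF of_nat_0_le_iff s]) blast
 show ?thesis
 proof (rule Bochner_Integration.integrable_bound)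
  show "integrable lborel (%z. (1 + norm x) ^ M * (c * hk (2 * s) (x - z)))"
   using s by (intro integrable_mult_right integrable_heat_kernel) simp
  show "AE z in lborel. norm (hk s (x - z) * (1 + norm z) ^ M) <= norm ((1 + norm x) ^ M * (c * hk (2 * s) (x - z)))"
  proof (rule AE_I2)
   fix z
   have "(1 + norm z) ^ M <= ((1 + norm x) * (1 + norm (x - z))) ^ M"
    using one_plus_norm_mult[of z x] by (intro power_mono) (auto simp: norm_minus_commute)
   then have "hk s (x - z) * (1 + norm z) ^ M <= hk s (x - z) * ((1 + norm x) * (1 + norm (x - z))) ^ M"
    by (intro mult_left_mono) auto
   also have "... = (1 + norm x) ^ M * ((1 + norm (x - z)) powr real M * hk s (x - z))"
   proof -
    have pr: "(1 + norm (x - z)) powr real M = (1 + norm (x - z)) ^ M"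
     by (rule powr_realpow) (simp add: add_pos_nonneg)
    show ?thesis unfolding pr power_mult_distrib by (simp only: mult_ac)
   qed
   also have "... <= (1 + norm x) ^ M * (c * hk (2 * s) (x - z))"
    by (intro mult_left_mono c) auto
   finally show "norm (hk s (x - z) * (1 + norm z) ^ M) <= norm ((1 + norm x) ^ M * (c * hk (2 * s) (x - z)))"
    using c(1) by simp
  qed
 qed measurable
qed

lemma continuous_kernel_partial:
 assumes t: "0 < t"
 shows "continuous_on UNIV (kernel_partial t bs)"
proof (rule continuous_at_imp_continuous_on, rule ballI)
 fix z
 obtain D where "(kernel_partial t bs has_derivative D) (at z)" using kernel_partial_has_derivative[OF t] by blast
 then show "isCont (kernel_partial t bs) z" by (rule has_derivative_continuous)
qed

lemma borel_measurable_kernel_partial: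
 assumes "0 < t" "f \<in> borel_measurable M"
 shows "(%x. kernel_partial t bs (f x)) \<in> borel_measurable M"
 by (rule borel_measurable_continuous_on[OF continuous_kernel_partial[OF assms(1)] assms(2)])

lemma kernel_partial_difference_quotient:
 assumes t: "0 < t"
 shows "(%n. (kernel_partial t bs (v - inverse (real (Suc n)) *\<^sub>R b) - kernel_partial t bs v) / inverse (real (Suc n)))
      \<longlonglongrightarrow> kernel_partial t (b # bs) v"
proof -
 obtain D where D: "(kernel_partial t bs has_derivative D) (at v)" "!!b. D b = - kernel_partial t (b # bs) v"
  using kernel_partial_has_derivative[OF t] by blast
 have "((%r. v - r *\<^sub>R b) has_derivative (%h. - (h *\<^sub>R b))) (at 0)"
  by (auto intro!: derivative_eq_intros)
 then have "((%r. kernel_partial t bs (v - r *\<^sub>R b)) has_derivative (%h. D (- (h *\<^sub>R b)))) (at (0::real))"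
  by (rule has_derivative_compose) (simp add: D(1))
 moreover have "D (- (h *\<^sub>R b)) = kernel_partial t (b # bs) v * h" for h
  using has_derivative_linear[OF D(1)] D(2)[of b] by (simp add: linear_neg linear_scale)
 ultimately have "DERIV (%r. kernel_partial t bs (v - r *\<^sub>R b)) 0 :> kernel_partial t (b # bs) v"
  by (simp add: has_field_derivative_def)
 then have "((%h. (kernel_partial t bs (v - h *\<^sub>R b) - kernel_partial t bs v) / h) \<longlongrightarrow> kernel_partial t (b # bs) v) (at 0)"
  by (auto dest: DERIV_D)
 moreover have "filterlim (%n. inverse (real (Suc n))) (at 0) sequentially"
  unfolding filterlim_at using LIMSEQ_inverse_real_of_nat by simp
 ultimately show ?thesis by (rule filterlim_compose)
qed

text \<open>A further derivative is a limit of difference quotients in \<open>y\<close>; the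
  Lipschitz bound dominates them, so the convolution identity passes from \<open>bs\<close> to
  \<open>b # bs\<close>.\<close>

lemma kernel_partial_convolution:
 fixes x y :: "'a::euclidean_space"
 assumes s: "0 < s" and t: "0 < t"
 shows "integrable lborel (%z. hk s (x - z) * kernel_partial t bs (z - y))"
  and "(LINT z|lborel. hk s (x - z) * kernel_partial t bs (z - y)) = kernel_partial (s + t) bs (x - y)"
proof -
 have m [measurable]: "(%z. kernel_partial t bs (z - y)) \<in> Bmeas" for bs and y :: 'a
  by (intro borel_measurable_kernel_partial t) measurable
 show int: "integrable lborel (%z. hk s (x - z) * kernel_partial t bs (z - y))" for bs y
 proof -
  obtain C where C: "0 < C" "!!z. (1 + norm z) ^ 0 * \<bar>kernel_partial t bs z\<bar> <= C"
   using kernel_partial_decay[OF t] by blast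
  show ?thesis
  proof (rule Bochner_Integration.integrable_bound)
   show "integrable lborel (%z. hk s (x - z) * C)" by (intro integrable_mult_left integrable_heat_kernel s)
   show "AE z in lborel. norm (hk s (x - z) * kernel_partial t bs (z - y)) <= norm (hk s (x - z) * C)"
    using C by (intro AE_I2) (auto simp: abs_mult intro!: mult_left_mono)
  qed measurable
 qed
 show "(LINT z|lborel. hk s (x - z) * kernel_partial t bs (z - y)) = kernel_partial (s + t) bs (x - y)"
 proof (induction bs arbitrary: y)
  case Nil
  have "(LINT z|lborel. hk s (x - z) * hk t (z - y)) = hk (s + t) (x - y)"
   using nn_integral_heat_kernel_convolution[OF s t, of x y]
   by (subst integral_eq_nn_integral) auto
  then show ?case by (simp add: kernel_partial_Nil)
 next
  case (Cons b bs)
  define h where "h n = inverse (real (Suc n))" for n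
  have h: "0 < h n" for n by (simp add: h_def)
  obtain C where C: "0 < C" "!!v w. (1 + norm v) ^ 0 * \<bar>kernel_partial t bs v - kernel_partial t bs w\<bar> <= C * ((1 + norm (v - w)) ^ 0 * norm (v - w))"
   using kernel_partial_lipschitz[OF t] by blast
  let ?q = "%n z. hk s (x - z) * ((kernel_partial t bs (z - (y + h n *\<^sub>R b)) - kernel_partial t bs (z - y)) / h n)"
  have lim1: "(%n. LINT z|lborel. ?q n z) \<longlonglongrightarrow> (LINT z|lborel. hk s (x - z) * kernel_partial t (b # bs) (z - y))"
  proof (rule integral_dominated_convergence[where w = "%z. hk s (x - z) * (C * norm b)"])
   show "integrable lborel (%z. hk s (x - z) * (C * norm b))" by (intro integrable_mult_left integrable_heat_kernel s)
   show "AE z in lborel. (%n. ?q n z) \<longlonglongrightarrow> hk s (x - z) * kernel_partial t (b # bs) (z - y)"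
    using kernel_partial_difference_quotient[OF t, of bs _ b]
    by (intro AE_I2 tendsto_mult tendsto_const) (simp add: h_def diff_diff_eq[symmetric])
   show "AE z in lborel. norm (?q n z) <= hk s (x - z) * (C * norm b)" for n
   proof (rule AE_I2)
    fix z
    have "\<bar>kernel_partial t bs (z - (y + h n *\<^sub>R b)) - kernel_partial t bs (z - y)\<bar> <= C * (h n * norm b)"
     using C(2)[of "z - (y + h n *\<^sub>R b)" "z - y"] h[of n] by simp
    then have "\<bar>kernel_partial t bs (z - (y + h n *\<^sub>R b)) - kernel_partial t bs (z - y)\<bar> / h n <= C * norm b"
     using h[of n] by (simp add: field_simps)
    then have "hk s (x - z) * (\<bar>kernel_partial t bs (z - (y + h n *\<^sub>R b)) - kernel_partial t bs (z - y)\<bar> / h n)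
      <= hk s (x - z) * (C * norm b)" by (rule mult_left_mono) simp
    then show "norm (?q n z) <= hk s (x - z) * (C * norm b)"
     using h[of n] by (simp add: abs_mult)
   qed
  qed measurable
  have eq: "(LINT z|lborel. ?q n z) = (kernel_partial (s + t) bs ((x - y) - h n *\<^sub>R b) - kernel_partial (s + t) bs (x - y)) / h n" for n
  proof -
   have "(LINT z|lborel. ?q n z) = (LINT z|lborel. (hk s (x - z) * kernel_partial t bs (z - (y + h n *\<^sub>R b))
      - hk s (x - z) * kernel_partial t bs (z - y)) / h n)"
    by (simp add: right_diff_distrib)
   also have "... = (kernel_partial (s + t) bs (x - (y + h n *\<^sub>R b)) - kernel_partial (s + t) bs (x - y)) / h n"
    using int by (simp add: Cons.IH)
   finally show ?thesis by (simp add: diff_diff_eq)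
  qed
  have lim2: "(%n. (kernel_partial (s + t) bs ((x - y) - h n *\<^sub>R b) - kernel_partial (s + t) bs (x - y)) / h n)
    \<longlonglongrightarrow> kernel_partial (s + t) (b # bs) (x - y)"
   unfolding h_def using s t by (intro kernel_partial_difference_quotient) simp
  show ?case by (rule LIMSEQ_unique[OF lim1[unfolded eq] lim2])
 qed
qed

text \<open>Finitely many \<open>bs\<close> are involved, so the constants of the single derivatives
  can be summed; the weight in \<open>y\<close> is traded for one in \<open>z\<close>.\<close>

lemma kernel_partial_uniform:
 assumes t: "0 < t"
 obtains C where "0 < C"
  "!!(bs :: 'a::euclidean_space list) y z. [|bs \<in> lists Basis; length bs <= N|] ==>
    (1 + norm y) ^ N * \<bar>kernel_partial t bs (z - y)\<bar> <= C * (1 + norm z) ^ N"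
  "!!(bs :: 'a list) y z w. [|bs \<in> lists Basis; length bs <= N|] ==>
    (1 + norm y) ^ N * \<bar>kernel_partial t bs (z - y) - kernel_partial t bs (w - y)\<bar>
     <= C * ((1 + norm z) ^ N * ((1 + norm (z - w)) ^ N * norm (z - w)))"
proof -
 let ?S = "{bs \<in> lists (Basis :: 'a set). length bs <= N}"
 have fin: "finite ?S" using finite_lists_length_le[OF finite_Basis, of N] by (simp add: lists_eq_set conj_commute Collect_conj_eq Int_commute)
 have "\<forall>bs::'a list. \<exists>C. 0 < C & (\<forall>z. (1 + norm z) ^ N * \<bar>kernel_partial t bs z\<bar> <= C)"
  using kernel_partial_decay[OF t] by blast
 from choice[OF this] obtain A where A: "!!bs::'a list. 0 < A bs" "!!(bs::'a list) z. (1 + norm z) ^ N * \<bar>kernel_partial t bs z\<bar> <= A bs" by blast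
 have "\<forall>bs::'a list. \<exists>C. 0 < C & (\<forall>v w. (1 + norm v) ^ N * \<bar>kernel_partial t bs v - kernel_partial t bs w\<bar> <= C * ((1 + norm (v - w)) ^ N * norm (v - w)))"
  using kernel_partial_lipschitz[OF t] by blast
 from choice[OF this] obtain L where L: "!!bs::'a list. 0 < L bs"
  "!!(bs::'a list) v w. (1 + norm v) ^ N * \<bar>kernel_partial t bs v - kernel_partial t bs w\<bar> <= L bs * ((1 + norm (v - w)) ^ N * norm (v - w))" by blast
 define C where "C = (\<Sum>bs\<in>?S. A bs + L bs)"
 have C: "A bs <= C" "L bs <= C" if "bs \<in> ?S" for bs
 proof -
  have "A bs + L bs <= C" unfolding C_def using A(1) L(1) that fin by (intro member_le_sum) (auto intro: less_imp_le add_pos_pos)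
  then show "A bs <= C" "L bs <= C" using A(1)[of bs] L(1)[of bs] by linarith+
 qed
 have Cp: "0 < C" using C(1)[of "[]"] A(1)[of "[]"] by simp
 have w: "(1 + norm y) ^ N <= (1 + norm z) ^ N * (1 + norm (z - y)) ^ N" for y z :: 'a
 proof -
  have "(1 + norm y) ^ N <= ((1 + norm z) * (1 + norm (z - y))) ^ N"
   using one_plus_norm_mult[of y z] by (intro power_mono) (auto simp: norm_minus_commute)
  then show ?thesis by (simp add: power_mult_distrib)
 qed
 show thesis
 proof (rule that[OF Cp])
  fix bs :: "'a list" and y z w' :: 'a assume "bs \<in> lists Basis" "length bs <= N"
  then have bs: "bs \<in> ?S" by simp
  have "(1 + norm y) ^ N * \<bar>kernel_partial t bs (z - y)\<bar> <= (1 + norm z) ^ N * (1 + norm (z - y)) ^ N * \<bar>kernel_partial t bs (z - y)\<bar>"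
   by (intro mult_right_mono w) auto
  also have "... = (1 + norm z) ^ N * ((1 + norm (z - y)) ^ N * \<bar>kernel_partial t bs (z - y)\<bar>)" by (simp only: mult.assoc)
  also have "... <= (1 + norm z) ^ N * C" using C(1)[OF bs] A(2)[of "z - y" bs] by (intro mult_left_mono) auto
  finally show "(1 + norm y) ^ N * \<bar>kernel_partial t bs (z - y)\<bar> <= C * (1 + norm z) ^ N" by (simp only: mult.commute)
  have "(1 + norm y) ^ N * \<bar>kernel_partial t bs (z - y) - kernel_partial t bs (w' - y)\<bar>
    <= (1 + norm z) ^ N * (1 + norm (z - y)) ^ N * \<bar>kernel_partial t bs (z - y) - kernel_partial t bs (w' - y)\<bar>"
   by (intro mult_right_mono w) auto
  also have "... = (1 + norm z) ^ N * ((1 + norm (z - y)) ^ N * \<bar>kernel_partial t bs (z - y) - kernel_partial t bs (w' - y)\<bar>)"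
   by (simp only: mult.assoc)
  also have "... <= (1 + norm z) ^ N * (L bs * ((1 + norm (z - w')) ^ N * norm (z - w')))"
   using L(2)[of "z - y" bs "w' - y"] by (intro mult_left_mono) auto
  also have "... <= (1 + norm z) ^ N * (C * ((1 + norm (z - w')) ^ N * norm (z - w')))"
   using C(2)[OF bs] by (intro mult_left_mono mult_right_mono) auto
  finally show "(1 + norm y) ^ N * \<bar>kernel_partial t bs (z - y) - kernel_partial t bs (w' - y)\<bar>
     <= C * ((1 + norm z) ^ N * ((1 + norm (z - w')) ^ N * norm (z - w')))"
   by (simp only: mult_ac)
 qed
qed

text \<open>In every Schwartz seminorm the translated kernels grow polynomially and depend
  continuously on the translation; both properties pass to \<open>heat t \<phi>\<close> by the
  continuity of \<open>\<phi>\<close>.\<close>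

lemma heat_continuous_growth:
 fixes \<phi> :: "('a::euclidean_space => complex) => complex"
 assumes \<phi>: "tempered_distribution \<phi>" and t: "0 < t"
 shows "continuous_on UNIV (heat t \<phi>)" and "\<exists>C N. \<forall>z. norm (heat t \<phi> z) <= C * (1 + norm z) ^ N"
proof -
 obtain N C where C: "0 < C"
  "!!f B. [|f \<in> schwartz; !!bs x. [|bs \<in> lists Basis; length bs <= N|] ==> (1 + norm x) ^ N * norm (iterated_partial bs f x) <= B|]
    ==> norm (\<phi> f) <= C * B"
  by (rule tempered_distribution_bound[OF \<phi>]) blast
 obtain C' where C': "0 < C'"
  "!!(bs :: 'a list) y z. [|bs \<in> lists Basis; length bs <= N|] ==>
    (1 + norm y) ^ N * \<bar>kernel_partial t bs (z - y)\<bar> <= C' * (1 + norm z) ^ N"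
  "!!(bs :: 'a list) y z w. [|bs \<in> lists Basis; length bs <= N|] ==>
    (1 + norm y) ^ N * \<bar>kernel_partial t bs (z - y) - kernel_partial t bs (w - y)\<bar>
     <= C' * ((1 + norm z) ^ N * ((1 + norm (z - w)) ^ N * norm (z - w)))"
  by (rule kernel_partial_uniform[OF t, of N, where 'a='a]) blast
 note S = heat_kernel_schwartz[OF t]
 have "norm (heat t \<phi> z) <= C * (C' * (1 + norm z) ^ N)" for z
  unfolding heat_def by (rule C(2)[OF S]) (use C'(2) in \<open>simp add: iterated_partial_heat_kernel(1)[OF t]\<close>)
 then have "norm (heat t \<phi> z) <= C * C' * (1 + norm z) ^ N" for z by (simp add: mult.assoc)
 then show "\<exists>C N. \<forall>z. norm (heat t \<phi> z) <= C * (1 + norm z) ^ N" by blast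
 have diff: "norm (heat t \<phi> z - heat t \<phi> w) <= C * (C' * ((1 + norm z) ^ N * ((1 + norm (z - w)) ^ N * norm (z - w))))" for z w
 proof -
  let ?g = "%v y. complex_of_real (hk t (v - y))"
  have S': "(%y. (- 1) * ?g w y) \<in> schwartz" by (rule schwartz_cmult[OF S])
  have "heat t \<phi> z - heat t \<phi> w = \<phi> (%y. ?g z y + (- 1) * ?g w y)"
   using tempered_distribution_add[OF \<phi> S S'] tempered_distribution_cmult[OF \<phi> S, of "- 1" w] by (simp add: heat_def)
  also have "norm ... <= C * (C' * ((1 + norm z) ^ N * ((1 + norm (z - w)) ^ N * norm (z - w))))"
  proof (rule C(2)[OF schwartz_add[OF S S']])
   fix bs :: "'a list" and y :: 'a assume bs: "bs \<in> lists Basis" "length bs <= N"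
   have "iterated_partial bs (%y. ?g z y + (- 1) * ?g w y) y = of_real (kernel_partial t bs (z - y) - kernel_partial t bs (w - y))"
    unfolding iterated_partial_add[OF S S' bs(1)] iterated_partial_cmult[OF S bs(1)] iterated_partial_heat_kernel(1)[OF t] by simp
   then show "(1 + norm y) ^ N * norm (iterated_partial bs (%y. ?g z y + (- 1) * ?g w y) y)
     <= C' * ((1 + norm z) ^ N * ((1 + norm (z - w)) ^ N * norm (z - w)))"
    using C'(3)[OF bs, of y z w] by (simp only: norm_of_real)
  qed
  finally show ?thesis .
 qed
 show "continuous_on UNIV (heat t \<phi>)"
 proof (rule continuous_at_imp_continuous_on, rule ballI)
  fix z :: 'a
  have lim0: "((%w. C * (C' * ((1 + norm z) ^ N * ((1 + norm (z - w)) ^ N * norm (z - w))))) \<longlongrightarrow>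
    C * (C' * ((1 + norm z) ^ N * ((1 + norm (z - z)) ^ N * norm (z - z))))) (at z)"
   by (intro tendsto_intros)
  have "((%w. heat t \<phi> z - heat t \<phi> w) \<longlongrightarrow> 0) (at z)"
   by (rule Lim_null_comparison[OF _ lim0[simplified]]) (use diff in \<open>auto intro!: always_eventually\<close>)
  then have "((%w. heat t \<phi> z - (heat t \<phi> z - heat t \<phi> w)) \<longlongrightarrow> heat t \<phi> z - 0) (at z)" by (intro tendsto_intros)
  then show "isCont (heat t \<phi>) z" by (simp add: isCont_def)
 qed
qed

text \<open>A distribution commutes with finite sums by linearity, with integrals only after an
  argument. The convolution of the two kernels is therefore replaced by finite sums over the values
  of simple functions, which converge to the kernel at time \<open>s + t\<close> in the seminorm
  controlling \<open>\<phi>\<close>.\<close>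

lemma heat_semigroup_le:
 fixes \<phi> :: "('a::euclidean_space => complex) => complex"
 assumes \<phi>: "tempered_distribution \<phi>" and s: "0 < s" and t: "0 < t"
 shows "ennreal (norm (heat (s + t) \<phi> x)) <= (NN z. ennreal (hk s (x - z) * norm (heat t \<phi> z)))"
proof -
 define F where "F z = heat t \<phi> z" for z
 have Fc: "continuous_on UNIV F" using heat_continuous_growth(1)[OF \<phi> t] by (simp add: F_def[abs_def])
 have Fm [measurable]: "F \<in> Bmeas" using Fc by (rule borel_measurable_continuous_onI)
 obtain CF NF where F: "!!z. norm (F z) <= CF * (1 + norm z) ^ NF"
  using heat_continuous_growth(2)[OF \<phi> t] unfolding F_def by blast
 have CF: "0 <= CF" using F[of 0] by (simp add: order_trans[OF norm_ge_zero])
 obtain N C where C: "0 < C"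
  "!!f B. [|f \<in> schwartz; !!bs x. [|bs \<in> lists Basis; length bs <= N|] ==> (1 + norm x) ^ N * norm (iterated_partial bs f x) <= B|]
    ==> norm (\<phi> f) <= C * B"
  by (rule tempered_distribution_bound[OF \<phi>]) blast
 obtain C' where C': "0 < C'"
  "!!(bs :: 'a list) y z. [|bs \<in> lists Basis; length bs <= N|] ==>
    (1 + norm y) ^ N * \<bar>kernel_partial t bs (z - y)\<bar> <= C' * (1 + norm z) ^ N"
  "!!(bs :: 'a list) y z w. [|bs \<in> lists Basis; length bs <= N|] ==>
    (1 + norm y) ^ N * \<bar>kernel_partial t bs (z - y) - kernel_partial t bs (w - y)\<bar>
     <= C' * ((1 + norm z) ^ N * ((1 + norm (z - w)) ^ N * norm (z - w)))"
  by (rule kernel_partial_uniform[OF t, of N, where 'a='a]) blast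
 \<comment> \<open>Simple functions converging to the identity; \<open>m i v\<close> below is the
   Gaussian mass of the cell where \<open>r i\<close> takes the value \<open>v\<close>.\<close>
 obtain r :: "nat => 'a => 'a" where r: "!!i. simple_function lborel (r i)" "!!z. (%i. r i z) \<longlonglongrightarrow> z"
  "!!i z. norm (r i z) <= 2 * norm z"
  using borel_measurable_implies_sequence_metric[of "%x::'a. x" lborel 0] by (auto simp: dist_norm)
 have rm [measurable]: "r i \<in> Bmeas" for i
  using borel_measurable_simple_function[OF r(1)] by simp
 have fin: "finite (range (r i))" for i using r(1)[of i] by (simp add: simple_function_def)
 let ?G = "%z. hk s (x - z)"
 define m where "m i v = (LINT z|lborel. ?G z * indicator {z. r i z = v} z)" for i v
 have m0: "0 <= m i v" for i v unfolding m_def by (intro integral_nonneg_AE AE_I2) auto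
 have rset [measurable]: "{z. r i z = v} \<in> sets borel" for i v
  using measurable_sets[OF rm, of "{v}" i] by (simp add: vimage_def)
 have Gi: "integrable lborel (%z. ?G z * indicator {z. r i z = v} z)" for i v
  using rset[of i v] by (intro integrable_real_mult_indicator integrable_heat_kernel s) simp
 have simple: "integrable lborel (%z. ?G z * g (r i z)) & (LINT z|lborel. ?G z * g (r i z)) = (\<Sum>v\<in>range (r i). m i v * g v)"
  for g :: "'a => real" and i
 proof -
  have eq: "(%z. ?G z * g (r i z)) = (%z. \<Sum>v\<in>range (r i). ?G z * indicator {z. r i z = v} z * g v)"
  proof
   fix z
   have "(\<Sum>v\<in>range (r i). ?G z * indicator {z. r i z = v} z * g v) = (\<Sum>v\<in>range (r i). if v = r i z then ?G z * g v else 0)"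
    by (intro sum.cong) (auto simp: indicator_def)
   also have "... = ?G z * g (r i z)" using fin[of i] by simp
   finally show "?G z * g (r i z) = (\<Sum>v\<in>range (r i). ?G z * indicator {z. r i z = v} z * g v)" ..
  qed
  show ?thesis unfolding eq m_def using Gi by (simp add: Bochner_Integration.integral_sum)
 qed
 \<comment> \<open>A majorant of the seminorm distance between the kernel at time
   \<open>s + t\<close> and its finite sum. As \<open>z - r i z\<close> has norm at most
   \<open>3 * norm z\<close>, one polynomial times the Gaussian dominates the integrands for all
   \<open>i\<close>.\<close>
 define \<epsilon> where "\<epsilon> i = (LINT z|lborel. ?G z * (C' * ((1 + norm z) ^ N * ((1 + norm (z - r i z)) ^ N * norm (z - r i z)))))" for i
 let ?w = "%z. C' * 3 * 3 ^ N * (?G z * (1 + norm z) ^ (N + N + 1))"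
 have wi: "integrable lborel ?w" by (intro integrable_mult_right integrable_heat_kernel_poly s)
 have wb: "?G z * (C' * ((1 + norm z) ^ N * ((1 + norm (z - r i z)) ^ N * norm (z - r i z)))) <= ?w z" for i z
 proof -
  have n3: "norm (z - r i z) <= 3 * norm z" using norm_triangle_ineq4[of z "r i z"] r(3)[of i z] by simp
  have "(1 + norm (z - r i z)) ^ N * norm (z - r i z) <= (3 * (1 + norm z)) ^ N * (3 * (1 + norm z))"
   using n3 by (intro mult_mono power_mono) auto
  then have "?G z * (C' * ((1 + norm z) ^ N * ((1 + norm (z - r i z)) ^ N * norm (z - r i z))))
    <= ?G z * (C' * ((1 + norm z) ^ N * ((3 * (1 + norm z)) ^ N * (3 * (1 + norm z)))))"
   using C'(1) by (intro mult_left_mono) auto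
  also have "... = ?w z" unfolding power_mult_distrib by (simp only: power_add power_one_right mult_ac)
  finally show ?thesis .
 qed
 have ei: "integrable lborel (%z. ?G z * (C' * ((1 + norm z) ^ N * ((1 + norm (z - r i z)) ^ N * norm (z - r i z)))))" for i
  by (rule Bochner_Integration.integrable_bound[OF wi]) (use wb C'(1) in \<open>auto intro!: AE_I2 simp: abs_mult\<close>)
 have \<epsilon>0: "\<epsilon> \<longlonglongrightarrow> 0"
 proof -
  have "\<epsilon> \<longlonglongrightarrow> (LINT z|lborel. ?G z * (C' * ((1 + norm z) ^ N * ((1 + norm (z - z)) ^ N * norm (z - z)))))"
   unfolding \<epsilon>_def
  proof (rule integral_dominated_convergence[OF _ _ wi])
   show "AE z in lborel. (%i. ?G z * (C' * ((1 + norm z) ^ N * ((1 + norm (z - r i z)) ^ N * norm (z - r i z)))))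
     \<longlonglongrightarrow> ?G z * (C' * ((1 + norm z) ^ N * ((1 + norm (z - z)) ^ N * norm (z - z))))"
    by (intro AE_I2 tendsto_intros r(2))
   show "AE z in lborel. norm (?G z * (C' * ((1 + norm z) ^ N * ((1 + norm (z - r i z)) ^ N * norm (z - r i z))))) <= ?w z" for i
    using wb C'(1) by (intro AE_I2) (simp add: abs_mult)
  qed measurable
  then show ?thesis by simp
 qed
 define L where "L i = (LINT z|lborel. ?G z * norm (F (r i z)))" for i
 let ?u = "%z. CF * 2 ^ NF * (?G z * (1 + norm z) ^ NF)"
 have ui: "integrable lborel ?u" by (intro integrable_mult_right integrable_heat_kernel_poly s)
 have ub: "?G z * norm (F v) <= ?u z" if "norm v <= 2 * norm z" for z v
 proof -
  have "norm (F v) <= CF * (1 + norm v) ^ NF" by (rule F)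
  also have "... <= CF * (2 * (1 + norm z)) ^ NF" using that CF by (intro mult_left_mono power_mono) auto
  finally have "?G z * norm (F v) <= ?G z * (CF * (2 * (1 + norm z)) ^ NF)" by (intro mult_left_mono) auto
  then show ?thesis unfolding power_mult_distrib by (simp only: mult_ac)
 qed
 have L: "L \<longlonglongrightarrow> (LINT z|lborel. ?G z * norm (F z))"
  unfolding L_def
 proof (rule integral_dominated_convergence[OF _ _ ui])
  show "AE z in lborel. (%i. ?G z * norm (F (r i z))) \<longlonglongrightarrow> ?G z * norm (F z)"
  proof (intro AE_I2 tendsto_mult tendsto_const tendsto_norm)
   fix z
   show "(%i. F (r i z)) \<longlonglongrightarrow> F z"
    using continuous_on_tendsto_compose[OF Fc r(2)] by simp
  qed
  show "AE z in lborel. norm (?G z * norm (F (r i z))) <= ?u z" for i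
   using ub r(3) by (intro AE_I2) (simp add: abs_mult)
 qed measurable
 let ?g = "%t v y. complex_of_real (hk t (v - y))"
 have st: "0 < s + t" using s t by simp
 have main: "norm (heat (s + t) \<phi> x) <= C * \<epsilon> i + L i" for i
 proof -
  let ?S = "%y. \<Sum>v\<in>range (r i). complex_of_real (m i v) * ?g t v y"
  have S: "?S \<in> schwartz" "\<phi> ?S = (\<Sum>v\<in>range (r i). complex_of_real (m i v) * \<phi> (?g t v))"
   "!!bs. bs \<in> lists Basis ==> iterated_partial bs ?S = (%y. \<Sum>v\<in>range (r i). complex_of_real (m i v) * iterated_partial bs (?g t v) y)"
   using tempered_distribution_sum[OF \<phi> fin[of i] heat_kernel_schwartz[OF t]] by auto
  have S': "(%y. (- 1) * ?S y) \<in> schwartz" by (rule schwartz_cmult[OF S(1)])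
  note G = heat_kernel_schwartz[OF st, of x]
  have split: "heat (s + t) \<phi> x = \<phi> (%y. ?g (s + t) x y + (- 1) * ?S y) + \<phi> ?S"
   unfolding heat_def tempered_distribution_add[OF \<phi> G S'] tempered_distribution_cmult[OF \<phi> S(1)] by simp
  have "norm (heat (s + t) \<phi> x) <= norm (\<phi> (%y. ?g (s + t) x y + (- 1) * ?S y)) + norm (\<phi> ?S)"
   unfolding split by (rule norm_triangle_ineq)
  also have "... <= C * \<epsilon> i + L i"
  proof (rule add_mono)
   show "norm (\<phi> (%y. ?g (s + t) x y + (- 1) * ?S y)) <= C * \<epsilon> i"
   proof (rule C(2)[OF schwartz_add[OF G S']])
    fix bs :: "'a list" and y :: 'a assume bs: "bs \<in> lists Basis" "length bs <= N"
    have "iterated_partial bs (%y. ?g (s + t) x y + (- 1) * ?S y) y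
      = of_real (kernel_partial (s + t) bs (x - y) - (\<Sum>v\<in>range (r i). m i v * kernel_partial t bs (v - y)))"
     unfolding iterated_partial_add[OF G S' bs(1)] iterated_partial_cmult[OF S(1) bs(1)] S(3)[OF bs(1)]
      iterated_partial_heat_kernel(1)[OF t] iterated_partial_heat_kernel(1)[OF st] by simp
    also have "kernel_partial (s + t) bs (x - y) - (\<Sum>v\<in>range (r i). m i v * kernel_partial t bs (v - y))
      = (LINT z|lborel. ?G z * kernel_partial t bs (z - y)) - (LINT z|lborel. ?G z * kernel_partial t bs (r i z - y))"
     using simple[of "%v. kernel_partial t bs (v - y)" i] kernel_partial_convolution(2)[OF s t, of x bs y] by simp
    also have "... = (LINT z|lborel. ?G z * (kernel_partial t bs (z - y) - kernel_partial t bs (r i z - y)))"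
     using simple[of "%v. kernel_partial t bs (v - y)" i] kernel_partial_convolution(1)[OF s t, of x bs y]
     by (subst Bochner_Integration.integral_diff[symmetric]) (auto simp: right_diff_distrib)
    finally have ip: "norm (iterated_partial bs (%y. ?g (s + t) x y + (- 1) * ?S y) y)
      = \<bar>LINT z|lborel. ?G z * (kernel_partial t bs (z - y) - kernel_partial t bs (r i z - y))\<bar>"
     by (simp only: norm_of_real)
    have di: "integrable lborel (%z. ?G z * (kernel_partial t bs (z - y) - kernel_partial t bs (r i z - y)))"
     using simple[of "%v. kernel_partial t bs (v - y)" i] kernel_partial_convolution(1)[OF s t, of x bs y]
     by (simp add: right_diff_distrib)
    have "(1 + norm y) ^ N * norm (iterated_partial bs (%y. ?g (s + t) x y + (- 1) * ?S y) y)
      <= (1 + norm y) ^ N * (LINT z|lborel. \<bar>?G z * (kernel_partial t bs (z - y) - kernel_partial t bs (r i z - y))\<bar>)"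
     unfolding ip by (intro mult_left_mono integral_abs_bound) auto
    also have "... = (LINT z|lborel. (1 + norm y) ^ N * \<bar>?G z * (kernel_partial t bs (z - y) - kernel_partial t bs (r i z - y))\<bar>)"
     by simp
    also have "... <= \<epsilon> i"
     unfolding \<epsilon>_def
    proof (intro integral_mono integrable_mult_right integrable_abs di ei)
     fix z
     have "(1 + norm y) ^ N * \<bar>?G z * (kernel_partial t bs (z - y) - kernel_partial t bs (r i z - y))\<bar>
       = ?G z * ((1 + norm y) ^ N * \<bar>kernel_partial t bs (z - y) - kernel_partial t bs (r i z - y)\<bar>)"
      by (simp add: abs_mult mult_ac)
     also have "... <= ?G z * (C' * ((1 + norm z) ^ N * ((1 + norm (z - r i z)) ^ N * norm (z - r i z))))"
      by (intro mult_left_mono C'(3)[OF bs]) auto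
     finally show "(1 + norm y) ^ N * \<bar>?G z * (kernel_partial t bs (z - y) - kernel_partial t bs (r i z - y))\<bar>
       <= ?G z * (C' * ((1 + norm z) ^ N * ((1 + norm (z - r i z)) ^ N * norm (z - r i z))))" .
    qed
    finally show "(1 + norm y) ^ N * norm (iterated_partial bs (%y. ?g (s + t) x y + (- 1) * ?S y) y) <= \<epsilon> i" .
   qed
   have "norm (\<phi> ?S) <= (\<Sum>v\<in>range (r i). norm (complex_of_real (m i v) * \<phi> (?g t v)))"
    unfolding S(2) by (rule norm_sum)
   also have "... = (\<Sum>v\<in>range (r i). m i v * norm (F v))"
    using m0 by (simp add: norm_mult F_def heat_def)
   also have "... = L i" using simple[of "%v. norm (F v)" i] by (simp add: L_def)
   finally show "norm (\<phi> ?S) <= L i" .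
  qed
  finally show ?thesis .
 qed
 have "(%i. C * \<epsilon> i + L i) \<longlonglongrightarrow> C * 0 + (LINT z|lborel. ?G z * norm (F z))"
  by (intro tendsto_intros \<epsilon>0 L)
 then have "norm (heat (s + t) \<phi> x) <= C * 0 + (LINT z|lborel. ?G z * norm (F z))"
  by (rule LIMSEQ_le_const) (use main in blast)
 then have "ennreal (norm (heat (s + t) \<phi> x)) <= ennreal (LINT z|lborel. ?G z * norm (F z))"
  by (intro ennreal_leI) simp
 also have "... = (NN z. ennreal (?G z * norm (F z)))"
 proof (rule nn_integral_eq_integral[symmetric])
  show "integrable lborel (%z. ?G z * norm (F z))"
   by (rule Bochner_Integration.integrable_bound[OF ui]) (use ub CF in \<open>auto intro!: AE_I2 simp: abs_mult\<close>)
 qed auto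
 finally show ?thesis by (simp add: F_def)
qed

section \<open>Homogeneous data: temperedness, self-similarity, injectivity of the heat flow\<close>

lemma complex_borel_version:
 fixes g :: "'a::euclidean_space => complex"
 assumes g: "g \<in> Lmeas"
 obtains g' where "g' \<in> Bmeas" "AE x in lborel. g x = g' x"
proof -
 have "(%x. Re (g x)) \<in> Lmeas" "(%x. Im (g x)) \<in> Lmeas"
  using g by measurable
 from this[THEN completion_ex_borel_measurable_real]
 obtain u v where uv: "u \<in> borel_measurable lborel" "AE x in lborel. Re (g x) = u x"
  "v \<in> borel_measurable lborel" "AE x in lborel. Im (g x) = v x" by blast
 have [measurable]: "u \<in> Bmeas" "v \<in> Bmeas" using uv by auto
 show thesis
 proof (rule that)
  show "(%x. Complex (u x) (v x)) \<in> Bmeas"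
   by (simp add: borel_measurable_complex_iff)
  show "AE x in lborel. g x = Complex (u x) (v x)"
   using uv(2,4) by eventually_elim (simp add: complex_eq_iff)
 qed
qed

lemma borel_imp_lebesgue_measurable:
 assumes "f \<in> Bmeas"
 shows "f \<in> Lmeas"
proof -
 have "f \<in> measurable lborel borel" using assms by simp
 then show ?thesis by (rule measurable_completion)
qed

lemma nn_integral_inverse_quadratic_finite:
 "(NN x. ennreal (1 / (1 + x\<^sup>2))) < \<infinity>"
proof -
 let ?f = "%x::real. 1 / (1 + x\<^sup>2)"
 have half: "(NN x. ennreal (?f x) * indicator {0..} x) = ennreal (pi / 2 - arctan 0)"
 proof (rule nn_integral_FTC_atLeast)
  show "DERIV arctan x :> ?f x" for x
   using DERIV_arctan[of x] by (simp add: inverse_eq_divide)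
  show "(arctan \<longlongrightarrow> pi / 2) at_top" by (rule tendsto_arctan_at_top)
 qed auto
 have "(NN x. ennreal (?f x))
   <= (NN x. ennreal (?f x) * indicator {0..} x + ennreal (?f (0 - x)) * indicator {0..} (0 - x))"
  by (intro nn_integral_mono) (auto simp: indicator_def)
 also have "... = (NN x. ennreal (?f x) * indicator {0..} x) + (NN x. ennreal (?f (0 - x)) * indicator {0..} (0 - x))"
  by (rule nn_integral_add) measurable
 also have "(NN x. ennreal (?f (0 - x)) * indicator {0..} (0 - x)) = (NN x. ennreal (?f x) * indicator {0..} x)"
  by (rule nn_integral_lborel_reflect[of "%x. ennreal (?f x) * indicator {0..} x"]) measurable
 finally show ?thesis unfolding half by (simp add: le_less_trans ennreal_add_eq_top top.not_eq_extremum)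
qed

text \<open>The exponent comes from one integrable factor \<open>1 / (1 + x^2)\<close> per
  coordinate, each of which is at least \<open>1 / (1 + norm x)^2\<close>.\<close>

lemma nn_integral_polynomial_decay_finite:
 "(NN x. ennreal (1 / (1 + norm (x::'a::euclidean_space)) ^ (2 * DIM('a)))) < \<infinity>"
proof -
 have "(NN x. ennreal (1 / (1 + norm (x::'a)) ^ (2 * DIM('a))))
   <= (\<integral>\<^sup>+x. (\<Prod>b\<in>Basis. ennreal (1 / (1 + (x \<bullet> b)\<^sup>2))) \<partial>(lborel :: 'a measure))"
 proof (rule nn_integral_mono)
  fix x :: 'a
  have "(\<Prod>b\<in>(Basis::'a set). 1 + (x \<bullet> b)\<^sup>2) <= (\<Prod>b\<in>(Basis::'a set). (1 + norm x)\<^sup>2)"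
  proof (rule prod_mono, rule conjI)
   fix b :: 'a assume b: "b \<in> Basis"
   have "(x \<bullet> b)\<^sup>2 <= (norm x)\<^sup>2" using power_mono[OF Basis_le_norm[OF b, of x], of 2] by simp
   then show "1 + (x \<bullet> b)\<^sup>2 <= (1 + norm x)\<^sup>2" by (simp add: power2_sum add_increasing2)
  qed simp
  also have "... = (1 + norm x) ^ (2 * DIM('a))" by (simp add: power_mult)
  finally have "(1 / (1 + norm x) ^ (2 * DIM('a))) <= 1 / (\<Prod>b\<in>(Basis::'a set). 1 + (x \<bullet> b)\<^sup>2)"
   by (intro divide_left_mono mult_pos_pos prod_pos) (auto simp: add_pos_nonneg)
  also have "... = (\<Prod>b\<in>(Basis::'a set). 1 / (1 + (x \<bullet> b)\<^sup>2))" by (simp add: prod_dividef)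
  finally show "ennreal (1 / (1 + norm x) ^ (2 * DIM('a))) <= (\<Prod>b\<in>Basis. ennreal (1 / (1 + (x \<bullet> b)\<^sup>2)))"
   by (subst prod_ennreal) (auto intro!: ennreal_leI)
 qed
 also have "... = (\<Prod>b\<in>(Basis::'a set). (NN x. ennreal (1 / (1 + x\<^sup>2))))"
  by (rule nn_integral_lborel_prod) auto
 also have "... < \<infinity>" using nn_integral_inverse_quadratic_finite
  by (simp add: power_less_top_ennreal)
 finally show ?thesis .
qed

lemma power_weight_integral_finite:
 assumes \<sigma>: "0 < \<sigma>" "\<sigma> < real DIM('a::euclidean_space)"
 obtains C where "0 < C"
  "(NN x. ennreal (norm (x::'a) powr (- \<sigma>) / (1 + norm x) ^ (2 * DIM('a)))) <= ennreal C"
proof -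
 let ?R = "\<sigma> / real DIM('a)"
 have [measurable]: "cball (0::'a) 1 \<in> sets borel" by simp
 have R: "0 <= ?R" "?R < 1" "0 <= - \<sigma> / real DIM('a) + ?R" using \<sigma> by auto
 obtain C where C: "0 < C"
  "!!E. E \<in> lmeasurable ==>
    (NL x. ennreal (norm x powr (- \<sigma>)) * indicator (E \<inter> cball (0::'a) 1) x)
     <= ennreal (C * measure lebesgue E powr (1 - ?R))"
  using nn_integral_local_weight[where 'a='a, OF R] by blast
 have "(NN x. ennreal (norm (x::'a) powr (- \<sigma>) / (1 + norm x) ^ (2 * DIM('a))))
   <= (NN x. ennreal (norm x powr (- \<sigma>)) * indicator (cball 0 1 \<inter> cball (0::'a) 1) x
      + ennreal (1 / (1 + norm x) ^ (2 * DIM('a))))"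
 proof (rule nn_integral_mono)
  fix x :: 'a
  show "ennreal (norm x powr (- \<sigma>) / (1 + norm x) ^ (2 * DIM('a)))
   <= ennreal (norm x powr (- \<sigma>)) * indicator (cball 0 1 \<inter> cball 0 1) x + ennreal (1 / (1 + norm x) ^ (2 * DIM('a)))"
  proof (cases "norm x <= 1")
   case True
   have "norm x powr (- \<sigma>) / (1 + norm x) ^ (2 * DIM('a)) <= norm x powr (- \<sigma>) / 1"
    by (intro divide_left_mono one_le_power) (auto simp: add_pos_nonneg)
   then show ?thesis using True by (auto intro: add_increasing2 ennreal_leI)
  next
   case False
   have "norm x powr (- \<sigma>) <= norm x powr 0" using False \<sigma> by (intro powr_mono) auto
   then have "norm x powr (- \<sigma>) / (1 + norm x) ^ (2 * DIM('a)) <= 1 / (1 + norm x) ^ (2 * DIM('a))"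
    using False by (intro divide_right_mono) (auto split: if_splits)
   then show ?thesis using False by (auto intro: ennreal_leI)
  qed
 qed
 also have "... = (NN x. ennreal (norm x powr (- \<sigma>)) * indicator (cball 0 1 \<inter> cball (0::'a) 1) x)
      + (NN x. ennreal (1 / (1 + norm (x::'a)) ^ (2 * DIM('a))))"
  by (rule nn_integral_add) measurable
 also have "... < \<infinity>"
 proof -
  have "(NN x. ennreal (norm x powr (- \<sigma>)) * indicator (cball 0 1 \<inter> cball (0::'a) 1) x) < \<infinity>"
   using C(2)[of "cball 0 1"] by (simp only: nn_integral_completion) (auto intro: le_less_trans)
  then show ?thesis using nn_integral_polynomial_decay_finite[where 'a='a] by simp
 qed
 finally have fin: "(NN x. ennreal (norm (x::'a) powr (- \<sigma>) / (1 + norm x) ^ (2 * DIM('a)))) < \<infinity>" .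
 then obtain c where c: "0 <= c" "(NN x. ennreal (norm (x::'a) powr (- \<sigma>) / (1 + norm x) ^ (2 * DIM('a)))) = ennreal c"
  by (cases "(NN x. ennreal (norm (x::'a) powr (- \<sigma>) / (1 + norm x) ^ (2 * DIM('a))))") auto
 show thesis by (rule that[of "c + 1"]) (use c in \<open>auto intro!: ennreal_leI\<close>)
qed

lemma Phi_measurable: "\<omega> \<in> Lmeas ==> Phi \<omega> \<sigma> \<in> Lmeas"
 unfolding Phi_def by (intro borel_measurable_times borel_imp_lebesgue_measurable[of "%x. of_real (norm x powr (- \<sigma>))"]) auto

lemma Phi_integrable:
 fixes \<omega> :: "'a::euclidean_space => complex"
 assumes \<omega>: "\<omega> \<in> Lmeas" "AE x in lebesgue. norm (\<omega> x) <= \<epsilon>" and \<epsilon>: "0 <= \<epsilon>"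
  and C: "0 < C" "(NN x. ennreal (norm (x::'a) powr (- \<sigma>) / (1 + norm x) ^ (2 * DIM('a)))) <= ennreal C"
  and f: "f \<in> Bmeas" "!!x. (1 + norm x) ^ (2 * DIM('a)) * norm (f x :: complex) <= B" and B: "0 <= B"
 shows "integrable lebesgue (%y. Phi \<omega> \<sigma> y * f y)" and "norm (LINT y|lebesgue. Phi \<omega> \<sigma> y * f y) <= \<epsilon> * C * B"
proof -
 have m: "(%y. Phi \<omega> \<sigma> y * f y) \<in> Lmeas"
  by (intro borel_measurable_times Phi_measurable \<omega> borel_imp_lebesgue_measurable f)
 have "(NL y. ennreal (norm (Phi \<omega> \<sigma> y * f y)))
   <= (NL y. ennreal (\<epsilon> * B) * ennreal (norm (y::'a) powr (- \<sigma>) / (1 + norm y) ^ (2 * DIM('a))))"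
 proof (rule nn_integral_mono_AE)
  show "AE y in lebesgue. ennreal (norm (Phi \<omega> \<sigma> y * f y)) <= ennreal (\<epsilon> * B) * ennreal (norm y powr (- \<sigma>) / (1 + norm y) ^ (2 * DIM('a)))"
   using \<omega>(2)
  proof eventually_elim
   fix y :: 'a assume y: "norm (\<omega> y) <= \<epsilon>"
   have p: "0 < (1 + norm y) ^ (2 * DIM('a))" by (simp add: add_pos_nonneg)
   have "norm (f y) <= B / (1 + norm y) ^ (2 * DIM('a))" using f(2)[of y] p by (simp add: field_simps)
   then have "norm (Phi \<omega> \<sigma> y * f y) <= (\<epsilon> * norm y powr (- \<sigma>)) * (B / (1 + norm y) ^ (2 * DIM('a)))"
    unfolding Phi_def norm_mult using y \<epsilon> by (intro mult_mono) auto
   also have "... = (\<epsilon> * B) * (norm y powr (- \<sigma>) / (1 + norm y) ^ (2 * DIM('a)))" by simp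
   finally show "ennreal (norm (Phi \<omega> \<sigma> y * f y)) <= ennreal (\<epsilon> * B) * ennreal (norm y powr (- \<sigma>) / (1 + norm y) ^ (2 * DIM('a)))"
    using \<epsilon> B by (simp add: ennreal_mult[symmetric] ennreal_leI)
  qed
 qed
 also have "... = ennreal (\<epsilon> * B) * (NN y. ennreal (norm (y::'a) powr (- \<sigma>) / (1 + norm y) ^ (2 * DIM('a))))"
  unfolding nn_integral_completion by (rule nn_integral_cmult) measurable
 also have "... <= ennreal (\<epsilon> * B) * ennreal C" by (intro mult_left_mono C) auto
 also have "... = ennreal (\<epsilon> * C * B)" using \<epsilon> B C(1) by (simp add: ennreal_mult[symmetric] mult_ac)
 finally have fin: "(NL y. ennreal (norm (Phi \<omega> \<sigma> y * f y))) <= ennreal (\<epsilon> * C * B)" .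
 show int: "integrable lebesgue (%y. Phi \<omega> \<sigma> y * f y)"
  by (rule integrableI_bounded[OF m]) (use fin in \<open>auto intro: le_less_trans\<close>)
 have "ennreal (norm (LINT y|lebesgue. Phi \<omega> \<sigma> y * f y)) <= (NL y. ennreal (norm (Phi \<omega> \<sigma> y * f y)))"
  by (rule integral_norm_bound_ennreal[OF int])
 also note fin
 finally show "norm (LINT y|lebesgue. Phi \<omega> \<sigma> y * f y) <= \<epsilon> * C * B" using \<epsilon> B C(1) by simp
qed

lemma schwartz_borel: "f \<in> schwartz ==> f \<in> Bmeas"
 using schwartzD(1)[of f "[]"]
 by (intro borel_measurable_continuous_onI continuous_at_imp_continuous_on) (auto intro: differentiable_imp_continuous_within)

lemma tempered_regular_Phi:
 fixes \<omega> :: "'a::euclidean_space => complex"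
 assumes \<omega>: "\<omega> \<in> Lmeas" "AE x in lebesgue. norm (\<omega> x) <= \<epsilon>" and \<epsilon>: "0 <= \<epsilon>"
  and \<sigma>: "0 < \<sigma>" "\<sigma> < real DIM('a)"
 shows "tempered_distribution (regular_distribution (Phi \<omega> \<sigma>))"
proof -
 obtain C where C: "0 < C"
  "(NN x. ennreal (norm (x::'a) powr (- \<sigma>) / (1 + norm x) ^ (2 * DIM('a)))) <= ennreal C"
  by (rule power_weight_integral_finite[OF \<sigma>])
 let ?P = "schwartz_seminorm (2 * DIM('a)) :: ('a => complex) => real"
 have P: "(1 + norm x) ^ (2 * DIM('a)) * norm (f x) <= ?P f" "0 <= ?P f" if "f \<in> schwartz" for f :: "'a => complex" and x
  using schwartz_seminorm_upper(1)[where f = f and M = "2 * DIM('a)" and M' = "2 * DIM('a)" and bs = "[]" and x = x]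
   schwartz_seminorm_upper(2)[where f = f and M = "2 * DIM('a)" and M' = "2 * DIM('a)" and bs = "[]"] that by auto
 note I = Phi_integrable[OF \<omega> \<epsilon> C schwartz_borel P]
 show ?thesis
  unfolding tempered_distribution_def regular_distribution_def
 proof (intro conjI ballI allI)
  show "(LINT y|lebesgue. Phi \<omega> \<sigma> y * (f y + g y)) = (LINT y|lebesgue. Phi \<omega> \<sigma> y * f y) + (LINT y|lebesgue. Phi \<omega> \<sigma> y * g y)"
   if "f \<in> schwartz" "g \<in> schwartz" for f g
   using I(1) that by (simp add: distrib_left)
  show "(LINT y|lebesgue. Phi \<omega> \<sigma> y * (c * f y)) = c * (LINT y|lebesgue. Phi \<omega> \<sigma> y * f y)" for c f
   by (simp add: mult.left_commute)
  have "norm (LINT y|lebesgue. Phi \<omega> \<sigma> y * f y) <= \<epsilon> * C * ?P f" if "f \<in> schwartz" for f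
   using I(2) that by blast
  then show "\<exists>N C. \<forall>f\<in>schwartz. norm (LINT y|lebesgue. Phi \<omega> \<sigma> y * f y) <= C * schwartz_seminorm N f" by blast
 qed
qed

lemma lebesgue_scale_density:
 assumes c: "0 < c"
 shows "(lebesgue :: 'a::euclidean_space measure) = density (distr lebesgue lebesgue ((*\<^sub>R) c)) (%_. ennreal (c ^ DIM('a)))"
proof -
 have "(%x::'a. 0 + (\<Sum>j\<in>Basis. (c * (x \<bullet> j)) *\<^sub>R j)) = (*\<^sub>R) c"
  unfolding scaleR_scaleR[symmetric] scaleR_sum_right[symmetric] euclidean_representation by auto
 then show ?thesis
  using lebesgue_affine_euclidean[of "%_::'a. c" 0] c by simp
qed

lemma lebesgue_integral_scale:
 fixes f :: "'a::euclidean_space => 'b::{banach, second_countable_topology}"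
 assumes f: "f \<in> Lmeas" and c: "0 < c"
 shows "(LINT x|lebesgue. f x) = c ^ DIM('a) *\<^sub>R (LINT x|lebesgue. f (c *\<^sub>R x))"
 by (subst lebesgue_scale_density[OF c]) (use f c in \<open>simp add: integral_density integral_distr\<close>)

lemma integrable_lebesgue_scale:
 fixes f :: "'a::euclidean_space => 'b::{banach, second_countable_topology}"
 assumes f: "integrable lebesgue f" and c: "0 < c"
 shows "integrable lebesgue (%x. f (c *\<^sub>R x))"
proof -
 have m: "f \<in> Lmeas" using f by auto
 have "integrable (density (distr lebesgue lebesgue ((*\<^sub>R) c)) (%_. ennreal (c ^ DIM('a)))) f"
  using f lebesgue_scale_density[OF c, where 'a='a] by simp
 then have "integrable lebesgue (%x. c ^ DIM('a) *\<^sub>R f (c *\<^sub>R x))"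
  using m c by (simp add: integrable_density integrable_distr_eq)
 then have "integrable lebesgue (%x. (1 / c ^ DIM('a)) *\<^sub>R c ^ DIM('a) *\<^sub>R f (c *\<^sub>R x))"
  by (rule integrable_scaleR_right)
 then show ?thesis using c by simp
qed

lemma AE_lebesgue_scale:
 assumes P: "AE x in (lebesgue :: 'a::euclidean_space measure). P x" and c: "0 < c"
 shows "AE x in (lebesgue :: 'a measure). P (c *\<^sub>R x)"
proof -
 obtain Z where Z: "Z \<in> null_sets lebesgue" "{x. ~ P x} \<subseteq> Z"
  using P by (auto simp: eventually_ae_filter)
 have Zl: "Z \<in> lmeasurable" "measure lebesgue Z = 0" using Z(1) by (auto simp: fmeasurableI_null_sets measure_eq_0_null_sets)
 let ?Z = "(*\<^sub>R) (1/c) ` Z"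
 have "?Z \<in> lmeasurable" "measure lebesgue ?Z = 0"
  using scaleR_image_lmeasurable[OF Zl(1), of "1/c"] Zl(2) c by auto
 then have "?Z \<in> null_sets lebesgue" by (metis emeasure_eq_measure2 ennreal_0 fmeasurableD null_setsI)
 moreover have "{x \<in> space lebesgue. ~ P (c *\<^sub>R x)} \<subseteq> ?Z"
 proof
  fix x assume "x \<in> {x \<in> space lebesgue. ~ P (c *\<^sub>R x)}"
  then have "c *\<^sub>R x \<in> Z" using Z(2) by auto
  then show "x \<in> ?Z" using c by (intro image_eqI[of _ _ "c *\<^sub>R x"]) auto
 qed
 ultimately show ?thesis by (auto simp: eventually_ae_filter)
qed

text \<open>Homogeneity of \<open>\<omega>\<close> is an a.e. identity for each fixed dilation;
  inside the integral it yields, with the scaling of the kernel, a self-similarity valid at every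
  point.\<close>

lemma heat_Phi_scale:
 fixes \<omega> :: "'a::euclidean_space => complex"
 assumes \<omega>: "\<omega> \<in> Lmeas" and hom: "homogeneous_degree_0 \<omega>" and c: "0 < c" and t: "0 < t"
 shows "heat (c\<^sup>2 * t) (regular_distribution (Phi \<omega> \<sigma>)) (c *\<^sub>R x) = of_real (c powr (- \<sigma>)) * heat t (regular_distribution (Phi \<omega> \<sigma>)) x"
proof -
 let ?D = "DIM('a)"
 have ker: "hk (c\<^sup>2 * t) (c *\<^sub>R x - c *\<^sub>R y) = c powr (- real ?D) * hk t (x - y)" for y
  using heat_kernel_scale[OF c t, of "x - y"] by (simp add: scaleR_diff_right)
 have m: "(%y. Phi \<omega> \<sigma> y * of_real (hk s (z - y))) \<in> Lmeas" for s and z :: 'a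
  by (intro borel_measurable_times Phi_measurable \<omega> borel_imp_lebesgue_measurable) measurable
 have "heat (c\<^sup>2 * t) (regular_distribution (Phi \<omega> \<sigma>)) (c *\<^sub>R x)
   = c ^ ?D *\<^sub>R (LINT y|lebesgue. Phi \<omega> \<sigma> (c *\<^sub>R y) * of_real (hk (c\<^sup>2 * t) (c *\<^sub>R x - c *\<^sub>R y)))"
  unfolding heat_def regular_distribution_def by (rule lebesgue_integral_scale[OF m c])
 also have "(LINT y|lebesgue. Phi \<omega> \<sigma> (c *\<^sub>R y) * of_real (hk (c\<^sup>2 * t) (c *\<^sub>R x - c *\<^sub>R y)))
   = (LINT y|lebesgue. of_real (c powr (- \<sigma>) * c powr (- real ?D)) * (Phi \<omega> \<sigma> y * of_real (hk t (x - y))))"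
 proof (rule integral_cong_AE)
  have "AE y in lebesgue. \<omega> (c *\<^sub>R y) = \<omega> y" using hom c by (simp add: homogeneous_degree_0_def)
  then show "AE y in lebesgue. Phi \<omega> \<sigma> (c *\<^sub>R y) * of_real (hk (c\<^sup>2 * t) (c *\<^sub>R x - c *\<^sub>R y))
    = of_real (c powr (- \<sigma>) * c powr (- real ?D)) * (Phi \<omega> \<sigma> y * of_real (hk t (x - y)))"
  proof eventually_elim
   fix y assume *: "\<omega> (c *\<^sub>R y) = \<omega> y"
   have "norm (c *\<^sub>R y) powr (- \<sigma>) = c powr (- \<sigma>) * norm y powr (- \<sigma>)" using c by (simp add: powr_mult)
   then show "Phi \<omega> \<sigma> (c *\<^sub>R y) * of_real (hk (c\<^sup>2 * t) (c *\<^sub>R x - c *\<^sub>R y))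
    = of_real (c powr (- \<sigma>) * c powr (- real ?D)) * (Phi \<omega> \<sigma> y * of_real (hk t (x - y)))"
    unfolding Phi_def ker * of_real_mult by (simp only: of_real_mult mult_ac)
  qed
  show "(%y. Phi \<omega> \<sigma> (c *\<^sub>R y) * of_real (hk (c\<^sup>2 * t) (c *\<^sub>R x - c *\<^sub>R y))) \<in> Lmeas"
   using measurable_compose[OF lebesgue_measurable_scaling m, of c "c\<^sup>2 * t" "c *\<^sub>R x"] by simp
  show "(%y. of_real (c powr (- \<sigma>) * c powr (- real ?D)) * (Phi \<omega> \<sigma> y * of_real (hk t (x - y)))) \<in> Lmeas"
   using m[of t x] by measurable
 qed
 also have "... = of_real (c powr (- \<sigma>) * c powr (- real ?D)) * heat t (regular_distribution (Phi \<omega> \<sigma>)) x"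
  by (simp add: heat_def regular_distribution_def)
 also have "c ^ ?D *\<^sub>R (of_real (c powr (- \<sigma>) * c powr (- real ?D)) * heat t (regular_distribution (Phi \<omega> \<sigma>)) x)
   = of_real (c powr real ?D * c powr (- real ?D) * c powr (- \<sigma>)) * heat t (regular_distribution (Phi \<omega> \<sigma>)) x"
  using c by (simp add: scaleR_conv_of_real powr_realpow mult_ac)
 also have "c powr real ?D * c powr (- real ?D) = 1"
  using c by (simp only: powr_add[symmetric]) simp
 finally show ?thesis by simp
qed

lemma heat_kernel_le_double:
 fixes w :: "'a::euclidean_space"
 assumes t: "0 < t" "t <= 1"
 shows "hk t w <= 2 powr (real DIM('a) / 2) * exp (- (norm w)\<^sup>2 / 8) * hk (2 * t) w"
proof -
 let ?D = "real DIM('a) / 2"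
 have "(4 * pi * (2 * t)) powr (- ?D) = (2 * (4 * pi * t)) powr (- ?D)" by (simp add: mult_ac)
 also have "... = 2 powr (- ?D) * (4 * pi * t) powr (- ?D)" by (rule powr_mult)
 finally have c: "2 powr ?D * (4 * pi * (2 * t)) powr (- ?D) = (4 * pi * t) powr (- ?D)"
  by (simp add: powr_minus)
 have "- (norm w)\<^sup>2 / (4 * t) = - (norm w)\<^sup>2 / (8 * t) + - (norm w)\<^sup>2 / (8 * t)" by simp
 also have "- (norm w)\<^sup>2 / (8 * t) <= - (norm w)\<^sup>2 / 8"
 proof -
  have "(norm w)\<^sup>2 / 8 <= (norm w)\<^sup>2 / (8 * t)" using t by (intro divide_left_mono) auto
  then show ?thesis by simp
 qed
 finally have "exp (- (norm w)\<^sup>2 / (4 * t)) <= exp (- (norm w)\<^sup>2 / 8 + - (norm w)\<^sup>2 / (8 * t))" by simp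
 also have "... = exp (- (norm w)\<^sup>2 / 8) * exp (- (norm w)\<^sup>2 / (4 * (2 * t)))" by (simp only: exp_add) simp
 finally have "hk t w <= (4 * pi * t) powr (- ?D) * (exp (- (norm w)\<^sup>2 / 8) * exp (- (norm w)\<^sup>2 / (4 * (2 * t))))"
  unfolding heat_kernel_def by (rule mult_left_mono) simp
 also have "... = 2 powr ?D * exp (- (norm w)\<^sup>2 / 8) * hk (2 * t) w"
  unfolding heat_kernel_def c[symmetric] by (simp only: mult_ac)
 finally show ?thesis .
qed

text \<open>A bound uniform in \<open>t <= 1\<close>: half of the Gaussian exponent is spent on
  decay in \<open>y\<close> at the fixed time 8, the other half remains a kernel of unit mass in
  \<open>x\<close>. It supplies the dominating function as t tends to 0.\<close>

lemma heat_kernel_local_bound: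
 fixes x y :: "'a::euclidean_space"
 assumes t: "0 < t" "t <= 1" and x: "norm x <= r"
 shows "hk t (x - y) <= 2 powr (real DIM('a) / 2) * exp (r\<^sup>2 / 8) * (32 * pi) powr (real DIM('a) / 2) * hk 8 y * hk (2 * t) (x - y)"
proof -
 let ?D = "real DIM('a) / 2" and ?w = "x - y"
 have "norm y <= norm ?w + r" using norm_triangle_ineq4[of x ?w] x by (simp add: algebra_simps)
 then have "(norm y)\<^sup>2 <= (norm ?w + r)\<^sup>2" by (intro power_mono) auto
 also have "... <= 2 * (norm ?w)\<^sup>2 + 2 * r\<^sup>2"
  using zero_le_power2[of "norm ?w - r"] by (simp add: power2_eq_square algebra_simps)
 finally have "- (norm ?w)\<^sup>2 / 8 <= r\<^sup>2 / 8 + - (norm y)\<^sup>2 / 32"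
  using zero_le_power2[of "norm ?w"] zero_le_power2[of r] by linarith
 then have "exp (- (norm ?w)\<^sup>2 / 8) <= exp (r\<^sup>2 / 8) * exp (- (norm y)\<^sup>2 / 32)"
  by (simp add: exp_add[symmetric])
 also have "exp (- (norm y)\<^sup>2 / 32) = (32 * pi) powr ?D * hk 8 y"
  by (simp add: heat_kernel_def powr_minus mult.commute)
 finally have e: "exp (- (norm ?w)\<^sup>2 / 8) <= exp (r\<^sup>2 / 8) * ((32 * pi) powr ?D * hk 8 y)" .
 have "hk t ?w <= 2 powr ?D * exp (- (norm ?w)\<^sup>2 / 8) * hk (2 * t) ?w"
  by (rule heat_kernel_le_double[OF t])
 also have "... <= 2 powr ?D * (exp (r\<^sup>2 / 8) * ((32 * pi) powr ?D * hk 8 y)) * hk (2 * t) ?w"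
  by (intro mult_right_mono mult_left_mono e) auto
 finally show ?thesis by (simp only: mult.assoc)
qed

lemma heat_approximate_identity:
 fixes \<psi> :: "'a::euclidean_space => real"
 assumes \<psi>: "continuous_on UNIV \<psi>" "!!x. 0 <= \<psi> x" "!!x. \<psi> x <= 1"
 shows "(%n. LINT x|lborel. hk ((inverse (real (Suc n)))\<^sup>2) (x - y) * \<psi> x) \<longlonglongrightarrow> \<psi> y"
proof -
 define c where "c n = inverse (real (Suc n))" for n
 have c: "0 < c n" for n by (simp add: c_def)
 have [measurable]: "\<psi> \<in> Bmeas" using \<psi>(1) by (rule borel_measurable_continuous_onI)
 have sub: "(LINT x|lborel. hk ((c n)\<^sup>2) (x - y) * \<psi> x) = (LINT z|lborel. hk 1 z * \<psi> (y + c n *\<^sub>R z))" for n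
 proof -
  have "(LINT x|lborel. hk ((c n)\<^sup>2) (x - y) * \<psi> x)
    = (LINT z|lborel. c n ^ DIM('a) * (hk ((c n)\<^sup>2) (y + c n *\<^sub>R z - y) * \<psi> (y + c n *\<^sub>R z)))"
   using c[of n] by (subst lborel_affine[of "c n" y]) (simp_all add: integral_density integral_distr)
  also have "... = (LINT z|lborel. hk 1 z * \<psi> (y + c n *\<^sub>R z))"
  proof (rule Bochner_Integration.integral_cong[OF refl])
   fix z :: 'a
   have "c n ^ DIM('a) * c n powr (- real DIM('a)) = 1"
    using c[of n] by (simp add: powr_minus powr_realpow)
   then show "c n ^ DIM('a) * (hk ((c n)\<^sup>2) (y + c n *\<^sub>R z - y) * \<psi> (y + c n *\<^sub>R z)) = hk 1 z * \<psi> (y + c n *\<^sub>R z)"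
    using heat_kernel_scale[OF c, of 1 n z] by (simp add: mult.assoc[symmetric])
  qed
  finally show ?thesis .
 qed
 have i1: "integrable lborel (hk 1 :: 'a => real)"
  using integrable_heat_kernel[of 1 "0::'a"] by (simp add: heat_kernel_minus)
 have "(%n. LINT z|lborel. hk 1 z * \<psi> (y + c n *\<^sub>R z)) \<longlonglongrightarrow> (LINT z|lborel. hk 1 (z::'a) * \<psi> y)"
 proof (rule integral_dominated_convergence[where w = "hk 1"])
  show "integrable lborel (hk 1 :: 'a => real)" by (rule i1)
  show "AE z in lborel. (%n. hk 1 z * \<psi> (y + c n *\<^sub>R z)) \<longlonglongrightarrow> hk 1 z * \<psi> y"
  proof (rule AE_I2, intro tendsto_mult tendsto_const)
   fix z :: 'a
   have "(%n. y + c n *\<^sub>R z) \<longlonglongrightarrow> y + 0 *\<^sub>R z"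
    unfolding c_def by (intro tendsto_intros LIMSEQ_inverse_real_of_nat)
   then show "(%n. \<psi> (y + c n *\<^sub>R z)) \<longlonglongrightarrow> \<psi> y"
    using continuous_on_tendsto_compose[OF \<psi>(1), of "%n. y + c n *\<^sub>R z" y sequentially] by simp
  qed
  show "AE z in lborel. norm (hk 1 z * \<psi> (y + c n *\<^sub>R z)) <= hk 1 z" for n
   using \<psi>(2,3) by (intro AE_I2) (simp add: abs_mult mult_left_le)
 qed measurable
 moreover have "(LINT z|lborel. hk 1 (z::'a) * \<psi> y) = \<psi> y"
 proof -
  have "(LINT z|lborel. hk 1 (z::'a)) = 1"
   using nn_integral_heat_kernel[of 1, where 'a='a] by (subst integral_eq_nn_integral) auto
  then show ?thesis by simp
 qed
 ultimately have "(%n. LINT x|lborel. hk ((c n)\<^sup>2) (x - y) * \<psi> x) \<longlonglongrightarrow> \<psi> y" by (simp only: sub)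
 then show ?thesis by (simp only: c_def)
qed

text \<open>Fubini moves the kernel from \<open>f\<close> to the test function; for short times the
  smoothed test functions converge to \<open>\<psi>\<close>, dominated by a multiple of
  \<open>hk 8\<close> because \<open>\<psi>\<close> has bounded support.\<close>

lemma heat_test_function_zero:
 fixes f :: "'a::euclidean_space => complex" and \<psi> :: "'a => real"
 assumes f [measurable]: "f \<in> Bmeas" and W: "integrable lborel (%y. norm (f y) * hk 8 y)"
  and zero: "!!t. 0 < t ==> AE x in lborel. (LINT y|lborel. f y * of_real (hk t (x - y))) = 0"
  and \<psi>: "continuous_on UNIV \<psi>" "!!x. 0 <= \<psi> x" "!!x. \<psi> x <= 1" "!!x. r <= norm x ==> \<psi> x = 0"
 shows "(LINT y|lborel. f y * of_real (\<psi> y)) = 0"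
proof -
 have [measurable]: "\<psi> \<in> Bmeas" using \<psi>(1) by (rule borel_measurable_continuous_onI)
 define c where "c n = (inverse (real (Suc n)))\<^sup>2" for n
 have c: "0 < c n" "c n <= 1" for n
  unfolding c_def by (auto intro!: power_le_one simp: field_simps)
 define K where "K = 2 powr (real DIM('a) / 2) * exp (r\<^sup>2 / 8) * (32 * pi) powr (real DIM('a) / 2)"
 have K: "0 <= K" by (simp add: K_def)
 have kb: "hk (c n) (x - y) * \<psi> x <= K * hk 8 y * hk (2 * c n) (x - y)" for n x y
 proof (cases "norm x <= r")
  case True
  have "hk (c n) (x - y) * \<psi> x <= hk (c n) (x - y)" using \<psi>(2,3) by (intro mult_left_le) auto
  also have "... <= K * hk 8 y * hk (2 * c n) (x - y)"
   unfolding K_def by (rule heat_kernel_local_bound[OF c True])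
  finally show ?thesis .
 qed (use \<psi>(4) K in simp)
 define g where "g n y = (LINT x|lborel. hk (c n) (x - y) * \<psi> x)" for n y
 have gm [measurable]: "g n \<in> Bmeas" for n unfolding g_def by measurable
 have nn: "(NN x. ennreal (hk (c n) (x - y) * \<psi> x)) <= ennreal (K * hk 8 y)" for n y
 proof -
  have "(NN x. ennreal (hk (c n) (x - y) * \<psi> x))
    <= (NN x. ennreal (K * hk 8 y) * ennreal (hk (2 * c n) (x - y)))"
   using kb K by (intro nn_integral_mono) (simp add: ennreal_mult[symmetric] ennreal_leI)
  also have "... = ennreal (K * hk 8 y)"
   using c[of n] by (subst nn_integral_cmult) (auto simp: nn_integral_heat_kernel_diff)
  finally show ?thesis .
 qed
 have gb: "0 <= g n y" "g n y <= K * hk 8 y" for n y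
 proof -
  show "0 <= g n y" unfolding g_def using \<psi>(2) by (intro integral_nonneg_AE AE_I2) auto
  have "ennreal (g n y) <= (NN x. ennreal (norm (hk (c n) (x - y) * \<psi> x)))"
  proof (cases "integrable lborel (%x. hk (c n) (x - y) * \<psi> x)")
   case True
   then show ?thesis using integral_norm_bound_ennreal[OF True] \<open>0 <= g n y\<close> by (simp add: g_def)
  qed (simp add: g_def not_integrable_integral_eq)
  also have "... <= ennreal (K * hk 8 y)" using nn \<psi>(2) by (simp add: abs_mult)
  finally show "g n y <= K * hk 8 y" using K by simp
 qed
 have fg0: "(LINT y|lborel. f y * of_real (g n y)) = 0" for n
 proof -
  let ?F = "%y x. f y * of_real (hk (c n) (x - y) * \<psi> x)"
  have int: "integrable (lborel \<Otimes>\<^sub>M lborel) (case_prod ?F)"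
  proof (rule integrableI_bounded)
   show "case_prod ?F \<in> borel_measurable (lborel \<Otimes>\<^sub>M lborel)" by measurable
   have "(\<integral>\<^sup>+z. ennreal (norm (case_prod ?F z)) \<partial>(lborel \<Otimes>\<^sub>M lborel))
     = (NN y. (NN x. ennreal (norm (?F y x))))"
    by (subst lborel.nn_integral_fst[symmetric]) (auto simp: split_beta)
   also have "... = (NN y. ennreal (norm (f y)) * (NN x. ennreal (hk (c n) (x - y) * \<psi> x)))"
    using \<psi>(2) by (subst nn_integral_cmult[symmetric]) (auto simp: norm_mult ennreal_mult abs_mult)
   also have "... <= (NN y. ennreal K * ennreal (norm (f y) * hk 8 y))"
   proof (rule nn_integral_mono)
    fix y
    have "ennreal (norm (f y)) * (NN x. ennreal (hk (c n) (x - y) * \<psi> x))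
      <= ennreal (norm (f y)) * ennreal (K * hk 8 y)" by (intro mult_left_mono nn) auto
    also have "... = ennreal K * ennreal (norm (f y) * hk 8 y)"
     using K by (simp add: ennreal_mult mult_ac)
    finally show "ennreal (norm (f y)) * (NN x. ennreal (hk (c n) (x - y) * \<psi> x))
      <= ennreal K * ennreal (norm (f y) * hk 8 y)" .
   qed
   also have "... = ennreal K * (NN y. ennreal (norm (f y) * hk 8 y))"
    by (rule nn_integral_cmult) measurable
   also have "... < \<infinity>" using W by (simp add: ennreal_mult_less_top integrable_iff_bounded abs_mult)
   finally show "(\<integral>\<^sup>+z. ennreal (norm (case_prod ?F z)) \<partial>(lborel \<Otimes>\<^sub>M lborel)) < \<infinity>" .
  qed
  have "(LINT y|lborel. f y * of_real (g n y)) = (LINT y|lborel. LINT x|lborel. ?F y x)"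
   by (simp only: g_def integral_mult_right_zero integral_complex_of_real)
  also have "... = (LINT x|lborel. LINT y|lborel. ?F y x)"
   by (rule lborel_pair.Fubini_integral[OF int, symmetric])
  also have "... = (LINT x|(lborel :: 'a measure). 0)"
  proof (rule integral_cong_AE)
   have eq: "(LINT y|lborel. ?F y x) = (LINT y|lborel. f y * of_real (hk (c n) (x - y))) * of_real (\<psi> x)" for x
    by (simp add: mult.assoc[symmetric])
   show "AE x in lborel. (LINT y|lborel. ?F y x) = 0"
    using zero[OF c(1)[of n]] by eventually_elim (simp only: eq mult_zero_left)
  qed measurable
  finally show ?thesis by simp
 qed
 have "(%n. LINT y|lborel. f y * of_real (g n y)) \<longlonglongrightarrow> (LINT y|lborel. f y * of_real (\<psi> y))"
 proof (rule integral_dominated_convergence[where w = "%y. K * (norm (f y) * hk 8 y)"])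
  show "integrable lborel (%y. K * (norm (f y) * hk 8 y))" by (intro integrable_mult_right W)
  show "AE y in lborel. (%n. f y * of_real (g n y)) \<longlonglongrightarrow> f y * of_real (\<psi> y)"
   using heat_approximate_identity[OF \<psi>(1-3)] unfolding g_def c_def
   by (intro AE_I2 tendsto_mult tendsto_const tendsto_of_real) auto
  show "AE y in lborel. norm (f y * of_real (g n y)) <= K * (norm (f y) * hk 8 y)" for n
  proof (rule AE_I2)
   fix y
   have "norm (f y) * g n y <= norm (f y) * (K * hk 8 y)" by (intro mult_left_mono gb) auto
   then show "norm (f y * of_real (g n y)) <= K * (norm (f y) * hk 8 y)"
    using gb(1)[of n y] by (simp add: norm_mult mult_ac)
  qed
 qed measurable
 then show ?thesis unfolding fg0 by (simp add: LIMSEQ_const_iff)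
qed

text \<open>Tests the half planes where \<open>w * f\<close> has positive real part, for
  \<open>w\<close> among 1, -1, i, -i: if such a set is not null, it contains a compact set of
  positive measure, over which the integral cannot vanish.\<close>

lemma integral_compact_zero_imp_AE_zero:
 fixes f :: "'a::euclidean_space => complex"
 assumes f [measurable]: "f \<in> Bmeas"
  and int: "!!K. compact K ==> integrable lborel (%y. f y * indicator K y)"
  and zero: "!!K. compact K ==> (LINT y|lborel. f y * indicator K y) = 0"
 shows "AE y in lborel. f y = 0"
proof -
 have "AE y in lborel. Re (w * f y) <= 0" for w :: complex
 proof (rule ccontr)
  assume n: "~ (AE y in lborel. Re (w * f y) <= 0)"
  define S where "S n = {y. 0 < Re (w * f y)} \<inter> cball 0 (real n)" for n :: nat
  have Sm [measurable]: "S n \<in> sets borel" for n unfolding S_def by measurable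
  have "\<exists>n. emeasure lborel (S n) \<noteq> 0"
  proof (rule ccontr)
   assume "~ ?thesis"
   then have "(\<Union>n. S n) \<in> null_sets lborel" by (intro null_sets_UN) (auto simp: null_sets_def)
   moreover have "{y \<in> space lborel. ~ Re (w * f y) <= 0} \<subseteq> (\<Union>n. S n)"
    by (auto simp: S_def not_le intro: real_arch_simple)
   ultimately have "AE y in lborel. Re (w * f y) <= 0" by (rule AE_I')
   with n show False by simp
  qed
  then obtain n where n: "emeasure lborel (S n) \<noteq> 0" by blast
  have Sl: "S n \<in> lmeasurable" by (rule bounded_set_imp_lmeasurable) (auto simp: S_def)
  have pos: "0 < measure lebesgue (S n)"
   using n Sl emeasure_eq_measure2[OF Sl] by (auto simp: emeasure_completion zero_less_measure_iff)
  obtain T where T: "closed T" "T \<subseteq> S n" "S n - T \<in> lmeasurable" "emeasure lebesgue (S n - T) < ennreal (measure lebesgue (S n))"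
   using sets_lebesgue_inner_closed[of "S n" "measure lebesgue (S n)"] pos Sl by (auto dest: fmeasurableD)
  have Tc: "compact T" using T by (auto simp: compact_eq_bounded_closed S_def intro: bounded_subset[OF bounded_cball])
  have "~ T \<in> null_sets lborel"
  proof
   assume "T \<in> null_sets lborel"
   then have "T \<in> null_sets lebesgue" by (simp add: null_sets_completionI)
   then have "emeasure lebesgue (S n - T) = emeasure lebesgue (S n)"
    using Sl by (intro emeasure_Diff_null_set) (auto dest: fmeasurableD)
   then show False using T(4) emeasure_eq_measure2[OF Sl] by simp
  qed
  moreover have "T \<in> null_sets lborel"
  proof -
   have [measurable]: "T \<in> sets borel" using T(1) by simp
   have i: "integrable lborel (%y. w * (f y * indicator T y))" by (intro integrable_mult_right int Tc)
   have "(LINT y|lborel. Re (w * (f y * indicator T y))) = Re (LINT y|lborel. w * (f y * indicator T y))"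
    by (rule integral_Re[OF i])
   also have "... = 0" using zero[OF Tc] by simp
   finally have z: "(LINT y|lborel. Re (w * (f y * indicator T y))) = 0" .
   have "AE y in lborel. Re (w * (f y * indicator T y)) = 0"
   proof (rule integral_nonneg_eq_0_iff_AE[THEN iffD1, OF _ _ z])
    show "integrable lborel (%y. Re (w * (f y * indicator T y)))" using i by (rule integrable_Re)
    show "AE y in lborel. 0 <= Re (w * (f y * indicator T y))"
     using T(2) by (intro AE_I2) (force simp: S_def indicator_def)
   qed
   then have "AE y in lborel. y \<notin> T"
    by eventually_elim (use T(2) in \<open>force simp: S_def indicator_def\<close>)
   then show ?thesis by (subst (asm) AE_iff_null_sets[symmetric]) auto
  qed
  ultimately show False by blast
 qed
 from this[of 1] this[of "- 1"] this[of \<i>] this[of "- \<i>"] show ?thesis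
  by eventually_elim (simp add: complex_eq_iff)
qed

text \<open>The source of the lower bounds: a nonzero \<open>\<omega>\<close> has a nonzero heat
  flow. Indicators of compact sets are limits of continuous test functions, so a vanishing flow
  forces the density to have zero integral over every compact set.\<close>

lemma heat_Phi_injective:
 fixes \<omega> :: "'a::euclidean_space => complex"
 assumes \<omega>: "\<omega> \<in> Lmeas" "AE x in lebesgue. norm (\<omega> x) <= \<epsilon>" and \<epsilon>: "0 <= \<epsilon>"
  and \<sigma>: "0 < \<sigma>" "\<sigma> < real DIM('a)"
  and zero: "!!t. 0 < t ==> AE x in lebesgue. heat t (regular_distribution (Phi \<omega> \<sigma>)) x = 0"
 shows "AE x in lebesgue. \<omega> x = 0"
proof -
 obtain C where C: "0 < C"
  "(NN x. ennreal (norm (x::'a) powr (- \<sigma>) / (1 + norm x) ^ (2 * DIM('a)))) <= ennreal C"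
  by (rule power_weight_integral_finite[OF \<sigma>])
 obtain f where fm [measurable]: "f \<in> Bmeas" and f: "AE x in lborel. Phi \<omega> \<sigma> x = f x"
  by (rule complex_borel_version[OF Phi_measurable[OF \<omega>(1)]])
 have f': "AE x in lebesgue. Phi \<omega> \<sigma> x = f x" using f by (rule AE_completion)
 have transfer: "integrable lborel (%y. f y * h y)" "(LINT y|lborel. f y * h y) = (LINT y|lebesgue. Phi \<omega> \<sigma> y * h y)"
  if h [measurable]: "h \<in> Bmeas" and hb: "!!x. (1 + norm x) ^ (2 * DIM('a)) * norm (h x) <= B" and B: "0 <= B" for h :: "'a => complex" and B
 proof -
  note I = Phi_integrable(1)[OF \<omega> \<epsilon> C h hb B]
  have ae: "AE y in lebesgue. Phi \<omega> \<sigma> y * h y = f y * h y" using f' by eventually_elim simp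
  have m: "(%y. f y * h y) \<in> Lmeas" by (rule borel_imp_lebesgue_measurable) measurable
  have mP: "(%y. Phi \<omega> \<sigma> y * h y) \<in> Lmeas" using I by (rule borel_measurable_integrable)
  have "integrable lebesgue (%y. f y * h y)" by (rule integrable_cong_AE[THEN iffD1, OF mP m ae I])
  then show "integrable lborel (%y. f y * h y)" by (subst (asm) integrable_completion) auto
  have "(LINT y|lebesgue. Phi \<omega> \<sigma> y * h y) = (LINT y|lebesgue. f y * h y)"
   by (rule integral_cong_AE[OF mP m ae])
  also have "... = (LINT y|lborel. f y * h y)" by (rule integral_completion) auto
  finally show "(LINT y|lborel. f y * h y) = (LINT y|lebesgue. Phi \<omega> \<sigma> y * h y)" ..
 qed
 have decay: "\<exists>B\<ge>0. \<forall>y. (1 + norm y) ^ (2 * DIM('a)) * norm (complex_of_real (hk t (x - y))) <= B" if t: "0 < t" for t and x :: 'a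
 proof -
  have "bounded (range (%y. (1 + norm y) ^ (2 * DIM('a)) * norm (iterated_partial [] (%y. complex_of_real (hk t (x - y))) y)))"
   by (rule schwartzD(2)[OF heat_kernel_schwartz[OF t]]) simp
  then obtain B where B: "!!y. norm ((1 + norm y) ^ (2 * DIM('a)) * norm (complex_of_real (hk t (x - y)))) <= B"
   unfolding bounded_iff by auto
  have "0 <= B" using B[of 0] norm_ge_zero order_trans by blast
  moreover have "(1 + norm y) ^ (2 * DIM('a)) * norm (complex_of_real (hk t (x - y))) <= B" for y
   using B[of y] by simp
  ultimately show ?thesis by blast
 qed
 have W: "integrable lborel (%y. norm (f y) * hk 8 y)"
 proof -
  have "0 < (8::real)" by simp
  from decay[OF this, of 0]
  obtain B where B: "0 <= B & (\<forall>y::'a. (1 + norm y) ^ (2 * DIM('a)) * norm (complex_of_real (hk 8 (0 - y))) <= B)" ..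
  have "integrable lborel (%y. f y * complex_of_real (hk 8 (0 - y)))"
   by (rule transfer(1)[OF _ conjunct2[OF B, rule_format] conjunct1[OF B]]) measurable
  then have "integrable lborel (%y. norm (f y * complex_of_real (hk 8 (0 - y))))" by (rule integrable_norm)
  then show ?thesis by (simp add: norm_mult heat_kernel_minus)
 qed
 have z: "AE x in lborel. (LINT y|lborel. f y * of_real (hk t (x - y))) = 0" if t: "0 < t" for t
 proof -
  have "(LINT y|lborel. f y * of_real (hk t (x - y))) = heat t (regular_distribution (Phi \<omega> \<sigma>)) x" for x
  proof -
   from decay[OF t, of x]
   obtain B where B: "0 <= B & (\<forall>y. (1 + norm y) ^ (2 * DIM('a)) * norm (complex_of_real (hk t (x - y))) <= B)" ..
   show ?thesis unfolding heat_def regular_distribution_def by (rule transfer(2)[OF _ conjunct2[OF B, rule_format] conjunct1[OF B]]) measurable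
  qed
  then show ?thesis using zero[OF t] by (simp add: AE_completion_iff)
 qed
 have local_bound: "\<exists>k\<ge>0. \<forall>y::'a. norm y <= r --> 1 <= k * hk 8 y" for r
 proof -
  let ?k = "1 / ((32 * pi) powr (- (real DIM('a) / 2)) * exp (- r\<^sup>2 / 32))"
  have "1 <= ?k * hk 8 y" if "norm y <= r" for y :: 'a
  proof -
   have "(norm y)\<^sup>2 <= r\<^sup>2" using that by (intro power_mono) auto
   then have "(32 * pi) powr (- (real DIM('a) / 2)) * exp (- r\<^sup>2 / 32) <= hk 8 y"
    unfolding heat_kernel_def by (simp add: mult_left_mono)
   then show ?thesis by (simp add: field_simps)
  qed
  then show ?thesis by (intro exI[of _ ?k]) auto
 qed
 have "AE y in lborel. f y = 0"
 proof (rule integral_compact_zero_imp_AE_zero[OF fm])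
  fix K :: "'a set" assume K: "compact K"
  then obtain \<rho> where \<rho>: "!!x. x \<in> K ==> norm x <= \<rho>" using compact_imp_bounded bounded_iff by metis
  obtain k where k: "0 <= k" "!!y::'a. norm y <= \<rho> + 1 ==> 1 <= k * hk 8 y" using local_bound[of "\<rho> + 1"] by auto
  have [measurable]: "K \<in> sets borel" using K by (simp add: compact_imp_closed)
  have Wk: "integrable lborel (%y. k * (norm (f y) * hk 8 y))" by (intro integrable_mult_right W)
  have dom: "norm (f y * of_real u) <= k * (norm (f y) * hk 8 y)" if u: "0 <= u" "u <= 1" "\<rho> + 1 <= norm y ==> u = 0" for y u
  proof -
   have "u <= k * hk 8 y"
   proof (cases "\<rho> + 1 <= norm y")
    case True then show ?thesis using u k(1) by simp
   next
    case False then show ?thesis using u k(2)[of y] by simp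
   qed
   then have "norm (f y) * u <= norm (f y) * (k * hk 8 y)" by (intro mult_left_mono) auto
   then show ?thesis using u by (simp add: norm_mult mult_ac)
  qed
  have indb: "norm (f y * indicator K y) <= k * (norm (f y) * hk 8 y)" for y
  proof -
   have "(indicator K y :: complex) = of_real (indicator K y)" by (simp add: indicator_def)
   then show ?thesis using dom[of "indicator K y" y] \<rho>[of y] by (auto simp: indicator_def)
  qed
  show int: "integrable lborel (%y. f y * indicator K y)"
   by (rule Bochner_Integration.integrable_bound[OF Wk]) (use indb k(1) in \<open>auto intro!: AE_I2\<close>)
  show "(LINT y|lborel. f y * indicator K y) = 0"
  proof (cases "K = {}")
   case False
   \<comment> \<open>Continuous, equal to 1 on \<open>K\<close>, zero at distance 1 and beyond, and
     decreasing in \<open>n\<close> to the indicator of \<open>K\<close>.\<close>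
   define \<psi> where "\<psi> n x = max 0 (1 - real (Suc n) * infdist x K)" for n x
   have \<psi>c: "continuous_on UNIV (\<psi> n)" for n unfolding \<psi>_def by (intro continuous_intros)
   have [measurable]: "\<psi> n \<in> Bmeas" for n using \<psi>c by (rule borel_measurable_continuous_onI)
   have \<psi>01: "0 <= \<psi> n x" "\<psi> n x <= 1" for n x by (auto simp: \<psi>_def infdist_nonneg)
   have \<psi>0: "\<psi> n x = 0" if "\<rho> + 1 <= norm x" for n x
   proof -
    have "1 <= infdist x K"
     unfolding infdist_notempty[OF False]
    proof (rule cINF_greatest[OF False])
     fix a assume "a \<in> K"
     then show "1 <= dist x a" using \<rho>[of a] that norm_triangle_ineq2[of x a] by (simp add: dist_norm)
    qed
    then have "1 * 1 <= real (Suc n) * infdist x K" by (intro mult_mono) auto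
    then show ?thesis by (simp add: \<psi>_def)
   qed
   have "(%n. LINT y|lborel. f y * of_real (\<psi> n y)) \<longlonglongrightarrow> (LINT y|lborel. f y * indicator K y)"
   proof (rule integral_dominated_convergence[OF _ _ Wk])
    show "AE y in lborel. (%n. f y * of_real (\<psi> n y)) \<longlonglongrightarrow> f y * indicator K y"
    proof (rule AE_I2, rule tendsto_mult[OF tendsto_const])
     fix y
     show "(%n. complex_of_real (\<psi> n y)) \<longlonglongrightarrow> indicator K y"
     proof (cases "y \<in> K")
      case True
      then show ?thesis by (simp add: \<psi>_def)
     next
      case False
      then have pos: "0 < infdist y K"
       using \<open>K \<noteq> {}\<close> K by (metis compact_imp_closed in_closed_iff_infdist_zero infdist_nonneg less_eq_real_def)
      obtain N where N: "1 / infdist y K < real N" using reals_Archimedean2 by blast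
      have "\<psi> n y = 0" if "N <= n" for n
      proof -
       have "1 / infdist y K <= real (Suc n)" using N that by simp
       then have "1 <= real (Suc n) * infdist y K" using pos by (simp add: field_simps)
       then show ?thesis by (simp add: \<psi>_def)
      qed
      then have "eventually (%n. complex_of_real (\<psi> n y) = indicator K y) sequentially"
       using False by (auto simp: eventually_sequentially)
      then show ?thesis by (rule tendsto_eventually)
     qed
    qed
    show "AE y in lborel. norm (f y * of_real (\<psi> n y)) <= k * (norm (f y) * hk 8 y)" for n
     using \<psi>01 \<psi>0 by (intro AE_I2 dom) auto
   qed measurable
   moreover have "(LINT y|lborel. f y * of_real (\<psi> n y)) = 0" for n
    by (rule heat_test_function_zero[OF fm W z \<psi>c \<psi>01 \<psi>0])
   ultimately show ?thesis by (simp add: LIMSEQ_const_iff)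
  qed simp
 qed
 then have "AE x in lborel. \<omega> x = 0"
  using f AE_lborel_singleton[of "0::'a"]
  by eventually_elim (auto simp: Phi_def)
 then show ?thesis by (rule AE_completion)
qed

section \<open>Solutions: iterated integrals, rescaling, differences\<close>

lemma borel_measurable_lebesgue_AE:
 fixes f g :: "'a::euclidean_space => 'b::topological_space"
 assumes g: "g \<in> Lmeas" and eq: "AE x in lebesgue. f x = g x"
 shows "f \<in> Lmeas"
proof (rule measurableI)
 obtain Z where Z: "Z \<in> null_sets lebesgue" "{x. f x \<noteq> g x} \<subseteq> Z"
  using eq by (auto simp: eventually_ae_filter)
 fix A :: "'b set" assume A: "A \<in> sets borel"
 have "f -` A \<inter> space lebesgue = (g -` A \<inter> space lebesgue - Z) \<union> (f -` A \<inter> Z)" using Z(2) by auto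
 moreover have "g -` A \<inter> space lebesgue - Z \<in> sets lebesgue"
  using measurable_sets[OF g A] Z(1) by (intro sets.Diff) auto
 moreover have "f -` A \<inter> Z \<in> sets lebesgue"
  using null_sets_completion_subset[of "f -` A \<inter> Z" Z lborel] Z(1) by auto
 ultimately show "f -` A \<inter> space lebesgue \<in> sets lebesgue" by (metis sets.Un)
qed simp

text \<open>Lebesgue measure on a product is the completion of the product measure, so sections are
  controlled only for almost every \<open>r\<close>; the proof passes through a Borel version of
  \<open>f\<close>.\<close>

lemma lebesgue_Fubini_fst:
 fixes f :: "'a::euclidean_space \<times> 'b::euclidean_space => complex"
 assumes f: "integrable lebesgue f"
 shows "AE r in lebesgue. integrable lebesgue (%y. f (r, y))"
  and "integrable lebesgue (%r. LINT y|lebesgue. f (r, y))"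
proof -
 have fm: "f \<in> Lmeas" using f by (rule borel_measurable_integrable)
 obtain g where g: "g \<in> Bmeas" "AE z in lborel. f z = g z"
  by (rule complex_borel_version[OF fm])
 have gl: "integrable lebesgue g"
  using f borel_imp_lebesgue_measurable[OF g(1)] AE_completion[OF g(2)] fm
  by (subst (asm) integrable_cong_AE) auto
 then have gi: "integrable (lborel \<Otimes>\<^sub>M lborel) g"
  using g(1) by (subst (asm) integrable_completion) (auto simp: lborel_prod)
 have "AE z in lborel \<Otimes>\<^sub>M lborel. f z = g z" unfolding lborel_prod by (rule g(2))
 then have ae: "AE r in lborel. AE y in lborel. f (r, y) = g (r, y)" by (rule lborel_pair.AE_pair)
 have gm: "(%y. g (r, y)) \<in> Bmeas" for r
 proof -
  have "g \<in> borel_measurable (borel \<Otimes>\<^sub>M borel)" using g(1) by (simp add: borel_prod)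
  then show ?thesis by measurable
 qed
 have both: "AE r in lborel. integrable lebesgue (%y. f (r, y)) & (LINT y|lebesgue. f (r, y)) = (LINT y|lborel. g (r, y))"
  using ae lborel_pair.AE_integrable_fst'[OF gi]
 proof eventually_elim
  fix r assume eq: "AE y in lborel. f (r, y) = g (r, y)" and int: "integrable lborel (%y. g (r, y))"
  have eq': "AE y in lebesgue. f (r, y) = g (r, y)" by (rule AE_completion[OF eq])
  have gml: "(%y. g (r, y)) \<in> Lmeas" by (rule borel_imp_lebesgue_measurable[OF gm])
  have fml: "(%y. f (r, y)) \<in> Lmeas" by (rule borel_measurable_lebesgue_AE[OF gml eq'])
  have "integrable lebesgue (%y. g (r, y))" using int gm[of r] by (subst integrable_completion) auto
  then have "integrable lebesgue (%y. f (r, y))" by (rule integrable_cong_AE[THEN iffD2, OF fml gml eq'])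
  moreover have "(LINT y|lebesgue. f (r, y)) = (LINT y|lebesgue. g (r, y))" by (rule integral_cong_AE[OF fml gml eq'])
  moreover have "... = (LINT y|lborel. g (r, y))" using gm[of r] by (intro integral_completion) simp
  ultimately show "integrable lebesgue (%y. f (r, y)) & (LINT y|lebesgue. f (r, y)) = (LINT y|lborel. g (r, y))" by simp
 qed
 have "AE r in lborel. integrable lebesgue (%y. f (r, y))" using both by eventually_elim simp
 then show "AE r in lebesgue. integrable lebesgue (%y. f (r, y))" by (rule AE_completion)
 have "AE r in lborel. (LINT y|lebesgue. f (r, y)) = (LINT y|lborel. g (r, y))" using both by eventually_elim simp
 then have ae2: "AE r in lebesgue. (LINT y|lebesgue. f (r, y)) = (LINT y|lborel. g (r, y))" by (rule AE_completion)
 have i: "integrable lborel (%r. LINT y|lborel. g (r, y))" by (rule lborel_pair.integrable_fst'[OF gi])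
 then have il: "integrable lebesgue (%r. LINT y|lborel. g (r, y))"
  by (subst integrable_completion) auto
 then have ml: "(%r. LINT y|lborel. g (r, y)) \<in> Lmeas" by (rule borel_measurable_integrable)
 show "integrable lebesgue (%r. LINT y|lebesgue. f (r, y))"
  by (rule integrable_cong_AE[THEN iffD2, OF borel_measurable_lebesgue_AE[OF ml ae2] ml ae2 il])
qed

definition duhamel_source :: "real => real => (real => 'a::euclidean_space => complex) => real => 'a => real => 'a => complex" where
 "duhamel_source \<gamma> \<alpha> u t x r y = nonlinearity \<gamma> \<alpha> (u r) y * of_real (hk (t - r) (x - y))"

text \<open>The integral equation in iterated form with an arbitrary linear part \<open>H\<close> in
  place of a heat flow. This form is stable under rescaling and admits the zero solution with
  \<open>H = 0\<close>, to which a single solution is compared.\<close>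

definition mild_solution ::
  "real => real => real => (real => 'a::euclidean_space => complex) => (real => 'a => complex) => bool" where
 "mild_solution a \<gamma> \<alpha> H u \<longleftrightarrow> (\<forall>t>0. AE x in lebesgue.
   (AE r in lebesgue. r \<in> {0<..<t} --> integrable lebesgue (duhamel_source \<gamma> \<alpha> u t x r)) &
   integrable lebesgue (%r. indicator {0<..<t} r *\<^sub>R (LINT y|lebesgue. duhamel_source \<gamma> \<alpha> u t x r y)) &
   u t x = H t x + of_real a * (LINT r|lebesgue. indicator {0<..<t} r *\<^sub>R (LINT y|lebesgue. duhamel_source \<gamma> \<alpha> u t x r y)))"

lemma integral_solution_imp_mild:
 assumes "integral_solution a \<gamma> \<alpha> \<phi> u"
 shows "mild_solution a \<gamma> \<alpha> (%t. heat t \<phi>) u"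
 unfolding mild_solution_def
proof (intro allI impI)
 fix t :: real assume t: "0 < t"
 let ?S = "%x r. LINT y|lebesgue. duhamel_source \<gamma> \<alpha> u t x r y"
 have "AE x in lebesgue.
    set_integrable lebesgue ({0<..<t} \<times> UNIV)
     (%(r, y). of_real (hk (t - r) (x - y)) * nonlinearity \<gamma> \<alpha> (u r) y) &
    u t x = heat t \<phi> x + of_real a *
     (LINT r:{0<..<t}|lebesgue. heat (t - r) (regular_distribution (nonlinearity \<gamma> \<alpha> (u r))) x)"
  using assms t by (simp add: integral_solution_def)
 then show "AE x in lebesgue.
   (AE r in lebesgue. r \<in> {0<..<t} --> integrable lebesgue (duhamel_source \<gamma> \<alpha> u t x r)) &
   integrable lebesgue (%r. indicator {0<..<t} r *\<^sub>R ?S x r) &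
   u t x = heat t \<phi> x + of_real a * (LINT r|lebesgue. indicator {0<..<t} r *\<^sub>R ?S x r)"
 proof eventually_elim
  fix x
  assume *: "set_integrable lebesgue ({0<..<t} \<times> UNIV)
     (%(r, y). of_real (hk (t - r) (x - y)) * nonlinearity \<gamma> \<alpha> (u r) y) &
    u t x = heat t \<phi> x + of_real a *
     (LINT r:{0<..<t}|lebesgue. heat (t - r) (regular_distribution (nonlinearity \<gamma> \<alpha> (u r))) x)"
  let ?f = "%z. indicator ({0<..<t} \<times> UNIV) z *\<^sub>R (case z of (r, y) => of_real (hk (t - r) (x - y)) * nonlinearity \<gamma> \<alpha> (u r) y)"
  have i: "integrable lebesgue ?f" using * by (simp add: set_integrable_def)
  have eq: "(%y. ?f (r, y)) = (%y. indicator {0<..<t} r *\<^sub>R duhamel_source \<gamma> \<alpha> u t x r y)" for r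
   by (auto simp: duhamel_source_def indicator_def mult.commute)
  have "AE r in lebesgue. r \<in> {0<..<t} --> integrable lebesgue (duhamel_source \<gamma> \<alpha> u t x r)"
   using lebesgue_Fubini_fst(1)[OF i] unfolding eq by eventually_elim auto
  moreover have "integrable lebesgue (%r. indicator {0<..<t} r *\<^sub>R ?S x r)"
   using lebesgue_Fubini_fst(2)[OF i] unfolding eq by simp
  moreover have "u t x = heat t \<phi> x + of_real a * (LINT r|lebesgue. indicator {0<..<t} r *\<^sub>R ?S x r)"
   using * by (simp add: set_lebesgue_integral_def heat_def regular_distribution_def duhamel_source_def)
  ultimately show "(AE r in lebesgue. r \<in> {0<..<t} --> integrable lebesgue (duhamel_source \<gamma> \<alpha> u t x r)) &
   integrable lebesgue (%r. indicator {0<..<t} r *\<^sub>R ?S x r) &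
   u t x = heat t \<phi> x + of_real a * (LINT r|lebesgue. indicator {0<..<t} r *\<^sub>R ?S x r)" by blast
 qed
qed

lemma mild_solution_zero: "mild_solution a \<gamma> \<alpha> (%_ _. 0) (%_ _. 0)"
 by (simp add: mild_solution_def duhamel_source_def[abs_def] nonlinearity_def)

text \<open>The parabolic rescaling. With \<open>b = (2 + \<gamma>) / (\<alpha> - 1)\<close> it maps
  solutions to solutions; with \<open>b = \<sigma>\<close> it fixes the heat flow of
  \<open>Phi \<omega> \<sigma>\<close>, which is why \<open>b\<close> is left free.\<close>

definition rescaled :: "real => real => (real => 'a::euclidean_space => complex) => real => 'a => complex" where
 "rescaled b c u t x = of_real (c powr b) * u (c\<^sup>2 * t) (c *\<^sub>R x)"

lemma nonlinearity_measurable: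
 "v \<in> Lmeas ==> nonlinearity \<gamma> \<alpha> v \<in> Lmeas"
proof -
 assume v [measurable]: "v \<in> Lmeas"
 have [measurable]: "(%x::'a. norm x powr \<gamma>) \<in> Lmeas" by (rule borel_measurable_norm_powr_lebesgue)
 show ?thesis unfolding nonlinearity_def by measurable
qed

lemma mild_solution_rescaled:
 fixes u :: "real => 'a::euclidean_space => complex"
 assumes u: "mild_solution a \<gamma> \<alpha> H u" and m: "!!t. 0 < t ==> u t \<in> Lmeas"
  and c: "0 < c" and b: "b * (\<alpha> - 1) = 2 + \<gamma>"
 shows "mild_solution a \<gamma> \<alpha> (rescaled b c H) (rescaled b c u)"
 unfolding mild_solution_def
proof (intro allI impI)
 fix t :: real assume t: "0 < t"
 have c2: "0 < c\<^sup>2" using c by simp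
 let ?S = "%x r. LINT y|lebesgue. duhamel_source \<gamma> \<alpha> u (c\<^sup>2 * t) x r y"
 let ?I = "{0<..<t}" and ?I' = "{0<..<c\<^sup>2 * t}"
 have ind: "indicator ?I' (c\<^sup>2 *\<^sub>R r) = (indicator ?I r :: real)" for r
  using c by (auto simp: indicator_def zero_less_mult_iff)
 have src: "duhamel_source \<gamma> \<alpha> (rescaled b c u) t x r y
   = of_real (c powr (b + 2) * c ^ DIM('a)) * duhamel_source \<gamma> \<alpha> u (c\<^sup>2 * t) (c *\<^sub>R x) (c\<^sup>2 * r) (c *\<^sub>R y)" if r: "r < t" for x y r
 proof -
  have g: "c powr \<gamma> * norm y powr \<gamma> = norm (c *\<^sub>R y) powr \<gamma>" using c by (simp add: powr_mult)
  have "c powr (b + 2) = c powr (b * (\<alpha> - 1) + b - \<gamma>)" using b by (simp add: algebra_simps)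
  also have "... = c powr (b * (\<alpha> - 1)) * c powr b / c powr \<gamma>" by (simp add: powr_add powr_diff)
  finally have e: "c powr (b + 2) * c powr \<gamma> = c powr (b * (\<alpha> - 1)) * c powr b" using c by simp
  have "norm y powr \<gamma> * norm (complex_of_real (c powr b) * u (c\<^sup>2 * r) (c *\<^sub>R y)) powr (\<alpha> - 1) * c powr b
    = norm y powr \<gamma> * norm (u (c\<^sup>2 * r) (c *\<^sub>R y)) powr (\<alpha> - 1) * (c powr (b * (\<alpha> - 1)) * c powr b)"
   by (simp add: norm_mult powr_mult powr_powr mult_ac)
  also have "... = c powr (b + 2) * (norm (c *\<^sub>R y) powr \<gamma> * norm (u (c\<^sup>2 * r) (c *\<^sub>R y)) powr (\<alpha> - 1))"
   unfolding e[symmetric] g[symmetric] by (simp only: mult_ac)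
  finally have n: "nonlinearity \<gamma> \<alpha> (rescaled b c u r) y = of_real (c powr (b + 2)) * nonlinearity \<gamma> \<alpha> (u (c\<^sup>2 * r)) (c *\<^sub>R y)"
   unfolding nonlinearity_def rescaled_def mult.assoc[symmetric] of_real_mult[symmetric] by (simp only: mult.assoc)
  have "hk (c\<^sup>2 * (t - r)) (c *\<^sub>R (x - y)) = c powr (- real DIM('a)) * hk (t - r) (x - y)"
   by (rule heat_kernel_scale[OF c]) (use r in simp)
  then have k: "hk (t - r) (x - y) = c ^ DIM('a) * hk (c\<^sup>2 * t - c\<^sup>2 * r) (c *\<^sub>R x - c *\<^sub>R y)"
   using c by (simp add: right_diff_distrib scaleR_diff_right powr_minus powr_realpow field_simps)
  show ?thesis unfolding duhamel_source_def n k by simp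
 qed
 have "AE x in lebesgue.
   (AE r in lebesgue. r \<in> ?I' --> integrable lebesgue (duhamel_source \<gamma> \<alpha> u (c\<^sup>2 * t) x r)) &
   integrable lebesgue (%r. indicator ?I' r *\<^sub>R ?S x r) &
   u (c\<^sup>2 * t) x = H (c\<^sup>2 * t) x + of_real a * (LINT r|lebesgue. indicator ?I' r *\<^sub>R ?S x r)"
  using u t c2 unfolding mild_solution_def by simp
 from AE_lebesgue_scale[OF this c]
 show "AE x in lebesgue.
   (AE r in lebesgue. r \<in> ?I --> integrable lebesgue (duhamel_source \<gamma> \<alpha> (rescaled b c u) t x r)) &
   integrable lebesgue (%r. indicator ?I r *\<^sub>R (LINT y|lebesgue. duhamel_source \<gamma> \<alpha> (rescaled b c u) t x r y)) &
   rescaled b c u t x = rescaled b c H t x + of_real a * (LINT r|lebesgue. indicator ?I r *\<^sub>R (LINT y|lebesgue. duhamel_source \<gamma> \<alpha> (rescaled b c u) t x r y))"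
 proof eventually_elim
  fix x :: 'a
  let ?x = "c *\<^sub>R x"
  assume *: "(AE r in lebesgue. r \<in> ?I' --> integrable lebesgue (duhamel_source \<gamma> \<alpha> u (c\<^sup>2 * t) ?x r)) &
   integrable lebesgue (%r. indicator ?I' r *\<^sub>R ?S ?x r) &
   u (c\<^sup>2 * t) ?x = H (c\<^sup>2 * t) ?x + of_real a * (LINT r|lebesgue. indicator ?I' r *\<^sub>R ?S ?x r)"
  let ?g = "%r. indicator ?I' r *\<^sub>R ?S ?x r"
  have g: "integrable lebesgue ?g" using * by blast
  have "AE r in lebesgue. c\<^sup>2 *\<^sub>R r \<in> ?I' --> integrable lebesgue (duhamel_source \<gamma> \<alpha> u (c\<^sup>2 * t) ?x (c\<^sup>2 *\<^sub>R r))"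
   by (rule AE_lebesgue_scale[OF _ c2]) (use * in blast)
  then have 1: "AE r in lebesgue. r \<in> ?I --> integrable lebesgue (duhamel_source \<gamma> \<alpha> (rescaled b c u) t x r)"
  proof eventually_elim
   fix r :: real
   assume "c\<^sup>2 *\<^sub>R r \<in> ?I' --> integrable lebesgue (duhamel_source \<gamma> \<alpha> u (c\<^sup>2 * t) ?x (c\<^sup>2 *\<^sub>R r))"
   moreover have req: "duhamel_source \<gamma> \<alpha> (rescaled b c u) t x r
     = (%y. of_real (c powr (b + 2) * c ^ DIM('a)) * duhamel_source \<gamma> \<alpha> u (c\<^sup>2 * t) ?x (c\<^sup>2 * r) (c *\<^sub>R y))" if "r \<in> ?I"
    using that by (intro ext src) simp
   moreover have "c\<^sup>2 *\<^sub>R r \<in> ?I'" if "r \<in> ?I" using that c by simp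
   ultimately show "r \<in> ?I --> integrable lebesgue (duhamel_source \<gamma> \<alpha> (rescaled b c u) t x r)"
    using integrable_lebesgue_scale[OF _ c, of "duhamel_source \<gamma> \<alpha> u (c\<^sup>2 * t) ?x (c\<^sup>2 * r)"]
    req by auto
  qed
  have val: "(LINT y|lebesgue. duhamel_source \<gamma> \<alpha> (rescaled b c u) t x r y) = of_real (c powr (b + 2)) * ?S ?x (c\<^sup>2 * r)" if r: "r \<in> ?I" for r
  proof -
   have "u (c\<^sup>2 * r) \<in> Lmeas" using m r c by simp
   from nonlinearity_measurable[OF this, of \<gamma> \<alpha>]
   have [measurable]: "nonlinearity \<gamma> \<alpha> (u (c\<^sup>2 * r)) \<in> Lmeas" .
   have "(%y. hk (c\<^sup>2 * t - c\<^sup>2 * r) (?x - y)) \<in> Bmeas" unfolding heat_kernel_def by measurable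
   from borel_imp_lebesgue_measurable[OF this]
   have [measurable]: "(%y. hk (c\<^sup>2 * t - c\<^sup>2 * r) (?x - y)) \<in> Lmeas" .
   have "duhamel_source \<gamma> \<alpha> u (c\<^sup>2 * t) ?x (c\<^sup>2 * r) \<in> Lmeas"
    unfolding duhamel_source_def[abs_def] by measurable
   from lebesgue_integral_scale[OF this c] r show ?thesis
    by (simp add: src scaleR_conv_of_real)
  qed
  have eq: "indicator ?I r *\<^sub>R (LINT y|lebesgue. duhamel_source \<gamma> \<alpha> (rescaled b c u) t x r y) = of_real (c powr (b + 2)) * ?g (c\<^sup>2 *\<^sub>R r)" for r
   unfolding ind by (cases "r \<in> ?I") (simp_all only: val indicator_simps scaleR_one scaleR_zero_left real_scaleR_def mult_zero_right not_False_eq_True)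
  have 2: "integrable lebesgue (%r. indicator ?I r *\<^sub>R (LINT y|lebesgue. duhamel_source \<gamma> \<alpha> (rescaled b c u) t x r y))"
   unfolding eq by (intro integrable_mult_right integrable_lebesgue_scale[OF g c2])
  have "(LINT r|lebesgue. ?g r) = c\<^sup>2 ^ DIM(real) *\<^sub>R (LINT r|lebesgue. ?g (c\<^sup>2 *\<^sub>R r))"
   by (rule lebesgue_integral_scale[OF borel_measurable_integrable[OF g] c2])
  then have "(LINT r|lebesgue. ?g r) = of_real (c\<^sup>2) * (LINT r|lebesgue. ?g (c\<^sup>2 *\<^sub>R r))" (is "?A = _ * ?B")
   by (simp only: DIM_real power_one_right scaleR_conv_of_real)
  moreover have "c powr (b + 2) = c powr b * c\<^sup>2" using c by (simp add: powr_add powr_numeral)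
  ultimately have 3: "of_real (c powr b) * ?A = of_real (c powr (b + 2)) * ?B" by (simp only: of_real_mult mult.assoc)
  have ueq: "u (c\<^sup>2 * t) ?x = H (c\<^sup>2 * t) ?x + of_real a * ?A" using * by blast
  have "rescaled b c u t x = rescaled b c H t x + of_real a * (of_real (c powr b) * ?A)"
   unfolding rescaled_def ueq by (simp only: distrib_left mult_ac)
  also have "... = rescaled b c H t x + of_real a * (LINT r|lebesgue. indicator ?I r *\<^sub>R (LINT y|lebesgue. duhamel_source \<gamma> \<alpha> (rescaled b c u) t x r y))"
   unfolding eq 3 by (simp only: integral_mult_right_zero)
  finally show "(AE r in lebesgue. r \<in> ?I --> integrable lebesgue (duhamel_source \<gamma> \<alpha> (rescaled b c u) t x r)) &
   integrable lebesgue (%r. indicator ?I r *\<^sub>R (LINT y|lebesgue. duhamel_source \<gamma> \<alpha> (rescaled b c u) t x r y)) &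
   rescaled b c u t x = rescaled b c H t x + of_real a * (LINT r|lebesgue. indicator ?I r *\<^sub>R (LINT y|lebesgue. duhamel_source \<gamma> \<alpha> (rescaled b c u) t x r y))"
   using 1 2 by blast
 qed
qed

lemma powr_diff_le:
 fixes A B :: real
 assumes AB: "0 <= B" "B <= A" and \<alpha>: "1 < \<alpha>"
 shows "A powr \<alpha> - B powr \<alpha> <= \<alpha> * A powr (\<alpha> - 1) * (A - B)"
proof (cases "B = 0 \<or> B = A")
 case True
 have "A powr \<alpha> = A powr (\<alpha> - 1) * A" using AB by (cases "A = 0") (simp_all add: powr_diff)
 moreover have "0 <= (\<alpha> - 1) * (A powr (\<alpha> - 1) * A)" using AB \<alpha> by simp
 ultimately show ?thesis using True by (auto simp: algebra_simps)
next
 case False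
 then have B: "0 < B" "B < A" using AB by auto
 have "DERIV (%x. x powr \<alpha>) z :> \<alpha> * z powr (\<alpha> - 1)" if "B <= z" for z
  by (rule has_real_derivative_powr) (use that B in auto)
 then obtain z where z: "B < z" "z < A" "A powr \<alpha> - B powr \<alpha> = (A - B) * (\<alpha> * z powr (\<alpha> - 1))"
  using MVT2[OF B(2), of "%x. x powr \<alpha>" "%z. \<alpha> * z powr (\<alpha> - 1)"] by blast
 have "z powr (\<alpha> - 1) <= A powr (\<alpha> - 1)" using z B \<alpha> by (intro powr_mono2) auto
 then have "(A - B) * (\<alpha> * z powr (\<alpha> - 1)) <= (A - B) * (\<alpha> * A powr (\<alpha> - 1))"
  using B \<alpha> by (intro mult_left_mono) auto
 then show ?thesis using z(3) by (simp add: mult_ac)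
qed

text \<open>By symmetry \<open>norm b <= norm a\<close>. The difference is then
  \<open>|a|^(\<alpha> - 1) (a - b)\<close> plus
  \<open>(|a|^(\<alpha> - 1) - |b|^(\<alpha> - 1)) b\<close>; the second term is at most
  \<open>|a|^\<alpha> - |b|^\<alpha>\<close>, to which the mean value theorem applies. The two
  contributions give \<open>1 + \<alpha>\<close>.\<close>

lemma power_nonlinearity_diff:
 fixes a b :: complex
 assumes \<alpha>: "1 < \<alpha>"
 shows "norm (of_real (norm a powr (\<alpha> - 1)) * a - of_real (norm b powr (\<alpha> - 1)) * b)
  <= (\<alpha> + 1) * ((norm a + norm b) powr (\<alpha> - 1) * norm (a - b))"
proof -
 have main: "norm (of_real (norm a powr (\<alpha> - 1)) * a - of_real (norm b powr (\<alpha> - 1)) * b)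
  <= (\<alpha> + 1) * ((norm a + norm b) powr (\<alpha> - 1) * norm (a - b))" if le: "norm b <= norm a" for a b :: complex
 proof -
  let ?A = "norm a" and ?B = "norm b" and ?\<beta> = "\<alpha> - 1"
  have mono: "?B powr ?\<beta> <= ?A powr ?\<beta>" using le \<alpha> by (intro powr_mono2) auto
  have pB: "?B powr \<alpha> = ?B powr ?\<beta> * ?B" and pA: "?A powr \<alpha> = ?A powr ?\<beta> * ?A"
   by (cases "?B = 0"; simp add: powr_diff) (cases "?A = 0"; simp add: powr_diff)
  have "of_real (?A powr ?\<beta>) * a - of_real (?B powr ?\<beta>) * b
    = of_real (?A powr ?\<beta>) * (a - b) + of_real (?A powr ?\<beta> - ?B powr ?\<beta>) * b" by (simp add: algebra_simps)
  then have "norm (of_real (?A powr ?\<beta>) * a - of_real (?B powr ?\<beta>) * b)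
    <= norm (of_real (?A powr ?\<beta>) * (a - b)) + norm (of_real (?A powr ?\<beta> - ?B powr ?\<beta>) * b)" by (metis norm_triangle_ineq)
  also have "... = ?A powr ?\<beta> * norm (a - b) + (?A powr ?\<beta> - ?B powr ?\<beta>) * ?B"
   using mono by (simp only: norm_mult norm_of_real) simp
  also have "(?A powr ?\<beta> - ?B powr ?\<beta>) * ?B <= ?A powr \<alpha> - ?B powr \<alpha>"
   using mult_left_mono[OF le, of "?A powr ?\<beta>"] by (simp add: pA pB algebra_simps)
  also have "... <= \<alpha> * ?A powr ?\<beta> * (?A - ?B)" by (rule powr_diff_le) (use le \<alpha> in auto)
  also have "... <= \<alpha> * ?A powr ?\<beta> * norm (a - b)"
   using norm_triangle_ineq2[of a b] \<alpha> by (intro mult_left_mono) auto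
  finally have "norm (of_real (?A powr ?\<beta>) * a - of_real (?B powr ?\<beta>) * b) <= (\<alpha> + 1) * (?A powr ?\<beta> * norm (a - b))"
   by (simp add: algebra_simps)
  also have "... <= (\<alpha> + 1) * ((?A + ?B) powr ?\<beta> * norm (a - b))"
   using \<alpha> by (intro mult_left_mono mult_right_mono powr_mono2) auto
  finally show ?thesis .
 qed
 show ?thesis
 proof (cases "norm b <= norm a")
  case True then show ?thesis by (rule main)
 next
  case False
  then show ?thesis using main[of a b] by (simp add: norm_minus_commute add.commute)
 qed
qed

text \<open>The slices \<open>u t\<close> are Lebesgue measurable one by one; Tonelli for the source
  asks for a jointly Borel function, which has to agree with the slices only at almost every
  time.\<close>

definition borel_representable :: "(real => 'a::euclidean_space => complex) => (real \<times> 'a => complex) => bool" where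
 "borel_representable u g \<longleftrightarrow> (\<forall>t>0. u t \<in> Lmeas) & g \<in> Bmeas &
   (AE r in lebesgue. 0 < r --> (AE y in lebesgue. u r y = g (r, y)))"

text \<open>Local integrability gives joint measurability on compact sets of positive times, and
  these exhaust the half space.\<close>

lemma kato_space_representable:
 fixes u :: "real => 'a::euclidean_space => complex"
 assumes u: "u \<in> kato_space \<gamma> \<alpha> k p"
 shows "\<exists>g. borel_representable u g"
proof -
 let ?K = "%n. {1 / real (Suc n)..real (Suc n)} \<times> cball (0::'a) (real (Suc n))"
 let ?U = "%(t, x). u t x"
 have "set_integrable lebesgue (?K n) ?U" for n
 proof -
  have "compact (?K n)" by (intro compact_Times) auto
  moreover have "?K n \<subseteq> {0<..} \<times> UNIV" by (auto intro: less_le_trans[of 0 "1 / real (Suc n)"])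
  ultimately show ?thesis using u by (simp add: kato_space_def)
 qed
 then have m: "(%z. indicator (?K n) z *\<^sub>R ?U z) \<in> Lmeas" for n
  unfolding set_integrable_def by (rule borel_measurable_integrable)
 have lim: "(%n. indicator (?K n) z *\<^sub>R ?U z) \<longlonglongrightarrow> indicator ({0<..} \<times> UNIV) z *\<^sub>R ?U z" for z :: "real \<times> 'a"
 proof (cases "0 < fst z")
  case True
  define m where "m = nat \<lceil>max (max (1 / fst z) (fst z)) (norm (snd z))\<rceil>"
  have m: "max (max (1 / fst z) (fst z)) (norm (snd z)) <= real m" unfolding m_def by linarith
  have "\<forall>\<^sub>F n in sequentially. indicator ({0<..} \<times> UNIV) z *\<^sub>R ?U z = indicator (?K n) z *\<^sub>R ?U z"
  proof (rule eventually_sequentiallyI[of m])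
   fix n assume "m <= n"
   then have mn: "1 / fst z <= real (Suc n)" "fst z <= real (Suc n)" "norm (snd z) <= real (Suc n)" using m by auto
   then have "1 / real (Suc n) <= fst z" using True by (simp add: field_simps)
   then have "z \<in> ?K n" using mn by (cases z) auto
   moreover have "z \<in> {0<..} \<times> UNIV" using True by (cases z) auto
   ultimately show "indicator ({0<..} \<times> UNIV) z *\<^sub>R ?U z = indicator (?K n) z *\<^sub>R ?U z" by simp
  qed
  then show ?thesis by (intro tendsto_eventually) (simp only: eq_commute)
 next
  case False
  have "z \<notin> ?K n" for n
  proof
   assume "z \<in> ?K n"
   then have "1 / real (Suc n) <= fst z" by auto
   moreover have "0 < 1 / real (Suc n)" by simp
   ultimately show False using False by linarith
  qed
  moreover have "z \<notin> {0<..} \<times> UNIV" using False by (cases z) auto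
  ultimately show ?thesis by simp
 qed
 have "(%z. indicator ({0<..} \<times> (UNIV :: 'a set)) z *\<^sub>R ?U z) \<in> Lmeas"
  by (rule borel_measurable_LIMSEQ_metric[OF m lim])
 then obtain g where g: "g \<in> Bmeas" "AE z in lborel. indicator ({0<..} \<times> (UNIV :: 'a set)) z *\<^sub>R ?U z = g z"
  by (rule complex_borel_version)
 have "AE z in lborel \<Otimes>\<^sub>M lborel. indicator ({0<..} \<times> (UNIV :: 'a set)) z *\<^sub>R ?U z = g z"
  unfolding lborel_prod by (rule g(2))
 then have "AE r in lborel. AE y in lborel. indicator ({0<..} \<times> (UNIV :: 'a set)) (r, y) *\<^sub>R ?U (r, y) = g (r, y)"
  by (rule lborel_pair.AE_pair)
 then have "AE r in lborel. 0 < r --> (AE y in lebesgue. u r y = g (r, y))"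
  by eventually_elim (auto simp: AE_completion_iff indicator_def)
 then have "AE r in lebesgue. 0 < r --> (AE y in lebesgue. u r y = g (r, y))" by (rule AE_completion)
 moreover have "\<forall>t>0. u t \<in> Lmeas" using u by (simp add: kato_space_def)
 ultimately show ?thesis unfolding borel_representable_def using g(1) by blast
qed

lemma borel_representable_zero: "borel_representable (%_ _. 0) (%_. 0)"
 by (simp add: borel_representable_def)

lemma lebesgue_measurable_scale:
 fixes f :: "'a::euclidean_space => 'b::{topological_space}"
 assumes f: "f \<in> Lmeas" and c: "0 < c"
 shows "(%x. f (c *\<^sub>R x)) \<in> Lmeas"
 using lebesgue_measurable_scaling[of c] f by (rule measurable_compose)

lemma borel_representable_rescaled:
 fixes u :: "real => 'a::euclidean_space => complex"
 assumes u: "borel_representable u g" and c: "0 < c"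
 shows "borel_representable (rescaled b c u) (%z. of_real (c powr b) * g (c\<^sup>2 * fst z, c *\<^sub>R snd z))"
proof -
 have c2: "0 < c\<^sup>2" using c by simp
 have [measurable]: "g \<in> Bmeas" using u by (simp add: borel_representable_def)
 have "AE r in lebesgue. 0 < r --> (AE y in lebesgue. u r y = g (r, y))" using u by (simp add: borel_representable_def)
 from AE_lebesgue_scale[OF this c2]
 have "AE r in lebesgue. 0 < r --> (AE y in lebesgue. rescaled b c u r y = of_real (c powr b) * g (c\<^sup>2 * r, c *\<^sub>R y))"
 proof eventually_elim
  fix r :: real assume *: "0 < c\<^sup>2 *\<^sub>R r --> (AE y in lebesgue. u (c\<^sup>2 *\<^sub>R r) y = g (c\<^sup>2 *\<^sub>R r, y))"
  show "0 < r --> (AE y in lebesgue. rescaled b c u r y = of_real (c powr b) * g (c\<^sup>2 * r, c *\<^sub>R y))"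
  proof
   assume "0 < r"
   then have "AE y in lebesgue. u (c\<^sup>2 * r) y = g (c\<^sup>2 * r, y)" using * c2 by simp
   from AE_lebesgue_scale[OF this c]
   show "AE y in lebesgue. rescaled b c u r y = of_real (c powr b) * g (c\<^sup>2 * r, c *\<^sub>R y)"
    by eventually_elim (simp add: rescaled_def)
  qed
 qed
 moreover have "rescaled b c u t \<in> Lmeas" if "0 < t" for t
 proof -
  have "u (c\<^sup>2 * t) \<in> Lmeas" using u that c2 by (simp add: borel_representable_def)
  from lebesgue_measurable_scale[OF this c] show ?thesis unfolding rescaled_def[abs_def] by measurable
 qed
 moreover have "(%z. of_real (c powr b) * g (c\<^sup>2 * fst z, c *\<^sub>R snd z)) \<in> Bmeas"
 proof -
  have [measurable]: "(%z::real \<times> 'a. (c\<^sup>2 * fst z, c *\<^sub>R snd z)) \<in> Bmeas"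
   by (intro borel_measurable_continuous_onI continuous_intros)
  show ?thesis by measurable
 qed
 ultimately show ?thesis unfolding borel_representable_def by (simp only: fst_conv snd_conv) blast
qed

context kato_exponents
begin

text \<open>The system controls the difference of two solutions. The second conclusion bounds the
  nonlinear part of that difference alone, which the lower bounds and the linear case
  require.\<close>

lemma mild_solution_difference:
 fixes u1 u2 H1 H2 :: "real => 'a::euclidean_space => complex"
 assumes a: "a \<in> {-1, 1}" and mild: "mild_solution a \<gamma> \<alpha> H1 u1" "mild_solution a \<gamma> \<alpha> H2 u2"
  and rep: "borel_representable u1 g1" "borel_representable u2 g2"
  and H: "!!t. 0 < t ==> H1 t \<in> Lmeas" "!!t. 0 < t ==> H2 t \<in> Lmeas"
 obtains F where "duhamel_system F (%r y. norm (u1 r y) + norm (u2 r y)) (%r y. norm (u1 r y - u2 r y)) (%r y. norm (H1 r y - H2 r y))"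
  "!!t. 0 < t ==> AE x in lborel. ennreal (norm (u1 t x - u2 t x - (H1 t x - H2 t x))) <= duhamel {0<..<t} t F x"
proof -
 have [measurable]: "g1 \<in> Bmeas" "g2 \<in> Bmeas"
  using rep by (auto simp: borel_representable_def)
 have um: "u1 t \<in> Lmeas" "u2 t \<in> Lmeas" if "0 < t" for t
  using rep that by (auto simp: borel_representable_def)
 let ?N = "nonlinearity \<gamma> \<alpha>"
 \<comment> \<open>Built from the joint Borel versions, so that \<open>duhamel\<close> is
   measurable; at almost every time it is the modulus of the difference of the
   nonlinearities.\<close>
 define F where "F = (%z. norm (?N (%y. g1 (fst z, y)) (snd z) - ?N (%y. g2 (fst z, y)) (snd z)))"
 have Fm: "F \<in> Bmeas"
 proof -
  have [measurable]: "(snd :: real \<times> 'a => 'a) \<in> Bmeas"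
   by (intro borel_measurable_continuous_onI continuous_intros)
  show ?thesis unfolding F_def nonlinearity_def by (simp only: prod.collapse) measurable
 qed
 have F0: "0 <= F z" for z by (simp add: F_def)
 have ae: "AE r in lebesgue. 0 < r --> (AE y in lebesgue. F (r, y) = norm (?N (u1 r) y - ?N (u2 r) y))"
 proof -
  have "AE r in lebesgue. 0 < r --> (AE y in lebesgue. u1 r y = g1 (r, y))" "AE r in lebesgue. 0 < r --> (AE y in lebesgue. u2 r y = g2 (r, y))"
   using rep by (auto simp: borel_representable_def)
  then show ?thesis
  proof eventually_elim
   fix r :: real
   assume *: "0 < r --> (AE y in lebesgue. u1 r y = g1 (r, y))" "0 < r --> (AE y in lebesgue. u2 r y = g2 (r, y))"
   show "0 < r --> (AE y in lebesgue. F (r, y) = norm (?N (u1 r) y - ?N (u2 r) y))"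
   proof
    assume "0 < r"
    then have "AE y in lebesgue. u1 r y = g1 (r, y)" "AE y in lebesgue. u2 r y = g2 (r, y)" using * by auto
    then show "AE y in lebesgue. F (r, y) = norm (?N (u1 r) y - ?N (u2 r) y)"
     by eventually_elim (simp add: F_def nonlinearity_def)
   qed
  qed
 qed
 have Nle: "norm (?N (u1 r) y - ?N (u2 r) y) <= (\<alpha> + 1) * (norm y powr \<gamma> * (norm (u1 r y) + norm (u2 r y)) powr (\<alpha> - 1) * norm (u1 r y - u2 r y))" for r y
 proof -
  have "?N (u1 r) y - ?N (u2 r) y = of_real (norm y powr \<gamma>) * (of_real (norm (u1 r y) powr (\<alpha> - 1)) * u1 r y - of_real (norm (u2 r y) powr (\<alpha> - 1)) * u2 r y)"
   by (simp add: nonlinearity_def algebra_simps)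
  then have "norm (?N (u1 r) y - ?N (u2 r) y) = norm y powr \<gamma> * norm (of_real (norm (u1 r y) powr (\<alpha> - 1)) * u1 r y - of_real (norm (u2 r y) powr (\<alpha> - 1)) * u2 r y)"
   by (simp add: norm_mult)
  also have "... <= norm y powr \<gamma> * ((\<alpha> + 1) * ((norm (u1 r y) + norm (u2 r y)) powr (\<alpha> - 1) * norm (u1 r y - u2 r y)))"
   by (intro mult_left_mono power_nonlinearity_diff \<alpha>_gt_1) simp
  finally show ?thesis by (simp only: mult_ac)
 qed
 have maj: "majorises F (%r y. norm (u1 r y) + norm (u2 r y)) (%r y. norm (u1 r y - u2 r y))"
 proof -
  have "AE r in lborel. 0 < r --> (AE y in lebesgue. F (r, y) = norm (?N (u1 r) y - ?N (u2 r) y))"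
   using ae by (simp only: AE_completion_iff)
  then have "AE r in lborel. 0 < r --> (AE y in lebesgue. F (r, y) <= (\<alpha> + 1) * (norm y powr \<gamma> * (norm (u1 r y) + norm (u2 r y)) powr (\<alpha> - 1) * norm (u1 r y - u2 r y)))"
  proof eventually_elim
   fix r :: real assume *: "0 < r --> (AE y in lebesgue. F (r, y) = norm (?N (u1 r) y - ?N (u2 r) y))"
   show "0 < r --> (AE y in lebesgue. F (r, y) <= (\<alpha> + 1) * (norm y powr \<gamma> * (norm (u1 r y) + norm (u2 r y)) powr (\<alpha> - 1) * norm (u1 r y - u2 r y)))"
   proof
    assume "0 < r"
    then have "AE y in lebesgue. F (r, y) = norm (?N (u1 r) y - ?N (u2 r) y)" using * by blast
    then show "AE y in lebesgue. F (r, y) <= (\<alpha> + 1) * (norm y powr \<gamma> * (norm (u1 r y) + norm (u2 r y)) powr (\<alpha> - 1) * norm (u1 r y - u2 r y))"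
     by eventually_elim (simp only: Nle)
   qed
  qed
  then show ?thesis unfolding majorises_def using Fm F0 by blast
 qed
 have key: "AE x in lborel. ennreal (norm (u1 t x - u2 t x - (H1 t x - H2 t x))) <= duhamel {0<..<t} t F x" if t: "0 < t" for t
 proof -
  let ?I = "{0<..<t}"
  let ?S = "%u x r. LINT y|lebesgue. duhamel_source \<gamma> \<alpha> u t x r y"
  let ?P = "%u H x. (AE r in lebesgue. r \<in> ?I --> integrable lebesgue (duhamel_source \<gamma> \<alpha> u t x r)) &
   integrable lebesgue (%r. indicator ?I r *\<^sub>R ?S u x r) &
   u t x = H t x + of_real a * (LINT r|lebesgue. indicator ?I r *\<^sub>R ?S u x r)"
  have "AE x in lebesgue. ?P u1 H1 x" "AE x in lebesgue. ?P u2 H2 x" using mild t unfolding mild_solution_def by blast+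
  then have "AE x in lebesgue. ennreal (norm (u1 t x - u2 t x - (H1 t x - H2 t x))) <= duhamel ?I t F x"
  proof eventually_elim
   fix x assume P: "?P u1 H1 x" "?P u2 H2 x"
   let ?D = "%r. indicator ?I r *\<^sub>R ?S u1 x r - indicator ?I r *\<^sub>R ?S u2 x r"
   have i: "integrable lebesgue (%r. indicator ?I r *\<^sub>R ?S u1 x r)" "integrable lebesgue (%r. indicator ?I r *\<^sub>R ?S u2 x r)" using P by blast+
   have iD: "integrable lebesgue ?D" by (rule Bochner_Integration.integrable_diff[OF i])
   have "u1 t x - u2 t x - (H1 t x - H2 t x) = of_real a * ((LINT r|lebesgue. indicator ?I r *\<^sub>R ?S u1 x r) - (LINT r|lebesgue. indicator ?I r *\<^sub>R ?S u2 x r))"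
    using P by (simp add: algebra_simps)
   also have "... = of_real a * (LINT r|lebesgue. ?D r)" using i by simp
   finally have "norm (u1 t x - u2 t x - (H1 t x - H2 t x)) = norm (LINT r|lebesgue. ?D r)"
    using a by (auto simp: norm_mult)
   then have "ennreal (norm (u1 t x - u2 t x - (H1 t x - H2 t x))) <= (NL r. ennreal (norm (?D r)))"
    using integral_norm_bound_ennreal[OF iD] by simp
   also have "... <= (NL r. indicator ?I r * (NN y. ennreal (hk (t - r) (x - y) * F (r, y))))"
   proof (rule nn_integral_mono_AE)
    have "AE r in lebesgue. r \<in> ?I --> integrable lebesgue (duhamel_source \<gamma> \<alpha> u1 t x r)"
     "AE r in lebesgue. r \<in> ?I --> integrable lebesgue (duhamel_source \<gamma> \<alpha> u2 t x r)" using P by blast+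
    then show "AE r in lebesgue. ennreal (norm (?D r)) <= indicator ?I r * (NN y. ennreal (hk (t - r) (x - y) * F (r, y)))"
     using ae
    proof eventually_elim
     fix r assume s: "r \<in> ?I --> integrable lebesgue (duhamel_source \<gamma> \<alpha> u1 t x r)" "r \<in> ?I --> integrable lebesgue (duhamel_source \<gamma> \<alpha> u2 t x r)"
      and aeF: "0 < r --> (AE y in lebesgue. F (r, y) = norm (?N (u1 r) y - ?N (u2 r) y))"
     show "ennreal (norm (?D r)) <= indicator ?I r * (NN y. ennreal (hk (t - r) (x - y) * F (r, y)))"
     proof (cases "r \<in> ?I")
      case True
      then have s: "integrable lebesgue (duhamel_source \<gamma> \<alpha> u1 t x r)" "integrable lebesgue (duhamel_source \<gamma> \<alpha> u2 t x r)"
       and aeF: "AE y in lebesgue. F (r, y) = norm (?N (u1 r) y - ?N (u2 r) y)" using s aeF by auto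
      have "?D r = (LINT y|lebesgue. duhamel_source \<gamma> \<alpha> u1 t x r y - duhamel_source \<gamma> \<alpha> u2 t x r y)"
       using True s by simp
      then have "ennreal (norm (?D r)) <= (NL y. ennreal (norm (duhamel_source \<gamma> \<alpha> u1 t x r y - duhamel_source \<gamma> \<alpha> u2 t x r y)))"
       using integral_norm_bound_ennreal[OF Bochner_Integration.integrable_diff[OF s]] by simp
      also have "... = (NL y. ennreal (hk (t - r) (x - y) * F (r, y)))"
      proof (rule nn_integral_cong_AE)
       show "AE y in lebesgue. ennreal (norm (duhamel_source \<gamma> \<alpha> u1 t x r y - duhamel_source \<gamma> \<alpha> u2 t x r y)) = ennreal (hk (t - r) (x - y) * F (r, y))"
        using aeF
       proof eventually_elim
        fix y assume F: "F (r, y) = norm (?N (u1 r) y - ?N (u2 r) y)"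
        have "duhamel_source \<gamma> \<alpha> u1 t x r y - duhamel_source \<gamma> \<alpha> u2 t x r y = (?N (u1 r) y - ?N (u2 r) y) * of_real (hk (t - r) (x - y))"
         by (simp add: duhamel_source_def algebra_simps)
        then show "ennreal (norm (duhamel_source \<gamma> \<alpha> u1 t x r y - duhamel_source \<gamma> \<alpha> u2 t x r y)) = ennreal (hk (t - r) (x - y) * F (r, y))"
         using F by (simp add: norm_mult heat_kernel_nonneg mult.commute)
       qed
      qed
      also have "... = (NN y. ennreal (hk (t - r) (x - y) * F (r, y)))" by (rule nn_integral_completion)
      finally show ?thesis using True by simp
     qed simp
    qed
   qed
   also have "... = duhamel ?I t F x" unfolding duhamel_def by (rule nn_integral_completion)
   finally show "ennreal (norm (u1 t x - u2 t x - (H1 t x - H2 t x))) <= duhamel ?I t F x" .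
  qed
  then show ?thesis by (simp only: AE_completion_iff)
 qed
 have "duhamel_system F (%r y. norm (u1 r y) + norm (u2 r y)) (%r y. norm (u1 r y - u2 r y)) (%r y. norm (H1 r y - H2 r y))"
  unfolding duhamel_system_def
 proof (intro conjI allI impI maj)
  fix r :: real assume r: "0 < r"
  note [measurable] = um[OF r] H[OF r]
  show "(%y. norm (u1 r y) + norm (u2 r y)) \<in> Lmeas" "(%y. norm (u1 r y - u2 r y)) \<in> Lmeas"
   "(%y. norm (H1 r y - H2 r y)) \<in> Lmeas" by measurable
  show "AE x in lborel. ennreal (norm (u1 r x - u2 r x) - norm (H1 r x - H2 r x)) <= duhamel {0<..<r} r F x"
   using key[OF r]
  proof eventually_elim
   fix x assume "ennreal (norm (u1 r x - u2 r x - (H1 r x - H2 r x))) <= duhamel {0<..<r} r F x"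
   moreover have "ennreal (norm (u1 r x - u2 r x) - norm (H1 r x - H2 r x)) <= ennreal (norm (u1 r x - u2 r x - (H1 r x - H2 r x)))"
    by (intro ennreal_leI norm_triangle_ineq2)
   ultimately show "ennreal (norm (u1 r x - u2 r x) - norm (H1 r x - H2 r x)) <= duhamel {0<..<r} r F x" by (rule order_trans[rotated])
  qed
 qed auto
 then show thesis using that key by blast
qed

end

lemma weak_bound_triangle:
 fixes f g h :: "'a::euclidean_space => real"
 assumes f: "weak_bound Q A (%x. norm x powr K * f x)" and g: "weak_bound Q B (%x. norm x powr K * g x)"
  and Q: "0 <= Q" "Q <= 1" and m: "f \<in> Lmeas" "g \<in> Lmeas"
  and le: "!!x. h x <= f x + g x"
 shows "weak_bound Q (4 * (A + B)) (%x. norm x powr K * h x)"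
proof (rule weak_bound_AE_mono)
 show "weak_bound Q (4 * (A + B)) (%x. norm x powr K * f x + norm x powr K * g x)"
  by (intro weak_bound_add f g Q borel_measurable_times borel_measurable_norm_powr_lebesgue m)
 show "AE x in lebesgue. norm x powr K * h x <= norm x powr K * f x + norm x powr K * g x"
  using le by (intro AE_I2) (simp add: distrib_left[symmetric] mult_left_mono)
qed

lemma weak_bound_rescaled:
 fixes f :: "real => 'a::euclidean_space => complex"
 assumes f: "weak_bound Q N (%x. norm x powr K * norm (f (c\<^sup>2 * t) x))" and c: "0 < c"
 shows "weak_bound Q (c powr (b - K - real DIM('a) * Q) * N) (%x. norm x powr K * norm (rescaled b c f t x))"
proof -
 have "weak_bound Q (c powr (b - K) * (c powr (- real DIM('a) * Q) * N))
  (%x. c powr (b - K) * (norm (c *\<^sub>R x) powr K * norm (f (c\<^sup>2 * t) (c *\<^sub>R x))))"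
  by (intro weak_bound_cmult weak_bound_scale[OF f c]) simp
 moreover have "c powr (b - K) * (norm (c *\<^sub>R x) powr K * norm (f (c\<^sup>2 * t) (c *\<^sub>R x))) = norm x powr K * norm (rescaled b c f t x)" for x
  using c by (simp add: rescaled_def norm_mult powr_mult powr_diff)
 moreover have "c powr (b - K) * (c powr (- real DIM('a) * Q) * N) = c powr (b - K - real DIM('a) * Q) * N"
 proof -
  have e: "b - K - real DIM('a) * Q = (b - K) + - real DIM('a) * Q" by simp
  show ?thesis unfolding e powr_add by (simp only: mult.assoc)
 qed
 ultimately show ?thesis by (simp only:)
qed

text \<open>An a priori bound, however large, improves to \<open>2A\<close> by iterating \<open>X \<mapsto> A + X/2\<close>.\<close>

lemma absorb_half:
 fixes A X0 :: real
 assumes closed: "!!X L. (!!n::nat. P (X n)) ==> X \<longlonglongrightarrow> L ==> P L"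
  and step: "!!X. 0 < X ==> P X ==> P (A + X / 2)" and A: "0 < A" and X0: "0 < X0" "P X0"
 shows "P (2 * A)"
proof -
 define X where "X = rec_nat X0 (%_ x. A + x / 2)"
 have rec: "X 0 = X0" "X (Suc n) = A + X n / 2" for n by (simp_all add: X_def)
 have "0 < X n & P (X n)" for n
  by (induction n) (use X0 A step in \<open>auto simp: rec add_pos_pos\<close>)
 moreover have "X n = 2 * A + (X0 - 2 * A) * (1/2) ^ n" for n
  by (induction n) (auto simp: rec field_simps)
 then have "X = (%n. 2 * A + (X0 - 2 * A) * (1/2) ^ n)" by blast
 moreover have "(%n. 2 * A + (X0 - 2 * A) * (1/2) ^ n) \<longlonglongrightarrow> 2 * A + (X0 - 2 * A) * 0"
  by (intro tendsto_intros LIMSEQ_realpow_zero) auto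
 ultimately show ?thesis using closed[of X "2 * A"] by simp
qed

section \<open>Decay along the path: heat flows, admissible norms, absorption\<close>

context kato_exponents
begin

definition decays :: "real => real => (real => 'a::euclidean_space => real) => bool" where
 "decays N b f \<longleftrightarrow> (\<forall>t>0. weak_bound R (N * t powr (- b)) (%y. norm y powr k * f t y))"

text \<open>The rates along the path are the ones forced by parabolic scaling, so the single number
  \<open>b\<close> describes them all. The constants may vary with \<open>s'\<close> without any
  uniformity, as only the corners of the path are evaluated in the end.\<close>

definition path_decays :: "(real => real) => real => (real => 'a::euclidean_space => real) => bool" where
 "path_decays CP b f \<longleftrightarrow> (\<forall>t>0. \<forall>s'. 0 <= s' --> s' <= s -->
   weak_bound (pr s') (CP s' * t powr (- b - d / 2 * (s - s'))) (%y. norm y powr pw s' * f t y))"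

text \<open>The three arguments are the corners of the path that enter
  \<open>weak_bound_admissible\<close>.\<close>

definition adm_const :: "(real => real) => real" where
 "adm_const CP = 4 * (1 + unit_ball_vol d) * (CP 0 + CP (max (k / d) 0) + CP s)"

lemma decaysD: "decays N b f ==> 0 < t ==> weak_bound R (N * t powr (- b)) (%y. norm y powr k * f t y)"
 by (simp add: decays_def)

lemma path_decays_triangle:
 fixes f g h :: "real => 'a::euclidean_space => real"
 assumes f: "path_decays C1 b f" and g: "path_decays C2 b g"
  and m: "!!t. 0 < t ==> f t \<in> Lmeas" "!!t. 0 < t ==> g t \<in> Lmeas"
  and le: "!!t x. 0 < t ==> h t x <= f t x + g t x"
 shows "path_decays (%s'. 4 * (C1 s' + C2 s')) b h"
 unfolding path_decays_def
proof (intro allI impI)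
 fix t s' :: real assume t: "0 < t" and s': "0 <= s'" "s' <= s"
 let ?T = "t powr (- b - d / 2 * (s - s'))"
 have "weak_bound (pr s') (4 * (C1 s' * ?T + C2 s' * ?T)) (%y. norm y powr pw s' * h t y)"
 proof (rule weak_bound_triangle[OF _ _ pr_nonneg _ m le, OF _ _ _ t t t])
  show "pr s' <= 1" using pr_le[OF s'(2)] R_lt_1 by simp
 qed (use f g t s' in \<open>auto simp: path_decays_def\<close>)
 moreover have "4 * (C1 s' * ?T + C2 s' * ?T) = 4 * (C1 s' + C2 s') * ?T" by (simp add: algebra_simps)
 ultimately show "weak_bound (pr s') (4 * (C1 s' + C2 s') * ?T) (%y. norm y powr pw s' * h t y)" by simp
qed

text \<open>Weight and reciprocal exponent enter the dilation only through the homogeneity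
  \<open>s'\<close>, whose contribution cancels against the rate; hence one factor for the whole
  path.\<close>

lemma path_decays_rescaled:
 fixes f :: "real => 'a::euclidean_space => complex"
 assumes dim: "d = real DIM('a)" and f: "path_decays CP b (%t y. norm (f t y))" and c: "0 < c"
 shows "path_decays (%s'. CP s' * c powr (\<sigma> - d * s - 2 * b)) b (%t y. norm (rescaled \<sigma> c f t y))"
 unfolding path_decays_def
proof (intro allI impI)
 fix t s' :: real assume t: "0 < t" and s': "0 <= s'" "s' <= s"
 let ?e = "- b - d / 2 * (s - s')"
 have "weak_bound (pr s') (CP s' * (c\<^sup>2 * t) powr ?e) (%y. norm y powr pw s' * norm (f (c\<^sup>2 * t) y))"
  using f t s' c by (simp add: path_decays_def)
 from weak_bound_rescaled[where f = f and t = t, OF this c, of \<sigma>]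
 have w: "weak_bound (pr s') (c powr (\<sigma> - pw s' - d * pr s') * (CP s' * (c\<^sup>2 * t) powr ?e)) (%y. norm y powr pw s' * norm (rescaled \<sigma> c f t y))"
  by (simp only: dim)
 have "pw s' + d * pr s' = d * s'" using path_homogeneity[of s'] d_pos by (simp add: field_simps)
 then have e: "\<sigma> - pw s' - d * pr s' + 2 * ?e = \<sigma> - d * s - 2 * b" by (simp add: algebra_simps)
 have "(c\<^sup>2 * t) powr ?e = c powr (2 * ?e) * t powr ?e"
  using c by (simp only: powr_mult powr_powr[symmetric] powr_numeral)
 then have "c powr (\<sigma> - pw s' - d * pr s') * (CP s' * (c\<^sup>2 * t) powr ?e) = CP s' * c powr (\<sigma> - pw s' - d * pr s' + 2 * ?e) * t powr ?e"
  by (simp only: powr_add mult_ac)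
 then show "weak_bound (pr s') (CP s' * c powr (\<sigma> - d * s - 2 * b) * t powr ?e) (%y. norm y powr pw s' * norm (rescaled \<sigma> c f t y))"
  using w unfolding e by (simp only:)
qed

lemma path_decays_imp_decays: "path_decays CP b f ==> decays (CP s) b f"
 unfolding path_decays_def decays_def using s_nonneg pr_s pw_s by force

text \<open>Half of the time is spent on the assumed decay and half on smoothing:
  \<open>heat t\<close> is dominated by the kernel at time \<open>t/2\<close> applied to the modulus
  of \<open>heat (t/2)\<close>.\<close>

lemma path_decays_heat:
 assumes dim: "d = real DIM('a::euclidean_space)"
 shows "\<exists>CH. (\<forall>s'. 0 < CH s') & (\<forall>(\<phi> :: ('a => complex) => complex) N. tempered_distribution \<phi> --> 0 < N -->
   decays N b (%t y. norm (heat t \<phi> y)) --> path_decays (%s'. CH s' * N) b (%t y. norm (heat t \<phi> y)))"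
proof -
 let ?Q = "%s' C. \<forall>(\<phi> :: ('a => complex) => complex) N t. tempered_distribution \<phi> --> 0 < N -->
   decays N b (%t y. norm (heat t \<phi> y)) --> 0 < t -->
   weak_bound (pr s') (C * N * t powr (- b - d / 2 * (s - s'))) (%y. norm y powr pw s' * norm (heat t \<phi> y))"
 have "\<exists>C. 0 < C & (0 <= s' --> s' <= s --> ?Q s' C)" for s'
 proof (cases "0 <= s' & s' <= s")
  case False
  then show ?thesis by (intro exI[of _ 1]) auto
 next
  case True
  show ?thesis
  proof (rule heat_path_smoothing[OF dim, of s'], goal_cases)
   show "0 <= s'" "s' <= s" using True by auto
   case (3 C) note C = 3
   let ?e = "- b - d / 2 * (s - s')"
   let ?C = "C * (1/2) powr ?e"
   have "?Q s' ?C"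
   proof (intro allI impI)
    fix \<phi> :: "('a => complex) => complex" and N t :: real
    assume \<phi>: "tempered_distribution \<phi>" and N: "0 < N" and dec: "decays N b (%t y. norm (heat t \<phi> y))" and t: "0 < t"
    have t2: "0 < t / 2" using t by simp
    have "weak_bound (pr s') (C * (N * (t/2) powr (- b)) * (t/2) powr (- (d / 2 * (s - s')))) (%x. norm x powr pw s' * norm (heat t \<phi> x))"
    proof (rule C(2)[OF _ _ _ decaysD[OF dec t2] t2])
     have "continuous_on UNIV (heat (t/2) \<phi>)" by (rule heat_continuous_growth(1)[OF \<phi> t2])
     then show "(%y. norm (heat (t/2) \<phi> y)) \<in> Bmeas"
      by (intro borel_measurable_continuous_onI continuous_on_norm)
     show "AE x in lborel. ennreal (norm (heat t \<phi> x)) <= (NN y. ennreal (hk (t/2) (x - y) * norm (heat (t/2) \<phi> y)))"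
      using heat_semigroup_le[OF \<phi> t2 t2] by simp
    qed (use N t in auto)
    moreover have "(t/2) powr (- b) * (t/2) powr (- (d / 2 * (s - s'))) = (1/2) powr ?e * t powr ?e"
     by (simp add: powr_add[symmetric] powr_mult[symmetric])
    then have "C * (N * (t/2) powr (- b)) * (t/2) powr (- (d / 2 * (s - s'))) = ?C * N * t powr ?e"
     by (metis (no_types, lifting) mult.assoc mult.commute)
    ultimately show "weak_bound (pr s') (?C * N * t powr ?e) (%y. norm y powr pw s' * norm (heat t \<phi> y))" by (simp only:)
   qed
   moreover have "0 < ?C" using C(1) by simp
   ultimately show "\<exists>C. 0 < C & (0 <= s' --> s' <= s --> ?Q s' C)" by blast
  qed
 qed
 then have "\<forall>s'. \<exists>C. 0 < C & (0 <= s' --> s' <= s --> ?Q s' C)" by blast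
 from choice[OF this] obtain CH where CH: "!!s'. 0 < CH s'" "!!s'. 0 <= s' ==> s' <= s ==> ?Q s' (CH s')" by blast
 show ?thesis
 proof (intro exI[of _ CH] conjI allI impI CH(1))
  fix \<phi> :: "('a => complex) => complex" and N
  assume "tempered_distribution \<phi>" "0 < N" "decays N b (%t y. norm (heat t \<phi> y))"
  then show "path_decays (%s'. CH s' * N) b (%t y. norm (heat t \<phi> y))"
   unfolding path_decays_def using CH(2) by simp
 qed
qed

lemma duhamel_path_decays:
 assumes dim: "d = real DIM('a::euclidean_space)" and c': "c' < 1" and A: "0 < A" and CH: "!!s'. 0 < CH s'"
 shows "\<exists>CW. (\<forall>s'. 0 < CW s') & (\<forall>(F :: real \<times> 'a => real) V W H b B. duhamel_system F V W H --> 0 < B -->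
   0 <= (\<alpha> - 1) * \<theta> + b --> (\<alpha> - 1) * \<theta> + b <= c' --> decays A \<theta> V --> decays B b W -->
   path_decays (%s'. CH s' * B) b H --> path_decays (%s'. CW s' * B) b W)"
proof -
 define Q where "Q = (%s' C. \<forall>(F :: real \<times> 'a => real) V W H b B. duhamel_system F V W H --> 0 < B -->
   0 <= (\<alpha> - 1) * \<theta> + b --> (\<alpha> - 1) * \<theta> + b <= c' --> decays A \<theta> V --> decays B b W -->
   path_decays (%s'. CH s' * B) b H -->
   (\<forall>t>0. weak_bound (pr s') (C * B * t powr (- b - d / 2 * (s - s'))) (%y. norm y powr pw s' * W t y)))"
 have "\<exists>C. 0 < C & (0 <= s' --> s' <= s --> Q s' C)" for s'
 proof (cases "0 <= s' & s' <= s")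
  case False
  then show ?thesis by (intro exI[of _ 1]) auto
 next
  case True
  then have "0 <= s'" "s' <= s" by auto
  then have "\<exists>C>0. Q s' C"
   unfolding Q_def decays_def path_decays_def by (rule duhamel_bootstrap[where CH = CH, OF dim c' A CH])
  then show ?thesis by blast
 qed
 then have "\<forall>s'. \<exists>C. 0 < C & (0 <= s' --> s' <= s --> Q s' C)" by blast
 from choice[OF this] obtain CW where CW: "!!s'. 0 < CW s'" "!!s'. 0 <= s' ==> s' <= s ==> Q s' (CW s')" by blast
 show ?thesis
 proof (intro exI[of _ CW] conjI allI impI CW(1))
  fix F :: "real \<times> 'a => real" and V W H b B
  assume *: "duhamel_system F V W H" "0 < B" "0 <= (\<alpha> - 1) * \<theta> + b" "(\<alpha> - 1) * \<theta> + b <= c'" "decays A \<theta> V" "decays B b W"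
   "path_decays (%s'. CH s' * B) b H"
  have "weak_bound (pr s') (CW s' * B * t powr (- b - d / 2 * (s - s'))) (%y. norm y powr pw s' * W t y)"
   if "0 < t" "0 <= s'" "s' <= s" for t s'
   using CW(2)[OF that(2,3), unfolded Q_def, rule_format, OF * that(1)] .
  then show "path_decays (%s'. CW s' * B) b W" unfolding path_decays_def by blast
 qed
qed

lemma path_decays_admissible:
 fixes f :: "real => 'a::euclidean_space => real"
 assumes dim: "d = real DIM('a)" and f: "path_decays CP b f" and t: "0 < t" and CP: "!!s'. 0 < CP s'"
  and m: "f t \<in> Lmeas" and nn: "!!x. 0 <= f t x"
  and adm: "k' <= k" "0 <= R'" "R' <= R" "0 <= k' / d + R'"
 shows "weak_bound R' (adm_const CP * t powr (- b - d / 2 * (s - (k' / d + R')))) (%x. norm x powr k' * f t x)"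
proof -
 \<comment> \<open>With this \<open>?T\<close> the decay bound takes the form
   \<open>N * T powr s'\<close> expected by \<open>weak_bound_admissible\<close>.\<close>
 let ?T = "t powr (d / 2)" and ?S = "CP 0 + CP (max (k / d) 0) + CP s"
 let ?N = "?S * t powr (- b - d / 2 * s)"
 have S: "0 < ?S" by (intro add_pos_pos CP)
 have TT: "?N * ?T powr s' = ?S * t powr (- b - d / 2 * (s - s'))" for s'
  by (simp add: powr_powr powr_add[symmetric] algebra_simps)
 have "weak_bound R' (4 * (1 + unit_ball_vol d) * ?N * ?T powr (k' / d + R')) (%x. norm x powr k' * f t x)"
 proof (rule weak_bound_admissible[of "f t" R k, folded dim, folded s_def])
  fix s' assume s'2: "s' \<in> {0, max (k / d) 0, s}"
  have "max (k / d) 0 <= s" using s_nonneg R_nonneg by (simp add: s_def)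
  then have r: "0 <= s'" "s' <= s" using s'2 s_nonneg by auto
  have "CP s' <= ?S" using s'2 CP[of 0] CP[of s] CP[of "max (k / d) 0"] by auto
  then have "CP s' * t powr (- b - d / 2 * (s - s')) <= ?N * ?T powr s'" unfolding TT by (intro mult_right_mono) auto
  moreover have "weak_bound (pr s') (CP s' * t powr (- b - d / 2 * (s - s'))) (%y. norm y powr pw s' * f t y)"
   using f t r by (simp add: path_decays_def)
  ultimately show "weak_bound (path_recip d k s') (?N * ?T powr s') (%x. norm x powr path_weight d k s' * f t x)"
   unfolding pr_def pw_def by (rule weak_bound_mono[rotated])
 qed (use m nn R_nonneg R_lt_1 s_nonneg t S adm in auto)
 then show ?thesis unfolding adm_const_def by (simp only: mult.assoc TT[unfolded mult.assoc])
qed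

text \<open>The fixed point argument, run backwards: a difference of solutions is controlled by the
 difference of the linear parts as soon as the nonlinear term is a contraction.\<close>

lemma duhamel_absorb:
 assumes dim: "d = real DIM('a::euclidean_space)" and c': "c' < 1"
 shows "\<exists>CD>0. \<forall>(F :: real \<times> 'a => real) V W H A K b1 B1 b2 B2. duhamel_system F V W H --> 0 < A --> 0 < K --> 0 < B1 --> 0 <= B2 -->
   CD * A powr (\<alpha> - 1) <= 1 / 8 --> \<theta> <= b1 --> (\<alpha> - 1) * \<theta> + b1 <= c' --> \<theta> <= b2 --> (\<alpha> - 1) * \<theta> + b2 <= c' -->
   decays A \<theta> V --> decays K \<theta> W -->
   (\<forall>t>0. weak_bound R (B1 * t powr (- b1) + B2 * t powr (- b2)) (%y. norm y powr k * H t y)) -->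
   (\<forall>t>0. weak_bound R (8 * (B1 * t powr (- b1) + B2 * t powr (- b2))) (%y. norm y powr k * W t y))"
proof (rule duhamel_contraction[OF dim c'], goal_cases)
 case (1 C) note C = 1
 show ?thesis
 proof (intro exI[of _ C] conjI allI impI C(1))
  fix F :: "real \<times> 'a => real" and V W H and A K b1 B1 b2 B2 t :: real
  assume sys: "duhamel_system F V W H" and pos: "0 < A" "0 < K" "0 < B1" "0 <= B2" and small: "C * A powr (\<alpha> - 1) <= 1 / 8"
   and b1: "\<theta> <= b1" "(\<alpha> - 1) * \<theta> + b1 <= c'" and b2: "\<theta> <= b2" "(\<alpha> - 1) * \<theta> + b2 <= c'"
   and V: "decays A \<theta> V" and W: "decays K \<theta> W"
   and H: "\<forall>t>0. weak_bound R (B1 * t powr (- b1) + B2 * t powr (- b2)) (%y. norm y powr k * H t y)"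
   and t: "0 < t"
  note sysD = duhamel_systemD[OF sys]
  let ?g = "%t. B1 * t powr (- b1) + B2 * t powr (- b2)"
  have g: "0 < ?g r" if "0 < r" for r using pos that by (simp add: add_pos_nonneg)
  \<comment> \<open>The iteration runs on a bounded interval, because the a priori rate
    \<open>\<theta>\<close> is dominated by the target rate \<open>b1\<close> only there; doubling
    puts \<open>t\<close> inside.\<close>
  define T where "T = 2 * t"
  have T: "0 < T" "t < T" using t by (auto simp: T_def)
  let ?P = "%X. \<forall>r. 0 < r & r < T --> weak_bound R (X * ?g r) (%y. norm y powr k * W r y)"
  \<comment> \<open>The quasi-triangle constant 4 multiplies both the linear part and the Duhamel
    part; smallness 1/8 turns the latter into \<open>X / 2\<close>, so the map is \<open>X\<close>
    to \<open>4 + X / 2\<close>.\<close>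
  have "?P (2 * 4)"
  proof (rule absorb_half[where P = ?P])
   fix X :: "nat => real" and L assume "!!n. ?P (X n)" and lim: "X \<longlonglongrightarrow> L"
   then have "weak_bound R (X n * ?g r) (%y. norm y powr k * W r y)" if "0 < r" "r < T" for n r using that by blast
   then have "weak_bound R (L * ?g r) (%y. norm y powr k * W r y)" if "0 < r" "r < T" for r
    by (rule weak_bound_closed[OF _ tendsto_mult[OF lim tendsto_const]]) (use that in auto)
   then show "?P L" by blast
  next
   fix X :: real assume X: "0 < X" and P: "?P X"
   have \<theta>0: "0 <= (\<alpha> - 1) * \<theta>" using \<alpha>_gt_1 \<theta>_pos by simp
   show "?P (4 + X / 2)"
   proof (intro allI impI)
    fix r assume r: "0 < r & r < T"
    have w: "weak_bound R (C * A powr (\<alpha> - 1) * ((X * B1) * r powr ((\<alpha> - 1) * (\<theta> - \<theta>) - b1) + (X * B2) * r powr ((\<alpha> - 1) * (\<theta> - \<theta>) - b2)))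
     (%x. norm x powr k * (W r x - H r x))"
    proof (rule C(2)[OF sysD(1) _ sysD(2,3,5,6) pos(1)])
     fix r' assume "0 < r'" "r' < r"
     then have "weak_bound R (X * ?g r') (%y. norm y powr k * W r' y)" using P r by auto
     then show "weak_bound R (X * B1 * r' powr - b1 + X * B2 * r' powr - b2) (%y. norm y powr k * W r' y)"
      by (simp add: algebra_simps)
    qed (use pos X r \<theta>0 \<theta>_pos b1 b2 sysD(8) decaysD[OF V] in auto)
    have "C * A powr (\<alpha> - 1) * ((X * B1) * r powr ((\<alpha> - 1) * (\<theta> - \<theta>) - b1) + (X * B2) * r powr ((\<alpha> - 1) * (\<theta> - \<theta>) - b2))
      = C * A powr (\<alpha> - 1) * (X * ?g r)" by (simp add: algebra_simps)
    also have "... <= 1 / 8 * (X * ?g r)"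
     using small X g[of r] r by (intro mult_right_mono) auto
    finally have "weak_bound R (1 / 8 * (X * ?g r)) (%x. norm x powr k * (W r x - H r x))"
     by (rule weak_bound_mono[OF w])
    from weak_bound_add_diff[OF this H[rule_format] R_nonneg less_imp_le[OF R_lt_1] sysD(3,4)] r
    have "weak_bound R (4 * (1 / 8 * (X * ?g r) + ?g r)) (%x. norm x powr k * W r x)" by blast
    then show "weak_bound R ((4 + X / 2) * ?g r) (%x. norm x powr k * W r x)" by (simp add: algebra_simps)
   qed
  next
   \<comment> \<open>A starting constant, possibly huge, from \<open>r powr (- \<theta>) <= T powr
     (b1 - \<theta>) * r powr (- b1)\<close> for \<open>r < T\<close>.\<close>
   let ?X = "K * T powr (b1 - \<theta>) / B1"
   show "0 < ?X" using pos T by simp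
   show "?P ?X"
   proof (intro allI impI)
    fix r assume r: "0 < r & r < T"
    have "r powr (- \<theta>) = r powr (b1 - \<theta>) * r powr (- b1)" by (simp add: powr_add[symmetric])
    also have "... <= T powr (b1 - \<theta>) * r powr (- b1)" using r b1 by (intro mult_right_mono powr_mono2) auto
    finally have "K * r powr (- \<theta>) <= K * (T powr (b1 - \<theta>) * r powr (- b1))" using pos by (intro mult_left_mono) auto
    also have "... = ?X * (B1 * r powr (- b1))" using pos by simp
    also have "... <= ?X * ?g r" using pos T by (intro mult_left_mono) auto
    finally show "weak_bound R (?X * ?g r) (%y. norm y powr k * W r y)" using decaysD[OF W] r weak_bound_mono by blast
   qed
  qed simp
  then show "weak_bound R (8 * ?g t) (%y. norm y powr k * W t y)" using t T by simp
 qed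
qed

text \<open>Self-similarity turns a bound at time 1 into a bound at all times, through the dilation
  by \<open>1 / sqrt t\<close>.\<close>

lemma heat_Phi_decays_of_one:
 fixes \<omega> :: "'a::euclidean_space => complex"
 assumes dim: "d = real DIM('a)" and \<omega>: "\<omega> \<in> Lmeas" "homogeneous_degree_0 \<omega>"
  and \<Phi>: "\<Phi> = regular_distribution (Phi \<omega> \<sigma>)" and b: "b = (\<sigma> - d * s) / 2"
  and 1: "weak_bound R N (%y. norm y powr k * norm (heat 1 \<Phi> y))"
 shows "decays N b (%t y. norm (heat t \<Phi> y))"
  unfolding decays_def
proof (intro allI impI)
  fix t :: real assume t: "0 < t"
  define c where "c = 1 / sqrt t"
  have c: "0 < c" "c\<^sup>2 * t = 1" using t by (auto simp: c_def field_simps)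
  have "weak_bound R N (%y. norm y powr k * norm (heat (c\<^sup>2 * t) \<Phi> y))" unfolding c(2) by (rule 1)
  from weak_bound_rescaled[where f = "%t. heat t \<Phi>" and t = t, OF this c(1), of \<sigma>]
  have w: "weak_bound R (c powr (\<sigma> - k - d * R) * N) (%y. norm y powr k * norm (rescaled \<sigma> c (%t. heat t \<Phi>) t y))" by (simp only: dim)
  have "rescaled \<sigma> c (%t. heat t \<Phi>) t y = heat t \<Phi> y" for y
   unfolding rescaled_def \<Phi> heat_Phi_scale[OF \<omega> c(1) t] using c(1)
   by (simp add: mult.assoc[symmetric] of_real_mult[symmetric] powr_add[symmetric] del: of_real_mult)
  moreover have "c powr (\<sigma> - k - d * R) = t powr (- b)"
  proof -
   have "c = t powr (- (1/2))" using t by (simp add: c_def powr_minus powr_half_sqrt field_simps)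
   moreover have "\<sigma> - k - d * R = 2 * b" using d_pos by (simp add: b s_def field_simps)
   ultimately show ?thesis by (simp add: powr_powr)
  qed
  ultimately show "weak_bound R (N * t powr (- b)) (%y. norm y powr k * norm (heat t \<Phi> y))" using w by (simp add: mult_ac)
qed

text \<open>At time 1 both hypotheses have the same size, which bounds \<open>heat 1 \<Phi>\<close>
  by \<open>4 * (C + C)\<close>; self-similarity does the rest. The rate \<open>\<delta>\<close> may
  then be lowered to \<open>\<delta>'\<close>: for \<open>t <= 1\<close>, where this strengthens the
  claim, the bounds of the two flows at rate \<open>b\<close> are used instead, with
  \<open>36 = 4 * (1 + 8)\<close>.\<close>

lemma heat_Phi_decays:
 fixes \<omega> :: "'a::euclidean_space => complex" and \<phi> :: "('a => complex) => complex"
 assumes dim: "d = real DIM('a)" and \<omega>: "\<omega> \<in> Lmeas" "homogeneous_degree_0 \<omega>"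
  and \<Phi>: "\<Phi> = regular_distribution (Phi \<omega> \<sigma>)"
  and temp: "tempered_distribution \<phi>" "tempered_distribution \<Phi>"
  and b: "b = (\<sigma> - d * s) / 2" and C: "0 < C" and \<delta>: "0 < \<delta>'" "\<delta>' <= \<delta>"
  and dec: "decays C b (%t y. norm (heat t \<phi> y))" "decays C (b + \<delta>) (%t y. norm (heat t (%f. \<phi> f - \<Phi> f) y))"
 shows "decays (8 * C) b (%t y. norm (heat t \<Phi> y))"
  and "decays (36 * C) (b + \<delta>') (%t y. norm (heat t (%f. \<phi> f - \<Phi> f) y))"
proof -
 let ?\<psi> = "%f. \<phi> f - \<Phi> f"
 have \<psi>: "tempered_distribution ?\<psi>" by (rule tempered_distribution_diff[OF temp])
 have m: "(%y. norm (heat t \<zeta> y)) \<in> Lmeas" if "tempered_distribution \<zeta>" "0 < t" for \<zeta> :: "('a => complex) => complex" and t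
  using heat_continuous_growth(1)[OF that] by (intro borel_imp_lebesgue_measurable borel_measurable_continuous_onI continuous_on_norm)
 have 1: "weak_bound R (4 * (C + C)) (%y. norm y powr k * norm (heat 1 \<Phi> y))"
 proof (rule weak_bound_triangle[OF _ _ R_nonneg less_imp_le[OF R_lt_1] m[OF temp(1)] m[OF \<psi>]])
  show "weak_bound R C (%y. norm y powr k * norm (heat 1 \<phi> y))" "weak_bound R C (%y. norm y powr k * norm (heat 1 ?\<psi> y))"
   using decaysD[OF dec(1), of 1] decaysD[OF dec(2), of 1] by simp_all
  fix y show "norm (heat 1 \<Phi> y) <= norm (heat 1 \<phi> y) + norm (heat 1 ?\<psi> y)"
   using norm_triangle_ineq4[of "heat 1 \<phi> y" "heat 1 ?\<psi> y"] by (simp add: heat_def)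
 qed auto
 show dP: "decays (8 * C) b (%t y. norm (heat t \<Phi> y))"
  using heat_Phi_decays_of_one[OF dim \<omega> \<Phi> b 1] by simp
 show "decays (36 * C) (b + \<delta>') (%t y. norm (heat t ?\<psi> y))"
  unfolding decays_def
 proof (intro allI impI)
  fix t :: real assume t: "0 < t"
  show "weak_bound R (36 * C * t powr (- (b + \<delta>'))) (%y. norm y powr k * norm (heat t ?\<psi> y))"
  proof (cases "t <= 1")
   case True
   have "weak_bound R (4 * (C * t powr (- b) + 8 * C * t powr (- b))) (%y. norm y powr k * norm (heat t ?\<psi> y))"
    by (rule weak_bound_triangle[OF decaysD[OF dec(1) t] decaysD[OF dP t] R_nonneg less_imp_le[OF R_lt_1] m[OF temp(1) t] m[OF temp(2) t]])
     (simp add: heat_def norm_triangle_ineq4)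
   moreover have "t powr (- b) <= t powr (- (b + \<delta>'))" using True t \<delta> by (intro powr_mono') auto
   then have "C * t powr (- b) <= C * t powr (- (b + \<delta>'))" using C by simp
   then have "4 * (C * t powr (- b) + 8 * C * t powr (- b)) <= 36 * C * t powr (- (b + \<delta>'))" by simp
   ultimately show ?thesis by (rule weak_bound_mono)
  next
   case False
   have "t powr (- (b + \<delta>)) <= t powr (- (b + \<delta>'))" using False \<delta> by (intro powr_mono) auto
   then have "C * t powr (- (b + \<delta>)) <= 36 * C * t powr (- (b + \<delta>'))" using C by (intro mult_mono) auto
   then show ?thesis using decaysD[OF dec(2) t] weak_bound_mono by blast
  qed
 qed
qed

end

section \<open>Lower bounds for perturbations of a nonzero profile\<close>

text \<open>\<open>\<eta>\<close> is the optimal constant and \<open>E\<close> nearly attains it.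
  Cutting off neighbourhoods of the origin and of infinity keeps more than half of the measure; the
  4 combines this loss with a factor 2 for near optimality.\<close>

lemma weak_bound_attained:
 fixes f :: "'a::euclidean_space => real"
 assumes m: "f \<in> Lmeas" and nn: "!!x. 0 <= f x" and wb: "weak_bound R N f"
  and R: "0 <= R" "R <= 1" and nz: "~ (AE x in lebesgue. f x = 0)"
 obtains \<eta> l E n where "0 < \<eta>" "weak_bound R \<eta> f" "0 < l" "E \<in> lmeasurable" "0 < measure lebesgue E" "1 <= (n::real)"
  "!!x. x \<in> E ==> l < f x & norm x <= n & 1 / n <= norm x" "\<eta> <= 4 * (l * measure lebesgue E powr R)"
proof -
 define S where "S = {l * measure lebesgue E powr R | l E. 0 < l & E \<in> lmeasurable & (\<forall>x\<in>E. l < f x)}"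
 define \<eta> where "\<eta> = Sup S"
 have bdd: "bdd_above S" using wb by (intro bdd_aboveI[of _ N]) (auto simp: S_def weak_bound_def)
 have SI: "l * measure lebesgue E powr R \<in> S" if "0 < l" "E \<in> lmeasurable" "\<forall>x\<in>E. l < f x" for l E
  using that unfolding S_def by blast
 have S0: "0 \<in> S" using SI[of 1 "{}"] by simp
 have pos: "0 < \<eta>"
 proof -
  have "\<exists>n. emeasure lebesgue {x. 1 / real (Suc n) < f x} \<noteq> 0"
  proof (rule ccontr)
   assume "~ ?thesis"
   then have "{x. 1 / real (Suc n) < f x} \<in> null_sets lebesgue" for n using m by auto
   then have "(\<Union>n. {x. 1 / real (Suc n) < f x}) \<in> null_sets lebesgue" by (rule null_sets_UN)
   then have "AE x in lebesgue. x \<notin> (\<Union>n. {x. 1 / real (Suc n) < f x})" by (rule AE_not_in)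
   then have "AE x in lebesgue. f x = 0"
   proof eventually_elim
    fix x assume "x \<notin> (\<Union>n. {x. 1 / real (Suc n) < f x})"
    then have "~ 0 < f x" using nat_approx_posE[of "f x"] by force
    then show "f x = 0" using nn[of x] by simp
   qed
   with nz show False by simp
  qed
  then obtain n where n: "emeasure lebesgue {x. 1 / real (Suc n) < f x} \<noteq> 0" by blast
  then have "ennreal 0 < emeasure lebesgue {x. 1 / real (Suc n) < f x}" by (simp add: zero_less_iff_neq_zero)
  then obtain E where E: "E \<in> lmeasurable" "E \<subseteq> {x. 1 / real (Suc n) < f x}" "0 < measure lebesgue E"
   using lmeasurable_subset_measure_gt[of "{x. 1 / real (Suc n) < f x}" 0] superlevel_sets_lebesgue[OF m] by (metis order_refl)
  have "1 / real (Suc n) * measure lebesgue E powr R \<in> S" using E by (intro SI) auto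
  then have "1 / real (Suc n) * measure lebesgue E powr R <= \<eta>" unfolding \<eta>_def by (rule cSup_upper[OF _ bdd])
  moreover have "0 < 1 / real (Suc n) * measure lebesgue E powr R" using E(3) by simp
  ultimately show ?thesis by linarith
 qed
 have wb\<eta>: "weak_bound R \<eta> f"
  unfolding weak_bound_def \<eta>_def using cSup_upper[OF S0 bdd] cSup_upper[OF SI bdd] by blast
 have "\<exists>z\<in>S. \<eta> / 2 < z" unfolding \<eta>_def[symmetric]
  using less_cSupD[of S "\<eta> / 2"] S0 pos unfolding \<eta>_def by auto
 then obtain l E where E: "0 < l" "E \<in> lmeasurable" "\<forall>x\<in>E. l < f x" "\<eta> / 2 < l * measure lebesgue E powr R"
  unfolding S_def by blast
 have mE: "0 < measure lebesgue E"
 proof (rule ccontr)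
  assume "~ ?thesis"
  then have "measure lebesgue E = 0" using measure_nonneg[of lebesgue E] by linarith
  then show False using E(4) pos by simp
 qed
 let ?A = "%n. {x::'a. 1 / real (Suc n) <= norm x & norm x <= real (Suc n)}"
 have Am: "?A n \<in> sets lebesgue" for n
 proof -
  have "?A n \<in> sets borel" by measurable
  then show ?thesis by (simp add: sets_completionI_sets)
 qed
 have EA: "E \<inter> ?A n \<in> lmeasurable" for n using E(2) Am by (rule fmeasurable_Int_fmeasurable)
 have lim: "(%n. measure lebesgue (E \<inter> ?A n)) \<longlonglongrightarrow> measure lebesgue (\<Union>n. E \<inter> ?A n)"
 proof (rule Lim_measure_incseq)
  show "range (%n. E \<inter> ?A n) \<subseteq> sets lebesgue" using EA by (auto simp: fmeasurableD)
  show "incseq (%n. E \<inter> ?A n)"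
  proof (rule incseq_SucI)
   fix n
   have "1 / real (Suc (Suc n)) <= 1 / real (Suc n)" by (simp add: field_simps)
   then show "E \<inter> ?A n \<subseteq> E \<inter> ?A (Suc n)" by auto
  qed
  have "emeasure lebesgue (\<Union>n. E \<inter> ?A n) <= emeasure lebesgue E" using E(2) by (intro emeasure_mono) auto
  also have "... < \<infinity>" using fmeasurableD2[OF E(2)] by (simp add: top.not_eq_extremum del: emeasure_completion)
  finally show "emeasure lebesgue (\<Union>n. E \<inter> ?A n) \<noteq> \<infinity>" by simp
 qed
 have "(\<Union>n. E \<inter> ?A n) = E - {0}"
 proof (intro set_eqI iffI)
  fix x assume x: "x \<in> E - {0}"
  define m where "m = nat \<lceil>max (norm x) (1 / norm x)\<rceil>"
  have "max (norm x) (1 / norm x) <= real m" unfolding m_def by linarith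
  then have "norm x <= real (Suc m)" "1 / norm x <= real (Suc m)" by auto
  then have "x \<in> ?A m" using x by (auto simp: field_simps)
  then show "x \<in> (\<Union>n. E \<inter> ?A n)" using x by blast
 qed auto
 then have "measure lebesgue (\<Union>n. E \<inter> ?A n) = measure lebesgue E"
  using E(2) by (simp add: measure_Diff_null_set fmeasurableD)
 then have "\<forall>\<^sub>F n in sequentially. measure lebesgue E / 2 < measure lebesgue (E \<inter> ?A n)"
  using order_tendstoD(1)[OF lim, of "measure lebesgue E / 2"] mE by simp
 then obtain n where n: "measure lebesgue E / 2 < measure lebesgue (E \<inter> ?A n)"
  by (auto simp: eventually_sequentially)
 have "measure lebesgue E powr R <= 2 * measure lebesgue (E \<inter> ?A n) powr R"
 proof -
  have "measure lebesgue E powr R <= (2 * measure lebesgue (E \<inter> ?A n)) powr R" using n R mE by (intro powr_mono2) auto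
  also have "... = 2 powr R * measure lebesgue (E \<inter> ?A n) powr R" by (rule powr_mult)
  also have "... <= 2 * measure lebesgue (E \<inter> ?A n) powr R" using powr_mono[of R 1 2] R by (intro mult_right_mono) auto
  finally show ?thesis .
 qed
 then have "l * measure lebesgue E powr R <= l * (2 * measure lebesgue (E \<inter> ?A n) powr R)" using E(1) by (intro mult_left_mono) auto
 then have "\<eta> <= 4 * (l * measure lebesgue (E \<inter> ?A n) powr R)" using E(4) by simp
 then show thesis using that[OF pos wb\<eta> E(1) EA[of n], of "real (Suc n)"] n mE E(3) by simp
qed

text \<open>Any \<open>v\<close> close enough to a nonzero \<open>G\<close> is bounded below on half of a fixed set inside an
 annulus, where all the weights are comparable; this makes the lower bound uniform in \<open>k'\<close>, \<open>R'\<close>.\<close>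

lemma weak_bound_lower_stability:
 fixes G :: "'a::euclidean_space => complex"
 assumes m: "G \<in> Lmeas" and wb: "weak_bound R N0 (%x. norm x powr k * norm (G x))"
  and R: "0 <= R" "R <= 1" and nz: "~ (AE x in lebesgue. G x = 0)"
 obtains \<eta> L where "0 < \<eta>" "weak_bound R \<eta> (%x. norm x powr k * norm (G x))" "0 < L"
  "!!v k' R' N. [|v \<in> Lmeas; weak_bound R (\<eta> / 20) (%x. norm x powr k * norm (v x - G x));
    k' <= k; - real DIM('a) <= k'; 0 <= R'; R' <= 1; weak_bound R' N (%x. norm x powr k' * norm (v x))|] ==> L <= N"
proof -
 let ?f = "%x. norm x powr k * norm (G x)"
 have fm: "?f \<in> Lmeas" using m borel_measurable_norm_powr_lebesgue[of k, where 'a='a] by measurable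
 have nz': "~ (AE x in lebesgue. ?f x = 0)"
 proof
  assume "AE x in lebesgue. ?f x = 0"
  moreover have "AE x in (lebesgue :: 'a measure). x \<noteq> 0" using AE_completion[OF AE_lborel_singleton, of "0::'a"] by simp
  ultimately have "AE x in lebesgue. G x = 0" by eventually_elim auto
  with nz show False by simp
 qed
 obtain \<eta> l E n where \<eta>: "0 < \<eta>" "weak_bound R \<eta> ?f" and l: "0 < l" and E: "E \<in> lmeasurable" "0 < measure lebesgue E" and n: "1 <= (n::real)"
  and En: "!!x. x \<in> E ==> l < ?f x & norm x <= n & 1 / n <= norm x" and \<eta>l: "\<eta> <= 4 * (l * measure lebesgue E powr R)"
  by (rule weak_bound_attained[OF fm _ wb R nz']) auto
 \<comment> \<open>For \<open>norm x <= n\<close> and \<open>k'\<close> between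
   \<open>- DIM('a)\<close> and \<open>k\<close>, passing from weight \<open>k\<close> to weight
   \<open>k'\<close> costs at most this power of \<open>n\<close>; the half is what survives after
   subtracting \<open>v - G\<close>.\<close>
 define l' where "l' = l / 2 * n powr (- (k + real DIM('a)))"
 \<comment> \<open>The minimum bounds from below every power, with exponent in [0,1], of a measure
   of at least half that of \<open>E\<close>.\<close>
 define L where "L = l' * min 1 (measure lebesgue E / 2)"
 have l': "0 < l'" using l n by (simp add: l'_def)
 have L: "0 < L" using l' E(2) by (simp add: L_def)
 show thesis
 proof (rule that[OF \<eta> L])
  fix v :: "'a => complex" and k' R' N
  assume v: "v \<in> Lmeas" and near: "weak_bound R (\<eta> / 20) (%x. norm x powr k * norm (v x - G x))"
   and k': "k' <= k" "- real DIM('a) <= k'" and R': "0 <= R'" "R' <= 1" and N: "weak_bound R' N (%x. norm x powr k' * norm (v x))"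
  let ?h = "%x. norm x powr k * norm (v x - G x)"
  have hm: "?h \<in> Lmeas" using m v borel_measurable_norm_powr_lebesgue[of k, where 'a='a] by measurable
  let ?Bad = "E \<inter> {x. l / 2 < ?h x}"
  have Bad: "?Bad \<in> lmeasurable" using E(1) superlevel_sets_lebesgue[OF hm] by (rule fmeasurable_Int_fmeasurable)
  \<comment> \<open>Otherwise \<open>l * |E|^R\<close> would be at most
    \<open>4 * \<eta> / 20\<close>, against \<open>\<eta> <= 4 * l * |E|^R\<close>; this fixes the
    20.\<close>
  have small: "measure lebesgue ?Bad <= measure lebesgue E / 2"
  proof (rule ccontr)
   assume "~ ?thesis"
   then have gt: "measure lebesgue E <= 2 * measure lebesgue ?Bad" by simp
   have "measure lebesgue E powr R <= (2 * measure lebesgue ?Bad) powr R" using gt R by (intro powr_mono2) auto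
   also have "... = 2 powr R * measure lebesgue ?Bad powr R" by (rule powr_mult)
   also have "... <= 2 * measure lebesgue ?Bad powr R" using powr_mono[of R 1 2] R by (intro mult_right_mono) auto
   finally have "l * measure lebesgue E powr R <= l * (2 * measure lebesgue ?Bad powr R)" using l by (intro mult_left_mono) auto
   moreover have "l / 2 * measure lebesgue ?Bad powr R <= \<eta> / 20" using l by (intro weak_boundD[OF near _ Bad]) auto
   moreover have "0 < l * measure lebesgue E powr R" using l E(2) by simp
   ultimately show False using \<eta>l by simp
  qed
  let ?E = "E - ?Bad"
  have E': "?E \<in> lmeasurable" using E(1) Bad by (rule fmeasurable.Diff)
  have "measure lebesgue ?E = measure lebesgue E - measure lebesgue ?Bad"
   using E(1) Bad by (intro measurable_measure_Diff) (auto simp: fmeasurableD)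
  then have half: "measure lebesgue E / 2 <= measure lebesgue ?E" using small by simp
  have "l' < norm x powr k' * norm (v x)" if x: "x \<in> ?E" for x
  proof -
   note En' = En[of x]
   have xn: "norm x <= n" "0 < norm x" "l < ?f x"
    using En' x n by (auto intro: less_le_trans[of 0 "1 / n"])
   have "?f x <= norm x powr k * norm (v x) + ?h x"
    using norm_triangle_ineq4[of "v x" "v x - G x"] mult_left_mono[of "norm (G x)" "norm (v x) + norm (v x - G x)" "norm x powr k"]
    by (simp add: distrib_left)
   moreover have "?h x <= l / 2" using x by auto
   ultimately have gt: "l / 2 < norm x powr k * norm (v x)" using xn(3) by linarith
   have "n powr (- (k + real DIM('a))) <= n powr (k' - k)" using n k' by (intro powr_mono) auto
   also have "... <= norm x powr (k' - k)" using xn k' by (intro powr_mono2') auto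
   finally have le: "n powr (- (k + real DIM('a))) <= norm x powr (k' - k)" .
   have "l' <= l / 2 * norm x powr (k' - k)" unfolding l'_def using le l by (intro mult_left_mono) auto
   also have "... < norm x powr k * norm (v x) * norm x powr (k' - k)" using gt xn by (intro mult_strict_right_mono) auto
   also have "... = norm x powr k' * norm (v x)" using xn by (simp add: powr_diff)
   finally show ?thesis .
  qed
  then have "l' * measure lebesgue ?E powr R' <= N" by (intro weak_boundD[OF N l' E']) auto
  moreover have "min 1 (measure lebesgue E / 2) <= measure lebesgue ?E powr R'"
  proof -
   have "min 1 (measure lebesgue E / 2) <= min 1 (measure lebesgue E / 2) powr R'"
    using powr_mono'[of R' 1 "min 1 (measure lebesgue E / 2)"] R' E(2) by simp
   also have "... <= measure lebesgue ?E powr R'" using half E(2) R' by (intro powr_mono2) auto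
   finally show ?thesis .
  qed
  then have "L <= l' * measure lebesgue ?E powr R'" unfolding L_def using l' by (intro mult_left_mono) auto
  ultimately show "L <= N" by linarith
 qed
qed

section \<open>Comparison of small solutions\<close>

context kato_exponents
begin

text \<open>The counterpart of \<open>global_solution\<close> with an arbitrary linear part instead
  of a datum, so that it covers rescaled solutions and the zero solution.\<close>

definition kato_solution :: "real => real => (real => 'a::euclidean_space => complex) => (real => 'a => complex) => bool" where
 "kato_solution a M H u \<longleftrightarrow> mild_solution a \<gamma> \<alpha> H u & (\<exists>g. borel_representable u g) &
   (\<forall>t>0. H t \<in> Lmeas) & decays M \<theta> (%t y. norm (u t y))"

lemma kato_solution_zero: "0 <= M ==> kato_solution a M (%_ _. 0) (%_ _. 0)"
 unfolding kato_solution_def decays_def weak_bound_def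
 using mild_solution_zero borel_representable_zero by auto

lemma kato_solution_measurable: "kato_solution a M H u ==> 0 < t ==> u t \<in> Lmeas"
 and kato_solution_linear_measurable: "kato_solution a M H u ==> 0 < t ==> H t \<in> Lmeas"
 by (auto simp: kato_solution_def borel_representable_def)

lemma kato_solution_rescaled:
 fixes u :: "real => 'a::euclidean_space => complex"
 assumes dim: "d = real DIM('a)" and u: "kato_solution a M H u" and c: "0 < c" and \<sigma>: "\<sigma> * (\<alpha> - 1) = 2 + \<gamma>"
 shows "kato_solution a M (rescaled \<sigma> c H) (rescaled \<sigma> c u)"
proof -
 obtain g where g: "borel_representable u g" using u by (auto simp: kato_solution_def)
 have "mild_solution a \<gamma> \<alpha> (rescaled \<sigma> c H) (rescaled \<sigma> c u)"
  using u c \<sigma> kato_solution_measurable[OF u] by (intro mild_solution_rescaled) (auto simp: kato_solution_def)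
 moreover have "rescaled \<sigma> c H t \<in> Lmeas" if "0 < t" for t
 proof -
  have "H (c\<^sup>2 * t) \<in> Lmeas" using kato_solution_linear_measurable[OF u] that c by simp
  from lebesgue_measurable_scale[OF this c] show ?thesis unfolding rescaled_def[abs_def] by measurable
 qed
 moreover have "decays M \<theta> (%t y. norm (rescaled \<sigma> c u t y))"
  unfolding decays_def
 proof (intro allI impI)
  fix t :: real assume t: "0 < t"
  have "weak_bound R (M * (c\<^sup>2 * t) powr (- \<theta>)) (%y. norm y powr k * norm (u (c\<^sup>2 * t) y))"
   using u t c by (simp add: kato_solution_def decays_def)
  from weak_bound_rescaled[where f = u and t = t, OF this c, of \<sigma>]
  have w: "weak_bound R (c powr (\<sigma> - k - d * R) * (M * (c\<^sup>2 * t) powr (- \<theta>))) (%y. norm y powr k * norm (rescaled \<sigma> c u t y))"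
   by (simp only: dim)
  have "\<sigma> = (2 + \<gamma>) / (\<alpha> - 1)" using \<sigma> \<alpha>_gt_1 by (simp add: field_simps)
  then have "(2 + \<gamma>) / (2 * (\<alpha> - 1)) = \<sigma> / 2" by simp
  then have "\<theta> = \<sigma> / 2 - d / 2 * s" by (simp only: \<theta>_def)
  moreover have "d / 2 * s = k / 2 + d * R / 2" using d_pos by (simp add: s_def field_simps)
  ultimately have "\<sigma> - k - d * R = 2 * \<theta>" by linarith
  then have "c powr (\<sigma> - k - d * R) = (c\<^sup>2) powr \<theta>" using c by (simp add: powr_powr[symmetric] powr_numeral)
  then have "c powr (\<sigma> - k - d * R) * (M * (c\<^sup>2 * t) powr (- \<theta>)) = M * t powr (- \<theta>)"
   using c by (simp add: powr_mult powr_minus)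
  then show "weak_bound R (M * t powr (- \<theta>)) (%y. norm y powr k * norm (rescaled \<sigma> c u t y))" using w by (simp only:)
 qed
 ultimately show ?thesis unfolding kato_solution_def using borel_representable_rescaled[OF g c, of \<sigma>] by blast
qed

lemma kato_solutions_system:
 fixes u1 u2 :: "real => 'a::euclidean_space => complex"
 assumes a: "a \<in> {-1, 1}" and sol: "kato_solution a M H1 u1" "kato_solution a M H2 u2"
 obtains F where "duhamel_system F (%r y. norm (u1 r y) + norm (u2 r y)) (%r y. norm (u1 r y - u2 r y)) (%r y. norm (H1 r y - H2 r y))"
  "!!t. 0 < t ==> AE x in lborel. ennreal (norm (u1 t x - u2 t x - (H1 t x - H2 t x))) <= duhamel {0<..<t} t F x"
  "decays (8 * M) \<theta> (%r y. norm (u1 r y) + norm (u2 r y))" "decays (8 * M) \<theta> (%r y. norm (u1 r y - u2 r y))"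
proof -
 obtain g1 g2 where g: "borel_representable u1 g1" "borel_representable u2 g2" using sol unfolding kato_solution_def by blast
 have mild: "mild_solution a \<gamma> \<alpha> H1 u1" "mild_solution a \<gamma> \<alpha> H2 u2" using sol unfolding kato_solution_def by blast+
 obtain F where F: "duhamel_system F (%r y. norm (u1 r y) + norm (u2 r y)) (%r y. norm (u1 r y - u2 r y)) (%r y. norm (H1 r y - H2 r y))"
  "!!t. 0 < t ==> AE x in lborel. ennreal (norm (u1 t x - u2 t x - (H1 t x - H2 t x))) <= duhamel {0<..<t} t F x"
  by (rule mild_solution_difference[OF a mild g kato_solution_linear_measurable[OF sol(1)] kato_solution_linear_measurable[OF sol(2)]]) (assumption | rule that)+
 have dec: "decays M \<theta> (%t y. norm (u1 t y))" "decays M \<theta> (%t y. norm (u2 t y))" using sol by (auto simp: kato_solution_def)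
 have sum: "decays (8 * M) \<theta> h" if le: "!!t y. h t y <= norm (u1 t y) + norm (u2 t y)" for h
  unfolding decays_def
 proof (intro allI impI)
  fix t :: real assume t: "0 < t"
  have "weak_bound R (4 * (M * t powr (- \<theta>) + M * t powr (- \<theta>))) (%y. norm y powr k * h t y)"
   by (rule weak_bound_triangle[OF decaysD[OF dec(1) t] decaysD[OF dec(2) t] R_nonneg less_imp_le[OF R_lt_1] _ _ le])
    (use kato_solution_measurable[OF sol(1) t] kato_solution_measurable[OF sol(2) t] in measurable)
  then show "weak_bound R (8 * M * t powr (- \<theta>)) (%y. norm y powr k * h t y)" by (simp add: algebra_simps)
 qed
 show thesis by (rule that[OF F sum sum]) (auto simp: norm_triangle_ineq4)
qed

text \<open>Besides the absorption estimate, the nonlinear part of the difference is bounded with a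
  prescribed small factor \<open>\<kappa>\<close>, because the contraction constant tends to 0 with
  \<open>M\<close>. \<open>M0\<close> is fixed before the solutions and the rates.\<close>

lemma kato_solutions_close:
 assumes dim: "d = real DIM('a::euclidean_space)" and c': "c' < 1" and a: "a \<in> {-1, 1}" and \<kappa>: "0 < \<kappa>"
 obtains M0 where "0 < M0"
  "!!M (u1 :: real => 'a => complex) H1 u2 H2 B1 b1 B2 b2 t. [|0 < M; M <= M0; kato_solution a M H1 u1; kato_solution a M H2 u2;
    0 < B1; 0 <= B2; \<theta> <= b1; (\<alpha> - 1) * \<theta> + b1 <= c'; \<theta> <= b2; (\<alpha> - 1) * \<theta> + b2 <= c';
    !!t. 0 < t ==> weak_bound R (B1 * t powr (- b1) + B2 * t powr (- b2)) (%y. norm y powr k * norm (H1 t y - H2 t y)); 0 < t|] ==>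
    weak_bound R (8 * (B1 * t powr (- b1) + B2 * t powr (- b2))) (%y. norm y powr k * norm (u1 t y - u2 t y)) &
    weak_bound R (\<kappa> * (B1 * t powr (- b1) + B2 * t powr (- b2))) (%y. norm y powr k * norm (u1 t y - u2 t y - (H1 t y - H2 t y)))"
proof -
 have "\<exists>CD>0. \<forall>(F :: real \<times> 'a => real) V W H A K b1 B1 b2 B2. duhamel_system F V W H --> 0 < A --> 0 < K --> 0 < B1 --> 0 <= B2 -->
   CD * A powr (\<alpha> - 1) <= 1 / 8 --> \<theta> <= b1 --> (\<alpha> - 1) * \<theta> + b1 <= c' --> \<theta> <= b2 --> (\<alpha> - 1) * \<theta> + b2 <= c' -->
   decays A \<theta> V --> decays K \<theta> W -->
   (\<forall>t>0. weak_bound R (B1 * t powr (- b1) + B2 * t powr (- b2)) (%y. norm y powr k * H t y)) -->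
   (\<forall>t>0. weak_bound R (8 * (B1 * t powr (- b1) + B2 * t powr (- b2))) (%y. norm y powr k * W t y))" (is "\<exists>CD>0. ?AB CD")
  by (rule duhamel_absorb[OF dim c'])
 then obtain CD where CD: "0 < CD" "?AB CD" by (elim exE conjE) (rule that, assumption+)
 show thesis
 proof (rule duhamel_contraction[OF dim c'], goal_cases)
  case (1 C) note C = 1
  \<comment> \<open>A bound for \<open>(8 * M) powr (\<alpha> - 1)\<close> that meets both the
    absorption threshold 1/8 and the factor \<open>\<kappa>\<close>; \<open>8 * M\<close> is the
    decay constant of the sum of the two moduli.\<close>
  define z where "z = min (1 / (8 * CD)) (\<kappa> / (8 * C))"
  define M0 where "M0 = z powr (1 / (\<alpha> - 1)) / 8"
  have z: "0 < z" using C(1) CD(1) \<kappa> by (simp add: z_def)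
  have M0: "0 < M0" using z by (simp add: M0_def)
  show thesis
  proof (rule that[OF M0], goal_cases)
   case (1 M u1 H1 u2 H2 B1 b1 B2 b2 t)
   note M = 1(1,2) and sol = 1(3,4) and B = 1(5,6) and b1 = 1(7,8) and b2 = 1(9,10) and H = 1(11) and t = 1(12)
   let ?g = "%t. B1 * t powr (- b1) + B2 * t powr (- b2)"
   have "(8 * M) powr (\<alpha> - 1) <= (8 * M0) powr (\<alpha> - 1)" using M \<alpha>_gt_1 by (intro powr_mono2) auto
   also have "... = z" using z \<alpha>_gt_1 by (simp add: M0_def powr_powr)
   finally have small: "(8 * M) powr (\<alpha> - 1) <= z" .
   have s1: "CD * (8 * M) powr (\<alpha> - 1) <= 1 / 8"
   proof -
    have "CD * (8 * M) powr (\<alpha> - 1) <= CD * (1 / (8 * CD))" using small CD(1) by (intro mult_left_mono) (auto simp: z_def)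
    then show ?thesis using CD(1) by simp
   qed
   have s2: "8 * (C * (8 * M) powr (\<alpha> - 1)) <= \<kappa>"
   proof -
    have "C * (8 * M) powr (\<alpha> - 1) <= C * (\<kappa> / (8 * C))" using small C(1) by (intro mult_left_mono) (auto simp: z_def)
    then show ?thesis using C(1) by simp
   qed
   obtain F where F: "duhamel_system F (%r y. norm (u1 r y) + norm (u2 r y)) (%r y. norm (u1 r y - u2 r y)) (%r y. norm (H1 r y - H2 r y))"
    "!!t. 0 < t ==> AE x in lborel. ennreal (norm (u1 t x - u2 t x - (H1 t x - H2 t x))) <= duhamel {0<..<t} t F x"
    and dec: "decays (8 * M) \<theta> (%r y. norm (u1 r y) + norm (u2 r y))" "decays (8 * M) \<theta> (%r y. norm (u1 r y - u2 r y))"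
    by (rule kato_solutions_system[OF a sol]) (rule that)
   note sysD = duhamel_systemD[OF F(1)]
   have M8: "0 < 8 * M" using M by simp
   have W: "weak_bound R (8 * ?g t) (%y. norm y powr k * norm (u1 t y - u2 t y))" if "0 < t" for t
    using CD(2)[rule_format, OF F(1) M8 M8 B s1 b1 b2 dec H that] .
   have "weak_bound R (C * (8 * M) powr (\<alpha> - 1) * ((8 * B1) * t powr ((\<alpha> - 1) * (\<theta> - \<theta>) - b1) + (8 * B2) * t powr ((\<alpha> - 1) * (\<theta> - \<theta>) - b2)))
     (%x. norm x powr k * norm (u1 t x - u2 t x - (H1 t x - H2 t x)))"
   proof (rule C(2)[OF sysD(1) t sysD(2,3,5,6) M8 _ _ _ b1(2) _ b2(2) decaysD[OF dec(1)] _ F(2)[OF t]])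
    show "0 <= (\<alpha> - 1) * \<theta> + b1" "0 <= (\<alpha> - 1) * \<theta> + b2" using \<alpha>_gt_1 \<theta>_pos b1 b2 by simp_all
    fix r :: real assume "0 < r" "r < t"
    then show "weak_bound R (8 * B1 * r powr - b1 + 8 * B2 * r powr - b2) (%y. norm y powr k * norm (u1 r y - u2 r y))"
     using W[of r] by (simp add: algebra_simps)
   qed (use B in auto)
   moreover have "C * (8 * M) powr (\<alpha> - 1) * ((8 * B1) * t powr ((\<alpha> - 1) * (\<theta> - \<theta>) - b1) + (8 * B2) * t powr ((\<alpha> - 1) * (\<theta> - \<theta>) - b2))
     = 8 * (C * (8 * M) powr (\<alpha> - 1)) * ?g t" by (simp add: algebra_simps)
   moreover have "8 * (C * (8 * M) powr (\<alpha> - 1)) * ?g t <= \<kappa> * ?g t" using s2 B t by (intro mult_right_mono) auto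
   ultimately have "weak_bound R (\<kappa> * ?g t) (%x. norm x powr k * norm (u1 t x - u2 t x - (H1 t x - H2 t x)))"
    by (simp only: weak_bound_mono)
   then show ?case using W[OF t] by blast
  qed
 qed
qed

lemma kato_solutions_close_path:
 fixes CH :: "real => real"
 assumes dim: "d = real DIM('a::euclidean_space)" and c': "c' < 1" and a: "a \<in> {-1, 1}" and M: "0 < M" and CH: "!!s'. 0 < CH s'"
 obtains CW where "!!s'. 0 < CW s'"
  "!!(u1 :: real => 'a => complex) H1 u2 H2 B b. [|kato_solution a M H1 u1; kato_solution a M H2 u2; 0 < B; \<theta> <= b; (\<alpha> - 1) * \<theta> + b <= c';
    decays B b (%t y. norm (u1 t y - u2 t y)); path_decays (%s'. CH s' * B) b (%t y. norm (H1 t y - H2 t y))|] ==>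
    path_decays (%s'. CW s' * B) b (%t y. norm (u1 t y - u2 t y))"
proof -
 have M8: "0 < 8 * M" using M by simp
 have "\<exists>CW. (\<forall>s'. 0 < CW s') & (\<forall>(F :: real \<times> 'a => real) V W H b B. duhamel_system F V W H --> 0 < B -->
   0 <= (\<alpha> - 1) * \<theta> + b --> (\<alpha> - 1) * \<theta> + b <= c' --> decays (8 * M) \<theta> V --> decays B b W -->
   path_decays (%s'. CH s' * B) b H --> path_decays (%s'. CW s' * B) b W)" (is "\<exists>CW. ?AA CW & ?AB CW")
  by (rule duhamel_path_decays[where CH = CH, OF dim c' M8 CH])
 then obtain CW where CW: "\<forall>s'. 0 < CW s'" "?AB CW" by (elim exE conjE) (rule that, assumption+)
 show thesis
 proof (rule that[of CW])
  show "0 < CW s'" for s' using CW(1) by blast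
  fix u1 :: "real => 'a => complex" and H1 u2 H2 B b
  assume sol: "kato_solution a M H1 u1" "kato_solution a M H2 u2" and B: "0 < B" and b: "\<theta> <= b" "(\<alpha> - 1) * \<theta> + b <= c'"
   and *: "decays B b (%t y. norm (u1 t y - u2 t y))" "path_decays (%s'. CH s' * B) b (%t y. norm (H1 t y - H2 t y))"
  have b0: "0 <= (\<alpha> - 1) * \<theta> + b" using \<alpha>_gt_1 \<theta>_pos b by simp
  obtain F where F: "duhamel_system F (%r y. norm (u1 r y) + norm (u2 r y)) (%r y. norm (u1 r y - u2 r y)) (%r y. norm (H1 r y - H2 r y))"
   and dec: "decays (8 * M) \<theta> (%r y. norm (u1 r y) + norm (u2 r y))"
   by (rule kato_solutions_system[OF a sol]) (rule that)
  show "path_decays (%s'. CW s' * B) b (%t y. norm (u1 t y - u2 t y))"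
   using CW(2)[rule_format, OF F B b0 b(2) dec *] .
 qed
qed


lemma path_decays_cong:
 "(!!t y. 0 < t ==> f t y = g t y) ==> path_decays CP b f \<longleftrightarrow> path_decays CP b g"
 by (simp add: path_decays_def)

lemma heat_lebesgue_measurable:
 fixes \<phi> :: "('a::euclidean_space => complex) => complex"
 shows "tempered_distribution \<phi> ==> 0 < t ==> heat t \<phi> \<in> Lmeas"
 by (intro borel_imp_lebesgue_measurable borel_measurable_continuous_onI heat_continuous_growth(1))

text \<open>Everything is pulled back to time 1, where the stability lemma has constants independent
  of \<open>t\<close>; the profile there is nonzero by injectivity of the heat flow.\<close>

lemma self_similar_lower:
 fixes \<omega> :: "'a::euclidean_space => complex"
 assumes dim: "d = real DIM('a)" and \<omega>: "\<omega> \<in> Lmeas" "homogeneous_degree_0 \<omega>"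
  "AE x in lebesgue. norm (\<omega> x) <= \<epsilon>" "0 <= \<epsilon>" and \<sigma>: "0 < \<sigma>" "\<sigma> < d" and b: "b = (\<sigma> - d * s) / 2"
  and \<Phi>: "\<Phi> = regular_distribution (Phi \<omega> \<sigma>)"
  and wb: "decays N0 b (%t y. norm (heat t \<Phi> y))"
  and nz: "~ (AE x in lebesgue. \<omega> x = 0)"
 obtains \<eta> L where "0 < \<eta>" "decays \<eta> b (%t y. norm (heat t \<Phi> y))" "0 < L"
  "!!u t k' R' N. [|u \<in> Lmeas; 0 < t; weak_bound R (\<eta> / 20 * t powr (- b)) (%x. norm x powr k * norm (u x - heat t \<Phi> x));
    k' <= k; - d <= k'; 0 <= R'; R' <= 1; weak_bound R' N (%x. norm x powr k' * norm (u x))|] ==>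
    L * t powr (- ((\<sigma> - k' - d * R') / 2)) <= N"
proof -
 have temp: "tempered_distribution \<Phi>" unfolding \<Phi> by (rule tempered_regular_Phi[OF \<omega>(1,3,4)]) (use \<sigma> dim in auto)
 have scale: "heat t \<Phi> (c *\<^sub>R x) = of_real (c powr (- \<sigma>)) * heat 1 \<Phi> x" if "0 < c" "c\<^sup>2 = t" for c t x
  using heat_Phi_scale[OF \<omega>(1,2) that(1) zero_less_one, of \<sigma> x] that unfolding \<Phi> by simp
 have b2: "\<sigma> - k - d * R = 2 * b" using d_pos by (simp add: b s_def field_simps)
 let ?G = "heat 1 \<Phi>"
 have Gm: "?G \<in> Lmeas" by (rule heat_lebesgue_measurable[OF temp]) simp
 have wb1: "weak_bound R N0 (%x. norm x powr k * norm (?G x))" using decaysD[OF wb, of 1] by simp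
 have nzG: "~ (AE x in lebesgue. ?G x = 0)"
 proof
  assume G0: "AE x in lebesgue. ?G x = 0"
  have "AE x in lebesgue. heat t (regular_distribution (Phi \<omega> \<sigma>)) x = 0" if t: "0 < t" for t
  proof -
   have c: "0 < sqrt t" "(sqrt t)\<^sup>2 = t" "0 < 1 / sqrt t" using t by auto
   show ?thesis using AE_lebesgue_scale[OF G0 c(3)]
   proof eventually_elim
    fix x :: 'a assume "?G ((1 / sqrt t) *\<^sub>R x) = 0"
    then show "heat t (regular_distribution (Phi \<omega> \<sigma>)) x = 0"
     using scale[OF c(1,2), of "(1 / sqrt t) *\<^sub>R x"] c(1) unfolding \<Phi> by simp
   qed
  qed
  from heat_Phi_injective[OF \<omega>(1,3,4) \<sigma>(1) \<sigma>(2)[unfolded dim] this] nz show False by blast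
 qed
 obtain \<eta> L where \<eta>: "0 < \<eta>" "weak_bound R \<eta> (%x. norm x powr k * norm (?G x))" "0 < L"
  and low: "!!v k' R' N. [|v \<in> Lmeas; weak_bound R (\<eta> / 20) (%x. norm x powr k * norm (v x - ?G x));
    k' <= k; - real DIM('a) <= k'; 0 <= R'; R' <= 1; weak_bound R' N (%x. norm x powr k' * norm (v x))|] ==> L <= N"
  by (rule weak_bound_lower_stability[OF Gm wb1 R_nonneg less_imp_le[OF R_lt_1] nzG]) (rule that)
 show thesis
 proof (rule that[OF \<eta>(1) _ \<eta>(3)])
  show "decays \<eta> b (%t y. norm (heat t \<Phi> y))"
   by (rule heat_Phi_decays_of_one[OF dim \<omega>(1,2) \<Phi> b \<eta>(2)])
  fix u :: "'a => complex" and t k' R' N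
  assume u: "u \<in> Lmeas" and t: "0 < t"
   and near: "weak_bound R (\<eta> / 20 * t powr (- b)) (%x. norm x powr k * norm (u x - heat t \<Phi> x))"
   and k': "k' <= k" "- d <= k'" and R': "0 <= R'" "R' <= 1" and N: "weak_bound R' N (%x. norm x powr k' * norm (u x))"
  define c where "c = sqrt t"
  have c: "0 < c" "c\<^sup>2 = t" using t by (auto simp: c_def)
  have cp: "c powr e = t powr (e / 2)" for e using t by (simp add: c_def powr_half_sqrt[symmetric] powr_powr)
  let ?v = "%x. of_real (c powr \<sigma>) * u (c *\<^sub>R x)"
  have vm: "?v \<in> Lmeas" using lebesgue_measurable_scale[OF u c(1)] by measurable
  have "weak_bound R (\<eta> / 20) (%x. norm x powr k * norm (?v x - ?G x))"
  proof -
   let ?f = "%s x. u x - heat s \<Phi> x"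
   have "weak_bound R (\<eta> / 20 * t powr (- b)) (%x. norm x powr k * norm (?f (c\<^sup>2 * 1) x))" using near c(2) by simp
   from weak_bound_rescaled[where f = ?f and t = 1, OF this c(1), of \<sigma>]
   have w: "weak_bound R (c powr (\<sigma> - k - d * R) * (\<eta> / 20 * t powr (- b))) (%x. norm x powr k * norm (rescaled \<sigma> c ?f 1 x))" by (simp only: dim)
   have "c powr (\<sigma> - k - d * R) = t powr b" unfolding b2 cp by simp
   then have N: "c powr (\<sigma> - k - d * R) * (\<eta> / 20 * t powr (- b)) = \<eta> / 20" using t by (simp add: powr_minus)
   have "complex_of_real (c powr \<sigma>) * of_real (c powr (- \<sigma>)) = 1"
    using c(1) by (simp only: of_real_mult[symmetric] powr_add[symmetric]) simp
   then have "rescaled \<sigma> c ?f 1 x = ?v x - ?G x" for x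
    unfolding rescaled_def mult_1_right c(2) scale[OF c] right_diff_distrib mult.assoc[symmetric] by simp
   then show ?thesis using w unfolding N by (simp only:)
  qed
  moreover have "weak_bound R' (c powr (\<sigma> - k' - d * R') * N) (%x. norm x powr k' * norm (?v x))"
   using weak_bound_rescaled[where f = "%_. u" and t = 1, OF N c(1), of \<sigma>] by (simp only: dim rescaled_def)
  ultimately have "L <= c powr (\<sigma> - k' - d * R') * N" using low[OF vm] k' R' dim by blast
  then have "L <= t powr ((\<sigma> - k' - d * R') / 2) * N" by (simp only: cp)
  then show "L * t powr (- ((\<sigma> - k' - d * R') / 2)) <= N"
   using t by (simp add: powr_minus field_simps)
 qed
qed

text \<open>Extra decay from the potential: \<open>u\<close> is bounded at the rates
  \<open>\<theta>\<close> and \<open>b\<close>, hence at every rate in between. Using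
  \<open>v = \<theta> + \<delta>' / (\<alpha> - 1)\<close> for the factor \<open>V\<close> gains
  \<open>(\<alpha> - 1) * (v - \<theta>) = \<delta>'\<close> over the scale invariant rate, while
  \<open>u\<close> also enters as \<open>W\<close> with rate \<open>b\<close>. The upper bound on
  \<open>\<delta>'\<close> says \<open>v <= b\<close>.\<close>

lemma nonlinear_part_path_decays:
 fixes u :: "real => 'a::euclidean_space => complex"
 assumes dim: "d = real DIM('a)" and c': "c' < 1" and a: "a \<in> {-1, 1}" and M: "0 < M" and sol: "kato_solution a M H u"
  and C: "0 < C" and dec: "decays C b (%t y. norm (u t y))" and path: "path_decays K b (%t y. norm (u t y))" and K: "!!s'. 0 < K s'"
  and b: "\<theta> <= b" "(\<alpha> - 1) * \<theta> + b + \<delta>' <= c'" and \<delta>': "0 < \<delta>'" "\<delta>' <= (\<alpha> - 1) * (b - \<theta>)"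
 shows "\<exists>K'. (\<forall>s'. 0 < K' s') & path_decays K' (b + \<delta>') (%t y. norm (u t y - H t y))"
proof -
 define v where "v = \<theta> + \<delta>' / (\<alpha> - 1)"
 have v: "\<theta> <= v" "v <= b" "(\<alpha> - 1) * v = (\<alpha> - 1) * \<theta> + \<delta>'" "(\<alpha> - 1) * (\<theta> - v) = - \<delta>'"
  using \<delta>' \<alpha>_gt_1 by (auto simp: v_def field_simps)
 have "0 <= M" using M by simp
 from kato_solution_zero[OF this] have zero: "kato_solution a M (%_ _. 0) ((%_ _. 0) :: real => 'a => complex)" .
 obtain F where F: "duhamel_system F (%r y. norm (u r y) + norm (0::complex)) (%r y. norm (u r y - 0)) (%r y. norm (H r y - 0))"
  "!!t. 0 < t ==> AE x in lborel. ennreal (norm (u t x - 0 - (H t x - 0))) <= duhamel {0<..<t} t F x"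
  and dV: "decays (8 * M) \<theta> (%r y. norm (u r y) + norm (0::complex))"
  by (rule kato_solutions_system[OF a sol zero]) (rule that)
 have sys: "duhamel_system F (%r y. norm (u r y)) (%r y. norm (u r y)) (%r y. norm (H r y))" using F(1) by simp
 have F2: "AE x in lborel. ennreal (norm (u t x - H t x)) <= duhamel {0<..<t} t F x" if "0 < t" for t using F(2)[OF that] by simp
 have dV: "decays (8 * M) \<theta> (%r y. norm (u r y))" using dV by simp
 note sysD = duhamel_systemD[OF sys]
 define A where "A = max (8 * M) C"
 have A: "0 < A" using C by (simp add: A_def)
 have V: "weak_bound R (A * t powr (- v)) (%y. norm y powr k * norm (u t y))" if t: "0 < t" for t
 proof (cases "t <= 1")
  case True
  have "t powr (- \<theta>) <= t powr (- v)" using t True v by (intro powr_mono') auto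
  then have "8 * M * t powr (- \<theta>) <= A * t powr (- v)" using M by (intro mult_mono) (auto simp: A_def)
  then show ?thesis using decaysD[OF dV t] weak_bound_mono by blast
 next
  case False
  have "t powr (- b) <= t powr (- v)" using False v by (intro powr_mono) auto
  then have "C * t powr (- b) <= A * t powr (- v)" using C by (intro mult_mono) (auto simp: A_def)
  then show ?thesis using decaysD[OF dec t] weak_bound_mono by blast
 qed
 define Q where "Q = (%s' N. \<forall>t>0. weak_bound (pr s') (N * t powr (- (b + \<delta>') - d / 2 * (s - s'))) (%y. norm y powr pw s' * norm (u t y - H t y)))"
 define \<eta> where "\<eta> = (1 - \<beta>) / d"
 have \<eta>: "0 < \<eta>" using \<beta>_bounds d_pos by (simp add: \<eta>_def)
 have "\<exists>N. 0 < N & (0 <= s2 --> s2 <= s --> Q s2 N)" for s2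
 proof (cases "0 <= s2 & s2 <= s")
  case False
  then show ?thesis by (intro exI[of _ 1]) auto
 next
  case True
  \<comment> \<open>One step is enough: \<open>u\<close> is already bounded along the whole path, so
    \<open>s1\<close> only has to be within \<open>\<eta>\<close> of \<open>s2\<close>.\<close>
  define s1 where "s1 = min s (s2 + \<eta>)"
  have s1: "0 <= s1" "s2 <= s1" "s1 <= s" using True \<eta> by (auto simp: s1_def)
  have gain: "\<beta> + d / 2 * (s1 - s2) < 1"
  proof -
   have "d / 2 * (s1 - s2) <= d / 2 * \<eta>" using d_pos by (intro mult_left_mono) (auto simp: s1_def)
   also have "... = (1 - \<beta>) / 2" using d_pos by (simp add: \<eta>_def)
   finally show ?thesis using \<beta>_bounds by (simp add: field_simps)
  qed
  define B where "B = K s + K s1"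
  have B: "0 < B" using K by (simp add: B_def add_pos_pos)
  show ?thesis
  proof (rule duhamel_step[OF dim c' _ s1(2,3) gain], goal_cases)
   show "0 <= s2" using True by simp
   case (2 C2) note C2 = 2
   let ?N = "C2 * A powr (\<alpha> - 1) * B"
   have "Q s2 ?N"
    unfolding Q_def
   proof (intro allI impI)
    fix t :: real assume t: "0 < t"
    have "weak_bound (pr s2) (?N * t powr ((\<alpha> - 1) * (\<theta> - v) - b - d / 2 * (s - s2))) (%x. norm x powr pw s2 * norm (u t x - H t x))"
    proof (rule C2(2)[OF sysD(1) t sysD(2,3,5,6) A B _ _ V _ _ F2[OF t]])
     show "0 <= (\<alpha> - 1) * v + b" using \<alpha>_gt_1 \<theta>_pos v(1) b(1) by simp
     show "(\<alpha> - 1) * v + b <= c'" using v(3) b(2) by simp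
     fix r :: real assume r: "0 < r"
     have "K s * r powr (- b) <= B * r powr (- b)" using K[of s1] by (intro mult_right_mono) (auto simp: B_def)
     then show "weak_bound R (B * r powr (- b)) (%y. norm y powr k * norm (u r y))"
      using decaysD[OF path_decays_imp_decays[OF path] r] weak_bound_mono by blast
     have "K s1 * r powr (- b - d / 2 * (s - s1)) <= B * r powr (- b - d / 2 * (s - s1))" using K[of s] by (intro mult_right_mono) (auto simp: B_def)
     moreover have "weak_bound (pr s1) (K s1 * r powr (- b - d / 2 * (s - s1))) (%y. norm y powr pw s1 * norm (u r y))"
      using path r s1 by (simp add: path_decays_def)
     ultimately show "weak_bound (pr s1) (B * r powr (- b - d / 2 * (s - s1))) (%y. norm y powr pw s1 * norm (u r y))"
      by (rule weak_bound_mono[rotated])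
    qed
    moreover have "(\<alpha> - 1) * (\<theta> - v) - b - d / 2 * (s - s2) = - (b + \<delta>') - d / 2 * (s - s2)" using v(4) by simp
    ultimately show "weak_bound (pr s2) (?N * t powr (- (b + \<delta>') - d / 2 * (s - s2))) (%x. norm x powr pw s2 * norm (u t x - H t x))" by (simp only:)
   qed
   moreover have "0 < ?N" using C2(1) A B by simp
   ultimately show "\<exists>N. 0 < N & (0 <= s2 --> s2 <= s --> Q s2 N)" by blast
  qed
 qed
 then have "\<forall>s'. \<exists>N. 0 < N & (0 <= s' --> s' <= s --> Q s' N)" by blast
 from choice[OF this] obtain K' where K': "!!s'. 0 < K' s'" "!!s'. 0 <= s' ==> s' <= s ==> Q s' (K' s')" by blast
 have "path_decays K' (b + \<delta>') (%t y. norm (u t y - H t y))"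
  unfolding path_decays_def using K'(2)[unfolded Q_def] by blast
 then show ?thesis using K'(1) by blast
qed


text \<open>All results for one solution under a single smallness threshold. Equality of
  \<open>b\<close> and \<open>\<theta>\<close> is the nonlinear case; the condition on
  \<open>(\<alpha> - 1) * (b - \<theta>)\<close>, the gain of the nonlinear term over the linear
  one, selects the linear case.\<close>

lemma kato_asymptotics:
 assumes dim: "d = real DIM('a::euclidean_space)" and a: "a \<in> {-1, 1}" and c': "c' < 1"
  and \<sigma>: "0 < \<sigma>" "\<sigma> < d" and b: "b = (\<sigma> - d * s) / 2" "\<theta> <= b" "(\<alpha> - 1) * \<theta> + b + \<delta>0 <= c'" and \<delta>0: "0 < \<delta>0"
 obtains M0 where "0 < M0"
  "!!M (\<omega> :: 'a => complex) \<epsilon> \<phi> C \<delta> u. [|0 < M; M <= M0; \<omega> \<in> Lmeas; homogeneous_degree_0 \<omega>;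
    AE x in lebesgue. norm (\<omega> x) <= \<epsilon>; 0 <= \<epsilon>; tempered_distribution \<phi>; 0 < C; 0 < \<delta>;
    decays C b (%t y. norm (heat t \<phi> y)); decays C (b + \<delta>) (%t y. norm (heat t (%f. \<phi> f - regular_distribution (Phi \<omega> \<sigma>) f) y));
    kato_solution a M (%t. heat t \<phi>) u|] ==>
    (\<exists>K. (\<forall>s'. 0 < K s') & path_decays K b (%t y. norm (u t y))) &
    (~ (AE x in lebesgue. \<omega> x = 0) --> (\<exists>L>0. \<exists>t0>0. \<forall>t\<ge>t0. \<forall>k' R' N. k' <= k --> - d <= k' --> 0 <= R' --> R' <= 1 -->
     weak_bound R' N (%x. norm x powr k' * norm (u t x)) --> L * t powr (- ((\<sigma> - k' - d * R') / 2)) <= N)) &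
    (b = \<theta> --> (\<forall>w. kato_solution a M (%t. heat t (regular_distribution (Phi \<omega> \<sigma>))) w -->
     (\<exists>K. (\<forall>s'. 0 < K s') & (\<forall>c>0. path_decays (%s'. K s' * c powr (- 2 * min \<delta> \<delta>0)) (b + min \<delta> \<delta>0)
       (%t y. norm (rescaled \<sigma> c u t y - w t y)))))) &
    (\<delta>0 <= (\<alpha> - 1) * (b - \<theta>) --> (\<exists>K. (\<forall>s'. 0 < K s') & path_decays K (b + min \<delta> \<delta>0)
     (%t y. norm (u t y - heat t (regular_distribution (Phi \<omega> \<sigma>)) y))))"
proof (rule kato_solutions_close[OF dim c' a, of "1 / 640"], goal_cases)
 \<comment> \<open>With this factor the nonlinear part of the main term uses half of the admissible
   distance \<open>\<eta> / 20\<close>: two factors 4 give \<open>16 / 640 = 1 / 40\<close>.\<close>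
 show "0 < (1 / 640 :: real)" by simp
 case (2 M0) note M0 = 2(2) and close = 2(3)
 have close1: "decays (8 * B) b' (%t y. norm (u1 t y - u2 t y))"
  if M: "0 < M" "M <= M0" and sol: "kato_solution a M H1 u1" "kato_solution a M H2 u2" and B: "0 < B" and b': "\<theta> <= b'" "(\<alpha> - 1) * \<theta> + b' <= c'"
   and dec: "decays B b' (%t y. norm (H1 t y - H2 t y))" for M B b' and u1 u2 :: "real => 'a => complex" and H1 H2
  unfolding decays_def
 proof (intro allI impI)
  fix t :: real assume t: "0 < t"
  have "weak_bound R (B * t powr (- b') + 0 * t powr (- b')) (%y. norm y powr k * norm (H1 t y - H2 t y))" if "0 < t" for t
   using decaysD[OF dec that] by simp
  from close[OF M sol B order_refl b' b' this t] show "weak_bound R (8 * B * t powr (- b')) (%y. norm y powr k * norm (u1 t y - u2 t y))" by (simp add: mult.assoc)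
 qed
 show thesis
 proof (rule that[OF M0], goal_cases)
  case (1 M \<omega> \<epsilon> \<phi> C \<delta> u)
  note M = 1(1,2) and \<omega> = 1(3-6) and \<phi> = 1(7) and C = 1(8) and \<delta> = 1(9) and dec = 1(10,11) and sol = 1(12)
  define \<Phi> where "\<Phi> = regular_distribution (Phi \<omega> \<sigma>)"
  define \<psi> where "\<psi> = (%f. \<phi> f - \<Phi> f)"
  define \<delta>' where "\<delta>' = min \<delta> \<delta>0"
  have \<delta>': "0 < \<delta>'" "\<delta>' <= \<delta>" "\<delta>' <= \<delta>0" using \<delta> \<delta>0 by (auto simp: \<delta>'_def)
  have temp\<Phi>: "tempered_distribution \<Phi>" unfolding \<Phi>_def by (rule tempered_regular_Phi[OF \<omega>(1,3,4)]) (use \<sigma> dim in auto)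
  have temp\<psi>: "tempered_distribution \<psi>" unfolding \<psi>_def by (rule tempered_distribution_diff[OF \<phi> temp\<Phi>])
  have dec\<Phi>: "decays (8 * C) b (%t y. norm (heat t \<Phi> y))" and dec\<psi>: "decays (36 * C) (b + \<delta>') (%t y. norm (heat t \<psi> y))"
   using heat_Phi_decays[OF dim \<omega>(1,2) \<Phi>_def \<phi> temp\<Phi> b(1) C \<delta>'(1,2)] dec unfolding \<psi>_def \<Phi>_def by blast+
  have heat_diff: "heat t \<psi> y = heat t \<phi> y - heat t \<Phi> y" for t y by (simp add: heat_def \<psi>_def)
  have C36: "0 < 36 * C" using C by simp
  have bb: "(\<alpha> - 1) * \<theta> + b <= c'" "\<theta> <= b + \<delta>'" "(\<alpha> - 1) * \<theta> + (b + \<delta>') <= c'" using b \<delta>' \<delta>0 by auto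
  have zero: "kato_solution a M (%_ _. 0) ((%_ _. 0) :: real => 'a => complex)" using M by (intro kato_solution_zero) simp
  obtain CHb where CHb: "\<forall>s'. 0 < CHb s'" "\<forall>(\<phi> :: ('a => complex) => complex) N. tempered_distribution \<phi> --> 0 < N -->
    decays N b (%t y. norm (heat t \<phi> y)) --> path_decays (%s'. CHb s' * N) b (%t y. norm (heat t \<phi> y))"
   using path_decays_heat[OF dim, of b] by (elim exE conjE) (rule that, assumption+)
  obtain CHd where CHd: "\<forall>s'. 0 < CHd s'" "\<forall>(\<phi> :: ('a => complex) => complex) N. tempered_distribution \<phi> --> 0 < N -->
    decays N (b + \<delta>') (%t y. norm (heat t \<phi> y)) --> path_decays (%s'. CHd s' * N) (b + \<delta>') (%t y. norm (heat t \<phi> y))"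
   using path_decays_heat[OF dim, of "b + \<delta>'"] by (elim exE conjE) (rule that, assumption+)
  have path\<psi>: "path_decays (%s'. CHd s' * (36 * C)) (b + \<delta>') (%t y. norm (heat t \<psi> y))"
   using CHd(2)[rule_format, OF temp\<psi> C36 dec\<psi>] .
  have decu: "decays (8 * C) b (%t y. norm (u t y))"
   using close1[OF M sol zero C b(2) bb(1)] dec(1) by simp
  have P1: "\<exists>K. (\<forall>s'. 0 < K s') & path_decays K b (%t y. norm (u t y))"
  proof (rule kato_solutions_close_path[OF dim c' a M(1), of "%s'. CHb s' / 8"], goal_cases)
   show "0 < CHb s' / 8" for s' using CHb(1) by simp
   case (2 CW) note CW = 2
   have C8: "0 < 8 * C" using C by simp
   have "path_decays (%s'. CHb s' / 8 * (8 * C)) b (%t y. norm (heat t \<phi> y))"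
    using CHb(2)[rule_format, OF \<phi> C dec(1)] by simp
   then have "path_decays (%s'. CW s' * (8 * C)) b (%t y. norm (u t y - 0))"
    using CW(2)[OF sol zero C8 b(2) bb(1)] decu by simp
   then show ?thesis using CW(1) C by (intro exI[of _ "%s'. CW s' * (8 * C)"]) simp
  qed
  have P2: "\<exists>L>0. \<exists>t0>0. \<forall>t\<ge>t0. \<forall>k' R' N. k' <= k --> - d <= k' --> 0 <= R' --> R' <= 1 -->
     weak_bound R' N (%x. norm x powr k' * norm (u t x)) --> L * t powr (- ((\<sigma> - k' - d * R') / 2)) <= N"
   if nz: "~ (AE x in lebesgue. \<omega> x = 0)"
  proof (rule self_similar_lower[OF dim \<omega> \<sigma> b(1) \<Phi>_def dec\<Phi> nz])
   fix \<eta> L assume \<eta>: "0 < \<eta>" and dec\<eta>: "decays \<eta> b (%t y. norm (heat t \<Phi> y))" and L: "0 < L"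
    and low: "!!u t k' R' N. [|u \<in> Lmeas; 0 < t; weak_bound R (\<eta> / 20 * t powr (- b)) (%x. norm x powr k * norm (u x - heat t \<Phi> x));
    k' <= k; - d <= k'; 0 <= R'; R' <= 1; weak_bound R' N (%x. norm x powr k' * norm (u x))|] ==>
    L * t powr (- ((\<sigma> - k' - d * R') / 2)) <= N"
   let ?B = "36 * C"
   \<comment> \<open>From this time on the faster decaying part is at most 1/200 of the self-similar
     one; then \<open>1/40 + 161/8000 <= 1/20\<close>.\<close>
   define t0 where "t0 = (200 * ?B / \<eta>) powr (1 / \<delta>')"
   have t0: "0 < t0" using \<eta> C by (simp add: t0_def)
   have near: "weak_bound R (\<eta> / 20 * t powr (- b)) (%x. norm x powr k * norm (u t x - heat t \<Phi> x))" if t: "t0 <= t" for t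
   proof -
    have tp: "0 < t" using t t0 by simp
    have Hb: "weak_bound R (4 * \<eta> * r powr (- b) + 4 * ?B * r powr (- (b + \<delta>'))) (%y. norm y powr k * norm (heat r \<phi> y - 0))" if r: "0 < r" for r
    proof -
     have "weak_bound R (4 * (\<eta> * r powr (- b) + ?B * r powr (- (b + \<delta>')))) (%y. norm y powr k * norm (heat r \<phi> y - 0))"
     proof (rule weak_bound_triangle[OF decaysD[OF dec\<eta> r] decaysD[OF dec\<psi> r] R_nonneg less_imp_le[OF R_lt_1]])
      show "(%y. norm (heat r \<Phi> y)) \<in> Lmeas" "(%y. norm (heat r \<psi> y)) \<in> Lmeas"
       using heat_lebesgue_measurable[OF temp\<Phi> r] heat_lebesgue_measurable[OF temp\<psi> r] by measurable
      fix y show "norm (heat r \<phi> y - 0) <= norm (heat r \<Phi> y) + norm (heat r \<psi> y)"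
       using norm_triangle_ineq[of "heat r \<Phi> y" "heat r \<psi> y"] by (simp add: heat_diff)
     qed
     then show ?thesis by (simp add: algebra_simps)
    qed
    have B1: "0 < 4 * \<eta>" "0 <= 4 * ?B" using \<eta> C by auto
    let ?X = "t powr (- b)" and ?Y = "t powr (- (b + \<delta>'))"
    have D: "weak_bound R (1 / 640 * (4 * \<eta> * ?X + 4 * ?B * ?Y)) (%y. norm y powr k * norm (u t y - heat t \<phi> y))"
     using close[OF M sol zero B1 b(2) bb(1) bb(2,3) Hb tp] by simp
    have "weak_bound R (4 * (1 / 640 * (4 * \<eta> * ?X + 4 * ?B * ?Y) + ?B * ?Y)) (%y. norm y powr k * norm (u t y - heat t \<Phi> y))"
    proof (rule weak_bound_triangle[OF D decaysD[OF dec\<psi> tp] R_nonneg less_imp_le[OF R_lt_1]])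
     show "(%y. norm (u t y - heat t \<phi> y)) \<in> Lmeas" "(%y. norm (heat t \<psi> y)) \<in> Lmeas"
      using heat_lebesgue_measurable[OF \<phi> tp] heat_lebesgue_measurable[OF temp\<psi> tp] kato_solution_measurable[OF sol tp] by measurable
     fix y show "norm (u t y - heat t \<Phi> y) <= norm (u t y - heat t \<phi> y) + norm (heat t \<psi> y)"
      using norm_triangle_ineq[of "u t y - heat t \<phi> y" "heat t \<psi> y"] by (simp add: heat_diff)
    qed
    moreover have "4 * (1 / 640 * (4 * \<eta> * ?X + 4 * ?B * ?Y) + ?B * ?Y) <= \<eta> / 20 * ?X"
    proof -
     have "200 * ?B / \<eta> = t0 powr \<delta>'" using \<delta>' \<eta> C by (simp add: t0_def powr_powr)
     also have "... <= t powr \<delta>'" using t t0 \<delta>' by (intro powr_mono2) auto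
     finally have "200 * ?B <= \<eta> * t powr \<delta>'" using \<eta> by (simp add: field_simps)
     then have "200 * ?B * ?Y <= \<eta> * t powr \<delta>' * ?Y" by (intro mult_right_mono) auto
     also have "... = \<eta> * (t powr \<delta>' * ?Y)" by (simp only: mult.assoc)
     also have "t powr \<delta>' * ?Y = ?X" by (simp add: powr_add[symmetric])
     finally have 1: "200 * (?B * ?Y) <= \<eta> * ?X" by (simp only: mult.assoc)
     have "4 * (1 / 640 * (4 * \<eta> * X + 4 * B * Y) + B * Y) <= \<eta> / 20 * X" if "200 * (B * Y) <= \<eta> * X" "0 <= B * Y" for B X Y :: real
     proof -
      have "4 * (1 / 640 * (4 * \<eta> * X + 4 * B * Y) + B * Y) = (\<eta> * X) / 40 + (B * Y) * (161 / 40)" by (simp add: field_simps)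
      also have "... <= (\<eta> * X) / 20" using that by linarith
      finally show ?thesis by simp
     qed
     from this[OF 1] show ?thesis using C by simp
    qed
    ultimately show ?thesis by (rule weak_bound_mono)
   qed
   show ?thesis
   proof (rule exI[of _ L], rule conjI[OF L], rule exI[of _ t0], rule conjI[OF t0], intro allI impI)
    fix t k' R' N assume t: "t0 <= t" and *: "k' <= k" "- d <= k'" "0 <= R'" "R' <= 1" "weak_bound R' N (%x. norm x powr k' * norm (u t x))"
    have tp: "0 < t" using t t0 by simp
    show "L * t powr (- ((\<sigma> - k' - d * R') / 2)) <= N" by (rule low[OF kato_solution_measurable[OF sol tp] tp near[OF t] *])
   qed
  qed
  \<comment> \<open>Rescaling leaves the flow of \<open>\<Phi>\<close> unchanged and multiplies the
    decay constant of the difference of the data by \<open>c powr (- 2 * \<delta>')\<close>; since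
    the comparison constants are uniform, this factor passes to the solutions.\<close>
  have P3: "\<exists>K. (\<forall>s'. 0 < K s') & (\<forall>c>0. path_decays (%s'. K s' * c powr (- 2 * \<delta>')) (b + \<delta>') (%t y. norm (rescaled \<sigma> c u t y - w t y)))"
   if b\<theta>: "b = \<theta>" and w: "kato_solution a M (%t. heat t \<Phi>) w" for w
  proof -
   \<comment> \<open>The path comparison uses one \<open>B\<close> for the difference of the
     solutions and for the linear part. The former has the absorption constant 8 times the value of
     the latter at \<open>s\<close>, so \<open>CHd\<close> is normalised by
     \<open>?h\<close>.\<close>
   let ?h = "8 * CHd s"
   have h: "0 < ?h" using CHd(1) by simp
   have \<sigma>\<theta>: "\<sigma> * (\<alpha> - 1) = 2 + \<gamma>"
   proof -
    have "\<sigma> = 2 * \<theta> + d * s" using b(1) b\<theta> by simp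
    moreover define A X where "A = (2 + \<gamma>) / (2 * (\<alpha> - 1))" and "X = d / 2 * s"
    moreover have "\<theta> = A - X" "d * s = 2 * X" by (simp_all only: \<theta>_def A_def X_def)
    ultimately have "\<sigma> = 2 * A" by linarith
    moreover have "A * (2 * (\<alpha> - 1)) = 2 + \<gamma>" using \<alpha>_gt_1 by (simp only: A_def) simp
    ultimately show ?thesis by (simp only: mult_ac)
   qed
   have e: "\<sigma> - d * s - 2 * (b + \<delta>') = - 2 * \<delta>'" by (simp add: b(1) field_simps)
   show ?thesis
   proof (rule kato_solutions_close_path[OF dim c' a M(1), of "%s'. CHd s' / ?h"], goal_cases)
    show "0 < CHd s' / ?h" for s' using CHd(1) by simp
    case (2 CW) note CW = 2
    have "path_decays (%s'. CW s' * (?h * (36 * C)) * c powr (- 2 * \<delta>')) (b + \<delta>') (%t y. norm (rescaled \<sigma> c u t y - w t y))" if c: "0 < c" for c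
    proof -
     let ?p = "c powr (- 2 * \<delta>')"
     let ?B = "?h * (36 * C) * ?p"
     have p: "0 < ?p" using c by simp
     have sol': "kato_solution a M (rescaled \<sigma> c (%t. heat t \<phi>)) (rescaled \<sigma> c u)" by (rule kato_solution_rescaled[OF dim sol c \<sigma>\<theta>])
     have eq: "rescaled \<sigma> c (%t. heat t \<psi>) t y = rescaled \<sigma> c (%t. heat t \<phi>) t y - heat t \<Phi> y" if "0 < t" for t y
     proof -
      have "complex_of_real (c powr \<sigma>) * of_real (c powr (- \<sigma>)) = 1"
       using c by (simp only: of_real_mult[symmetric] powr_add[symmetric]) simp
      then have "of_real (c powr \<sigma>) * heat (c\<^sup>2 * t) \<Phi> (c *\<^sub>R y) = heat t \<Phi> y"
       unfolding \<Phi>_def heat_Phi_scale[OF \<omega>(1,2) c that] mult.assoc[symmetric] by simp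
      then show ?thesis by (simp add: rescaled_def heat_diff right_diff_distrib)
     qed
     have "path_decays (%s'. CHd s' * (36 * C) * ?p) (b + \<delta>') (%t y. norm (rescaled \<sigma> c (%t. heat t \<psi>) t y))"
      using path_decays_rescaled[where f = "%t. heat t \<psi>", OF dim path\<psi> c, of \<sigma>] unfolding e .
     then have path: "path_decays (%s'. CHd s' * (36 * C) * ?p) (b + \<delta>') (%t y. norm (rescaled \<sigma> c (%t. heat t \<phi>) t y - heat t \<Phi> y))"
      by (subst (asm) path_decays_cong[OF arg_cong[where f = norm, OF eq]])
     have pos: "0 < CHd s * (36 * C) * ?p" "0 < ?B" using CHd(1) C p by simp_all
     have "decays (8 * (CHd s * (36 * C) * ?p)) (b + \<delta>') (%t y. norm (rescaled \<sigma> c u t y - w t y))"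
      by (rule close1[OF M sol' w pos(1) bb(2,3) path_decays_imp_decays[OF path]])
     then have 1: "decays ?B (b + \<delta>') (%t y. norm (rescaled \<sigma> c u t y - w t y))" by (simp only: mult.assoc)
     have "CHd s' / ?h * ?B = CHd s' * (36 * C) * ?p" for s' using h by simp
     then have 2: "path_decays (%s'. CHd s' / ?h * ?B) (b + \<delta>') (%t y. norm (rescaled \<sigma> c (%t. heat t \<phi>) t y - heat t \<Phi> y))"
      using path by (simp only:)
     show ?thesis using CW(2)[OF sol' w pos(2) bb(2,3) 1 2] by (simp only: mult.assoc)
    qed
    moreover have "0 < CW s' * (?h * (36 * C))" for s' using CW(1) h C by simp
    ultimately show ?thesis by (intro exI[of _ "%s'. CW s' * (?h * (36 * C))"]) simp
   qed
  qed
  have P4: "\<exists>K. (\<forall>s'. 0 < K s') & path_decays K (b + \<delta>') (%t y. norm (u t y - heat t \<Phi> y))" if gap: "\<delta>0 <= (\<alpha> - 1) * (b - \<theta>)"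
  proof -
   obtain K where K: "\<forall>s'. 0 < K s'" "path_decays K b (%t y. norm (u t y))" using P1 by blast
   have C8: "0 < 8 * C" using C by simp
   have "\<exists>K'. (\<forall>s'. 0 < K' s') & path_decays K' (b + \<delta>') (%t y. norm (u t y - heat t \<phi> y))"
    by (rule nonlinear_part_path_decays[OF dim c' a M(1) sol C8 decu K(2)]) (use K(1) b(2) bb(3) \<delta>' gap in auto)
   then obtain K' where K': "\<forall>s'. 0 < K' s'" "path_decays K' (b + \<delta>') (%t y. norm (u t y - heat t \<phi> y))" by blast
   have "path_decays (%s'. 4 * (K' s' + CHd s' * (36 * C))) (b + \<delta>') (%t y. norm (u t y - heat t \<Phi> y))"
   proof (rule path_decays_triangle[OF K'(2) path\<psi>])
    fix t :: real assume t: "0 < t"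
    show "(%y. norm (u t y - heat t \<phi> y)) \<in> Lmeas" "(%y. norm (heat t \<psi> y)) \<in> Lmeas"
     using heat_lebesgue_measurable[OF \<phi> t] heat_lebesgue_measurable[OF temp\<psi> t] kato_solution_measurable[OF sol t] by measurable
    fix y show "norm (u t y - heat t \<Phi> y) <= norm (u t y - heat t \<phi> y) + norm (heat t \<psi> y)"
     using norm_triangle_ineq[of "u t y - heat t \<phi> y" "heat t \<psi> y"] by (simp add: heat_diff)
   qed
   moreover have "0 < 4 * (K' s' + CHd s' * (36 * C))" for s' using K'(1) CHd(1) C by (simp add: add_pos_pos)
   ultimately show ?thesis by (intro exI[of _ "%s'. 4 * (K' s' + CHd s' * (36 * C))"]) simp
  qed
  show ?case
   unfolding \<delta>'_def[symmetric] \<Phi>_def[symmetric]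
   by (intro conjI impI allI P1 P2 P3 P4; assumption)
 qed
qed

end

section \<open>Passage to the norms of the statement\<close>

lemma ennreal_inverse_antimono:
 fixes x y :: ennreal
 assumes "x <= y"
 shows "inverse y <= inverse x"
proof (cases "x = 0 \<or> y = top")
 case True
 then show ?thesis by auto
next
 case False
 then obtain r q where "x = ennreal r" "y = ennreal q" "0 <= r" "0 <= q"
  using assms by (cases x; cases y) (auto simp: top_unique)
 moreover from this have "0 < r" "r <= q" using False assms by (auto simp: less_le)
 ultimately show ?thesis by (simp add: inverse_ennreal ennreal_leI le_imp_inverse_le)
qed

lemma recip_antimono:
 assumes "1 <= p" "p <= p'"
 shows "recip p' <= recip p"
proof -
 have "inverse p <= inverse 1" using assms by (intro ennreal_inverse_antimono) auto
 then have "inverse p < top" by (simp add: le_less_trans[of _ 1])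
 then show ?thesis unfolding recip_def divide_ennreal_def
  using assms by (intro enn2real_mono) (auto intro: ennreal_inverse_antimono)
qed

lemma recip_less:
 assumes "0 < \<alpha>" "ennreal \<alpha> < p"
 shows "\<alpha> * recip p < 1"
proof (cases p)
 case (real r)
 then have "\<alpha> < r" using assms by (simp add: ennreal_less_iff)
 moreover have "recip p = 1 / r"
  using calculation assms real by (simp add: recip_def ennreal_1[symmetric] divide_ennreal del: ennreal_1)
 moreover have "\<alpha> * (1 / r) < 1" using calculation(1) assms(1) by simp
 ultimately show ?thesis by (simp only:)
next
 case top
 then show ?thesis by (simp add: recip_def)
qed

text \<open>An infinite norm satisfies the claim at once; a finite one is itself a constant to which
  \<open>low\<close> applies.\<close>

lemma less_weighted_weak_norm:
 fixes f :: "'a::euclidean_space => complex"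
 assumes f: "f \<in> Lmeas"
  and low: "!!N. weak_bound (recip p) N (%x. norm x powr k * norm (f x)) ==> X <= N"
 shows "ennreal X <= weighted_weak_norm k p f"
proof (rule ccontr)
 assume n: "~ ?thesis"
 then have "weighted_weak_norm k p f < top" by (simp add: not_le less_le_trans)
 then obtain N where N: "0 <= N" "weighted_weak_norm k p f = ennreal N"
  by (metis ennreal_cases less_irrefl)
 then have "weak_bound (recip p) N (%x. norm x powr k * norm (f x))"
  using weighted_weak_norm_le_iff[OF f N(1), of k p] by simp
 then have "X <= N" by (rule low)
 then show False using n N by (simp add: ennreal_leI)
qed

context kato_exponents
begin

lemma decays_iff:
 fixes f :: "real => 'a::euclidean_space => complex"
 assumes m: "!!t. 0 < t ==> f t \<in> Lmeas" and C: "0 <= C" and R: "R = recip p"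
 shows "decays C b (%t y. norm (f t y)) \<longleftrightarrow> (\<forall>t>0. weighted_weak_norm k p (f t) <= ennreal (C * t powr (- b)))"
proof -
 have "weighted_weak_norm k p (f t) <= ennreal (C * t powr (- b)) \<longleftrightarrow>
   weak_bound R (C * t powr (- b)) (%y. norm y powr k * norm (f t y))" if "0 < t" for t
  using weighted_weak_norm_le_iff[OF m[OF that], of "C * t powr (- b)" k p] C by (simp add: R)
 then show ?thesis by (auto simp: decays_def)
qed

lemma global_solution_imp_kato_solution:
 fixes u :: "real => 'a::euclidean_space => complex"
 assumes dim: "d = real DIM('a)" and R: "R = recip p" and M: "0 <= M" and \<phi>: "tempered_distribution \<phi>"
  and sol: "global_solution a \<gamma> \<alpha> k p M \<phi> u"
 shows "kato_solution a M (%t. heat t \<phi>) u"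
proof -
 have uK: "u \<in> kato_space \<gamma> \<alpha> k p" and uM: "kato_norm \<gamma> \<alpha> k p u <= ennreal M" and uI: "integral_solution a \<gamma> \<alpha> \<phi> u"
  using sol by (auto simp: global_solution_def)
 have um: "u t \<in> Lmeas" if "0 < t" for t using uK that by (simp add: kato_space_def)
 have \<theta>: "decay_exponent d (inv_qc d \<gamma> \<alpha>) k p = \<theta>"
  using d_pos \<alpha>_gt_1 unfolding decay_exponent_def inv_qc_def \<theta>_def s_def R[symmetric] by (simp add: field_simps)
 have "weighted_weak_norm k p (u t) <= ennreal (M * t powr (- \<theta>))" if t: "0 < t" for t
 proof -
  have le: "ennreal (t powr \<theta>) * weighted_weak_norm k p (u t) <= ennreal M"
   using uM t unfolding kato_norm_on_def dim[symmetric] \<theta>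
   by (meson SUP_upper greaterThan_iff order_trans)
  have "weighted_weak_norm k p (u t) = ennreal (t powr (- \<theta>)) * (ennreal (t powr \<theta>) * weighted_weak_norm k p (u t))"
   using t by (simp add: mult.assoc[symmetric] ennreal_mult[symmetric] powr_add[symmetric])
  also have "... <= ennreal (t powr (- \<theta>)) * ennreal M" by (intro mult_left_mono le) simp
  also have "... = ennreal (M * t powr (- \<theta>))" using M by (simp add: ennreal_mult[symmetric] mult.commute)
  finally show ?thesis .
 qed
 then have "decays M \<theta> (%t y. norm (u t y))" using decays_iff[of u, OF um M R] by blast
 then show ?thesis unfolding kato_solution_def
  using integral_solution_imp_mild[OF uI] kato_space_representable[OF uK] heat_lebesgue_measurable[OF \<phi>] by blast
qed

lemma admissible_bounds:
 assumes "admissible d k p k' p'" "R = recip p" "1 <= p"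
 shows "k' <= k" "0 <= recip p'" "recip p' <= R" "0 <= k' / d + recip p'" "recip p' <= 1" "- d <= k'"
proof -
 show 1: "k' <= k" "0 <= recip p'" "recip p' <= R" "0 <= k' / d + recip p'"
  using assms recip_antimono[of p p'] by (auto simp: admissible_def)
 show 2: "recip p' <= 1" using 1 R_lt_1 by simp
 have "- 1 <= k' / d" using 1 2 by simp
 then show "- d <= k'" using d_pos by (simp add: field_simps)
qed

lemma path_decays_weighted_weak_norm:
 fixes f :: "real => 'a::euclidean_space => complex"
 assumes dim: "d = real DIM('a)" and R: "R = recip p" "1 <= p" and f: "path_decays K b' (%t y. norm (f t y))" and K: "!!s'. 0 < K s'"
  and t: "0 < t" and m: "f t \<in> Lmeas" and adm: "admissible d k p k' p'" and b': "b' = (\<sigma> - d * s) / 2 + e"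
 shows "weighted_weak_norm k' p' (f t) <= ennreal (adm_const K * t powr (- decay_exponent d (\<sigma> / d) k' p' - e))"
proof -
 note adm' = admissible_bounds[OF adm R]
 have "weak_bound (recip p') (adm_const K * t powr (- b' - d / 2 * (s - (k' / d + recip p')))) (%x. norm x powr k' * norm (f t x))"
  by (rule path_decays_admissible[OF dim f t K]) (use m adm' in auto)
 moreover have "- b' - d / 2 * (s - (k' / d + recip p')) = - decay_exponent d (\<sigma> / d) k' p' - e"
  using d_pos by (simp add: b' decay_exponent_def field_simps)
 moreover have "0 <= adm_const K" unfolding adm_const_def
  using K[of 0] K[of s] K[of "max (k / d) 0"] d_pos by (intro mult_nonneg_nonneg add_nonneg_nonneg) auto
 ultimately show ?thesis using weighted_weak_norm_le_iff[OF m, of _ k' p'] by simp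
qed

lemma adm_const_pos: "(!!s'. 0 < K s') ==> 0 < adm_const K"
 unfolding adm_const_def using d_pos by (intro mult_pos_pos add_pos_pos add_pos_nonneg) auto

lemma kato_asymptotics_norms:
 assumes dim: "d = real DIM('a::euclidean_space)" and a: "a \<in> {-1, 1}" and c': "c' < 1" and R: "R = recip p" "1 <= p"
  and \<sigma>: "0 < \<sigma>" "\<sigma> < d" and b: "b = (\<sigma> - d * s) / 2" "\<theta> <= b" "(\<alpha> - 1) * \<theta> + b + \<delta>0 <= c'" and \<delta>0: "0 < \<delta>0"
 obtains M0 where "0 < M0"
  "!!M (\<omega> :: 'a => complex) \<phi> C \<delta> u. [|0 < M; M <= M0; \<omega> \<in> Lmeas; homogeneous_degree_0 \<omega>;
    esssup lebesgue (%x. ennreal (norm (\<omega> x))) <= ennreal 1; tempered_distribution \<phi>; 0 < C; 0 < \<delta>;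
    \<forall>t>0. weighted_weak_norm k p (heat t \<phi>) <= ennreal (C * t powr (- decay_exponent d (\<sigma> / d) k p));
    \<forall>t>0. weighted_weak_norm k p (heat t (%f. \<phi> f - regular_distribution (Phi \<omega> \<sigma>) f))
        <= ennreal (C * t powr (- decay_exponent d (\<sigma> / d) k p - \<delta>));
    global_solution a \<gamma> \<alpha> k p M \<phi> u|] ==>
    (\<exists>C'>0. \<forall>\<^sub>F t in at_top. \<forall>k' p'. admissible d k p k' p' -->
       (~ (AE x in lebesgue. \<omega> x = 0) -->
        ennreal (inverse C' * t powr (- decay_exponent d (\<sigma> / d) k' p')) <= weighted_weak_norm k' p' (u t)) &
       weighted_weak_norm k' p' (u t) <= ennreal (C' * t powr (- decay_exponent d (\<sigma> / d) k' p'))) &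
    (b = \<theta> --> (\<forall>w. global_solution a \<gamma> \<alpha> k p M (regular_distribution (Phi \<omega> \<sigma>)) w -->
     (\<exists>C'>0. \<forall>t>0. \<forall>k' p'. admissible d k p k' p' -->
        weighted_weak_norm k' p' (%x. u t x - w t x)
         <= ennreal (C' * t powr (- decay_exponent d (\<sigma> / d) k' p' - min \<delta> \<delta>0)) &
        weighted_weak_norm k' p' (%x. of_real (t powr (\<sigma> / 2)) * u t (sqrt t *\<^sub>R x) - w 1 x)
         <= ennreal (C' * t powr (- min \<delta> \<delta>0))))) &
    (\<delta>0 <= (\<alpha> - 1) * (b - \<theta>) -->
     (\<exists>C'>0. \<forall>t>0. \<forall>k' p'. admissible d k p k' p' -->
       weighted_weak_norm k' p' (%x. u t x - heat t (regular_distribution (Phi \<omega> \<sigma>)) x)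
        <= ennreal (C' * t powr (- decay_exponent d (\<sigma> / d) k' p' - min \<delta> \<delta>0)) &
       weighted_weak_norm k' p'
         (%x. of_real (t powr (\<sigma> / 2)) * u t (sqrt t *\<^sub>R x) - heat 1 (regular_distribution (Phi \<omega> \<sigma>)) x)
        <= ennreal (C' * t powr (- min \<delta> \<delta>0))))"
proof (rule kato_asymptotics[OF dim a c' \<sigma> b \<delta>0], goal_cases)
 case (1 M0) note M0 = 1(2) and main = 1(3)
 show thesis
 proof (rule that[OF M0], goal_cases)
  case (1 M \<omega> \<phi> C \<delta> u)
  note M = 1(1,2) and \<omega> = 1(3,4) and ess = 1(5) and \<phi> = 1(6) and C = 1(7) and \<delta> = 1(8) and dec = 1(9,10) and sol = 1(11)
  define \<Phi> where "\<Phi> = regular_distribution (Phi \<omega> \<sigma>)"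
  define \<delta>' where "\<delta>' = min \<delta> \<delta>0"
  have AE\<omega>: "AE x in lebesgue. norm (\<omega> x) <= 1"
  proof -
   have "AE x in lebesgue. ennreal (norm (\<omega> x)) <= esssup lebesgue (%x. ennreal (norm (\<omega> x)))" by (rule esssup_AE)
   then show ?thesis
   proof eventually_elim
    fix x assume "ennreal (norm (\<omega> x)) <= esssup lebesgue (%x. ennreal (norm (\<omega> x)))"
    then have "ennreal (norm (\<omega> x)) <= ennreal 1" using ess by (rule order_trans)
    then show "norm (\<omega> x) <= 1" by (simp only: ennreal_le_iff zero_le_one)
   qed
  qed
  have temp\<Phi>: "tempered_distribution \<Phi>" unfolding \<Phi>_def by (rule tempered_regular_Phi[OF \<omega>(1) AE\<omega>]) (use \<sigma> dim in auto)
  have temp\<psi>: "tempered_distribution (%f. \<phi> f - \<Phi> f)" by (rule tempered_distribution_diff[OF \<phi> temp\<Phi>])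
  have bdec: "decay_exponent d (\<sigma> / d) k p = b" using d_pos unfolding decay_exponent_def b(1) s_def R(1)[symmetric] by (simp add: field_simps)
  have M': "0 <= M" and C': "0 <= C" using M C by auto
  have ksol: "kato_solution a M (%t. heat t \<phi>) u" by (rule global_solution_imp_kato_solution[OF dim R(1) M' \<phi> sol])
  have dec1: "decays C b (%t y. norm (heat t \<phi> y))"
   using dec(1) decays_iff[of "%t. heat t \<phi>", OF heat_lebesgue_measurable[OF \<phi>] C' R(1), of b] unfolding bdec by simp
  have dec2: "decays C (b + \<delta>) (%t y. norm (heat t (%f. \<phi> f - regular_distribution (Phi \<omega> \<sigma>) f) y))"
   using dec(2) decays_iff[of "%t. heat t (%f. \<phi> f - \<Phi> f)", OF heat_lebesgue_measurable[OF temp\<psi>] C' R(1), of "b + \<delta>"]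
   unfolding bdec \<Phi>_def by simp
  note facts = main[OF M \<omega> AE\<omega> zero_le_one \<phi> C \<delta> dec1 dec2 ksol, folded \<Phi>_def \<delta>'_def]
  have um: "u t \<in> Lmeas" if "0 < t" for t using kato_solution_measurable[OF ksol that] .
  have upper: "\<exists>K. (\<forall>s'. 0 < K s') & path_decays K b (%t y. norm (u t y))" using facts by (rule conjunct1)
  have lower: "~ (AE x in lebesgue. \<omega> x = 0) ==> \<exists>L>0. \<exists>t0>0. \<forall>t\<ge>t0. \<forall>k' R' N. k' <= k --> - d <= k' --> 0 <= R' --> R' <= 1 -->
     weak_bound R' N (%x. norm x powr k' * norm (u t x)) --> L * t powr (- ((\<sigma> - k' - d * R') / 2)) <= N"
   using facts[THEN conjunct2, THEN conjunct1] by (rule mp)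
  have sqrtp: "sqrt t powr e = t powr (e / 2)" if "0 < t" for t e using that by (simp add: powr_half_sqrt[symmetric] powr_powr)
  have K_scale: "adm_const (%s'. K s' * z) = adm_const K * z" for K z by (simp add: adm_const_def algebra_simps)
  have P1: "\<exists>C'>0. \<forall>\<^sub>F t in at_top. \<forall>k' p'. admissible d k p k' p' -->
       (~ (AE x in lebesgue. \<omega> x = 0) -->
        ennreal (inverse C' * t powr (- decay_exponent d (\<sigma> / d) k' p')) <= weighted_weak_norm k' p' (u t)) &
       weighted_weak_norm k' p' (u t) <= ennreal (C' * t powr (- decay_exponent d (\<sigma> / d) k' p'))"
  proof -
   obtain K where K: "!!s'. 0 < K s'" "path_decays K b (%t y. norm (u t y))" using upper by blast
   obtain L t0 where L: "0 < L" "0 < t0" "!!t k' R' N. [|~ (AE x in lebesgue. \<omega> x = 0); t0 <= t; k' <= k; - d <= k'; 0 <= R'; R' <= 1;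
     weak_bound R' N (%x. norm x powr k' * norm (u t x))|] ==> L * t powr (- ((\<sigma> - k' - d * R') / 2)) <= N"
   proof (cases "AE x in lebesgue. \<omega> x = 0")
    case True
    show thesis by (rule that[of 1 1]) (use True in auto)
   next
    case False
    from lower[OF this] obtain L t0 where L: "0 < L" "0 < t0" "\<forall>t\<ge>t0. \<forall>k' R' N. k' <= k --> - d <= k' --> 0 <= R' --> R' <= 1 -->
     weak_bound R' N (%x. norm x powr k' * norm (u t x)) --> L * t powr (- ((\<sigma> - k' - d * R') / 2)) <= N"
     by (elim exE conjE) (rule that, assumption+)
    show thesis by (rule that[OF L(1,2)]) (rule L(3)[rule_format])
   qed
   define C' where "C' = max (adm_const K) (inverse L)"
   have C': "0 < C'" "adm_const K <= C'" using adm_const_pos[of K, OF K(1)] by (auto simp: C'_def)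
   have "inverse C' <= inverse (inverse L)" using L by (intro le_imp_inverse_le) (auto simp: C'_def)
   then have CL: "inverse C' <= L" by simp
   have "(~ (AE x in lebesgue. \<omega> x = 0) -->
        ennreal (inverse C' * t powr (- decay_exponent d (\<sigma> / d) k' p')) <= weighted_weak_norm k' p' (u t)) &
       weighted_weak_norm k' p' (u t) <= ennreal (C' * t powr (- decay_exponent d (\<sigma> / d) k' p'))"
    if t: "t0 <= t" and adm: "admissible d k p k' p'" for t k' p'
   proof (intro conjI impI)
    have tp: "0 < t" using t L(2) by simp
    note adm' = admissible_bounds[OF adm R]
    have "weighted_weak_norm k' p' (u t) <= ennreal (adm_const K * t powr (- decay_exponent d (\<sigma> / d) k' p' - 0))"
     by (rule path_decays_weighted_weak_norm[OF dim R K(2,1) tp um[OF tp] adm]) (simp add: b(1))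
    also have "... <= ennreal (C' * t powr (- decay_exponent d (\<sigma> / d) k' p'))"
     using C' by (intro ennreal_leI) (simp add: mult_right_mono)
    finally show "weighted_weak_norm k' p' (u t) <= ennreal (C' * t powr (- decay_exponent d (\<sigma> / d) k' p'))" .
    assume nz: "~ (AE x in lebesgue. \<omega> x = 0)"
    have e: "- decay_exponent d (\<sigma> / d) k' p' = - ((\<sigma> - k' - d * recip p') / 2)"
     using d_pos by (simp add: decay_exponent_def field_simps)
    have "ennreal (inverse C' * t powr (- decay_exponent d (\<sigma> / d) k' p')) <= ennreal (L * t powr (- decay_exponent d (\<sigma> / d) k' p'))"
     using CL by (intro ennreal_leI mult_right_mono) auto
    also have "... <= weighted_weak_norm k' p' (u t)"
     unfolding e by (rule less_weighted_weak_norm[OF um[OF tp]], rule L(3)[OF nz t adm'(1,6,2,5)])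
    finally show "ennreal (inverse C' * t powr (- decay_exponent d (\<sigma> / d) k' p')) <= weighted_weak_norm k' p' (u t)" .
   qed
   then show ?thesis unfolding eventually_at_top_linorder
    by (intro exI[of _ C'] conjI C'(1) exI[of _ t0] allI impI) blast+
  qed
  have P3: "\<exists>C'>0. \<forall>t>0. \<forall>k' p'. admissible d k p k' p' -->
        weighted_weak_norm k' p' (%x. u t x - w t x)
         <= ennreal (C' * t powr (- decay_exponent d (\<sigma> / d) k' p' - \<delta>')) &
        weighted_weak_norm k' p' (%x. of_real (t powr (\<sigma> / 2)) * u t (sqrt t *\<^sub>R x) - w 1 x)
         <= ennreal (C' * t powr (- \<delta>'))"
   if b\<theta>: "b = \<theta>" and gw: "global_solution a \<gamma> \<alpha> k p M \<Phi> w" for w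
  proof -
   have kw: "kato_solution a M (%t. heat t \<Phi>) w" by (rule global_solution_imp_kato_solution[OF dim R(1) M' temp\<Phi> gw])
   have "\<exists>K. (\<forall>s'. 0 < K s') & (\<forall>c>0. path_decays (%s'. K s' * c powr (- 2 * \<delta>')) (b + \<delta>') (%t y. norm (rescaled \<sigma> c u t y - w t y)))"
    by (rule facts[THEN conjunct2, THEN conjunct2, THEN conjunct1, THEN mp, OF b\<theta>, THEN spec, THEN mp, OF kw])
   then obtain K where K: "!!s'. 0 < K s'" "!!c. 0 < c ==> path_decays (%s'. K s' * c powr (- 2 * \<delta>')) (b + \<delta>') (%t y. norm (rescaled \<sigma> c u t y - w t y))" by blast
   \<comment> \<open>With \<open>c = 1\<close> this is the estimate at all times; with
     \<open>c = sqrt t\<close> at time 1 it is the one for the rescaled solution.\<close>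
   have gen: "weighted_weak_norm k' p' (%x. rescaled \<sigma> c u t x - w t x) <= ennreal (adm_const K * c powr (- 2 * \<delta>') * t powr (- decay_exponent d (\<sigma> / d) k' p' - \<delta>'))"
    if c: "0 < c" and t: "0 < t" and adm: "admissible d k p k' p'" for c t k' p'
   proof -
    have "u (c\<^sup>2 * t) \<in> Lmeas" using um c t by simp
    from lebesgue_measurable_scale[OF this c] have "(%x. rescaled \<sigma> c u t x - w t x) \<in> Lmeas"
     using kato_solution_measurable[OF kw t] unfolding rescaled_def by measurable
    from path_decays_weighted_weak_norm[where f = "%t x. rescaled \<sigma> c u t x - w t x", OF dim R K(2)[OF c] _ t this adm, of \<sigma> \<delta>']
    show ?thesis unfolding K_scale using K(1) c by (simp add: b(1))
   qed
   show ?thesis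
   proof (rule exI[of _ "adm_const K"], rule conjI[OF adm_const_pos[of K, OF K(1)]], intro allI impI conjI)
    fix t :: real and k' p' assume t: "0 < t" and adm: "admissible d k p k' p'"
    show "weighted_weak_norm k' p' (%x. u t x - w t x) <= ennreal (adm_const K * t powr (- decay_exponent d (\<sigma> / d) k' p' - \<delta>'))"
     using gen[OF zero_less_one t adm] by (simp add: rescaled_def)
    have "0 < sqrt t" using t by simp
    from gen[OF this zero_less_one adm]
    show "weighted_weak_norm k' p' (%x. of_real (t powr (\<sigma> / 2)) * u t (sqrt t *\<^sub>R x) - w 1 x) <= ennreal (adm_const K * t powr (- \<delta>'))"
     using t by (simp add: rescaled_def sqrtp[OF t])
   qed
  qed
  have P4: "\<exists>C'>0. \<forall>t>0. \<forall>k' p'. admissible d k p k' p' -->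
       weighted_weak_norm k' p' (%x. u t x - heat t \<Phi> x)
        <= ennreal (C' * t powr (- decay_exponent d (\<sigma> / d) k' p' - \<delta>')) &
       weighted_weak_norm k' p' (%x. of_real (t powr (\<sigma> / 2)) * u t (sqrt t *\<^sub>R x) - heat 1 \<Phi> x)
        <= ennreal (C' * t powr (- \<delta>'))"
   if gap: "\<delta>0 <= (\<alpha> - 1) * (b - \<theta>)"
  proof -
   let ?f = "%t x. u t x - heat t \<Phi> x"
   have "\<exists>K. (\<forall>s'. 0 < K s') & path_decays K (b + \<delta>') (%t y. norm (?f t y))"
    by (rule facts[THEN conjunct2, THEN conjunct2, THEN conjunct2, THEN mp, OF gap])
   then obtain K where K: "!!s'. 0 < K s'" "path_decays K (b + \<delta>') (%t y. norm (?f t y))" by blast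
   have e: "\<sigma> - d * s - 2 * (b + \<delta>') = - 2 * \<delta>'" by (simp add: b(1) field_simps)
   have fm: "?f t \<in> Lmeas" if t: "0 < t" for t
    using um[OF t] heat_lebesgue_measurable[OF temp\<Phi> t] by measurable
   show ?thesis
   proof (rule exI[of _ "adm_const K"], rule conjI[OF adm_const_pos[of K, OF K(1)]], intro allI impI conjI)
    fix t :: real and k' p' assume t: "0 < t" and adm: "admissible d k p k' p'"
    show "weighted_weak_norm k' p' (?f t) <= ennreal (adm_const K * t powr (- decay_exponent d (\<sigma> / d) k' p' - \<delta>'))"
     by (rule path_decays_weighted_weak_norm[where f = ?f, OF dim R K(2,1) t fm[OF t] adm]) (simp add: b(1))
    \<comment> \<open>In the linear case \<open>\<sigma>\<close> is not the exponent of the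
      equation, so the difference itself is rescaled instead of the solution.\<close>
    define c where "c = sqrt t"
    have c: "0 < c" "c\<^sup>2 = t" using t by (auto simp: c_def)
    have path: "path_decays (%s'. K s' * c powr (- 2 * \<delta>')) (b + \<delta>') (%t y. norm (rescaled \<sigma> c ?f t y))"
     using path_decays_rescaled[where f = ?f, OF dim K(2) c(1), of \<sigma>] unfolding e .
    have "complex_of_real (c powr \<sigma>) * of_real (c powr (- \<sigma>)) = 1"
     using c(1) by (simp only: of_real_mult[symmetric] powr_add[symmetric]) simp
    then have eq: "rescaled \<sigma> c ?f 1 = (%x. of_real (t powr (\<sigma> / 2)) * u t (sqrt t *\<^sub>R x) - heat 1 \<Phi> x)"
     unfolding rescaled_def \<Phi>_def heat_Phi_scale[OF \<omega> c(1) zero_less_one] right_diff_distrib mult.assoc[symmetric]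
     using c(2) by (simp add: fun_eq_iff sqrtp[OF t, symmetric] c_def)
    have "?f (c\<^sup>2 * 1) \<in> Lmeas" using fm[OF t] c(2) by simp
    from lebesgue_measurable_scale[OF this c(1)] have rm: "rescaled \<sigma> c ?f 1 \<in> Lmeas"
     unfolding rescaled_def[abs_def] by measurable
    have pos: "0 < K s' * c powr (- 2 * \<delta>')" for s' using K(1) c(1) by simp
    have "c powr (- 2 * \<delta>') = t powr (- \<delta>')" unfolding c_def sqrtp[OF t] by simp
    then show "weighted_weak_norm k' p' (%x. of_real (t powr (\<sigma> / 2)) * u t (sqrt t *\<^sub>R x) - heat 1 \<Phi> x) <= ennreal (adm_const K * t powr (- \<delta>'))"
     using path_decays_weighted_weak_norm[where f = "rescaled \<sigma> c ?f", OF dim R path pos zero_less_one rm adm, of \<sigma> \<delta>']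
     unfolding eq K_scale by (simp add: b(1))
   qed
  qed
  show ?case
   unfolding \<Phi>_def[symmetric] \<delta>'_def[symmetric]
   by (rule conjI[OF P1], rule conjI, intro impI allI, rule P3, assumption+, intro impI, rule P4, assumption)
 qed
qed

end

theorem theorem1p9:
  fixes a \<gamma> \<alpha> l k \<sigma> d :: real and q p :: ennreal
  assumes "d = real DIM('a::euclidean_space)"
    and "a \<in> {-1, 1}"
    and "\<gamma> > - min 2 d"
    and "\<alpha> > 1 + (2 + \<gamma>) / d"
    and "1 \<le> q" "l / d + recip q = inv_qc d \<gamma> \<alpha>"
    and "\<gamma> / (\<alpha> - 1) \<le> l"
    and "1 \<le> p" "ennreal \<alpha> < p"
    and "(l + \<gamma>) / \<alpha> \<le> k" "k \<le> l"
    and "0 \<le> k / d + recip p"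
    and "(2 + \<gamma> * \<alpha>) / (d * \<alpha> * (\<alpha> - 1)) < k / d + recip p"
    and "k / d + recip p < min (inv_qc d \<gamma> \<alpha>) ((d + \<gamma>) / (d * \<alpha>))"
    and "(2 + \<gamma>) / (\<alpha> - 1) \<le> \<sigma>" "\<sigma> < d"
  shows
    "\<exists>\<delta>\<^sub>0>0. \<exists>M\<^sub>0>0. \<forall>M\<in>{0<..M\<^sub>0}. \<exists>\<epsilon>>0.
     \<forall>(\<omega> :: 'a \<Rightarrow> complex) (\<phi> :: ('a \<Rightarrow> complex) \<Rightarrow> complex) C \<delta> (u :: real \<Rightarrow> 'a \<Rightarrow> complex).
       \<omega> \<in> borel_measurable lebesgue \<and> homogeneous_degree_0 \<omega> \<and>
       esssup lebesgue (\<lambda>x. ennreal (norm (\<omega> x))) \<le> ennreal \<epsilon> \<and>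
       tempered_distribution \<phi> \<and> (\<exists>f\<in>schwartz. \<phi> f \<noteq> 0) \<and>
       kato_norm \<gamma> \<alpha> k p (\<lambda>t. heat t \<phi>) \<le> ennreal \<epsilon> \<and>
       C > 0 \<and> \<delta> > 0 \<and>
       (\<forall>t>0. weighted_weak_norm k p (heat t \<phi>)
                \<le> ennreal (C * t powr (- decay_exponent d (\<sigma> / d) k p))) \<and>
       (\<forall>t>0. weighted_weak_norm k p (heat t (\<lambda>f. \<phi> f - regular_distribution (Phi \<omega> \<sigma>) f))
                \<le> ennreal (C * t powr (- decay_exponent d (\<sigma> / d) k p - \<delta>))) \<and>
       global_solution a \<gamma> \<alpha> k p M \<phi> u
       \<longrightarrow>
       (\<sigma> = (2 + \<gamma>) / (\<alpha> - 1) \<longrightarrow>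
          (\<forall>u\<^sub>S. global_solution a \<gamma> \<alpha> k p M
                   (regular_distribution (Phi \<omega> ((2 + \<gamma>) / (\<alpha> - 1)))) u\<^sub>S \<longrightarrow>
             (\<exists>C'>0. \<forall>t>0. \<forall>k' p'. admissible d k p k' p' \<longrightarrow>
                weighted_weak_norm k' p' (\<lambda>x. u t x - u\<^sub>S t x)
                  \<le> ennreal (C' * t powr (- decay_exponent d (inv_qc d \<gamma> \<alpha>) k' p' - min \<delta> \<delta>\<^sub>0)) \<and>
                weighted_weak_norm k' p'
                    (\<lambda>x. of_real (t powr ((2 + \<gamma>) / (2 * (\<alpha> - 1)))) * u t (sqrt t *\<^sub>R x) - u\<^sub>S 1 x)
                  \<le> ennreal (C' * t powr (- min \<delta> \<delta>\<^sub>0)))) \<and>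
          (\<exists>C'>0. \<forall>\<^sub>F t in at_top. \<forall>k' p'. admissible d k p k' p' \<longrightarrow>
             (\<not> (AE x in lebesgue. \<omega> x = 0) \<longrightarrow>
                ennreal (inverse C' * t powr (- decay_exponent d (inv_qc d \<gamma> \<alpha>) k' p'))
                  \<le> weighted_weak_norm k' p' (u t)) \<and>
             weighted_weak_norm k' p' (u t)
               \<le> ennreal (C' * t powr (- decay_exponent d (inv_qc d \<gamma> \<alpha>) k' p')))) \<and>
       (\<sigma> > (2 + \<gamma>) / (\<alpha> - 1) \<and> (\<sigma> + \<gamma>) / (d * \<alpha>) < k / d + recip p \<longrightarrow>
          (\<exists>C'>0. \<forall>t>0. \<forall>k' p'. admissible d k p k' p' \<longrightarrow>
             weighted_weak_norm k' p'
                 (\<lambda>x. u t x - heat t (regular_distribution (Phi \<omega> \<sigma>)) x)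
               \<le> ennreal (C' * t powr (- decay_exponent d (\<sigma> / d) k' p' - min \<delta> \<delta>\<^sub>0)) \<and>
             weighted_weak_norm k' p'
                 (\<lambda>x. of_real (t powr (\<sigma> / 2)) * u t (sqrt t *\<^sub>R x)
                        - heat 1 (regular_distribution (Phi \<omega> \<sigma>)) x)
               \<le> ennreal (C' * t powr (- min \<delta> \<delta>\<^sub>0))) \<and>
          (\<exists>C'>0. \<forall>\<^sub>F t in at_top. \<forall>k' p'. admissible d k p k' p' \<longrightarrow>
             (\<not> (AE x in lebesgue. \<omega> x = 0) \<longrightarrow>
                ennreal (inverse C' * t powr (- decay_exponent d (\<sigma> / d) k' p'))
                  \<le> weighted_weak_norm k' p' (u t)) \<and>
             weighted_weak_norm k' p' (u t)
               \<le> ennreal (C' * t powr (- decay_exponent d (\<sigma> / d) k' p'))))"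
proof -
 let ?R = "recip p"
 have d: "0 < d" using assms(1) by simp
 have \<gamma>2: "0 < 2 + \<gamma>" using assms(3) by simp
 have \<alpha>: "1 < \<alpha>" using assms(4) \<gamma>2 d by (smt (verit) divide_pos_pos)
 have s: "0 <= k / d + ?R" "(2 + \<gamma> * \<alpha>) / (d * \<alpha> * (\<alpha> - 1)) < k / d + ?R"
  "k / d + ?R < (2 + \<gamma>) / (d * (\<alpha> - 1))" "k / d + ?R < (d + \<gamma>) / (d * \<alpha>)"
  using assms(12-14) by (auto simp: inv_qc_def)
 define S where "S = k / d + ?R"
 have S2: "d / 2 * S < (2 + \<gamma>) / (2 * (\<alpha> - 1))"
  using s(3) d \<alpha> unfolding S_def[symmetric] by (simp add: field_simps)
 interpret kato_exponents d \<gamma> \<alpha> k ?R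
 proof
  show "0 < d" "1 < \<alpha>" "0 <= ?R" "0 <= k / d + ?R" using d \<alpha> s by auto
  show "\<alpha> * ?R < 1" by (rule recip_less[OF _ assms(9)]) (use \<alpha> in simp)
  have "l + \<gamma> <= \<alpha> * k" using assms(10) \<alpha> by (simp add: field_simps)
  then show "\<gamma> <= (\<alpha> - 1) * k" using assms(11) by (simp add: algebra_simps)
  have "\<alpha> * S < (d + \<gamma>) / d" using s(4) d \<alpha> unfolding S_def[symmetric] by (simp add: field_simps)
  then show "\<alpha> * (k / d + ?R) - \<gamma> / d < 1" using d unfolding S_def[symmetric] by (simp add: add_divide_distrib)
  show "0 < (2 + \<gamma>) / (2 * (\<alpha> - 1)) - d / 2 * (k / d + ?R)" using S2 unfolding S_def[symmetric] by simp
  \<comment> \<open>The lower bound on the homogeneity is equivalent to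
    \<open>\<alpha> * \<theta> < 1\<close>: the source formed by functions of rate
    \<open>\<theta>\<close> is integrable at time 0.\<close>
  have "2 + \<gamma> * \<alpha> < S * (d * \<alpha> * (\<alpha> - 1))" using s(2) d \<alpha> unfolding S_def[symmetric] by (simp add: pos_divide_less_eq)
  then have "\<alpha> * (2 + \<gamma>) - \<alpha> * (\<alpha> - 1) * (d * S) < 2 * (\<alpha> - 1)" by (simp add: algebra_simps)
  moreover have "\<alpha> * ((2 + \<gamma>) / (2 * (\<alpha> - 1)) - d / 2 * S) = (\<alpha> * (2 + \<gamma>) - \<alpha> * (\<alpha> - 1) * (d * S)) / (2 * (\<alpha> - 1))"
   using \<alpha> by (simp add: field_simps)
  ultimately show "\<alpha> * ((2 + \<gamma>) / (2 * (\<alpha> - 1)) - d / 2 * (k / d + ?R)) < 1"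
   using \<alpha> unfolding S_def[symmetric] by (simp add: divide_less_eq)
 qed
 define b where "b = (\<sigma> - d * s) / 2"
 have \<sigma>: "0 < \<sigma>" "\<sigma> < d"
 proof -
  have "0 < (2 + \<gamma>) / (\<alpha> - 1)" using \<gamma>2 \<alpha> by simp
  then show "0 < \<sigma>" "\<sigma> < d" using assms(15,16) by auto
 qed
 have \<theta>_alt: "\<theta> = ((2 + \<gamma>) / (\<alpha> - 1) - d * s) / 2" using \<alpha> by (simp add: \<theta>_def field_simps)
 have b\<theta>: "\<theta> <= b" "b = \<theta> \<longleftrightarrow> \<sigma> = (2 + \<gamma>) / (\<alpha> - 1)"
 proof -
  obtain X where X: "X = (2 + \<gamma>) / (\<alpha> - 1)" by blast
  have "\<theta> = (X - d * s) / 2" "X <= \<sigma>" using \<theta>_alt assms(15) by (simp_all only: X)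
  then show "\<theta> <= b" "b = \<theta> \<longleftrightarrow> \<sigma> = (2 + \<gamma>) / (\<alpha> - 1)" unfolding b_def X[symmetric] by auto
 qed
 \<comment> \<open>In the third case the premises of both asymptotic statements fail.\<close>
 consider (nonlinear) "\<sigma> = (2 + \<gamma>) / (\<alpha> - 1)"
  | (linear) "(2 + \<gamma>) / (\<alpha> - 1) < \<sigma>" "(\<sigma> + \<gamma>) / (d * \<alpha>) < k / d + ?R"
  | (other) "\<sigma> \<noteq> (2 + \<gamma>) / (\<alpha> - 1)" "~ (\<sigma> > (2 + \<gamma>) / (\<alpha> - 1) & (\<sigma> + \<gamma>) / (d * \<alpha>) < k / d + ?R)"
  using assms(15) by linarith
 then show ?thesis
 proof cases
  case nonlinear
  \<comment> \<open>Half of the room left by \<open>\<alpha> * \<theta> < 1\<close>, so that the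
    time integral still converges for the rate \<open>b + \<delta>0\<close>.\<close>
  define \<delta>0 where "\<delta>0 = (1 - \<alpha> * \<theta>) / 2"
  have \<delta>0: "0 < \<delta>0" using \<alpha>\<theta> by (simp add: \<delta>0_def)
  have b_eq: "b = \<theta>" using b\<theta> nonlinear by simp
  have c': "(\<alpha> - 1) * \<theta> + b + \<delta>0 < 1"
  proof -
   define z where "z = \<alpha> * \<theta>"
   have "(\<alpha> - 1) * \<theta> + b = z" by (simp add: b_eq z_def algebra_simps)
   moreover have "z < 1" using \<alpha>\<theta> by (simp only: z_def)
   ultimately show ?thesis unfolding \<delta>0_def z_def[symmetric] by (simp only:) (simp add: field_simps)
  qed
  have e: "inv_qc d \<gamma> \<alpha> = \<sigma> / d" "(2 + \<gamma>) / (2 * (\<alpha> - 1)) = \<sigma> / 2"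
   by (simp_all add: inv_qc_def nonlinear mult.commute)
  show ?thesis
  proof (rule kato_asymptotics_norms[OF assms(1,2) c' refl assms(8) \<sigma> b_def b\<theta>(1) order_refl \<delta>0], goal_cases)
   case (1 M0) note M0 = 1(1) and main = 1(2)
   \<comment> \<open>The witness for \<open>\<epsilon>\<close> is 1, the bound on the modulus of
     \<open>\<omega>\<close> used in the asymptotics; the contraction is governed by the radius
     \<open>M <= M0\<close>.\<close>
   show ?thesis
    unfolding e nonlinear[symmetric]
   proof (rule exI[of _ \<delta>0], rule conjI[OF \<delta>0], rule exI[of _ M0], rule conjI[OF M0], intro ballI, rule exI[of _ 1], rule conjI[OF zero_less_one], intro allI impI, (elim conjE)?, goal_cases)
    case (1 M \<omega> \<phi> C \<delta> u)
    have M: "0 < M" "M <= M0" using 1(1) by auto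
    have \<omega>: "\<omega> \<in> Lmeas" "homogeneous_degree_0 \<omega>" using 1 by simp_all
    note facts = main[OF M \<omega> 1(4,5,8,9,10,11,12)]
    show ?case
     by (rule conjI, intro impI, rule conjI, rule facts[THEN conjunct2, THEN conjunct1, THEN mp, OF b_eq], rule facts[THEN conjunct1], simp)
   qed
  qed
 next
  case linear
  \<comment> \<open>The first entry keeps the Duhamel integral convergent at time 0; the second is
    the gain in decay of the nonlinear term over the linear one.\<close>
  define \<delta>0 where "\<delta>0 = min ((1 - ((\<alpha> - 1) * \<theta> + b)) / 2) ((\<alpha> - 1) * (b - \<theta>))"
  have "\<theta> < b" using b\<theta> linear by linarith
  then have gap: "0 < (\<alpha> - 1) * (b - \<theta>)" using \<alpha> by simp
  have lt1: "(\<alpha> - 1) * \<theta> + b < 1"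
  proof -
   \<comment> \<open>The extra condition of the linear case is equivalent to
     \<open>(\<alpha> - 1) * \<theta> + b < 1\<close>.\<close>
   have "\<sigma> + \<gamma> < d * \<alpha> * s" using linear(2) d \<alpha> unfolding s_def by (simp add: pos_divide_less_eq mult.commute)
   moreover have "(\<alpha> - 1) * \<theta> = (2 + \<gamma> - (\<alpha> - 1) * (d * s)) / 2" using \<alpha> by (simp add: \<theta>_alt field_simps)
   ultimately show ?thesis by (simp add: b_def field_simps)
  qed
  have \<delta>0: "0 < \<delta>0" using gap lt1 by (simp add: \<delta>0_def)
  have \<delta>0_le: "\<delta>0 <= (\<alpha> - 1) * (b - \<theta>)" by (simp add: \<delta>0_def)
  define z where "z = (\<alpha> - 1) * \<theta> + b"
  have z: "z < 1" using lt1 by (simp only: z_def)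
  have "\<delta>0 <= (1 - z) / 2" unfolding \<delta>0_def z_def by (rule min.cobounded1)
  then have "z + \<delta>0 <= z + (1 - z) / 2" by (rule add_left_mono)
  also have "... < 1" using z by (simp add: field_simps)
  finally have c': "(\<alpha> - 1) * \<theta> + b + \<delta>0 < 1" unfolding z_def .
  have ne: "\<sigma> \<noteq> (2 + \<gamma>) / (\<alpha> - 1)" using linear by simp
  show ?thesis
  proof (rule kato_asymptotics_norms[OF assms(1,2) c' refl assms(8) \<sigma> b_def b\<theta>(1) order_refl \<delta>0], goal_cases)
   case (1 M0) note M0 = 1(1) and main = 1(2)
   show ?thesis
   proof (rule exI[of _ \<delta>0], rule conjI[OF \<delta>0], rule exI[of _ M0], rule conjI[OF M0], intro ballI, rule exI[of _ 1], rule conjI[OF zero_less_one], intro allI impI, (elim conjE)?, goal_cases)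
    case (1 M \<omega> \<phi> C \<delta> u)
    have M: "0 < M" "M <= M0" using 1(1) by auto
    have \<omega>: "\<omega> \<in> Lmeas" "homogeneous_degree_0 \<omega>" using 1 by simp_all
    note facts = main[OF M \<omega> 1(4,5,8,9,10,11,12)]
    show ?case
     by (rule conjI, intro impI, rule notE[OF ne], assumption, intro impI, rule conjI,
      rule facts[THEN conjunct2, THEN conjunct2, THEN mp, OF \<delta>0_le], rule facts[THEN conjunct1])
   qed
  qed
 next
  case other
  then show ?thesis
   by (intro exI[of _ 1] conjI zero_less_one ballI allI impI) (elim notE; assumption)+
 qed
qed

end
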